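(* Let $N\in\{2,3\}$ and assume that the main assumption $(A_0)$ (written out in the context) holds. Then there exists $\tau>0$ such that if $\|D^{+}\|_{L^r(\Omega)}\le\tau$, then problem (Q) admits at least one weak solution $(\theta,\phi)$ in the class $\mathcal S$.
   Context: Notation: $\mathbb R^+=[0,\infty)$. For a real function $f$, $f^+=\max(f,0)\ge 0$ and $f^-=\min(f,0)\le 0$, so $f=f^++f^-$. $D:=\operatorname{div}\mathbf u$ and $F:=\frac12|\nabla\mathbf u+(\nabla\mathbf u)^T|^2-\frac23D^2$, where $|A|^2=\sum_{i,j}a_{ij}^2$ for a matrix $A=(a_{ij})$. Problem (Q): find $(\theta,\phi)$ such that $$\rho\mathbf u\cdot\nabla\theta-\operatorname{div}\Big(\big(\nu+\tfrac{C_\theta}{\theta\phi}\big)\nabla\theta\Big)=-C_3F\theta^2+C_4\theta D+C_5\ \text{ in }\Omega,$$ $$\rho\mathbf u\cdot\nabla\phi-\operatorname{div}\Big(\big(\nu+\tfrac{C_\phi}{\theta\phi}\big)\nabla\phi\Big)=-\phi\,(C_6\theta F-C_7D+C_8\theta^{-1})\ \text{ in }\Omega,$$ $$\theta=a,\quad \phi=b\ \text{ on }\partial\Omega,$$ where $C_\theta=C_\theta(x,\theta,\phi)$, $C_\phi=C_\phi(x,\theta,\phi)$, $C_i=C_i(x)$ for $i=3,\dots,8$. Assumption $(A_0)$: $r>N/2$ is a fixed number, and - $\Omega\subset\mathbb R^N$ is open, bounded, with Lipschitz boundary $\partial\Omega$ and outward normal $\mathbf n$; - $\nu\ge0$ is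 a constant ($\nu=0$ is allowed); $F,\rho:\Omega\to\mathbb R^+$, $\rho,\rho^{-1}\in L^\infty(\Omega)$, $F\in L^r(\Omega)$; - $\mathbf u\in(L^3(\Omega))^N$, $D\in L^r(\Omega)$, $\operatorname{div}(\rho\mathbf u)=0$ in $\Omega$, $\mathbf u\cdot\mathbf n=0$ on $\partial\Omega$; - $a,b\in H^{1/2}(\partial\Omega)\cap L^\infty(\partial\Omega)$ and $a,b\ge\delta$ a.e. on $\partial\Omega$, for a fixed number $\delta>0$; - $C_i:\Omega\to\mathbb R^+$, with $C_5,C_8\in L^r(\Omega)$ and $C_i\in L^\infty(\Omega)$ for $i=3,4,6,7$; - for $\mathrm{ind}\in\{\theta,\phi\}$, $C_{\mathrm{ind}}:\Omega\times(\mathbb R^+)^2\to\mathbb R^+$ is Carathéodory (measurable in $x$ for all $(v,w)$, continuous in $(v,w)$ for a.a. $x$); there is a constant $\alpha_{\mathrm{ind}}>0$ with $C_{\mathrm{ind}}(x,v,w)\ge\alpha_{\mathrm{ind}}$ for all $v,w\in\mathbb R^+$ and a.a. $x\in\Omega$; and $x\mapsto C_{\mathrm{ind}}(x,v,w)\in L^\infty(\Omega)$ for all $v,w\in\mathbb R^+$, this last condition being understood as: $C_{\mathrm{ind}}(\cdot,\theta,\phi)$ is bounded whenever $\theta,\phi$ are bounded (nonnegative, measurable). Class $\mathcal S$: functions $f:\Omega\to\mathbb R^+$ with $f\in H^1(\Omega)\cap L^\infty(\Omega)$ and $f^{-1}\in L^\infty(\Omega)$. A weak solution of (Q) in the class $\mathcal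 S$ is a pair $(\theta,\phi)$ with $\theta,\phi\in\mathcal S$ satisfying the two equations in the sense of distributions and the boundary conditions in the sense of traces. *)

theory Defs
  imports "HOL-Analysis.Analysis"
begin

section \<open>Lebesgue spaces\<close>

definition Lp :: "'a measure \<Rightarrow> real \<Rightarrow> ('a \<Rightarrow> real) set" where
  "Lp M p = {f \<in> borel_measurable M. integrable M (\<lambda>x. \<bar>f x\<bar> powr p)}"

definition Lp_norm :: "'a measure \<Rightarrow> real \<Rightarrow> ('a \<Rightarrow> real) \<Rightarrow> real" where
  "Lp_norm M p f = (\<integral>x. \<bar>f x\<bar> powr p \<partial>M) powr (1 / p)"

definition Linf :: "'a measure \<Rightarrow> ('a \<Rightarrow> real) set" where
  "Linf M = {f \<in> borel_measurable M. \<exists>c. AE x in M. \<bar>f x\<bar> \<le> c}"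

text \<open>
  \<open>1/f \<in> L\<^sup>\<infinity>\<close>. Since \<open>inverse 0 = 0\<close>, it has to be said separately that \<open>f\<close> does not vanish.
\<close>
definition inverse_Linf :: "'a measure \<Rightarrow> ('a \<Rightarrow> real) \<Rightarrow> bool" where
  "inverse_Linf M f \<longleftrightarrow> (AE x in M. f x \<noteq> 0) \<and> (\<lambda>x. inverse (f x)) \<in> Linf M"

definition locally_integrable :: "(real^'n) set \<Rightarrow> (real^'n \<Rightarrow> real) \<Rightarrow> bool" where
  "locally_integrable \<Omega> f \<longleftrightarrow> f \<in> borel_measurable (lebesgue_on \<Omega>) \<and>
     (\<forall>K. compact K \<and> K \<subseteq> \<Omega> \<longrightarrow> integrable (lebesgue_on K) f)"

section \<open>Test functions and weak derivatives\<close>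

definition partial :: "'n \<Rightarrow> (real^'n \<Rightarrow> real) \<Rightarrow> real^'n \<Rightarrow> real" where
  "partial i f x = frechet_derivative f (at x) (axis i 1)"

definition grad :: "(real^'n \<Rightarrow> real) \<Rightarrow> real^'n \<Rightarrow> real^'n" where
  "grad f x = (\<chi> i. partial i f x)"

primrec C_k :: "nat \<Rightarrow> (real^'n \<Rightarrow> real) \<Rightarrow> bool" where
  "C_k 0 f \<longleftrightarrow> continuous_on UNIV f"
| "C_k (Suc k) f \<longleftrightarrow> (\<forall>x. f differentiable (at x)) \<and> (\<forall>i. C_k k (partial i f))"

definition smooth :: "(real^'n \<Rightarrow> real) \<Rightarrow> bool" where
  "smooth f \<longleftrightarrow> (\<forall>k. C_k k f)"

definition test_functions :: "(real^'n) set \<Rightarrow> (real^'n \<Rightarrow> real) set" where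
  "test_functions \<Omega> = {\<psi>. smooth \<psi> \<and> (\<exists>K. compact K \<and> K \<subseteq> \<Omega> \<and> (\<forall>x. x \<notin> K \<longrightarrow> \<psi> x = 0))}"

definition has_weak_gradient ::
  "(real^'n) set \<Rightarrow> (real^'n \<Rightarrow> real) \<Rightarrow> (real^'n \<Rightarrow> real^'n) \<Rightarrow> bool" where
  "has_weak_gradient \<Omega> f G \<longleftrightarrow> locally_integrable \<Omega> f \<and>
     (\<forall>i. locally_integrable \<Omega> (\<lambda>x. G x $ i) \<and>
       (\<forall>\<psi>\<in>test_functions \<Omega>.
          (\<integral>x. f x * partial i \<psi> x \<partial>lebesgue_on \<Omega>) = - (\<integral>x. G x $ i * \<psi> x \<partial>lebesgue_on \<Omega>)))"

text \<open>
  A representative of the weak gradient; it is unique almost everywhere in \<open>\<Omega>\<close> when it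
  exists and meaningless otherwise.
\<close>
definition wgrad :: "(real^'n) set \<Rightarrow> (real^'n \<Rightarrow> real) \<Rightarrow> real^'n \<Rightarrow> real^'n" where
  "wgrad \<Omega> f = (SOME G. has_weak_gradient \<Omega> f G)"

definition H1 :: "(real^'n) set \<Rightarrow> (real^'n \<Rightarrow> real) set" where
  "H1 \<Omega> = {f \<in> Lp (lebesgue_on \<Omega>) 2.
     (\<exists>G. has_weak_gradient \<Omega> f G) \<and> (\<forall>i. (\<lambda>x. wgrad \<Omega> f x $ i) \<in> Lp (lebesgue_on \<Omega>) 2)}"

definition H1_norm :: "(real^'n) set \<Rightarrow> (real^'n \<Rightarrow> real) \<Rightarrow> real" where
  "H1_norm \<Omega> f = sqrt ((\<integral>x. (f x)\<^sup>2 \<partial>lebesgue_on \<Omega>) + (\<integral>x. (norm (wgrad \<Omega> f x))\<^sup>2 \<partial>lebesgue_on \<Omega>))"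

definition weakly_differentiable :: "(real^'n) set \<Rightarrow> (real^'n \<Rightarrow> real^'n) \<Rightarrow> bool" where
  "weakly_differentiable \<Omega> u \<longleftrightarrow> (\<forall>i. \<exists>G. has_weak_gradient \<Omega> (\<lambda>x. u x $ i) G)"

definition jacobian :: "(real^'n) set \<Rightarrow> (real^'n \<Rightarrow> real^'n) \<Rightarrow> real^'n \<Rightarrow> real^'n^'n" where
  "jacobian \<Omega> u x = (\<chi> i. wgrad \<Omega> (\<lambda>y. u y $ i) x)"

definition divergence :: "(real^'n) set \<Rightarrow> (real^'n \<Rightarrow> real^'n) \<Rightarrow> real^'n \<Rightarrow> real" where
  "divergence \<Omega> u x = trace (jacobian \<Omega> u x)"

text \<open>\<open>F = 1/2 |\<nabla>u + (\<nabla>u)\<^sup>T|\<^sup>2 - 2/3 (div u)\<^sup>2\<close>, with the Frobenius norm.\<close>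
definition strain :: "(real^'n) set \<Rightarrow> (real^'n \<Rightarrow> real^'n) \<Rightarrow> real^'n \<Rightarrow> real" where
  "strain \<Omega> u x =
     1/2 * (\<Sum>i\<in>UNIV. \<Sum>j\<in>UNIV. ((jacobian \<Omega> u x + transpose (jacobian \<Omega> u x)) $ i $ j)\<^sup>2)
     - 2/3 * (divergence \<Omega> u x)\<^sup>2"

definition solenoidal :: "(real^'n) set \<Rightarrow> (real^'n \<Rightarrow> real^'n) \<Rightarrow> bool" where
  "solenoidal \<Omega> w \<longleftrightarrow> (\<forall>\<psi>\<in>test_functions \<Omega>. (\<integral>x. w x \<bullet> grad \<psi> x \<partial>lebesgue_on \<Omega>) = 0)"

text \<open>
  \<open>u \<cdot> n = 0\<close> on the boundary. For a field \<open>u\<close> that is only \<open>L\<^sup>p\<close> with integrable divergence,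
  \<open>u \<cdot> n\<close> is the functional on smooth functions on \<open>closure \<Omega>\<close> given by Gauss' formula,
  \<open>\<langle>u \<cdot> n, \<psi>\<rangle> = \<integral>\<^sub>\<Omega> u \<cdot> \<nabla>\<psi> + \<integral>\<^sub>\<Omega> \<psi> div u\<close>. The functions \<open>\<psi>\<close> below need not vanish on
  the boundary.
\<close>
definition normal_trace_zero :: "(real^'n) set \<Rightarrow> (real^'n \<Rightarrow> real^'n) \<Rightarrow> bool" where
  "normal_trace_zero \<Omega> u \<longleftrightarrow> (\<forall>\<psi>. smooth \<psi> \<longrightarrow>
     (\<integral>x. u x \<bullet> grad \<psi> x \<partial>lebesgue_on \<Omega>) + (\<integral>x. \<psi> x * divergence \<Omega> u x \<partial>lebesgue_on \<Omega>) = 0)"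

section \<open>Lipschitz domains, surface measure and traces\<close>

text \<open>
  Near each boundary point, \<open>\<Omega>\<close> is the strict epigraph, in the direction of some unit vector
  \<open>e\<close>, of a Lipschitz function on the hyperplane orthogonal to \<open>e\<close>.
\<close>
definition lipschitz_boundary :: "(real^'n) set \<Rightarrow> bool" where
  "lipschitz_boundary \<Omega> \<longleftrightarrow> (\<forall>p\<in>frontier \<Omega>. \<exists>s>0. \<exists>e g L. norm e = 1 \<and>
     L-lipschitz_on {y. y \<bullet> e = 0} g \<and>
     \<Omega> \<inter> ball p s = {x \<in> ball p s. x \<bullet> e > g (x - (x \<bullet> e) *\<^sub>R e)})"

text \<open>
  \<open>k\<close>-dimensional Hausdorff measure for \<open>k \<ge> 1\<close>, normalised to agree with the
  \<open>k\<close>-dimensional area. The covering sets are required to be bounded because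
  \<^const>\<open>diameter\<close> is unspecified on unbounded sets.
\<close>
definition hausdorff_pre :: "nat \<Rightarrow> real \<Rightarrow> 'a::metric_space set \<Rightarrow> ennreal" where
  "hausdorff_pre k d A =
     (INF C\<in>{C :: nat \<Rightarrow> 'a set. A \<subseteq> (\<Union>n. C n) \<and> (\<forall>n. bounded (C n) \<and> diameter (C n) \<le> d)}.
        \<Sum>n. ennreal (unit_ball_vol (real k) * (diameter (C n) / 2) ^ k))"

definition hausdorff_outer :: "nat \<Rightarrow> 'a::metric_space set \<Rightarrow> ennreal" where
  "hausdorff_outer k A = (SUP d\<in>{0<..}. hausdorff_pre k d A)"

definition hausdorff_measure :: "nat \<Rightarrow> 'a::metric_space measure" where
  "hausdorff_measure k = measure_of UNIV (sets borel) (hausdorff_outer k)"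

definition surface_measure :: "(real^'n) set \<Rightarrow> (real^'n) measure" where
  "surface_measure \<Omega> = completion (restrict_space (hausdorff_measure (CARD('n) - 1)) (frontier \<Omega>))"

text \<open>
  The trace operator is the continuous extension to \<open>H\<^sup>1(\<Omega>)\<close>, with values in
  \<open>L\<^sup>2(\<partial>\<Omega>)\<close>, of the restriction \<open>h \<mapsto> h|\<partial>\<Omega>\<close> defined for
  \<open>h \<in> H\<^sup>1(\<Omega>)\<close> continuous on the closure of \<open>\<Omega>\<close>; \<open>has_trace\<close> is its graph.
\<close>
definition has_trace :: "(real^'n) set \<Rightarrow> (real^'n \<Rightarrow> real) \<Rightarrow> (real^'n \<Rightarrow> real) \<Rightarrow> bool" where
  "has_trace \<Omega> f g \<longleftrightarrow> f \<in> H1 \<Omega> \<and> g \<in> Lp (surface_measure \<Omega>) 2 \<and>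
     (\<exists>h :: nat \<Rightarrow> real^'n \<Rightarrow> real.
        (\<forall>n. h n \<in> H1 \<Omega> \<and> continuous_on (closure \<Omega>) (h n)) \<and>
        (\<lambda>n. H1_norm \<Omega> (\<lambda>x. h n x - f x)) \<longlonglongrightarrow> 0 \<and>
        (\<lambda>n. \<integral>\<^sup>+x. ennreal ((h n x - g x)\<^sup>2) \<partial>surface_measure \<Omega>) \<longlonglongrightarrow> 0)"

text \<open>\<open>H\<^sup>1\<^sup>/\<^sup>2(\<partial>\<Omega>)\<close>, defined as the space of traces of \<open>H\<^sup>1(\<Omega>)\<close>.\<close>
definition H_half :: "(real^'n) set \<Rightarrow> (real^'n \<Rightarrow> real) set" where
  "H_half \<Omega> = {g. \<exists>f. has_trace \<Omega> f g}"

section \<open>The boundary value problem\<close>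

definition caratheodory :: "(real^'n) set \<Rightarrow> (real^'n \<Rightarrow> real \<Rightarrow> real \<Rightarrow> real) \<Rightarrow> bool" where
  "caratheodory \<Omega> C \<longleftrightarrow>
     (\<forall>v\<ge>0. \<forall>w\<ge>0. (\<lambda>x. C x v w) \<in> borel_measurable (lebesgue_on \<Omega>)) \<and>
     (AE x in lebesgue_on \<Omega>. continuous_on ({0..} \<times> {0..}) (\<lambda>(v, w). C x v w))"

definition diffusion_function :: "(real^'n) set \<Rightarrow> (real^'n \<Rightarrow> real \<Rightarrow> real \<Rightarrow> real) \<Rightarrow> bool" where
  "diffusion_function \<Omega> C \<longleftrightarrow>
     (\<forall>x\<in>\<Omega>. \<forall>v\<ge>0. \<forall>w\<ge>0. 0 \<le> C x v w) \<and>
     caratheodory \<Omega> C \<and>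
     (\<exists>\<alpha>>0. AE x in lebesgue_on \<Omega>. \<forall>v\<ge>0. \<forall>w\<ge>0. \<alpha> \<le> C x v w) \<and>
     (\<forall>v w. v \<in> borel_measurable (lebesgue_on \<Omega>) \<and> w \<in> borel_measurable (lebesgue_on \<Omega>) \<and>
        (\<exists>M. \<forall>x\<in>\<Omega>. 0 \<le> v x \<and> v x \<le> M \<and> 0 \<le> w x \<and> w x \<le> M) \<longrightarrow>
        (\<lambda>x. C x (v x) (w x)) \<in> Linf (lebesgue_on \<Omega>))"

definition class_S :: "(real^'n) set \<Rightarrow> (real^'n \<Rightarrow> real) set" where
  "class_S \<Omega> = {f. (\<forall>x\<in>\<Omega>. 0 \<le> f x) \<and> f \<in> H1 \<Omega> \<and> f \<in> Linf (lebesgue_on \<Omega>) \<and>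
     inverse_Linf (lebesgue_on \<Omega>) f}"

text \<open>
  \<open>w \<cdot> \<nabla>f - div (\<kappa> \<nabla>f) = h\<close> in the sense of distributions. Integrability is demanded
  because the Bochner integral of a non-integrable function is \<open>0\<close>.
\<close>
definition transport_diffusion ::
  "(real^'n) set \<Rightarrow> (real^'n \<Rightarrow> real^'n) \<Rightarrow> (real^'n \<Rightarrow> real) \<Rightarrow> (real^'n \<Rightarrow> real) \<Rightarrow>
   (real^'n \<Rightarrow> real) \<Rightarrow> bool" where
  "transport_diffusion \<Omega> w \<kappa> h f \<longleftrightarrow> (\<forall>\<psi>\<in>test_functions \<Omega>.
     integrable (lebesgue_on \<Omega>) (\<lambda>x. (w x \<bullet> wgrad \<Omega> f x) * \<psi> x) \<and>
     integrable (lebesgue_on \<Omega>) (\<lambda>x. \<kappa> x * (wgrad \<Omega> f x \<bullet> grad \<psi> x)) \<and>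
     integrable (lebesgue_on \<Omega>) (\<lambda>x. h x * \<psi> x) \<and>
     (\<integral>x. (w x \<bullet> wgrad \<Omega> f x) * \<psi> x \<partial>lebesgue_on \<Omega>)
       + (\<integral>x. \<kappa> x * (wgrad \<Omega> f x \<bullet> grad \<psi> x) \<partial>lebesgue_on \<Omega>)
     = (\<integral>x. h x * \<psi> x \<partial>lebesgue_on \<Omega>))"

definition weak_solution_Q ::
  "(real^'n) set \<Rightarrow> real \<Rightarrow> (real^'n \<Rightarrow> real) \<Rightarrow> (real^'n \<Rightarrow> real^'n) \<Rightarrow>
   (real^'n \<Rightarrow> real \<Rightarrow> real \<Rightarrow> real) \<Rightarrow> (real^'n \<Rightarrow> real \<Rightarrow> real \<Rightarrow> real) \<Rightarrow>
   (real^'n \<Rightarrow> real) \<Rightarrow> (real^'n \<Rightarrow> real) \<Rightarrow> (real^'n \<Rightarrow> real) \<Rightarrow>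
   (real^'n \<Rightarrow> real) \<Rightarrow> (real^'n \<Rightarrow> real) \<Rightarrow> (real^'n \<Rightarrow> real) \<Rightarrow>
   (real^'n \<Rightarrow> real) \<Rightarrow> (real^'n \<Rightarrow> real) \<Rightarrow> (real^'n \<Rightarrow> real) \<Rightarrow> (real^'n \<Rightarrow> real) \<Rightarrow> bool" where
  "weak_solution_Q \<Omega> \<nu> \<rho> u C\<theta> C\<phi> C3 C4 C5 C6 C7 C8 a b \<theta> \<phi> \<longleftrightarrow>
     \<theta> \<in> class_S \<Omega> \<and> \<phi> \<in> class_S \<Omega> \<and>
     transport_diffusion \<Omega> (\<lambda>x. \<rho> x *\<^sub>R u x)
       (\<lambda>x. \<nu> + C\<theta> x (\<theta> x) (\<phi> x) / (\<theta> x * \<phi> x))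
       (\<lambda>x. - C3 x * strain \<Omega> u x * (\<theta> x)\<^sup>2 + C4 x * \<theta> x * divergence \<Omega> u x + C5 x) \<theta> \<and>
     transport_diffusion \<Omega> (\<lambda>x. \<rho> x *\<^sub>R u x)
       (\<lambda>x. \<nu> + C\<phi> x (\<theta> x) (\<phi> x) / (\<theta> x * \<phi> x))
       (\<lambda>x. - \<phi> x * (C6 x * \<theta> x * strain \<Omega> u x - C7 x * divergence \<Omega> u x + C8 x * inverse (\<theta> x))) \<phi> \<and>
     has_trace \<Omega> \<theta> a \<and> has_trace \<Omega> \<phi> b"

end

theory Submission
  imports Defs "HOL-Complex_Analysis.Great_Picard"
begin

text \<open>
  Replace \<open>\<theta>\<close> and \<open>\<phi>\<close> in the coefficients by their truncations between positive bounds.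
  The linear problems are solved by minimisation over \<open>H\<^sup>1\<^sub>0\<close>, and the truncated system by Schauder's
  argument: compactness of the solution operator, and Brouwer's theorem for its composition
  with averages over the cells of a grid.

  It remains to see that the truncation is inactive. Testing with an increasing function of
  \<open>ln \<theta>\<close> (or of \<open>- ln \<theta>\<close>) kills the transport term, because \<open>\<rho> u\<close> is solenoidal, and turns the
  diffusion \<open>C\<^sub>\<theta> / (\<theta> \<phi>) \<nabla>\<theta>\<close> into a uniformly elliptic one for \<open>ln \<theta>\<close> as long as \<open>\<phi>\<close> is bounded above.
  Stampacchia's iteration over the level sets, with the Faber--Krahn inequality coming from
  Nash's inequality, then gives the bounds. For the upper ones only \<open>D\<^sup>+\<close> matters: if it is small,
  \<open>\<phi> \<le> M\<^sub>\<phi>\<close> and \<open>\<theta> \<le> M\<^sub>\<theta>\<close> hold with constants chosen in this order. The lower bounds follow.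

  No trace theorem is needed: the boundary values enter by \<open>\<theta> = S \<circ> f + z\<close>, where \<open>f\<close> is an extension
  of \<open>a\<close>, \<open>S\<close> is a bounded \<open>C\<^sup>1\<close> function fixing the values of \<open>a\<close>, and \<open>z\<close> lies in \<open>H\<^sup>1\<^sub>0\<close>.
\<close>

section \<open>Square integrable functions\<close>

text \<open>The two upper bounds are coupled: the equation for ln \<theta> is elliptic with constant
  \<alpha>\<theta> / M\<phi>, the one for ln \<phi> with constant \<alpha>\<phi> / M\<theta>. The
  circle is broken by granting ln \<phi> a fixed budget of growth, ln 2, which determines M\<phi>.
  Normalising the contribution of the positive part of D to the source of \<theta> then determines
  M\<theta>, independently of \<tau>; finally \<tau> is taken so small that the source of \<phi>
  stays within the budget. Apart from C5, all other terms have the sign that pulls the unknown down.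
  They reappear in the lower bounds, which are chosen after u but before the truncated system is
  solved.

  The functional inequalities come from a single one: the L2 distance of a function to its averages
  over a grid of mesh e is at most a constant times e times the L2 norm of its gradient. Nash,
  Poincare, Faber-Krahn and Rellich follow, and also the continuity on H10 of integration against
  L^r functions. The condition r > N/2 enters in this last fact and in the positivity of
  \<open>rate\<close>.\<close>

definition sqi :: "'a measure \<Rightarrow> ('a \<Rightarrow> 'b::euclidean_space) \<Rightarrow> bool" where
  "sqi M f \<longleftrightarrow> f \<in> borel_measurable M \<and> integrable M (\<lambda>x. (norm (f x))\<^sup>2)"

definition l2n :: "'a measure \<Rightarrow> ('a \<Rightarrow> 'b::euclidean_space) \<Rightarrow> real" where
  "l2n M f = sqrt (\<integral>x. (norm (f x))\<^sup>2 \<partial>M)"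

lemma sqi_measurable: "sqi M f \<Longrightarrow> f \<in> borel_measurable M"
  by (simp add: sqi_def)

lemma l2n_nonneg [simp]: "0 \<le> l2n M f"
  by (simp add: l2n_def)

lemma l2n_power2: "(l2n M f)\<^sup>2 = (\<integral>x. (norm (f x))\<^sup>2 \<partial>M)"
  by (simp add: l2n_def)

lemma sqi_bound:
  assumes "sqi M g" "f \<in> borel_measurable M" "AE x in M. norm (f x) \<le> C * norm (g x)"
  shows "sqi M f"
  unfolding sqi_def
proof
  show "f \<in> borel_measurable M" by fact
  have "AE x in M. norm ((norm (f x))\<^sup>2) \<le> norm (C\<^sup>2 * (norm (g x))\<^sup>2)"
    using assms(3)
  proof eventually_elim
    case (elim x)
    have "(norm (f x))\<^sup>2 \<le> (C * norm (g x))\<^sup>2"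
      using elim by (intro power_mono) auto
    then show ?case by (simp add: power_mult_distrib)
  qed
  moreover have "integrable M (\<lambda>x. C\<^sup>2 * (norm (g x))\<^sup>2)"
    using assms(1) by (auto simp: sqi_def)
  moreover have "(\<lambda>x. (norm (f x))\<^sup>2) \<in> borel_measurable M" using assms(2) by measurable
  ultimately show "integrable M (\<lambda>x. (norm (f x))\<^sup>2)"
    using Bochner_Integration.integrable_bound by blast
qed

lemma norm_mult_le_squares: "norm a * norm b \<le> (norm a)\<^sup>2 + (norm b)\<^sup>2"
  for a :: "'a::real_normed_vector" and b :: "'b::real_normed_vector"
  using sum_squares_bound[of "norm a" "norm b"] 
    mult_nonneg_nonneg[OF norm_ge_zero[of a] norm_ge_zero[of b]]
  by (simp only: mult.assoc)

lemma norm_add_squares: "(norm (a + b))\<^sup>2 \<le> 2 * (norm a)\<^sup>2 + 2 * (norm b)\<^sup>2"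
  for a b :: "'a::real_normed_vector"
proof -
  have "(norm (a + b))\<^sup>2 \<le> (norm a + norm b)\<^sup>2"
    by (intro power_mono norm_triangle_ineq) auto
  also have "\<dots> \<le> 2 * (norm a)\<^sup>2 + 2 * (norm b)\<^sup>2"
    using sum_squares_bound[of "norm a" "norm b"] by (simp add: power2_sum)
  finally show ?thesis .
qed

lemma sqi_add [intro]:
  assumes "sqi M f" "sqi M g" shows "sqi M (\<lambda>x. f x + g x)"
  unfolding sqi_def
proof
  show m: "(\<lambda>x. f x + g x) \<in> borel_measurable M"
    using assms by (auto simp: sqi_def)
  have "integrable M (\<lambda>x. 2 * (norm (f x))\<^sup>2 + 2 * (norm (g x))\<^sup>2)"
    using assms by (auto simp: sqi_def)
  then show "integrable M (\<lambda>x. (norm (f x + g x))\<^sup>2)"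
    by (rule Bochner_Integration.integrable_bound)
      (use m in \<open>auto intro!: norm_add_squares\<close>)
qed

lemma sqi_scaleR [intro]:
  assumes "sqi M f" shows "sqi M (\<lambda>x. c *\<^sub>R f x)"
  by (rule sqi_bound[OF assms, of _ "\<bar>c\<bar>"]) (use assms in \<open>auto simp: sqi_def\<close>)

lemma sqi_diff [intro]:
  assumes "sqi M f" "sqi M g" shows "sqi M (\<lambda>x. f x - g x)"
  using sqi_add[OF assms(1) sqi_scaleR[OF assms(2), of "-1"]] by simp

lemma sqi_minus [intro]: "sqi M f \<Longrightarrow> sqi M (\<lambda>x. - f x)"
  using sqi_scaleR[of M f "-1"] by simp

lemma sqi_zero [simp, intro]: "sqi M (\<lambda>x. 0)"
  by (simp add: sqi_def)

lemma sqi_cong_AE: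
  assumes "sqi M f" "g \<in> borel_measurable M" "AE x in M. f x = g x"
  shows "sqi M g"
  by (rule sqi_bound[OF assms(1,2), of 1]) (use assms(3) in \<open>auto elim: eventually_mono\<close>)

lemma sqi_mult_bounded:
  assumes "sqi M f" "g \<in> borel_measurable M" "AE x in M. \<bar>g x\<bar> \<le> K"
  shows "sqi M (\<lambda>x. g x *\<^sub>R f x)"
  by (rule sqi_bound[OF assms(1), of _ K])
    (use assms in \<open>auto simp: sqi_def elim!: eventually_mono intro!: mult_right_mono\<close>)

lemma sqi_norm_integrable:
  assumes "sqi M f" "sqi M g"
  shows "integrable M (\<lambda>x. norm (f x) * norm (g x))"
proof (rule Bochner_Integration.integrable_bound)
  show "integrable M (\<lambda>x. (norm (f x))\<^sup>2 + (norm (g x))\<^sup>2)"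
    using assms by (auto simp: sqi_def)
qed (use assms in \<open>auto simp: sqi_def norm_mult_le_squares abs_mult\<close>)

lemma sqi_inner_integrable:
  assumes "sqi M f" "sqi M g"
  shows "integrable M (\<lambda>x. f x \<bullet> g x)"
  by (rule Bochner_Integration.integrable_bound[OF sqi_norm_integrable[OF assms]])
    (use assms in \<open>auto simp: sqi_def abs_mult Cauchy_Schwarz_ineq2\<close>)

lemma sqi_mult_integrable:
  fixes f :: "'a \<Rightarrow> real" and g :: "'a \<Rightarrow> 'b::euclidean_space"
  assumes "sqi M f" "sqi M g"
  shows "integrable M (\<lambda>x. f x *\<^sub>R g x)"
  by (rule Bochner_Integration.integrable_bound[OF sqi_norm_integrable[OF assms]])
    (use assms in \<open>auto simp: sqi_def\<close>)

lemma l2_Cauchy_Schwarz_norm: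
  assumes "sqi M f" "sqi M g"
  shows "(\<integral>x. norm (f x) * norm (g x) \<partial>M) \<le> l2n M f * l2n M g"
proof -
  have [measurable]: "f \<in> borel_measurable M" "g \<in> borel_measurable M" using assms by (auto simp: sqi_def)
  have sq: "(\<integral>\<^sup>+x. (ennreal (norm (h x)))\<^sup>2 \<partial>M) = ennreal ((l2n M h)\<^sup>2)" if "sqi M h" for h :: "'a \<Rightarrow> 'z::euclidean_space"
    using that by (simp add: ennreal_power l2n_power2 nn_integral_eq_integral sqi_def)
  have "(\<integral>\<^sup>+x. ennreal (norm (f x)) * ennreal (norm (g x)) \<partial>M) = ennreal (\<integral>x. norm (f x) * norm (g x) \<partial>M)"
    using sqi_norm_integrable[OF assms] by (simp add: nn_integral_eq_integral flip: ennreal_mult)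
  then have "(ennreal (\<integral>x. norm (f x) * norm (g x) \<partial>M))\<^sup>2 \<le> ennreal ((l2n M f)\<^sup>2) * ennreal ((l2n M g)\<^sup>2)"
    using Cauchy_Schwarz_nn_integral[of "\<lambda>x. ennreal (norm (f x))" M "\<lambda>x. ennreal (norm (g x))"] by (simp add: sq assms)
  then have "(\<integral>x. norm (f x) * norm (g x) \<partial>M)\<^sup>2 \<le> (l2n M f * l2n M g)\<^sup>2"
    by (simp add: ennreal_power ennreal_le_iff power_mult_distrib flip: ennreal_mult)
  then show ?thesis by (rule power2_le_imp_le) simp
qed

lemma l2_Cauchy_Schwarz:
  assumes "sqi M f" "sqi M g"
  shows "\<bar>\<integral>x. f x \<bullet> g x \<partial>M\<bar> \<le> l2n M f * l2n M g"
proof -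
  have "\<bar>\<integral>x. f x \<bullet> g x \<partial>M\<bar> \<le> (\<integral>x. norm (f x \<bullet> g x) \<partial>M)"
    using integral_norm_bound[of M "\<lambda>x. f x \<bullet> g x"] by simp
  also have "\<dots> \<le> (\<integral>x. norm (f x) * norm (g x) \<partial>M)"
    by (intro integral_mono) (auto intro!: sqi_inner_integrable sqi_norm_integrable assms Cauchy_Schwarz_ineq2)
  also have "\<dots> \<le> l2n M f * l2n M g" by (rule l2_Cauchy_Schwarz_norm[OF assms])
  finally show ?thesis .
qed

lemma l2n_scaleR [simp]: "l2n M (\<lambda>x. c *\<^sub>R f x) = \<bar>c\<bar> * l2n M f"
  by (simp add: l2n_def power_mult_distrib real_sqrt_mult)

lemma l2n_minus: "l2n M (\<lambda>x. - f x) = l2n M f"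
  by (simp add: l2n_def)

lemma l2n_minus_commute: "l2n M (\<lambda>x. f x - g x) = l2n M (\<lambda>x. g x - f x)"
  by (simp add: l2n_def norm_minus_commute)

lemma l2n_cong_AE:
  assumes "f \<in> borel_measurable M" "g \<in> borel_measurable M" "AE x in M. f x = g x"
  shows "l2n M f = l2n M g"
  unfolding l2n_def
  by (intro arg_cong[where f=sqrt] integral_cong_AE) (use assms in \<open>auto elim: eventually_mono\<close>)

lemma l2n_mono:
  assumes "sqi M g" "f \<in> borel_measurable M" "AE x in M. norm (f x) \<le> C * norm (g x)" "0 \<le> C"
  shows "l2n M f \<le> C * l2n M g"
proof -
  have "(\<integral>x. (norm (f x))\<^sup>2 \<partial>M) \<le> (\<integral>x. C\<^sup>2 * (norm (g x))\<^sup>2 \<partial>M)"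
  proof (rule integral_mono_AE)
    show "integrable M (\<lambda>x. (norm (f x))\<^sup>2)"
      using sqi_bound[OF assms(1-3)] by (simp add: sqi_def)
    show "integrable M (\<lambda>x. C\<^sup>2 * (norm (g x))\<^sup>2)" using assms(1) by (simp add: sqi_def)
    show "AE x in M. (norm (f x))\<^sup>2 \<le> C\<^sup>2 * (norm (g x))\<^sup>2"
      using assms(3) by eventually_elim (simp flip: power_mult_distrib add: power_mono)
  qed
  then have "l2n M f \<le> sqrt (C\<^sup>2 * (\<integral>x. (norm (g x))\<^sup>2 \<partial>M))"
    unfolding l2n_def by simp
  then show ?thesis using assms(4) by (simp add: l2n_def real_sqrt_mult)
qed

lemma l2n_triangle:
  assumes "sqi M f" "sqi M g"
  shows "l2n M (\<lambda>x. f x + g x) \<le> l2n M f + l2n M g"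
proof -
  have "(l2n M (\<lambda>x. f x + g x))\<^sup>2 = (\<integral>x. (norm (f x))\<^sup>2 + 2 * (f x \<bullet> g x) + (norm (g x))\<^sup>2 \<partial>M)"
    unfolding l2n_power2
    by (intro Bochner_Integration.integral_cong)
      (auto simp: power2_norm_eq_inner inner_add_left inner_add_right inner_commute)
  also have "\<dots> = (l2n M f)\<^sup>2 + 2 * (\<integral>x. f x \<bullet> g x \<partial>M) + (l2n M g)\<^sup>2"
    using assms sqi_inner_integrable[OF assms] by (simp add: l2n_power2 sqi_def)
  also have "\<dots> \<le> (l2n M f)\<^sup>2 + 2 * (l2n M f * l2n M g) + (l2n M g)\<^sup>2"
    using l2_Cauchy_Schwarz[OF assms] by simp
  also have "\<dots> = (l2n M f + l2n M g)\<^sup>2" by (simp add: power2_sum)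
  finally show ?thesis by (rule power2_le_imp_le) simp
qed

lemma l2n_triangle3:
  assumes "sqi M f" "sqi M g" "sqi M h"
  shows "l2n M (\<lambda>x. f x - h x) \<le> l2n M (\<lambda>x. f x - g x) + l2n M (\<lambda>x. g x - h x)"
  using l2n_triangle[OF sqi_diff[OF assms(1,2)] sqi_diff[OF assms(2,3)]] by simp

lemma l2n_bound_diff:
  assumes "sqi M f" "sqi M g"
  shows "\<bar>l2n M f - l2n M g\<bar> \<le> l2n M (\<lambda>x. f x - g x)"
  using l2n_triangle3[OF assms(1,2) sqi_zero] l2n_triangle3[OF assms(2,1) sqi_zero]
    l2n_minus_commute[of M f g] by simp

lemma l2n_eq_0_AE:
  assumes "sqi M f" "l2n M f = 0" shows "AE x in M. f x = 0"
  using assms integral_nonneg_eq_0_iff_AE[of M "\<lambda>x. (norm (f x))\<^sup>2"]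
  by (auto simp: l2n_def sqi_def)

text \<open>Square integrability of every member is part of the notion because \<open>l2n\<close> is
  built on the Bochner integral: it is 0 for a function that is not square integrable, and
  convergence to 0 would then mean nothing.\<close>

definition l2conv :: "'a measure \<Rightarrow> (nat \<Rightarrow> 'a \<Rightarrow> 'b::euclidean_space) \<Rightarrow> ('a \<Rightarrow> 'b) \<Rightarrow> bool" where
  "l2conv M F f \<longleftrightarrow> (\<forall>n. sqi M (F n)) \<and> sqi M f \<and> (\<lambda>n. l2n M (\<lambda>x. F n x - f x)) \<longlonglongrightarrow> 0"

lemma l2convD:
  assumes "l2conv M F f"
  shows "sqi M (F n)" "sqi M f" "(\<lambda>n. l2n M (\<lambda>x. F n x - f x)) \<longlonglongrightarrow> 0"
  using assms by (auto simp: l2conv_def)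

lemma l2conv_subseq: "l2conv M F f \<Longrightarrow> strict_mono r \<Longrightarrow> l2conv M (\<lambda>n. F (r n)) f"
  unfolding l2conv_def using LIMSEQ_subseq_LIMSEQ[of _ 0 r] by (fastforce simp: o_def)

lemma l2conv_const: "sqi M f \<Longrightarrow> l2conv M (\<lambda>n. f) f"
  by (simp add: l2conv_def l2n_def)

lemma l2conv_add:
  assumes "l2conv M F f" "l2conv M G g"
  shows "l2conv M (\<lambda>n x. F n x + G n x) (\<lambda>x. f x + g x)"
proof -
  note * = l2convD[OF assms(1)] l2convD[OF assms(2)]
  have "(\<lambda>n. l2n M (\<lambda>x. F n x + G n x - (f x + g x))) \<longlonglongrightarrow> 0"
  proof (rule Lim_null_comparison[OF _ tendsto_add_zero[OF *(3) *(6)]])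
    have "l2n M (\<lambda>x. F n x + G n x - (f x + g x)) = l2n M (\<lambda>x. (F n x - f x) + (G n x - g x))" for n
      by (simp add: algebra_simps)
    then show "\<forall>\<^sub>F n in sequentially. norm (l2n M (\<lambda>x. F n x + G n x - (f x + g x)))
        \<le> l2n M (\<lambda>x. F n x - f x) + l2n M (\<lambda>x. G n x - g x)"
      by (auto intro!: always_eventually l2n_triangle sqi_diff *(1,2,4,5))
  qed
  then show ?thesis using * by (auto simp: l2conv_def)
qed

lemma l2conv_scaleR:
  assumes "l2conv M F f"
  shows "l2conv M (\<lambda>n x. c *\<^sub>R F n x) (\<lambda>x. c *\<^sub>R f x)"
proof -
  have "l2n M (\<lambda>x. c *\<^sub>R F n x - c *\<^sub>R f x) = \<bar>c\<bar> * l2n M (\<lambda>x. F n x - f x)" for n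
    by (simp flip: scaleR_diff_right)
  then show ?thesis using assms tendsto_mult_right_zero[OF l2convD(3)[OF assms], of "\<bar>c\<bar>"]
    by (auto simp: l2conv_def)
qed

lemma l2conv_diff:
  assumes "l2conv M F f" "l2conv M G g"
  shows "l2conv M (\<lambda>n x. F n x - G n x) (\<lambda>x. f x - g x)"
  using l2conv_add[OF assms(1) l2conv_scaleR[OF assms(2), of "-1"]] by simp

lemma l2conv_norm_tendsto:
  assumes "l2conv M F f" shows "(\<lambda>n. l2n M (F n)) \<longlonglongrightarrow> l2n M f"
proof -
  note * = l2convD[OF assms]
  have "(\<lambda>n. l2n M (F n) - l2n M f) \<longlonglongrightarrow> 0"
    by (rule Lim_null_comparison[OF _ *(3)]) (use * in \<open>auto intro!: always_eventually l2n_bound_diff\<close>)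
  then show ?thesis by (simp add: LIM_zero_iff)
qed

lemma l2conv_inner:
  assumes "l2conv M F f" "l2conv M G g"
  shows "(\<lambda>n. \<integral>x. F n x \<bullet> G n x \<partial>M) \<longlonglongrightarrow> (\<integral>x. f x \<bullet> g x \<partial>M)"
proof -
  note * = l2convD[OF assms(1)] l2convD[OF assms(2)]
  have "(\<lambda>n. (\<integral>x. F n x \<bullet> G n x \<partial>M) - (\<integral>x. f x \<bullet> g x \<partial>M)) \<longlonglongrightarrow> 0"
  proof (rule Lim_null_comparison)
    have "norm ((\<integral>x. F n x \<bullet> G n x \<partial>M) - (\<integral>x. f x \<bullet> g x \<partial>M))
       \<le> l2n M (\<lambda>x. F n x - f x) * l2n M (G n) + l2n M f * l2n M (\<lambda>x. G n x - g x)" for n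
    proof -
      have "(\<integral>x. F n x \<bullet> G n x \<partial>M) - (\<integral>x. f x \<bullet> g x \<partial>M)
        = (\<integral>x. (F n x - f x) \<bullet> G n x \<partial>M) + (\<integral>x. f x \<bullet> (G n x - g x) \<partial>M)"
        using * by (simp add: sqi_inner_integrable inner_diff_left inner_diff_right)
      moreover have "\<bar>\<integral>x. (F n x - f x) \<bullet> G n x \<partial>M\<bar> \<le> l2n M (\<lambda>x. F n x - f x) * l2n M (G n)"
        "\<bar>\<integral>x. f x \<bullet> (G n x - g x) \<partial>M\<bar> \<le> l2n M f * l2n M (\<lambda>x. G n x - g x)"
        using * by (auto intro!: l2_Cauchy_Schwarz)
      ultimately show ?thesis by simp
    qed
    then show "\<forall>\<^sub>F n in sequentially. norm ((\<integral>x. F n x \<bullet> G n x \<partial>M) - (\<integral>x. f x \<bullet> g x \<partial>M))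
       \<le> l2n M (\<lambda>x. F n x - f x) * l2n M (G n) + l2n M f * l2n M (\<lambda>x. G n x - g x)" by simp
    show "(\<lambda>n. l2n M (\<lambda>x. F n x - f x) * l2n M (G n) + l2n M f * l2n M (\<lambda>x. G n x - g x)) \<longlonglongrightarrow> 0"
      using tendsto_add[OF tendsto_mult[OF *(3) l2conv_norm_tendsto[OF assms(2)]]
          tendsto_mult[OF tendsto_const[of "l2n M f"] *(6)]] by simp
  qed
  then show ?thesis by (simp add: LIM_zero_iff)
qed

lemma l2conv_AE_subseq:
  assumes "l2conv M F f"
  shows "\<exists>r. strict_mono r \<and> (AE x in M. (\<lambda>n. F (r n) x) \<longlonglongrightarrow> f x)"
proof -
  note * = l2convD[OF assms]
  have i: "integrable M (\<lambda>x. (norm (F n x - f x))\<^sup>2)" for n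
    using sqi_diff[OF *(1,2)] by (simp add: sqi_def)
  have "(\<lambda>n. (\<integral>x. norm ((norm (F n x - f x))\<^sup>2) \<partial>M)) \<longlonglongrightarrow> 0"
    using tendsto_power[OF *(3), of 2] by (simp add: l2n_power2)
  from tendsto_L1_AE_subseq[OF i this]
  obtain r where r: "strict_mono r" "AE x in M. (\<lambda>n. (norm (F (r n) x - f x))\<^sup>2) \<longlonglongrightarrow> 0" by auto
  have "AE x in M. (\<lambda>n. F (r n) x) \<longlonglongrightarrow> f x"
    using r(2)
  proof eventually_elim
    case (elim x)
    from tendsto_real_sqrt[OF this] show ?case
      by (simp add: tendsto_norm_zero_iff LIM_zero_iff)
  qed
  with r(1) show ?thesis by blast
qed

lemma l2conv_dominated:
  fixes F :: "nat \<Rightarrow> 'a \<Rightarrow> 'b::euclidean_space" and g :: "'a \<Rightarrow> 'c::euclidean_space"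
  assumes "sqi M g" "\<And>n. F n \<in> borel_measurable M" "f \<in> borel_measurable M"
    and "AE x in M. (\<lambda>n. F n x) \<longlonglongrightarrow> f x"
    and "\<And>n. AE x in M. norm (F n x) \<le> norm (g x)"
  shows "l2conv M F f"
proof -
  have s: "sqi M (F n)" for n using sqi_bound[OF assms(1,2), of _ 1] assms(5) by simp
  have AE: "AE x in M. \<forall>n. norm (F n x) \<le> norm (g x)" using assms(5) by (simp add: AE_all_countable)
  have "AE x in M. norm (f x) \<le> norm (g x)"
    using assms(4) AE
  proof eventually_elim
    case (elim x)
    from elim(2) show ?case by (intro LIMSEQ_le_const2[OF tendsto_norm[OF elim(1)]]) auto
  qed
  note fb = this
  then have sf: "sqi M f" by (intro sqi_bound[OF assms(1,3), of 1]) simp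
  have "(\<lambda>n. \<integral>x. (norm (F n x - f x))\<^sup>2 \<partial>M) \<longlonglongrightarrow> (\<integral>x. 0 \<partial>M)"
  proof (rule integral_dominated_convergence[where w="\<lambda>x. (2 * norm (g x))\<^sup>2"])
    show "integrable M (\<lambda>x. (2 * norm (g x))\<^sup>2)" using assms(1) by (simp add: sqi_def power_mult_distrib)
    show "AE x in M. (\<lambda>i. (norm (F i x - f x))\<^sup>2) \<longlonglongrightarrow> 0"
      using assms(4)
    proof eventually_elim
      case (elim x)
      from tendsto_power[OF tendsto_norm_zero[OF LIM_zero[OF elim]], of 2] show ?case by simp
    qed
    show "AE x in M. norm ((norm (F n x - f x))\<^sup>2) \<le> (2 * norm (g x))\<^sup>2" for n
      using assms(5)[of n] fb
    proof eventually_elim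
      case (elim x)
      have "norm (F n x - f x) \<le> 2 * norm (g x)" using norm_triangle_ineq4[of "F n x" "f x"] elim by simp
      from power_mono[OF this, of 2] show ?case by simp
    qed
  qed (use assms in auto)
  then have "(\<lambda>n. l2n M (\<lambda>x. F n x - f x)) \<longlonglongrightarrow> sqrt 0"
    unfolding l2n_def by (intro tendsto_real_sqrt) simp
  then show ?thesis using s sf by (simp add: l2conv_def)
qed

text \<open>Fatou's lemma. The bound is asked for only eventually, so that it applies to the tail of
  a Cauchy sequence.\<close>

lemma l2n_le_liminf:
  assumes "\<And>n. sqi M (F n)" "f \<in> borel_measurable M" "AE x in M. (\<lambda>n. F n x) \<longlonglongrightarrow> f x"
    and "\<forall>\<^sub>F n in sequentially. l2n M (F n) \<le> B"
  shows "sqi M f" "l2n M f \<le> B"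
proof -
  have B: "0 \<le> B" using assms(4) l2n_nonneg
    by (metis (mono_tags, lifting) eventually_sequentially order_refl order_trans)
  have [measurable]: "F n \<in> borel_measurable M" for n using assms(1) by (simp add: sqi_def)
  have "(\<integral>\<^sup>+x. ennreal ((norm (f x))\<^sup>2) \<partial>M) = (\<integral>\<^sup>+x. liminf (\<lambda>n. ennreal ((norm (F n x))\<^sup>2)) \<partial>M)"
  proof (rule nn_integral_cong_AE)
    show "AE x in M. ennreal ((norm (f x))\<^sup>2) = liminf (\<lambda>n. ennreal ((norm (F n x))\<^sup>2))"
      using assms(3)
    proof eventually_elim
      case (elim x)
      have "(\<lambda>n. ennreal ((norm (F n x))\<^sup>2)) \<longlonglongrightarrow> ennreal ((norm (f x))\<^sup>2)"
        by (intro tendsto_intros elim)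
      then show ?case by (metis lim_imp_Liminf sequentially_bot)
    qed
  qed
  also have "\<dots> \<le> liminf (\<lambda>n. \<integral>\<^sup>+x. ennreal ((norm (F n x))\<^sup>2) \<partial>M)"
    by (intro nn_integral_liminf) simp
  also have "\<dots> \<le> ennreal (B\<^sup>2)"
  proof (rule Liminf_le)
    have "(\<integral>\<^sup>+x. ennreal ((norm (F n x))\<^sup>2) \<partial>M) = ennreal ((l2n M (F n))\<^sup>2)" for n
      unfolding l2n_power2 using assms(1)[of n] by (intro nn_integral_eq_integral) (auto simp: sqi_def)
    then show "\<forall>\<^sub>F n in sequentially. (\<integral>\<^sup>+x. ennreal ((norm (F n x))\<^sup>2) \<partial>M) \<le> ennreal (B\<^sup>2)"
      using assms(4) by (auto intro!: ennreal_leI power_mono elim!: eventually_mono)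
  qed auto
  finally have fin: "(\<integral>\<^sup>+x. ennreal ((norm (f x))\<^sup>2) \<partial>M) \<le> ennreal (B\<^sup>2)" .
  then have i: "integrable M (\<lambda>x. (norm (f x))\<^sup>2)"
    using assms(2) by (intro integrableI_bounded) (auto simp: top.extremum_strict intro: le_less_trans)
  then show "sqi M f" using assms(2) by (simp add: sqi_def)
  have "ennreal ((l2n M f)\<^sup>2) \<le> ennreal (B\<^sup>2)"
    using fin nn_integral_eq_integral[OF i] by (simp add: l2n_power2)
  then have "(l2n M f)\<^sup>2 \<le> B\<^sup>2" by (simp add: ennreal_le_iff)
  then show "l2n M f \<le> B" using B by (rule power2_le_imp_le)
qed

section \<open>Finite measures: completeness of L2 and Hoelder's inequality on a set\<close>

lemma (in finite_measure) sqi_const [simp, intro]: "sqi M (\<lambda>x. c)"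
  by (simp add: sqi_def)

lemma (in finite_measure) sqi_bounded:
  assumes "f \<in> borel_measurable M" "AE x in M. norm (f x) \<le> K"
  shows "sqi M f"
  by (rule sqi_bound[OF sqi_const[of "1::real"] assms(1), of K]) (use assms in simp)

lemma (in finite_measure) sqi_integrable:
  assumes "sqi M f" shows "integrable M f" "(\<integral>x. norm (f x) \<partial>M) \<le> sqrt (measure M (space M)) * l2n M f"
proof -
  show "integrable M f"
    using sqi_mult_integrable[OF sqi_const[of "1::real"] assms] by simp
  show "(\<integral>x. norm (f x) \<partial>M) \<le> sqrt (measure M (space M)) * l2n M f"
    using l2_Cauchy_Schwarz_norm[OF sqi_const[of "1::real"] assms] by (simp add: l2n_def)
qed

text \<open>A finite measure bounds the L1 norm by the L2 norm, so a subsequence is Cauchy almost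
  everywhere; Fatou's lemma then shows that the whole sequence tends to the pointwise limit in
  L2.\<close>

lemma (in finite_measure) l2_complete:
  fixes F :: "nat \<Rightarrow> 'a \<Rightarrow> 'b::euclidean_space"
  assumes F: "\<And>n. sqi M (F n)"
    and C: "\<And>e. 0 < e \<Longrightarrow> \<exists>K. \<forall>m\<ge>K. \<forall>n\<ge>K. l2n M (\<lambda>x. F m x - F n x) < e"
  shows "\<exists>f. l2conv M F f"
proof -
  have [measurable]: "F n \<in> borel_measurable M" for n using F by (simp add: sqi_def)
  define c where "c = sqrt (measure M (space M)) + 1"
  have c: "0 < c" by (simp add: c_def add_nonneg_pos)
  have cau: "\<exists>N. \<forall>i\<ge>N. \<forall>j\<ge>N. (\<integral>x. norm (F i x - F j x) \<partial>M) < e" if e: "0 < e" for e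
  proof -
    obtain N where N: "\<forall>m\<ge>N. \<forall>n\<ge>N. l2n M (\<lambda>x. F m x - F n x) < e / c" using C[OF divide_pos_pos[OF e c]] by blast
    have "(\<integral>x. norm (F i x - F j x) \<partial>M) < e" if "N \<le> i" "N \<le> j" for i j
    proof -
      have "(\<integral>x. norm (F i x - F j x) \<partial>M) \<le> sqrt (measure M (space M)) * l2n M (\<lambda>x. F i x - F j x)"
        by (rule sqi_integrable(2)[OF sqi_diff[OF F F]])
      also have "\<dots> \<le> c * l2n M (\<lambda>x. F i x - F j x)" by (intro mult_right_mono) (auto simp: c_def)
      also have "\<dots> < c * (e / c)" using N that c by (intro mult_strict_left_mono) auto
      finally show ?thesis using c by simp
    qed
    then show ?thesis by blast
  qed
  obtain r where r: "strict_mono r" "AE x in M. Cauchy (\<lambda>i. F (r i) x)"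
    by (rule cauchy_L1_AE_cauchy_subseq[of M F, OF sqi_integrable(1)[OF F] cau]) auto
  define f where "f x = lim (\<lambda>k. F (r k) x)" for x
  have fm [measurable]: "f \<in> borel_measurable M" unfolding f_def by measurable
  have lim: "AE x in M. (\<lambda>k. F (r k) x) \<longlonglongrightarrow> f x"
    using r(2) by eventually_elim (simp add: f_def Cauchy_convergent_iff convergent_LIMSEQ_iff)
  have key: "\<exists>K. \<forall>m\<ge>K. sqi M (\<lambda>x. F m x - f x) \<and> l2n M (\<lambda>x. F m x - f x) \<le> e" if e: "0 < e" for e
  proof -
    obtain K where K: "\<forall>m\<ge>K. \<forall>n\<ge>K. l2n M (\<lambda>x. F m x - F n x) < e" using C[OF e] by blast
    have "sqi M (\<lambda>x. F m x - f x) \<and> l2n M (\<lambda>x. F m x - f x) \<le> e" if "K \<le> m" for m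
    proof -
      have a: "AE x in M. (\<lambda>j. F m x - F (r j) x) \<longlonglongrightarrow> F m x - f x"
        using lim by eventually_elim (intro tendsto_intros)
      have b: "\<forall>\<^sub>F j in sequentially. l2n M (\<lambda>x. F m x - F (r j) x) \<le> e"
        by (rule eventually_sequentiallyI[of K]) (use K that seq_suble[OF r(1)] in \<open>meson less_imp_le order_trans\<close>)
      show ?thesis using l2n_le_liminf[OF sqi_diff[OF F F] _ a b] by auto
    qed
    then show ?thesis by blast
  qed
  obtain m where "sqi M (\<lambda>x. F m x - f x)" using key[of 1] by auto
  from sqi_diff[OF F[of m] this] have sf: "sqi M f" by simp
  have "(\<lambda>n. l2n M (\<lambda>x. F n x - f x)) \<longlonglongrightarrow> 0"
  proof (rule LIMSEQ_I)
    fix e :: real assume "0 < e"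
    then show "\<exists>no. \<forall>n\<ge>no. norm (l2n M (\<lambda>x. F n x - f x) - 0) < e"
      using key[of "e/2"] by fastforce
  qed
  then show ?thesis using F sf by (auto simp: l2conv_def)
qed

lemma l2conv_unique:
  assumes "l2conv M F f" "l2conv M F g" shows "AE x in M. f x = g x"
proof -
  have "l2conv M (\<lambda>n x. F n x - F n x) (\<lambda>x. f x - g x)" by (rule l2conv_diff[OF assms])
  then have "(\<lambda>n. l2n M (\<lambda>x. 0 - (f x - g x))) \<longlonglongrightarrow> 0" by (simp add: l2conv_def)
  then have "l2n M (\<lambda>x. f x - g x) = 0" by (simp add: LIMSEQ_const_iff l2n_minus_commute[of M g])
  then have "AE x in M. f x - g x = 0"
    by (intro l2n_eq_0_AE) (use assms in \<open>auto simp: l2conv_def\<close>)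
  then show ?thesis by simp
qed

text \<open>
  Hoelder's inequality on a set, up to a factor \<open>2\<close>: split \<open>\<bar>f\<bar>\<close> at the level
  \<open>t = (\<integral>\<bar>f\<bar>\<^sup>r / \<mu>(A))\<^sup>1\<^sup>/\<^sup>r\<close>.
\<close>
lemma (in finite_measure) Lp_integral_set:
  fixes f :: "'a \<Rightarrow> real"
  assumes f: "f \<in> Lp M r" and r: "r > 1" and A[measurable]: "A \<in> sets M"
  shows "integrable M f"
    and "(\<integral>x. \<bar>f x\<bar> * indicator A x \<partial>M) \<le> 2 * Lp_norm M r f * measure M A powr (1 - 1/r)"
proof -
  have [measurable]: "f \<in> borel_measurable M" and fr: "integrable M (\<lambda>x. \<bar>f x\<bar> powr r)"
    using f by (auto simp: Lp_def)
  \<comment> \<open>Above the level t write |y| = |y|^r |y|^(1 - r); the exponent 1 - r is negative,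
    so the last factor is largest at t.\<close>
  have pw: "\<bar>y\<bar> \<le> t + \<bar>y\<bar> powr r * t powr (1 - r)" if "t > 0" for y t :: real
  proof (cases "\<bar>y\<bar> \<le> t")
    case False
    then have "\<bar>y\<bar> = \<bar>y\<bar> powr r * \<bar>y\<bar> powr (1 - r)" using that by (simp flip: powr_add)
    also have "\<dots> \<le> \<bar>y\<bar> powr r * t powr (1 - r)"
      using False that r by (intro mult_left_mono powr_mono2') auto
    finally show ?thesis using that by simp
  qed (simp add: that add_increasing2)
  show i: "integrable M f"
  proof (rule Bochner_Integration.integrable_bound)
    show "integrable M (\<lambda>x. 1 + \<bar>f x\<bar> powr r)" using fr by simp
    show "AE x in M. norm (f x) \<le> norm (1 + \<bar>f x\<bar> powr r)"
    proof (rule AE_I2)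
      fix x show "norm (f x) \<le> norm (1 + \<bar>f x\<bar> powr r)"
        using pw[of 1 "f x"] by simp
    qed
  qed simp
  define I where "I = (\<integral>x. \<bar>f x\<bar> powr r \<partial>M)"
  define m where "m = measure M A"
  have I0: "0 \<le> I" unfolding I_def by simp
  have m0: "0 \<le> m" unfolding m_def by simp
  have est: "(\<integral>x. \<bar>f x\<bar> * indicator A x \<partial>M) \<le> t * m + I * t powr (1 - r)" if "t > 0" for t
  proof -
    have "(\<integral>x. \<bar>f x\<bar> * indicator A x \<partial>M) \<le> (\<integral>x. t * indicator A x + \<bar>f x\<bar> powr r * t powr (1 - r) \<partial>M)"
    proof (rule integral_mono)
      show "integrable M (\<lambda>x. \<bar>f x\<bar> * indicator A x)"
        using integrable_mult_indicator[OF A integrable_abs[OF i]] by (simp add: mult.commute)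
      show "integrable M (\<lambda>x. t * indicator A x + \<bar>f x\<bar> powr r * t powr (1 - r))"
        using fr by (auto intro!: integrable_real_indicator simp: emeasure_eq_measure)
      show "\<bar>f x\<bar> * indicator A x \<le> t * indicator A x + \<bar>f x\<bar> powr r * t powr (1 - r)" for x
        using pw[OF that, of "f x"] by (cases "x \<in> A") auto
    qed
    also have "\<dots> = t * m + I * t powr (1 - r)"
      using fr by (subst Bochner_Integration.integral_add)
        (auto intro!: integrable_real_indicator simp: emeasure_eq_measure I_def m_def)
    finally show ?thesis .
  qed
  have N: "Lp_norm M r f = I powr (1/r)" by (simp add: Lp_norm_def I_def)
  show "(\<integral>x. \<bar>f x\<bar> * indicator A x \<partial>M) \<le> 2 * Lp_norm M r f * measure M A powr (1 - 1/r)"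
  proof (cases "m = 0 \<or> I = 0")
    case True
    have "(\<integral>x. \<bar>f x\<bar> * indicator A x \<partial>M) = (\<integral>x. 0 \<partial>M)"
      using True
    proof
      assume "m = 0"
      then have "A \<in> null_sets M" by (simp add: m_def emeasure_eq_measure null_sets_def)
      then show ?thesis
        by (intro integral_cong_AE) (auto dest!: AE_not_in elim!: eventually_mono)
    next
      assume "I = 0"
      then have "AE x in M. \<bar>f x\<bar> powr r = 0"
        unfolding I_def using fr by (subst (asm) integral_nonneg_eq_0_iff_AE) auto
      then show ?thesis by (intro integral_cong_AE) (auto elim!: eventually_mono)
    qed
    then show ?thesis by (simp add: N)
  next
    case False
    then have mI: "m > 0" "I > 0" using I0 m0 by auto
    define t where "t = (I / m) powr (1/r)"
    have t: "t > 0" using mI by (simp add: t_def)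
    have "t * m = I powr (1/r) * m powr (1 - 1/r)"
      using mI r by (simp add: t_def powr_divide powr_diff)
    moreover have "I * t powr (1 - r) = I powr (1/r) * m powr (1 - 1/r)"
    proof -
      have "(1/r) * (1 - r) = 1/r - 1" using r by (simp add: field_simps)
      then have "I * t powr (1 - r) = I * (I / m) powr (1/r - 1)" by (simp add: t_def powr_powr)
      also have "\<dots> = I powr (1/r) * m powr (1 - 1/r)"
        using mI by (simp add: powr_divide powr_diff field_simps)
      finally show ?thesis .
    qed
    ultimately show ?thesis using est[OF t] by (simp add: N m_def)
  qed
qed

section \<open>Smooth functions\<close>

lemma has_derivative_grad:
  fixes f :: "real^'n \<Rightarrow> real"
  assumes "f differentiable (at x)"
  shows "(f has_derivative (\<lambda>h. grad f x \<bullet> h)) (at x)"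
proof -
  have d: "(f has_derivative frechet_derivative f (at x)) (at x)"
    using assms by (simp add: frechet_derivative_works)
  interpret bounded_linear "frechet_derivative f (at x)" by (rule has_derivative_bounded_linear[OF d])
  have "frechet_derivative f (at x) h = grad f x \<bullet> h" for h
  proof -
    have "h = (\<Sum>i\<in>UNIV. h $ i *\<^sub>R axis i 1)"
      using basis_expansion[of h] by (simp add: scalar_mult_eq_scaleR)
    then have "frechet_derivative f (at x) h = (\<Sum>i\<in>UNIV. h $ i * frechet_derivative f (at x) (axis i 1))"
      by (metis (mono_tags, lifting) sum scaleR real_scaleR_def sum.cong)
    then show ?thesis by (simp add: inner_vec_def grad_def partial_def mult.commute)
  qed
  then have "frechet_derivative f (at x) = (\<lambda>h. grad f x \<bullet> h)" by (rule ext)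
  with d show ?thesis by simp
qed

lemma grad_eqI:
  fixes f :: "real^'n \<Rightarrow> real"
  assumes "(f has_derivative (\<lambda>h. g \<bullet> h)) (at x)"
  shows "grad f x = g" "partial i f x = g $ i"
proof -
  have "frechet_derivative f (at x) = (\<lambda>h. g \<bullet> h)"
    using frechet_derivative_at[OF assms] by simp
  then show "partial i f x = g $ i" for i by (simp add: partial_def inner_axis)
  then show "grad f x = g" by (simp add: grad_def)
qed

lemma partial_eqI:
  assumes "(f has_derivative f') (at x)" shows "partial i f x = f' (axis i 1)"
  using frechet_derivative_at[OF assms] by (simp add: partial_def)

lemma C_k_Suc_D: "C_k (Suc k) f \<Longrightarrow> C_k k f"
proof (induction k arbitrary: f)
  case 0
  then show ?case
    by (auto simp: continuous_on_eq_continuous_at intro!: differentiable_imp_continuous_within)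
qed auto

lemma C_k_mono: "j \<le> k \<Longrightarrow> C_k k f \<Longrightarrow> C_k j f"
  by (induction k) (auto simp: le_Suc_eq dest: C_k_Suc_D simp del: C_k.simps(2))

lemma C_k_const: "C_k k (\<lambda>x::real^'a::finite. c)"
proof (induction k arbitrary: c)
  case (Suc k)
  have "partial i (\<lambda>x::real^'a. c) = (\<lambda>x. 0)" for i :: "'a::finite"
    by (rule ext, subst partial_eqI[OF has_derivative_const]) simp
  then show ?case using Suc[of 0] by simp
qed simp

lemma partial_add:
  assumes "f differentiable (at x)" "g differentiable (at x)"
  shows "partial i (\<lambda>x. f x + g x) x = partial i f x + partial i g x"
  by (subst partial_eqI[OF has_derivative_add[OF assms[THEN has_derivative_grad]]])
    (simp add: grad_def inner_axis)

lemma partial_mult: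
  assumes "f differentiable (at x)" "g differentiable (at x)"
  shows "partial i (\<lambda>x. f x * g x) x = f x * partial i g x + partial i f x * g x"
  by (subst partial_eqI[OF has_derivative_mult[OF assms[THEN has_derivative_grad]]])
    (simp add: grad_def inner_axis)

lemma C_k_add: "C_k k f \<Longrightarrow> C_k k g \<Longrightarrow> C_k k (\<lambda>x. f x + g x)"
proof (induction k arbitrary: f g)
  case (Suc k)
  have "partial i (\<lambda>x. f x + g x) = (\<lambda>x. partial i f x + partial i g x)" for i
    using Suc.prems by (auto intro!: partial_add)
  then show ?case using Suc by (auto intro!: derivative_intros)
qed (auto intro: continuous_intros)

lemma C_k_mult: "C_k k f \<Longrightarrow> C_k k g \<Longrightarrow> C_k k (\<lambda>x. f x * g x)"
proof (induction k arbitrary: f g)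
  case (Suc k)
  have "partial i (\<lambda>x. f x * g x) = (\<lambda>x. f x * partial i g x + partial i f x * g x)" for i
    using Suc.prems by (auto intro!: partial_mult)
  moreover have "C_k k f" "C_k k g" using Suc.prems C_k_Suc_D by blast+
  ultimately show ?case using Suc by (auto intro!: derivative_intros C_k_add)
qed (auto intro: continuous_intros)

lemma partial_affine:
  assumes "\<And>x. f differentiable (at x)"
  shows "partial i (\<lambda>x. f (a + c *\<^sub>R x)) x = c * partial i f (a + c *\<^sub>R x)"
    and "(\<lambda>x. f (a + c *\<^sub>R x)) differentiable (at x)"
proof -
  have "((\<lambda>x. a + c *\<^sub>R x) has_derivative (\<lambda>h. c *\<^sub>R h)) (at x)"
    by (auto intro!: derivative_eq_intros)
  from has_derivative_compose[OF this has_derivative_grad[OF assms]]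
  have d: "((\<lambda>x. f (a + c *\<^sub>R x)) has_derivative (\<lambda>h. grad f (a + c *\<^sub>R x) \<bullet> c *\<^sub>R h)) (at x)" .
  then show "(\<lambda>x. f (a + c *\<^sub>R x)) differentiable (at x)" by (auto simp: differentiable_def)
  show "partial i (\<lambda>x. f (a + c *\<^sub>R x)) x = c * partial i f (a + c *\<^sub>R x)"
    by (subst partial_eqI[OF d]) (simp add: grad_def inner_axis)
qed

lemma C_k_affine: "C_k k f \<Longrightarrow> C_k k (\<lambda>x. f (a + c *\<^sub>R x))"
proof (induction k arbitrary: f)
  case 0
  then show ?case
    by (auto intro!: continuous_on_compose2[of UNIV f] continuous_intros)
next
  case (Suc k)
  have "partial i (\<lambda>x. f (a + c *\<^sub>R x)) = (\<lambda>x. c * partial i f (a + c *\<^sub>R x))" for i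
    using Suc.prems by (auto intro!: partial_affine)
  then show ?case using Suc by (auto intro!: partial_affine(2) C_k_mult C_k_const)
qed

lemma smoothD: "smooth f \<Longrightarrow> f differentiable (at x)" "smooth f \<Longrightarrow> smooth (partial i f)"
  "smooth f \<Longrightarrow> continuous_on UNIV f"
  unfolding smooth_def by (metis C_k.simps(2), metis C_k.simps(2), metis C_k.simps(1))

lemma smooth_add: "smooth f \<Longrightarrow> smooth g \<Longrightarrow> smooth (\<lambda>x. f x + g x)"
  and smooth_mult: "smooth f \<Longrightarrow> smooth g \<Longrightarrow> smooth (\<lambda>x. f x * g x)"
  and smooth_const: "smooth (\<lambda>x. c)"
  and smooth_affine: "smooth f \<Longrightarrow> smooth (\<lambda>x. f (a + c *\<^sub>R x))"
  by (auto simp: smooth_def intro: C_k_add C_k_mult C_k_const C_k_affine)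

text \<open>\<open>d i m\<close> stands for the m-th derivative of the factor in coordinate i.
  Letting the order \<open>m\<close> vary with the coordinate makes the family closed under partial
  derivatives, so the induction runs for all \<open>m\<close> at once.\<close>

lemma C_k_coordinate_product:
  fixes d :: "'n::finite \<Rightarrow> nat \<Rightarrow> real \<Rightarrow> real"
  assumes d: "\<And>i m t. (d i m has_real_derivative d i (Suc m) t) (at t)"
  shows "C_k k (\<lambda>x::real^'n. \<Prod>i\<in>UNIV. d i (m i) (x $ i))"
proof (induction k arbitrary: m)
  case 0
  have c: "continuous_on UNIV (d i n)" for i n
    using DERIV_isCont[OF d] by (auto simp: continuous_on_eq_continuous_at)
  show ?case
    unfolding C_k.simps(1)
    by (rule continuous_on_prod, rule continuous_on_compose2[OF c], rule continuous_on_component) auto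
next
  case (Suc k)
  have D: "((\<lambda>x::real^'n. d i n (x $ i)) has_derivative (\<lambda>h. h $ i * d i (Suc n) (x $ i))) (at x)" for i n x
    by (rule DERIV_compose_FDERIV[OF d])
      (rule bounded_linear.has_derivative[OF bounded_linear_vec_nth has_derivative_ident])
  have DP: "((\<lambda>x::real^'n. \<Prod>i\<in>UNIV. d i (m i) (x $ i)) has_derivative
     (\<lambda>h. \<Sum>i\<in>UNIV. h $ i * d i (Suc (m i)) (x $ i) * (\<Prod>j\<in>UNIV - {i}. d j (m j) (x $ j)))) (at x)" for x
    by (rule has_derivative_prod) (rule D)
  have "partial i (\<lambda>x. \<Prod>i\<in>UNIV. d i (m i) (x $ i)) = (\<lambda>x. \<Prod>j\<in>UNIV. d j ((m(i := Suc (m i))) j) (x $ j))" for i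
  proof
    fix x :: "real^'n"
    have "(\<Prod>j\<in>UNIV. d j ((m(i := Suc (m i))) j) (x $ j))
       = d i (Suc (m i)) (x $ i) * (\<Prod>j\<in>UNIV - {i}. d j (m j) (x $ j))"
      by (subst prod.remove[of _ i]) (auto intro!: prod.cong)
    moreover have "(\<Sum>j\<in>UNIV. axis i 1 $ j * d j (Suc (m j)) (x $ j) * (\<Prod>l\<in>UNIV - {j}. d l (m l) (x $ l)))
      = d i (Suc (m i)) (x $ i) * (\<Prod>j\<in>UNIV - {i}. d j (m j) (x $ j))"
      by (subst sum.remove[of _ i]) (auto simp: axis_def intro!: sum.neutral)
    ultimately show "partial i (\<lambda>x. \<Prod>i\<in>UNIV. d i (m i) (x $ i)) x = (\<Prod>j\<in>UNIV. d j ((m(i := Suc (m i))) j) (x $ j))"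
      by (subst partial_eqI[OF DP]) simp
  qed
  then show ?case using Suc.IH DP by (auto simp: differentiable_def)
qed


text \<open>The functions p(1/t) e^(-1/t) for t > 0, extended by 0. Carrying the polynomial along
  makes the class closed under differentiation.\<close>

definition flat :: "real poly \<Rightarrow> real \<Rightarrow> real" where
  "flat p t = (if t \<le> 0 then 0 else poly p (1/t) * exp (- (1/t)))"

lemma power_exp_tendsto: "((\<lambda>y::real. y ^ n * exp (- y)) \<longlongrightarrow> 0) at_top"
  using tendsto_power_div_exp_0[of n] by (simp add: exp_minus field_simps)

lemma poly_exp_tendsto: "((\<lambda>y::real. poly p y * exp (- y)) \<longlongrightarrow> 0) at_top"
proof -
  have "((\<lambda>y::real. \<Sum>i\<le>degree p. coeff p i * (y ^ i * exp (- y))) \<longlongrightarrow> (\<Sum>i\<le>degree p. coeff p i * 0)) at_top"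
    by (intro tendsto_intros power_exp_tendsto)
  then show ?thesis by (simp add: poly_altdef sum_distrib_right mult.assoc)
qed

lemma flat_tendsto: "((\<lambda>t. flat p t) \<longlongrightarrow> 0) (at 0)"
proof -
  have "((\<lambda>t. poly p (1/t) * exp (- (1/t))) \<longlongrightarrow> 0) (at_right (0::real))"
    using filterlim_compose[OF poly_exp_tendsto[of p] filterlim_inverse_at_top_right]
    by (simp add: inverse_eq_divide)
  then have "((\<lambda>t. flat p t) \<longlongrightarrow> 0) (at_right 0)"
    by (rule Lim_transform_eventually) (auto simp: flat_def eventually_at_right_less eventually_at intro!: exI[of _ 1])
  moreover have "((\<lambda>t. flat p t) \<longlongrightarrow> 0) (at_left 0)"
    by (rule Lim_transform_eventually[OF tendsto_const])
      (auto simp: flat_def eventually_at intro!: exI[of _ 1])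
  ultimately show ?thesis by (rule filterlim_split_at_real[rotated])
qed

text \<open>With s = 1/t one has ds/dt = - s^2, so the derivative of p(s) e^(-s) is s^2 (p(s) -
  p'(s)) e^(-s). The matching at 0 rests on the decay in \<open>flat_tendsto\<close>.\<close>

lemma flat_DERIV: "(flat p has_real_derivative flat (monom 1 2 * (p - pderiv p)) t) (at t)"
proof -
  consider "t < 0" | "t > 0" | "t = 0" by linarith
  then show ?thesis
  proof cases
    case 1
    have "((\<lambda>t. 0::real) has_real_derivative 0) (at t)" by simp
    then have "(flat p has_real_derivative 0) (at t)"
      by (rule has_field_derivative_transform_within_open[of _ _ _ "{..<0}"]) (use 1 in \<open>auto simp: flat_def\<close>)
    then show ?thesis using 1 by (simp add: flat_def)
  next
    case 2
    have "((\<lambda>t. poly p (1/t) * exp (- (1/t))) has_real_derivative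
        poly (monom 1 2 * (p - pderiv p)) (1/t) * exp (- (1/t))) (at t)"
      using 2 by (auto intro!: derivative_eq_intros DERIV_chain2[OF poly_DERIV]
          simp: poly_monom field_simps power2_eq_square)
    then have "(flat p has_real_derivative poly (monom 1 2 * (p - pderiv p)) (1/t) * exp (- (1/t))) (at t)"
      by (rule has_field_derivative_transform_within_open[of _ _ _ "{0<..}"]) (use 2 in \<open>auto simp: flat_def\<close>)
    then show ?thesis using 2 by (simp add: flat_def)
  next
    case 3
    \<comment> \<open>The difference quotient at 0 is again of the form \<open>flat\<close>:
      dividing by h multiplies the polynomial by its variable, which gives
      \<open>pCons 0 p\<close>.\<close>
    have "(\<lambda>h. (flat p (0 + h) - flat p 0) / h) \<midarrow>0\<rightarrow> 0"
    proof (rule Lim_transform_eventually[OF flat_tendsto[of "pCons 0 p"]])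
      show "\<forall>\<^sub>F x in at 0. flat (pCons 0 p) x = (flat p (0 + x) - flat p 0) / x"
        by (auto simp: flat_def eventually_at intro!: exI[of _ 1])
    qed
    then show ?thesis using 3 by (simp add: DERIV_def flat_def)
  qed
qed

text \<open>The product of the one-variable functions \<open>flat 1\<close> over the coordinates.
  Two opposite translates of it multiply to a bump on a cube.\<close>

lemma smooth_orthant_bump:
  obtains B :: "real^'n \<Rightarrow> real" where "smooth B" "\<And>x. 0 \<le> B x" "\<And>x. B x \<noteq> 0 \<longleftrightarrow> (\<forall>i. 0 < x $ i)"
proof
  define q where "q m = ((\<lambda>p. monom 1 2 * (p - pderiv p)) ^^ m) (1 :: real poly)" for m
  define B :: "real^'n \<Rightarrow> real" where "B x = (\<Prod>i\<in>UNIV. flat (q 0) (x $ i))" for x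
  have D: "(flat (q m) has_real_derivative flat (q (Suc m)) t) (at t)" for m t
    using flat_DERIV[of "q m" t] by (simp add: q_def)
  show "smooth B"
    unfolding smooth_def B_def
  proof
    fix k
    from C_k_coordinate_product[of "\<lambda>(_::'n) m. flat (q m)" k "\<lambda>_. 0", OF D]
    show "C_k k (\<lambda>x::real^'n. \<Prod>i\<in>UNIV. flat (q 0) (x $ i))" .
  qed
  show "0 \<le> B x" for x unfolding B_def by (intro prod_nonneg) (auto simp: flat_def q_def)
  show "B x \<noteq> 0 \<longleftrightarrow> (\<forall>i. 0 < x $ i)" for x
    by (auto simp: B_def flat_def q_def not_le)
qed

section \<open>Test functions and mollifiers\<close>

abbreviation CcInf :: "(real^'n \<Rightarrow> real) set" where
  "CcInf \<equiv> test_functions UNIV"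

lemma partial_zero_outside:
  assumes "\<And>x. x \<notin> K \<Longrightarrow> \<psi> x = 0" "closed K" "x \<notin> K"
  shows "partial i \<psi> x = 0" "grad \<psi> x = 0"
proof -
  have "((\<lambda>x. 0) has_derivative (\<lambda>h. 0 \<bullet> h)) (at x)" by simp
  then have d: "(\<psi> has_derivative (\<lambda>h. 0 \<bullet> h)) (at x)"
    by (rule has_derivative_transform_within_open[of _ _ _ _ "-K"]) (use assms in auto)
  show "partial i \<psi> x = 0" "grad \<psi> x = 0" using grad_eqI[OF d] by simp_all
qed

lemma test_functionsI:
  assumes "smooth \<psi>" "compact K" "K \<subseteq> \<Omega>" "\<And>x. x \<notin> K \<Longrightarrow> \<psi> x = 0"
  shows "\<psi> \<in> test_functions \<Omega>"
  unfolding test_functions_def using assms by (intro CollectI conjI exI[of _ K]) auto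

lemma test_functionsE:
  assumes "\<psi> \<in> test_functions \<Omega>"
  obtains K where "smooth \<psi>" "compact K" "K \<subseteq> \<Omega>" "\<And>x. x \<notin> K \<Longrightarrow> \<psi> x = 0"
proof -
  have "smooth \<psi> \<and> (\<exists>K. compact K \<and> K \<subseteq> \<Omega> \<and> (\<forall>x. x \<notin> K \<longrightarrow> \<psi> x = 0))"
    using assms unfolding test_functions_def by (rule CollectD)
  then show ?thesis using that by metis
qed

lemma test_functions_partial:
  assumes "\<psi> \<in> test_functions \<Omega>" shows "partial i \<psi> \<in> test_functions \<Omega>"
proof -
  obtain K where K: "smooth \<psi>" "compact K" "K \<subseteq> \<Omega>" "\<And>x. x \<notin> K \<Longrightarrow> \<psi> x = 0"
    using test_functionsE[OF assms] by blast
  show ?thesis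
    using K partial_zero_outside(1)[OF K(4) compact_imp_closed[OF K(2)]]
    by (intro test_functionsI[OF smoothD(2)[OF K(1)] K(2,3)]) auto
qed

lemma test_functions_add:
  assumes "\<psi> \<in> test_functions \<Omega>" "\<zeta> \<in> test_functions \<Omega>"
  shows "(\<lambda>x. \<psi> x + \<zeta> x) \<in> test_functions \<Omega>"
proof -
  obtain K where K: "smooth \<psi>" "compact K" "K \<subseteq> \<Omega>" "\<And>x. x \<notin> K \<Longrightarrow> \<psi> x = 0"
    using test_functionsE[OF assms(1)] by blast
  obtain L where L: "smooth \<zeta>" "compact L" "L \<subseteq> \<Omega>" "\<And>x. x \<notin> L \<Longrightarrow> \<zeta> x = 0"
    using test_functionsE[OF assms(2)] by blast
  show ?thesis
    by (rule test_functionsI[OF smooth_add[OF K(1) L(1)] compact_Un[OF K(2) L(2)]])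
      (use K L in auto)
qed

lemma test_functions_mult_smooth:
  assumes "\<psi> \<in> test_functions \<Omega>" "smooth \<zeta>"
  shows "(\<lambda>x. \<zeta> x * \<psi> x) \<in> test_functions \<Omega>"
proof -
  obtain K where K: "smooth \<psi>" "compact K" "K \<subseteq> \<Omega>" "\<And>x. x \<notin> K \<Longrightarrow> \<psi> x = 0"
    using test_functionsE[OF assms(1)] by blast
  show ?thesis
    by (rule test_functionsI[OF smooth_mult[OF assms(2) K(1)] K(2,3)]) (simp add: K(4))
qed

lemma test_functions_scale: "\<psi> \<in> test_functions \<Omega> \<Longrightarrow> (\<lambda>x. c * \<psi> x) \<in> test_functions \<Omega>"
  by (rule test_functions_mult_smooth[OF _ smooth_const])

lemma test_functions_zero: "(\<lambda>x. 0) \<in> test_functions \<Omega>"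
  by (rule test_functionsI[OF smooth_const compact_empty]) auto

lemma test_functions_smooth: "\<psi> \<in> test_functions \<Omega> \<Longrightarrow> smooth \<psi>"
  by (simp add: test_functions_def)

text \<open>A translated orthant bump times its reflection is nonzero exactly on an open cube around
  0; normalising its integral gives the kernel.\<close>

lemma mollifier_exists:
  assumes "0 < e"
  obtains \<eta> :: "real^'n \<Rightarrow> real" where "\<eta> \<in> CcInf" "\<And>x. 0 \<le> \<eta> x" "\<And>x. e \<le> norm x \<Longrightarrow> \<eta> x = 0"
    "(\<integral>x. \<eta> x \<partial>lborel) = 1"
proof -
  obtain B :: "real^'n \<Rightarrow> real" where B: "smooth B" "\<And>x. 0 \<le> B x" "\<And>x. B x \<noteq> 0 \<longleftrightarrow> (\<forall>i. 0 < x $ i)"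
    using smooth_orthant_bump by blast
  \<comment> \<open>The Euclidean norm is at most the sum of the absolute values of the N
    coordinates, so the cube of half-width d lies in the closed ball of radius e/2.\<close>
  define d where "d = e / (2 * real CARD('n))"
  have d: "d > 0" using assms by (simp add: d_def)
  define c :: "real^'n" where "c = (\<chi> i. d)"
  define g where "g x = B (c + 1 *\<^sub>R x) * B (c + (-1) *\<^sub>R x)" for x
  have gs: "smooth g" unfolding g_def by (intro smooth_mult smooth_affine B)
  have g0: "0 \<le> g x" for x by (simp add: g_def B)
  have gnz: "g x \<noteq> 0 \<longleftrightarrow> (\<forall>i. \<bar>x $ i\<bar> < d)" for x
  proof -
    have "\<bar>t\<bar> < d \<longleftrightarrow> 0 < d + t \<and> 0 < d - t" for t :: real by (simp add: abs_less_iff) linarith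
    then show ?thesis by (simp add: g_def B(3) c_def all_conj_distrib)
  qed
  have gn: "norm x < e" if "g x \<noteq> 0" for x
  proof -
    have "norm x \<le> (\<Sum>i\<in>UNIV. \<bar>x $ i\<bar>)" by (rule norm_le_l1_cart)
    also have "\<dots> \<le> (\<Sum>i\<in>(UNIV::'n set). d)"
      using that gnz by (intro sum_mono) (simp add: less_imp_le)
    also have "\<dots> < e" using assms by (simp add: d_def)
    finally show ?thesis .
  qed
  have gK: "g x = 0" if "x \<notin> cball 0 e" for x using gn[of x] that by force
  have gT: "g \<in> CcInf" using gs gK by (intro test_functionsI[OF _ compact_cball[of 0 e]]) auto
  have gc: "continuous_on UNIV g" by (rule smoothD(3)[OF gs])
  have gi: "integrable lborel g"
  proof -
    have "integrable lborel (\<lambda>x. indicator (cball 0 e) x *\<^sub>R g x)"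
      by (intro borel_integrable_compact continuous_on_subset[OF gc]) auto
    also have "(\<lambda>x. indicator (cball 0 e) x *\<^sub>R g x) = g" using gK by (auto simp: fun_eq_iff indicator_def)
    finally show ?thesis .
  qed
  have "(\<integral>x. g x \<partial>lborel) \<noteq> 0"
  proof
    assume "(\<integral>x. g x \<partial>lborel) = 0"
    then have "AE x in lborel. g x = 0" using gi g0 by (simp add: integral_nonneg_eq_0_iff_AE)
    moreover have "open {x. g x \<noteq> 0}" using open_Collect_neq[OF gc continuous_on_const[of UNIV 0]] by simp
    ultimately have "{x. g x \<noteq> 0} = {}"
      using open_not_negligible[of "{x. g x \<noteq> 0}"] null_sets_completionI
      unfolding AE_iff_null negligible_iff_null_sets by (auto simp: AE_iff_null)
    moreover have "g 0 \<noteq> 0" using gnz[of 0] d by simp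
    ultimately show False by auto
  qed
  then have I: "(\<integral>x. g x \<partial>lborel) > 0" using g0 by (simp add: less_le integral_nonneg)
  show thesis
  proof
    show "(\<lambda>x. (1 / (\<integral>x. g x \<partial>lborel)) * g x) \<in> CcInf" by (rule test_functions_scale[OF gT])
    show "0 \<le> 1 / (\<integral>x. g x \<partial>lborel) * g x" for x using I g0 by simp
    show "1 / (\<integral>x. g x \<partial>lborel) * g x = 0" if "e \<le> norm x" for x using gn[of x] that by force
    show "(\<integral>x. 1 / (\<integral>x. g x \<partial>lborel) * g x \<partial>lborel) = 1" using I by simp
  qed
qed

section \<open>Compactly supported functions and mollification\<close>

lemma integral_lborel_translate:
  fixes f :: "'a::euclidean_space \<Rightarrow> 'b::{banach, second_countable_topology}"
  assumes [measurable]: "f \<in> borel_measurable borel"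
  shows "(\<integral>x. f (x + a) \<partial>lborel) = (\<integral>x. f x \<partial>lborel)"
    and "integrable lborel (\<lambda>x. f (x + a)) \<longleftrightarrow> integrable lborel f"
proof -
  have *: "f \<in> borel_measurable (distr lborel borel ((+) a))" by simp
  have "(\<integral>x. f x \<partial>lborel) = (\<integral>x. f x \<partial>distr lborel borel ((+) a))" by (simp add: lborel_distr_plus)
  also have "\<dots> = (\<integral>x. f (a + x) \<partial>lborel)" by (subst integral_distr) auto
  finally show "(\<integral>x. f (x + a) \<partial>lborel) = (\<integral>x. f x \<partial>lborel)" by (simp add: add.commute)
  have "integrable lborel f \<longleftrightarrow> integrable (distr lborel borel ((+) a)) f" by (simp add: lborel_distr_plus)
  also have "\<dots> \<longleftrightarrow> integrable lborel (\<lambda>x. f (a + x))" by (subst integrable_distr_eq) auto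
  finally show "integrable lborel (\<lambda>x. f (x + a)) \<longleftrightarrow> integrable lborel f" by (simp add: add.commute)
qed

lemma lborel_distr_reflect: "distr lborel borel (\<lambda>x. a - x :: 'a::euclidean_space) = lborel"
proof -
  show ?thesis using lborel_affine[of "-1" a] by (simp add: density_1)
qed

lemma integral_lborel_reflect:
  fixes f :: "'a::euclidean_space \<Rightarrow> 'b::{banach, second_countable_topology}"
  assumes [measurable]: "f \<in> borel_measurable borel"
  shows "(\<integral>x. f (a - x) \<partial>lborel) = (\<integral>x. f x \<partial>lborel)"
    and "integrable lborel (\<lambda>x. f (a - x)) \<longleftrightarrow> integrable lborel f"
proof -
  have "(\<integral>x. f x \<partial>lborel) = (\<integral>x. f x \<partial>distr lborel borel (\<lambda>x. a - x))" by (simp add: lborel_distr_reflect)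
  also have "\<dots> = (\<integral>x. f (a - x) \<partial>lborel)" by (subst integral_distr) auto
  finally show "(\<integral>x. f (a - x) \<partial>lborel) = (\<integral>x. f x \<partial>lborel)" by simp
  have "integrable lborel f \<longleftrightarrow> integrable (distr lborel borel (\<lambda>x. a - x)) f" by (simp add: lborel_distr_reflect)
  also have "\<dots> \<longleftrightarrow> integrable lborel (\<lambda>x. f (a - x))" by (subst integrable_distr_eq) auto
  finally show "integrable lborel (\<lambda>x. f (a - x)) \<longleftrightarrow> integrable lborel f" by simp
qed

lemma l2n_translate:
  fixes f :: "'a::euclidean_space \<Rightarrow> 'b::euclidean_space"
  assumes "f \<in> borel_measurable borel"
  shows "l2n lborel (\<lambda>x. f (x + a)) = l2n lborel f" "sqi lborel (\<lambda>x. f (x + a)) \<longleftrightarrow> sqi lborel f"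
proof -
  note [measurable] = assms
  have m: "(\<lambda>x. (norm (f x))\<^sup>2) \<in> borel_measurable borel" by measurable
  show "l2n lborel (\<lambda>x. f (x + a)) = l2n lborel f"
    using integral_lborel_translate(1)[OF m] by (simp add: l2n_def)
  show "sqi lborel (\<lambda>x. f (x + a)) \<longleftrightarrow> sqi lborel f"
    using integral_lborel_translate(2)[OF m] assms by (simp add: sqi_def)
qed

lemma integrable_indicator_cball: "integrable lborel (indicator (cball a R) :: 'a::euclidean_space \<Rightarrow> real)"
  using emeasure_lborel_cball_finite[of a R] by (intro integrable_real_indicator) auto

lemma sqi_indicator_cball: "sqi lborel (\<lambda>x::'a::euclidean_space. c * indicator (cball a R) x :: real)"
proof -
  have "(\<lambda>x::'a. (norm (c * indicator (cball a R) x :: real))\<^sup>2) = (\<lambda>x. c\<^sup>2 * indicator (cball a R) x)"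
    by (auto simp: fun_eq_iff indicator_def)
  then show ?thesis
    by (auto simp only: sqi_def intro!: conjI integrable_mult_right integrable_indicator_cball
        borel_measurable_times borel_measurable_indicator borel_measurable_const borel_closed closed_cball
        simp: sets_lborel)
qed

lemma continuous_compact_support:
  fixes f :: "'a::euclidean_space \<Rightarrow> 'b::euclidean_space"
  assumes f: "continuous_on UNIV f" and K: "compact K" "\<And>x. x \<notin> K \<Longrightarrow> f x = 0"
  shows "integrable lborel f" "\<exists>B. \<forall>x. norm (f x) \<le> B" "sqi lborel f"
proof -
  have cK: "continuous_on K f" using f by (rule continuous_on_subset) simp
  have ind: "(\<lambda>x. indicator K x *\<^sub>R f x) = f" "(\<lambda>x. indicator K x *\<^sub>R (norm (f x))\<^sup>2) = (\<lambda>x. (norm (f x))\<^sup>2)"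
    using K(2) by (auto simp: fun_eq_iff indicator_def)
  show "integrable lborel f"
    using borel_integrable_compact[OF K(1) cK] by (simp add: ind)
  have "compact (f ` K)" by (rule compact_continuous_image[OF cK K(1)])
  then obtain B where B: "\<forall>y\<in>f ` K. norm y \<le> B" using compact_imp_bounded bounded_iff by metis
  show "\<exists>B. \<forall>x. norm (f x) \<le> B"
  proof (intro exI allI)
    fix x show "norm (f x) \<le> max B 0"
      using B K(2)[of x] by (cases "x \<in> K") auto
  qed
  have "continuous_on K (\<lambda>x. (norm (f x))\<^sup>2)" using cK by (intro continuous_intros)
  from borel_integrable_compact[OF K(1) this]
  have "integrable lborel (\<lambda>x. (norm (f x))\<^sup>2)" by (simp only: ind)
  then show "sqi lborel f" using f by (simp add: sqi_def borel_measurable_continuous_onI)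
qed

text \<open>Only C^1, in order to admit the products of a test function with P(v) in
  \<open>wgr_chain\<close>, where P is merely C^1.\<close>

definition C1c :: "(real^'n \<Rightarrow> real) set" where
  "C1c = {g. C_k 1 g \<and> (\<exists>K. compact K \<and> (\<forall>x. x \<notin> K \<longrightarrow> g x = 0))}"

lemma test_functions_C1c: "\<psi> \<in> test_functions \<Omega> \<Longrightarrow> \<psi> \<in> C1c"
  by (erule test_functionsE) (auto simp: C1c_def smooth_def simp del: C_k.simps)

lemma C_1_D:
  assumes "C_k 1 g"
  shows "g differentiable (at x)" "continuous_on UNIV g" "continuous_on UNIV (partial i g)" "continuous_on UNIV (grad g)"
proof -
  have g: "\<And>x. g differentiable (at x)" "\<And>i. continuous_on UNIV (partial i g)"
    using assms by auto
  show "g differentiable (at x)" "continuous_on UNIV (partial i g)" using g by auto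
  show "continuous_on UNIV g" using C_k_mono[of 0 1 g] assms by simp
  show "continuous_on UNIV (grad g)" unfolding grad_def using g(2) by (intro continuous_intros) auto
qed

lemma C1cD:
  assumes "g \<in> C1c"
  shows "C_k 1 g" "g differentiable (at x)" "continuous_on UNIV g" "continuous_on UNIV (partial i g)"
    "continuous_on UNIV (grad g)"
    "integrable lborel g" "integrable lborel (partial i g)" "integrable lborel (grad g)"
    "sqi lborel g" "sqi lborel (grad g)"
    "\<exists>B\<ge>0. (\<forall>x. \<bar>g x\<bar> \<le> B) \<and> (\<forall>x. norm (grad g x) \<le> B) \<and> (\<forall>x h. \<bar>g (x + h) - g x\<bar> \<le> B * norm h)"
    "\<exists>R>0. \<forall>x. R \<le> norm x \<longrightarrow> g x = 0 \<and> grad g x = 0"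
proof -
  obtain K where K: "C_k 1 g" "compact K" "\<And>x. x \<notin> K \<Longrightarrow> g x = 0"
    using assms by (auto simp: C1c_def)
  note c = C_1_D[OF K(1)]
  show "C_k 1 g" "g differentiable (at x)" "continuous_on UNIV g" "continuous_on UNIV (partial i g)"
    "continuous_on UNIV (grad g)" using K c by auto
  note z = partial_zero_outside[OF K(3) compact_imp_closed[OF K(2)]]
  show "integrable lborel g" "sqi lborel g" using continuous_compact_support[OF c(2) K(2,3)] by auto
  show "integrable lborel (partial i g)"
    using continuous_compact_support[OF c(3) K(2) z(1)] by auto
  show "integrable lborel (grad g)" "sqi lborel (grad g)"
    using continuous_compact_support[OF c(4) K(2) z(2)] by auto
  obtain A where A: "\<And>x. norm (g x) \<le> A" using continuous_compact_support(2)[OF c(2) K(2,3)] by auto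
  obtain B where B: "\<And>x. norm (grad g x) \<le> B" using continuous_compact_support(2)[OF c(4) K(2) z(2)] by auto
  have AB: "0 \<le> A" "0 \<le> B" using order_trans[OF norm_ge_zero A] order_trans[OF norm_ge_zero B] by auto
  have L: "\<bar>g (x + h) - g x\<bar> \<le> B * norm h" for x h
  proof -
    have "norm (g (x + h) - g x) \<le> B * norm (x + h - x)"
    proof (rule differentiable_bound[of UNIV g "\<lambda>x h. grad g x \<bullet> h"])
      show "(g has_derivative (\<lambda>h. grad g y \<bullet> h)) (at y within UNIV)" for y
        using has_derivative_grad[OF c(1)] by simp
      show "onorm (\<lambda>h. grad g y \<bullet> h) \<le> B" for y
      proof (rule onorm_le)
        fix v show "norm (grad g y \<bullet> v) \<le> B * norm v"
          using Cauchy_Schwarz_ineq2[of "grad g y" v] mult_right_mono[OF B[of y] norm_ge_zero[of v]] by simp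
      qed
    qed auto
    then show ?thesis by simp
  qed
  show "\<exists>B\<ge>0. (\<forall>x. \<bar>g x\<bar> \<le> B) \<and> (\<forall>x. norm (grad g x) \<le> B) \<and> (\<forall>x h. \<bar>g (x + h) - g x\<bar> \<le> B * norm h)"
  proof (intro exI[of _ "max A B"] conjI allI)
    show "\<bar>g (x + h) - g x\<bar> \<le> max A B * norm h" for x h
      using L[of x h] mult_right_mono[OF max.cobounded2[of B A] norm_ge_zero[of h]] by simp
  qed (use A B AB in \<open>auto simp: le_max_iff_disj\<close>)
  obtain R where R: "\<And>x. x \<in> K \<Longrightarrow> norm x \<le> R" using compact_imp_bounded[OF K(2)] by (auto simp: bounded_iff)
  have "x \<notin> K" if "max R 0 + 1 \<le> norm x" for x using R[of x] that by auto
  then show "\<exists>R>0. \<forall>x. R \<le> norm x \<longrightarrow> g x = 0 \<and> grad g x = 0"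
    using K(3) z(2) by (intro exI[of _ "max R 0 + 1"]) auto
qed

lemma directional_quotient_tendsto:
  assumes "g differentiable (at x)"
  shows "(\<lambda>n. real (Suc n) * (g (x + (1 / real (Suc n)) *\<^sub>R h) - g x)) \<longlonglongrightarrow> grad g x \<bullet> h"
proof -
  have "((\<lambda>t. g (x + t *\<^sub>R h)) has_derivative (\<lambda>t. grad g x \<bullet> (t *\<^sub>R h))) (at 0)"
    by (rule has_derivative_compose[of "\<lambda>t. x + t *\<^sub>R h"])
      (use has_derivative_grad[OF assms] in \<open>auto intro!: derivative_eq_intros\<close>)
  then have "((\<lambda>t. g (x + t *\<^sub>R h)) has_real_derivative (grad g x \<bullet> h)) (at 0)"
    by (simp add: has_field_derivative_def mult.commute[of _ "grad g x \<bullet> h"])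
  then have q: "((\<lambda>t. (g (x + t *\<^sub>R h) - g x) / t) \<longlongrightarrow> grad g x \<bullet> h) (at 0)"
    by (simp add: DERIV_def)
  have "filterlim (\<lambda>n. 1 / real (Suc n)) (at 0) sequentially"
    by (auto simp: filterlim_at simp del: of_nat_Suc intro!: LIMSEQ_Suc lim_1_over_n)
  from filterlim_compose[OF q this] show ?thesis by (simp add: mult.commute)
qed

text \<open>By translation invariance the integral of every difference quotient vanishes; Lipschitz
  continuity and compact support dominate the quotients while they tend to the derivative.\<close>

lemma integral_partial_zero:
  assumes "g \<in> C1c" shows "(\<integral>x. partial i g x \<partial>lborel) = 0"
proof -
  note D = C1cD[OF assms]
  obtain B where B: "0 \<le> B" "\<And>x h. \<bar>g (x + h) - g x\<bar> \<le> B * norm h" using D(11) by blast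
  obtain R where R: "0 < R" "\<And>x. R \<le> norm x \<Longrightarrow> g x = 0" using D(12) by blast
  have [measurable]: "g \<in> borel_measurable borel" "partial i g \<in> borel_measurable borel"
    using D by (auto intro: borel_measurable_continuous_onI)
  define h :: "nat \<Rightarrow> real^'a" where "h n = (1 / real (Suc n)) *\<^sub>R axis i 1" for n
  have hn: "norm (h n) = 1 / real (Suc n)" for n by (simp add: h_def)
  have "(\<lambda>n. \<integral>x. real (Suc n) * (g (x + h n) - g x) \<partial>lborel) \<longlonglongrightarrow> (\<integral>x. partial i g x \<partial>lborel)"
  proof (rule integral_dominated_convergence[where w="\<lambda>x. B * indicator (cball 0 (R + 1)) x"])
    show "integrable lborel (\<lambda>x::real^'a. B * indicator (cball 0 (R + 1)) x)"
      by (intro integrable_mult_right integrable_indicator_cball)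
    show "AE x in lborel. (\<lambda>n. real (Suc n) * (g (x + h n) - g x)) \<longlonglongrightarrow> partial i g x"
      using directional_quotient_tendsto[OF D(2), of _ "axis i 1"]
      by (simp add: h_def inner_axis grad_def)
    show "AE x in lborel. norm (real (Suc n) * (g (x + h n) - g x)) \<le> B * indicator (cball 0 (R + 1)) x" for n
    proof (rule AE_I2)
      fix x :: "real^'a"
      show "norm (real (Suc n) * (g (x + h n) - g x)) \<le> B * indicator (cball 0 (R + 1)) x"
      proof (cases "norm x \<le> R + 1")
        case True
        have "real (Suc n) * \<bar>g (x + h n) - g x\<bar> \<le> real (Suc n) * (B * norm (h n))"
          by (intro mult_left_mono B) simp
        then show ?thesis using True by (simp add: hn abs_mult)
      next
        case False
        have "norm x \<le> norm (x + h n) + norm (h n)" using norm_triangle_ineq4[of "x + h n" "h n"] by simp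
        moreover have "norm (h n) \<le> 1" by (simp add: hn)
        ultimately show ?thesis using False R(2)[of x] R(2)[of "x + h n"] B(1) by simp
      qed
    qed
  qed auto
  moreover have "(\<integral>x. real (Suc n) * (g (x + h n) - g x) \<partial>lborel) = 0" for n
    using D(6) integral_lborel_translate[of g "h n"] by simp
  ultimately show ?thesis by (simp add: LIMSEQ_const_iff)
qed

text \<open>The translation by h is composed of n + 1 translations by h / (n + 1), so it changes g
  by at most the norm of the difference quotient \<open>F n\<close>, and these quotients converge in
  L2 to the derivative in direction h.\<close>

lemma l2n_translation_diff:
  assumes "g \<in> C1c"
  shows "l2n lborel (\<lambda>x. g (x + h) - g x) \<le> norm h * l2n lborel (grad g)"
proof -
  note D = C1cD[OF assms]
  obtain B where B: "0 \<le> B" "\<And>x h. \<bar>g (x + h) - g x\<bar> \<le> B * norm h" using D(11) by blast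
  obtain R where R: "0 < R" "\<And>x. R \<le> norm x \<Longrightarrow> g x = 0" using D(12) by blast
  have gm[measurable]: "g \<in> borel_measurable borel" "grad g \<in> borel_measurable borel"
    using D by (auto intro: borel_measurable_continuous_onI)
  have s: "sqi lborel (\<lambda>x. g (x + a))" for a using l2n_translate(2)[OF gm(1)] D(9) by simp
  have sub: "l2n lborel (\<lambda>x. g (x + real m *\<^sub>R k) - g x) \<le> real m * l2n lborel (\<lambda>x. g (x + k) - g x)" for m k
  proof (induction m)
    case (Suc m)
    have "l2n lborel (\<lambda>x. g (x + real (Suc m) *\<^sub>R k) - g x)
      \<le> l2n lborel (\<lambda>x. g (x + real (Suc m) *\<^sub>R k) - g (x + real m *\<^sub>R k)) + l2n lborel (\<lambda>x. g (x + real m *\<^sub>R k) - g x)"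
      using s D(9) by (intro l2n_triangle3)
    also have "l2n lborel (\<lambda>x. g (x + real (Suc m) *\<^sub>R k) - g (x + real m *\<^sub>R k)) = l2n lborel (\<lambda>x. g (x + k) - g x)"
      using l2n_translate(1)[of "\<lambda>x. g (x + k) - g x" "real m *\<^sub>R k"]
      by (simp add: scaleR_left_distrib algebra_simps)
    finally show ?case using Suc by (simp add: algebra_simps)
  qed (simp add: l2n_def)
  define F where "F n x = real (Suc n) * (g (x + (1 / real (Suc n)) *\<^sub>R h) - g x)" for n x
  have [measurable]: "F n \<in> borel_measurable borel" for n unfolding F_def[abs_def] by measurable
  have "l2conv lborel F (\<lambda>x. grad g x \<bullet> h)"
  proof (rule l2conv_dominated[where g="\<lambda>x. B * norm h * indicator (cball 0 (R + norm h)) x"])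
    show "sqi lborel (\<lambda>x::real^'a. B * norm h * indicator (cball 0 (R + norm h)) x)"
      by (rule sqi_indicator_cball)
    show "AE x in lborel. (\<lambda>n. F n x) \<longlonglongrightarrow> grad g x \<bullet> h"
      using directional_quotient_tendsto[OF D(2), of _ h] by (simp add: F_def)
    show "AE x in lborel. norm (F n x) \<le> norm (B * norm h * indicator (cball 0 (R + norm h)) x)" for n
    proof (rule AE_I2)
      fix x :: "real^'a"
      let ?h = "(1 / real (Suc n)) *\<^sub>R h"
      have nh: "norm ?h = norm h / real (Suc n)" by simp
      have nh': "norm ?h \<le> norm h" unfolding nh by (simp add: divide_le_eq mult_le_cancel_left1 del: of_nat_Suc)
      show "norm (F n x) \<le> norm (B * norm h * indicator (cball 0 (R + norm h)) x)"
      proof (cases "norm x \<le> R + norm h")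
        case True
        have "real (Suc n) * \<bar>g (x + ?h) - g x\<bar> \<le> real (Suc n) * (B * norm ?h)"
          by (intro mult_left_mono B) simp
        then show ?thesis using True B(1) unfolding nh by (simp add: F_def abs_mult)
      next
        case False
        have "norm x \<le> norm (x + ?h) + norm ?h" using norm_triangle_ineq4[of "x + ?h" ?h] by simp
        then have "g x = 0" "g (x + ?h) = 0" using False R(2)[of x] R(2)[of "x + ?h"] nh' norm_ge_zero[of h] by linarith+
        then show ?thesis by (simp add: F_def)
      qed
    qed
  qed auto
  from l2conv_norm_tendsto[OF this]
  have lim: "(\<lambda>n. l2n lborel (F n)) \<longlonglongrightarrow> l2n lborel (\<lambda>x. grad g x \<bullet> h)" .
  have "l2n lborel (\<lambda>x. g (x + h) - g x) \<le> l2n lborel (F n)" for n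
  proof -
    have Fn: "F n = (\<lambda>x. real (Suc n) *\<^sub>R (g (x + (1 / real (Suc n)) *\<^sub>R h) - g x))"
      by (simp add: F_def fun_eq_iff)
    show ?thesis
      using sub[of "Suc n" "(1 / real (Suc n)) *\<^sub>R h"] unfolding Fn l2n_scaleR by simp
  qed
  then have "l2n lborel (\<lambda>x. g (x + h) - g x) \<le> l2n lborel (\<lambda>x. grad g x \<bullet> h)"
    by (intro LIMSEQ_le_const[OF lim]) auto
  also have "\<dots> \<le> norm h * l2n lborel (grad g)"
  proof (rule l2n_mono[OF D(10)])
    show "AE x in lborel. norm (grad g x \<bullet> h) \<le> norm h * norm (grad g x)"
      using Cauchy_Schwarz_ineq2[of "grad g _" h] by (simp add: mult.commute)
  qed auto
  finally show ?thesis .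
qed

text \<open>The function is cut off in space by \<open>c k\<close> and in height by
  \<open>T k\<close>. Inside these cut-offs it is replaced by continuous functions converging almost
  everywhere, and the cut-offs supply the dominating function.\<close>

lemma L2_continuous_approximation:
  fixes f :: "'a::euclidean_space \<Rightarrow> real"
  assumes f: "sqi lborel f" and e: "0 < e"
  obtains g R where "continuous_on UNIV g" "\<And>x. R \<le> norm x \<Longrightarrow> g x = 0" "sqi lborel g" "l2n lborel (\<lambda>x. f x - g x) < e"
proof -
  have fm [measurable]: "f \<in> borel_measurable borel" using sqi_measurable[OF f] by simp
  define c where "c k x = max 0 (min 1 (real k + 1 - norm x))" for k and x :: 'a
  have c: "0 \<le> c k x" "c k x \<le> 1" "real k + 1 \<le> norm x \<Longrightarrow> c k x = 0" "norm x \<le> real k \<Longrightarrow> c k x = 1"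
    "continuous_on UNIV (c k)" for k x
    by (auto simp: c_def[abs_def] intro!: continuous_intros)
  define T where "T k s = max (- real k) (min (real k) s)" for k and s :: real
  have T: "\<bar>T k s\<bar> \<le> real k" "\<bar>T k s\<bar> \<le> \<bar>s\<bar>" "\<bar>s\<bar> \<le> real k \<Longrightarrow> T k s = s" "continuous_on A (T k)" for k s A
    by (auto simp: T_def[abs_def] intro!: continuous_intros)
  have [measurable]: "c k \<in> borel_measurable borel" "T k \<in> borel_measurable borel" for k
    using c(5) T(4) by (auto intro: borel_measurable_continuous_onI)
  have "l2conv lborel (\<lambda>k x. c k x * T k (f x)) f"
  proof (rule l2conv_dominated[OF f])
    show "AE x in lborel. (\<lambda>k. c k x * T k (f x)) \<longlonglongrightarrow> f x"
    proof (rule AE_I2, rule tendsto_eventually)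
      fix x
      obtain m :: nat where "max (norm x) \<bar>f x\<bar> \<le> real m" using real_arch_simple by blast
      then show "\<forall>\<^sub>F k in sequentially. c k x * T k (f x) = f x"
        by (intro eventually_sequentiallyI[of m]) (auto simp: c(4) T(3))
    qed
    show "AE x in lborel. norm (c k x * T k (f x)) \<le> norm (f x)" for k
      using c(1,2) T(2) mult_mono[of "c k _" 1 "\<bar>T k _\<bar>"] by (auto simp: abs_mult)
  qed auto
  from order_tendstoD(2)[OF l2convD(3)[OF this], of "e/2"] e obtain k
    where k: "l2n lborel (\<lambda>x. c k x * T k (f x) - f x) < e/2" by (auto simp: eventually_sequentially)
  have "f measurable_on UNIV" by (rule lebesgue_measurable_imp_measurable_on) (auto intro: measurable_completion)
  then obtain N g where g: "negligible N" "\<And>n. continuous_on UNIV (g n)" "\<And>x. x \<notin> N \<Longrightarrow> (\<lambda>n. g n x) \<longlonglongrightarrow> f x"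
    unfolding measurable_on_def by auto
  have gm [measurable]: "g n \<in> borel_measurable borel" for n using g(2) by (rule borel_measurable_continuous_onI)
  have Nae: "AE x in lborel. x \<notin> N" using AE_not_in[of N lebesgue] g(1) by (simp add: negligible_iff_null_sets AE_completion_iff)
  have gl: "l2conv lborel (\<lambda>n x. c k x * T k (g n x)) (\<lambda>x. c k x * T k (f x))"
  proof (rule l2conv_dominated[OF sqi_indicator_cball[of "real k" 0 "real k + 1"]])
    show "AE x in lborel. (\<lambda>n. c k x * T k (g n x)) \<longlonglongrightarrow> c k x * T k (f x)"
      using Nae by eventually_elim (auto intro!: tendsto_intros continuous_on_tendsto_compose[OF T(4)[where A=UNIV]] g(3))
    show "AE x in lborel. norm (c k x * T k (g n x)) \<le> norm (real k * indicator (cball 0 (real k + 1)) x)" for n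
    proof (rule AE_I2)
      fix x :: 'a
      show "norm (c k x * T k (g n x)) \<le> norm (real k * indicator (cball 0 (real k + 1)) x)"
        using c(1-3)[of k x] T(1)[of k "g n x"] mult_mono[of "c k x" 1 "\<bar>T k (g n x)\<bar>" "real k"]
        by (cases "norm x \<le> real k + 1") (auto simp: abs_mult)
    qed
  qed auto
  from order_tendstoD(2)[OF l2convD(3)[OF this], of "e/2"] e obtain n
    where n: "l2n lborel (\<lambda>x. c k x * T k (g n x) - c k x * T k (f x)) < e/2" by (auto simp: eventually_sequentially)
  note S = l2convD(1)[OF gl, of n] l2convD(2)[OF gl]
  show thesis
  proof (rule that[OF _ _ S(1)])
    show "continuous_on UNIV (\<lambda>x. c k x * T k (g n x))"
      by (intro continuous_on_mult c(5) continuous_on_compose2[OF T(4)[where A=UNIV] g(2)]) auto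
    show "c k x * T k (g n x) = 0" if "real k + 1 \<le> norm x" for x using c(3)[OF that] by simp
    show "l2n lborel (\<lambda>x. f x - c k x * T k (g n x)) < e"
      using l2n_triangle3[OF f S(2) S(1)] k n l2n_minus_commute[of lborel f "\<lambda>x. c k x * T k (f x)"]
        l2n_minus_commute[of lborel "\<lambda>x. c k x * T k (f x)" "\<lambda>x. c k x * T k (g n x)"] by linarith
  qed
qed

text \<open>Uniform continuity settles continuous functions of compact support; density carries this
  over to L2 because translations are isometries.\<close>

lemma L2_translation_continuous:
  fixes f :: "'a::euclidean_space \<Rightarrow> real"
  assumes f: "sqi lborel f" and e: "0 < e"
  shows "\<exists>d>0. \<forall>h. norm h < d \<longrightarrow> l2n lborel (\<lambda>x. f (x + h) - f x) < e"
proof -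
  obtain g R where g: "continuous_on UNIV g" "\<And>x. R \<le> norm x \<Longrightarrow> g x = 0" "sqi lborel g" "l2n lborel (\<lambda>x. f x - g x) < e/3"
    using L2_continuous_approximation[OF f, of "e/3"] e by auto
  have m: "f \<in> borel_measurable borel" "g \<in> borel_measurable borel" using sqi_measurable f g(3) by fastforce+
  have sh: "sqi lborel (\<lambda>x. f (x + h))" "sqi lborel (\<lambda>x. g (x + h))" for h
    using l2n_translate(2)[OF m(1), of h] l2n_translate(2)[OF m(2), of h] f g(3) by auto
  define q where "q = l2n lborel (\<lambda>x::'a. 1 * indicator (cball 0 (R + 1)) x :: real)"
  define e' where "e' = e / (3 * (q + 1))"
  have q: "0 \<le> q" by (simp add: q_def)
  then have e': "0 < e'" "e' * q < e/3" using e by (auto simp: e'_def field_simps)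
  have "uniformly_continuous_on (cball 0 (R + 2)) g"
    by (rule compact_uniformly_continuous[OF continuous_on_subset[OF g(1)]]) auto
  then obtain d where d: "0 < d" "\<And>x y. x \<in> cball 0 (R + 2) \<Longrightarrow> y \<in> cball 0 (R + 2) \<Longrightarrow> dist y x < d \<Longrightarrow> dist (g y) (g x) < e'"
    unfolding uniformly_continuous_on_def using e'(1) by metis
  show ?thesis
  proof (intro exI[of _ "min d 1"] conjI allI impI)
    fix h :: 'a assume h: "norm h < min d 1"
    have "l2n lborel (\<lambda>x. g (x + h) - g x) \<le> e' * q"
      unfolding q_def
    proof (rule l2n_mono[OF sqi_indicator_cball])
      show "AE x in lborel. norm (g (x + h) - g x) \<le> e' * norm (1 * indicator (cball 0 (R + 1)) x :: real)"
      proof (rule AE_I2)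
        fix x :: 'a
        have n: "norm x \<le> norm (x + h) + norm h" "norm (x + h) \<le> norm x + norm h"
          using norm_triangle_ineq4[of "x + h" h] norm_triangle_ineq[of x h] by simp_all
        show "norm (g (x + h) - g x) \<le> e' * norm (1 * indicator (cball 0 (R + 1)) x :: real)"
        proof (cases "norm x \<le> R + 1")
          case True
          have "norm x \<le> R + 2" "norm (x + h) \<le> R + 2" "dist (x + h) x < d" using True n(2) h by (auto simp: dist_norm)
          then have "dist (g (x + h)) (g x) < e'" by (intro d(2)) (simp_all only: mem_cball_0)
          then show ?thesis using True by (simp add: dist_norm)
        next
          case False
          then show ?thesis using g(2)[of x] g(2)[of "x + h"] n h by simp
        qed
      qed
    qed (use e' sqi_measurable[OF sqi_diff[OF sh(2) g(3)]] in auto)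
    moreover have "l2n lborel (\<lambda>x. f (x + h) - g (x + h)) = l2n lborel (\<lambda>x. f x - g x)"
      by (rule l2n_translate(1)[of "\<lambda>x. f x - g x"]) (use m in auto)
    moreover have "l2n lborel (\<lambda>x. f (x + h) - f x) \<le> l2n lborel (\<lambda>x. f (x + h) - g (x + h)) + l2n lborel (\<lambda>x. g (x + h) - f x)"
      by (rule l2n_triangle3[OF sh f])
    moreover have "l2n lborel (\<lambda>x. g (x + h) - f x) \<le> l2n lborel (\<lambda>x. g (x + h) - g x) + l2n lborel (\<lambda>x. g x - f x)"
      by (rule l2n_triangle3[OF sh(2) g(3) f])
    ultimately show "l2n lborel (\<lambda>x. f (x + h) - f x) < e"
      using g(4) e'(2) l2n_minus_commute[of lborel f g] by linarith
  qed (use d in simp)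
qed

definition convol :: "('a::euclidean_space \<Rightarrow> real) \<Rightarrow> ('a \<Rightarrow> real) \<Rightarrow> 'a \<Rightarrow> real" where
  "convol \<eta> f x = (\<integral>y. \<eta> (x - y) * f y \<partial>lborel)"

lemma convol_integrand:
  fixes \<eta> f :: "'a::euclidean_space \<Rightarrow> real"
  assumes "continuous_on UNIV \<eta>" "\<And>x. \<bar>\<eta> x\<bar> \<le> B" "integrable lborel f"
  shows "integrable lborel (\<lambda>y. \<eta> (x - y) * f y)"
proof (rule Bochner_Integration.integrable_bound[where f="\<lambda>y. B * f y"])
  have [measurable]: "\<eta> \<in> borel_measurable borel" using assms(1) by (rule borel_measurable_continuous_onI)
  show "(\<lambda>y. \<eta> (x - y) * f y) \<in> borel_measurable lborel" using assms(3) by measurable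
  have "\<bar>\<eta> (x - y)\<bar> \<le> \<bar>B\<bar>" for y using assms(2)[of "x - y"] by simp
  then show "AE y in lborel. norm (\<eta> (x - y) * f y) \<le> norm (B * f y)"
    by (intro AE_I2) (simp add: abs_mult mult_right_mono)
qed (use assms in auto)

text \<open>The kernel is Lipschitz with bounded gradient, so the remainders of its difference
  quotients are at most 2 B in absolute value, and dominated convergence differentiates under the
  integral sign.\<close>

lemma convol_has_derivative:
  assumes \<eta>: "\<eta> \<in> C1c" and f: "integrable lborel f"
  shows "(convol \<eta> f has_derivative (\<lambda>h. (\<chi> i. convol (partial i \<eta>) f x) \<bullet> h)) (at x)"
proof -
  note D = C1cD[OF \<eta>]
  obtain B where B: "0 \<le> B" "\<And>x. \<bar>\<eta> x\<bar> \<le> B" "\<And>x. norm (grad \<eta> x) \<le> B"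
    "\<And>x h. \<bar>\<eta> (x + h) - \<eta> x\<bar> \<le> B * norm h" using D(11) by blast
  have [measurable]: "\<eta> \<in> borel_measurable borel" "grad \<eta> \<in> borel_measurable borel"
    using D by (auto intro: borel_measurable_continuous_onI)
  have pB: "\<bar>partial i \<eta> y\<bar> \<le> B" for i y
    using component_le_norm_cart[of "grad \<eta> y" i] B(3)[of y] by (simp add: grad_def)
  note ci = convol_integrand[OF D(3) B(2) f] convol_integrand[OF D(4) pB f]
  let ?G = "\<chi> i. convol (partial i \<eta>) f x"
  have G: "?G \<bullet> h = (\<integral>y. (grad \<eta> (x - y) \<bullet> h) * f y \<partial>lborel)"
    and Gi: "integrable lborel (\<lambda>y. (grad \<eta> (x - y) \<bullet> h) * f y)" for h
  proof -
    have eq: "(grad \<eta> (x - y) \<bullet> h) * f y = (\<Sum>i\<in>UNIV. h $ i * (partial i \<eta> (x - y) * f y))" for y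
      by (simp add: inner_vec_def grad_def sum_distrib_left mult_ac)
    show "integrable lborel (\<lambda>y. (grad \<eta> (x - y) \<bullet> h) * f y)"
      unfolding eq by (intro Bochner_Integration.integrable_sum integrable_mult_right ci)
    have "(\<integral>y. (grad \<eta> (x - y) \<bullet> h) * f y \<partial>lborel) = (\<Sum>i\<in>UNIV. \<integral>y. h $ i * (partial i \<eta> (x - y) * f y) \<partial>lborel)"
      unfolding eq by (rule Bochner_Integration.integral_sum) (intro integrable_mult_right ci)
    then show "?G \<bullet> h = (\<integral>y. (grad \<eta> (x - y) \<bullet> h) * f y \<partial>lborel)"
      by (simp add: inner_vec_def convol_def mult.commute[of "h $ _"])
  qed
  show ?thesis
    unfolding has_derivative_at
  proof
    show "bounded_linear (\<lambda>h. ?G \<bullet> h)" by (rule bounded_linear_inner_right)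
    show "(\<lambda>h. norm (convol \<eta> f (x + h) - convol \<eta> f x - ?G \<bullet> h) / norm h) \<midarrow>0\<rightarrow> 0"
      unfolding tendsto_at_iff_sequentially
    proof (intro allI impI)
      fix H :: "nat \<Rightarrow> real^'a" assume "\<forall>n. H n \<in> UNIV - {0}" and H0: "H \<longlonglongrightarrow> 0"
      then have nz: "H n \<noteq> 0" for n by auto
      have Hf: "filterlim H (at 0) sequentially" using H0 nz by (simp add: filterlim_at)
      define Q where "Q n y = (\<eta> (x - y + H n) - \<eta> (x - y) - grad \<eta> (x - y) \<bullet> H n) / norm (H n) * f y" for n y
      have "(\<lambda>n. \<integral>y. Q n y \<partial>lborel) \<longlonglongrightarrow> (\<integral>y. (0::real) \<partial>(lborel :: (real^'a) measure))"
      proof (rule integral_dominated_convergence[where w="\<lambda>y. 2 * B * \<bar>f y\<bar>"])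
        show "AE y in lborel. (\<lambda>n. Q n y) \<longlonglongrightarrow> 0"
        proof (rule AE_I2)
          fix y
          have "((\<lambda>h. norm (\<eta> (x - y + h) - \<eta> (x - y) - grad \<eta> (x - y) \<bullet> h) / norm h) \<longlongrightarrow> 0) (at 0)"
            using has_derivative_grad[OF D(2), of "x - y"] by (simp add: has_derivative_at)
          then have "(\<lambda>n. norm (\<eta> (x - y + H n) - \<eta> (x - y) - grad \<eta> (x - y) \<bullet> H n) / norm (H n)) \<longlonglongrightarrow> 0"
            by (rule filterlim_compose[OF _ Hf])
          then have "(\<lambda>n. (\<eta> (x - y + H n) - \<eta> (x - y) - grad \<eta> (x - y) \<bullet> H n) / norm (H n)) \<longlonglongrightarrow> 0"
            by (rule tendsto_norm_zero_cancel[OF back_subst[of "\<lambda>f. f \<longlonglongrightarrow> 0"]]) (simp add: norm_divide)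
          from tendsto_mult_left_zero[OF this] show "(\<lambda>n. Q n y) \<longlonglongrightarrow> 0" by (simp add: Q_def)
        qed
        show "AE y in lborel. norm (Q n y) \<le> 2 * B * \<bar>f y\<bar>" for n
        proof (rule AE_I2)
          fix y
          have "\<bar>\<eta> (x - y + H n) - \<eta> (x - y) - grad \<eta> (x - y) \<bullet> H n\<bar> \<le> B * norm (H n) + B * norm (H n)"
            using B(4)[of "x - y" "H n"] Cauchy_Schwarz_ineq2[of "grad \<eta> (x - y)" "H n"]
              mult_right_mono[OF B(3)[of "x - y"] norm_ge_zero[of "H n"]] by linarith
          then have "\<bar>\<eta> (x - y + H n) - \<eta> (x - y) - grad \<eta> (x - y) \<bullet> H n\<bar> / norm (H n) \<le> 2 * B"
            using nz[of n] by (simp add: divide_le_eq)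
          from mult_right_mono[OF this abs_ge_zero[of "f y"]]
          show "norm (Q n y) \<le> 2 * B * \<bar>f y\<bar>" by (simp add: Q_def abs_mult)
        qed
      qed (use f in \<open>auto simp: Q_def\<close>)
      moreover have "(\<integral>y. Q n y \<partial>lborel) = (convol \<eta> f (x + H n) - convol \<eta> f x - ?G \<bullet> H n) / norm (H n)" for n
      proof -
        have "Q n = (\<lambda>y. (\<eta> (x + H n - y) * f y - \<eta> (x - y) * f y - (grad \<eta> (x - y) \<bullet> H n) * f y) / norm (H n))"
          by (rule ext) (simp add: Q_def left_diff_distrib diff_add_eq)
        then show ?thesis using ci Gi[of "H n"] by (simp add: G[unfolded convol_def] convol_def)
      qed
      ultimately have "(\<lambda>n. (convol \<eta> f (x + H n) - convol \<eta> f x - ?G \<bullet> H n) / norm (H n)) \<longlonglongrightarrow> 0" by simp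
      from tendsto_norm_zero[OF this]
      show "((\<lambda>h. norm (convol \<eta> f (x + h) - convol \<eta> f x - ?G \<bullet> h) / norm h) \<circ> H) \<longlonglongrightarrow> 0"
        by (simp add: o_def norm_divide)
    qed
  qed
qed

lemma convol_smooth:
  assumes "\<eta> \<in> CcInf" "integrable lborel f"
  shows "smooth (convol \<eta> f)" "partial i (convol \<eta> f) = convol (partial i \<eta>) f"
proof -
  have d: "(convol \<eta> f has_derivative (\<lambda>h. (\<chi> i. convol (partial i \<eta>) f x) \<bullet> h)) (at x)"
    if "\<eta> \<in> CcInf" for \<eta> x
    by (rule convol_has_derivative[OF test_functions_C1c[OF that] assms(2)])
  have p: "partial i (convol \<eta> f) = convol (partial i \<eta>) f" if "\<eta> \<in> CcInf" for \<eta> i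
    using grad_eqI(2)[OF d[OF that]] by (simp add: fun_eq_iff)
  show "partial i (convol \<eta> f) = convol (partial i \<eta>) f" by (rule p[OF assms(1)])
  have "C_k k (convol \<eta> f)" for k
    using assms(1)
  proof (induction k arbitrary: \<eta>)
    case 0
    have "isCont (convol \<eta> f) x" for x
      using has_derivative_continuous[OF d[OF 0]] by (simp add: continuous_at_imp_continuous_at_within)
    then show ?case by (simp add: continuous_on_eq_continuous_at)
  next
    case (Suc k)
    show ?case
      using Suc.IH[OF test_functions_partial[OF Suc.prems]] d[OF Suc.prems]
      by (auto simp: p[OF Suc.prems] differentiable_def)
  qed
  then show "smooth (convol \<eta> f)" by (simp add: smooth_def)
qed

text \<open>The kernel is a probability density, so by Cauchy-Schwarz the squared error at x is at
  most the mean of |f(x - h) - f(x)|^2 over h; Tonelli's theorem and the continuity of translations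
  in L2 finish. The radius d works for all kernels at once, so that one kernel can serve several
  functions.\<close>

lemma convol_L2_close:
  fixes f :: "'a::euclidean_space \<Rightarrow> real"
  assumes f: "sqi lborel f" and e: "0 < e"
  shows "\<exists>d>0. \<forall>\<eta>. continuous_on UNIV \<eta> \<and> (\<forall>x. 0 \<le> \<eta> x) \<and> (\<forall>x. d \<le> norm x \<longrightarrow> \<eta> x = 0)
     \<and> (\<integral>x. \<eta> x \<partial>lborel) = 1 \<longrightarrow> convol \<eta> f \<in> borel_measurable borel \<longrightarrow>
     sqi lborel (\<lambda>x. convol \<eta> f x - f x) \<and> l2n lborel (\<lambda>x. convol \<eta> f x - f x) \<le> e"
proof -
  have fm[measurable]: "f \<in> borel_measurable borel" using sqi_measurable[OF f] by simp
  obtain d where d0: "d > 0" "\<And>h. norm h < d \<Longrightarrow> l2n lborel (\<lambda>x. f (x + h) - f x) < e"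
    using L2_translation_continuous[OF f e] by auto
  have d: "d > 0" "(\<integral>x. (f (x + h) - f x)\<^sup>2 \<partial>lborel) \<le> e\<^sup>2" if "norm h < d" for h
    using d0(1) power_mono[OF less_imp_le[OF d0(2)[OF that]], of 2] by (simp_all add: l2n_power2)
  show ?thesis
  proof (intro exI[of _ d] conjI allI impI d0(1); (elim conjE)?)
    fix \<eta> :: "'a \<Rightarrow> real"
    assume \<eta>c: "continuous_on UNIV \<eta>" and \<eta>0: "\<forall>x. 0 \<le> \<eta> x" and \<eta>s: "\<forall>x. d \<le> norm x \<longrightarrow> \<eta> x = 0"
      and \<eta>1: "(\<integral>x. \<eta> x \<partial>lborel) = 1" and cm[measurable]: "convol \<eta> f \<in> borel_measurable borel"
    have [measurable]: "\<eta> \<in> borel_measurable borel" using \<eta>c by (rule borel_measurable_continuous_onI)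
    have \<eta>K: "\<eta> x = 0" if "x \<notin> cball 0 d" for x using \<eta>s that by simp
    note \<eta>cs = continuous_compact_support[OF \<eta>c compact_cball[of 0 d] \<eta>K]
    have nn1: "(\<integral>\<^sup>+h. ennreal (\<eta> h) \<partial>lborel) = 1"
      using \<eta>cs(1) \<eta>0 \<eta>1 by (simp add: nn_integral_eq_integral)
    have pw: "ennreal ((convol \<eta> f x - f x)\<^sup>2) \<le> (\<integral>\<^sup>+h. ennreal (\<eta> h * (f (x - h) - f x)\<^sup>2) \<partial>lborel)" for x
    proof -
      have "sqi lborel (\<lambda>h. f (x - h))"
        using integral_lborel_reflect(2)[of "\<lambda>x. (norm (f x))\<^sup>2" x] f by (simp add: sqi_def)
      then have i1: "integrable lborel (\<lambda>h. \<eta> h * f (x - h))"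
        using sqi_mult_integrable[OF \<eta>cs(3), of "\<lambda>h. f (x - h)"] by simp
      have "convol \<eta> f x = (\<integral>h. \<eta> h * f (x - h) \<partial>lborel)"
        unfolding convol_def using integral_lborel_reflect(1)[of "\<lambda>y. \<eta> (x - y) * f y" x] by simp
      also have "\<dots> - f x = (\<integral>h. \<eta> h * (f (x - h) - f x) \<partial>lborel)"
        using i1 \<eta>cs(1) \<eta>1 by (simp add: right_diff_distrib)
      finally have eq: "convol \<eta> f x - f x = (\<integral>h. \<eta> h * (f (x - h) - f x) \<partial>lborel)" .
      have i2: "integrable lborel (\<lambda>h. \<eta> h * (f (x - h) - f x))"
        using i1 \<eta>cs(1) by (simp add: right_diff_distrib)
      have "ennreal \<bar>convol \<eta> f x - f x\<bar> \<le> (\<integral>\<^sup>+h. ennreal (\<eta> h * \<bar>f (x - h) - f x\<bar>) \<partial>lborel)"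
        using integral_norm_bound_ennreal[OF i2] \<eta>0 by (simp add: eq abs_mult)
      also have "\<dots> = (\<integral>\<^sup>+h. ennreal (sqrt (\<eta> h)) * ennreal (sqrt (\<eta> h) * \<bar>f (x - h) - f x\<bar>) \<partial>lborel)"
        using \<eta>0 by (intro nn_integral_cong) (simp flip: ennreal_mult' mult.assoc)
      finally have "(ennreal \<bar>convol \<eta> f x - f x\<bar>)\<^sup>2 \<le>
        (\<integral>\<^sup>+h. ennreal (sqrt (\<eta> h)) * ennreal (sqrt (\<eta> h) * \<bar>f (x - h) - f x\<bar>) \<partial>lborel)\<^sup>2"
        by (rule power_mono) simp
      also have "\<dots> \<le> (\<integral>\<^sup>+h. (ennreal (sqrt (\<eta> h)))\<^sup>2 \<partial>lborel) *
          (\<integral>\<^sup>+h. (ennreal (sqrt (\<eta> h) * \<bar>f (x - h) - f x\<bar>))\<^sup>2 \<partial>lborel)"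
        by (rule Cauchy_Schwarz_nn_integral) measurable
      also have "(\<integral>\<^sup>+h. (ennreal (sqrt (\<eta> h)))\<^sup>2 \<partial>lborel) = 1"
        using \<eta>0 nn1 by (simp add: ennreal_power)
      also have "(\<integral>\<^sup>+h. (ennreal (sqrt (\<eta> h) * \<bar>f (x - h) - f x\<bar>))\<^sup>2 \<partial>lborel)
          = (\<integral>\<^sup>+h. ennreal (\<eta> h * (f (x - h) - f x)\<^sup>2) \<partial>lborel)"
        using \<eta>0 by (simp add: ennreal_power power_mult_distrib)
      finally show ?thesis by (simp add: ennreal_power)
    qed
    have "(\<integral>\<^sup>+x. ennreal ((convol \<eta> f x - f x)\<^sup>2) \<partial>lborel)
        \<le> (\<integral>\<^sup>+x. \<integral>\<^sup>+h. ennreal (\<eta> h * (f (x - h) - f x)\<^sup>2) \<partial>lborel \<partial>lborel)"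
      by (intro nn_integral_mono pw)
    also have "\<dots> = (\<integral>\<^sup>+h. \<integral>\<^sup>+x. ennreal (\<eta> h * (f (x - h) - f x)\<^sup>2) \<partial>lborel \<partial>lborel)"
      by (rule lborel_pair.Fubini') measurable
    also have "\<dots> \<le> (\<integral>\<^sup>+h. ennreal (\<eta> h) * ennreal (e\<^sup>2) \<partial>lborel)"
    proof (intro nn_integral_mono)
      fix h
      show "(\<integral>\<^sup>+x. ennreal (\<eta> h * (f (x - h) - f x)\<^sup>2) \<partial>lborel) \<le> ennreal (\<eta> h) * ennreal (e\<^sup>2)"
      proof (cases "norm h < d")
        case True
        have s: "sqi lborel (\<lambda>x. f (x + (- h)) - f x)" by (rule sqi_diff[OF l2n_translate(2)[OF fm, THEN iffD2, OF f] f])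
        have "(\<integral>\<^sup>+x. ennreal ((f (x - h) - f x)\<^sup>2) \<partial>lborel) = ennreal (\<integral>x. (f (x - h) - f x)\<^sup>2 \<partial>lborel)"
          using s by (intro nn_integral_eq_integral) (auto simp: sqi_def)
        also have "\<dots> \<le> ennreal (e\<^sup>2)" using d(2)[of "-h"] True by (intro ennreal_leI) simp
        finally have "ennreal (\<eta> h) * (\<integral>\<^sup>+x. ennreal ((f (x - h) - f x)\<^sup>2) \<partial>lborel) \<le> ennreal (\<eta> h) * ennreal (e\<^sup>2)"
          by (rule mult_left_mono) simp
        then show ?thesis using \<eta>0 by (simp add: ennreal_mult' nn_integral_cmult)
      qed (use \<eta>s in simp)
    qed
    also have "\<dots> = ennreal (e\<^sup>2)" using nn1 by (simp add: nn_integral_multc)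
    finally have fin: "(\<integral>\<^sup>+x. ennreal ((convol \<eta> f x - f x)\<^sup>2) \<partial>lborel) \<le> ennreal (e\<^sup>2)" .
    then have i: "integrable lborel (\<lambda>x. (convol \<eta> f x - f x)\<^sup>2)"
      by (intro integrableI_bounded) (auto simp: top.extremum_strict intro: le_less_trans)
    then show "sqi lborel (\<lambda>x. convol \<eta> f x - f x)" by (simp add: sqi_def)
    have "ennreal ((l2n lborel (\<lambda>x. convol \<eta> f x - f x))\<^sup>2) \<le> ennreal (e\<^sup>2)"
      using fin nn_integral_eq_integral[OF i] by (simp add: l2n_power2)
    then have "(l2n lborel (\<lambda>x. convol \<eta> f x - f x))\<^sup>2 \<le> e\<^sup>2" by (subst (asm) ennreal_le_iff) simp_all
    then show "l2n lborel (\<lambda>x. convol \<eta> f x - f x) \<le> e" by (rule power2_le_imp_le) (use e in simp)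
  qed
qed

section \<open>Vector fields and products with bounded functions\<close>

lemma borel_measurable_vec_nth [measurable (raw)]:
  fixes f :: "'a \<Rightarrow> real^'n"
  assumes "f \<in> borel_measurable M" shows "(\<lambda>x. f x $ i) \<in> borel_measurable M"
proof -
  have "(\<lambda>x. f x \<bullet> axis i 1) \<in> borel_measurable M" using assms by measurable
  then show ?thesis by (simp add: cart_eq_inner_axis)
qed

lemma borel_measurable_vecI:
  fixes f :: "'a \<Rightarrow> real^'n"
  assumes "\<And>i. (\<lambda>x. f x $ i) \<in> borel_measurable M" shows "f \<in> borel_measurable M"
  using assms by (subst borel_measurable_euclidean_space) (auto simp: Basis_vec_def cart_eq_inner_axis)

lemma sqi_component: "sqi M G \<Longrightarrow> sqi M (\<lambda>x. G x $ i)" for G :: "'a \<Rightarrow> real^'n"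
  by (rule sqi_bound[of M G _ 1]) (auto simp: sqi_def component_le_norm_cart borel_measurable_vec_nth)

lemma l2conv_components:
  fixes F :: "nat \<Rightarrow> 'a \<Rightarrow> real^'n"
  assumes "\<And>i. l2conv M (\<lambda>n x. F n x $ i) (\<lambda>x. f x $ i)"
  shows "l2conv M F f"
proof -
  note * = l2convD[OF assms]
  have vec: "sqi M g" if "\<And>i. sqi M (\<lambda>x. g x $ i)" for g :: "'a \<Rightarrow> real^'n"
  proof -
    have "g \<in> borel_measurable M"
      using that by (intro borel_measurable_vecI) (auto simp: sqi_def)
    moreover
 have "(norm (g x))\<^sup>2 = (\<Sum>i\<in>UNIV. (norm (g x $ i))\<^sup>2)" for x
      by (simp add: norm_vec_def L2_set_def sum_nonneg)
    ultimately show ?thesis using that by (auto simp: sqi_def)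
  qed
  have s: "sqi M (F n)" "sqi M f" for n using vec * by auto
  have eq: "(l2n M (\<lambda>x. F n x - f x))\<^sup>2 = (\<Sum>i\<in>UNIV. (l2n M (\<lambda>x. F n x $ i - f x $ i))\<^sup>2)" for n
  proof -
    have "(norm (F n x - f x))\<^sup>2 = (\<Sum>i\<in>UNIV. (norm (F n x $ i - f x $ i))\<^sup>2)" for x
      by (simp add: norm_vec_def L2_set_def sum_nonneg)
    moreover have "integrable M (\<lambda>x. (norm (F n x $ i - f x $ i))\<^sup>2)" for i
      using sqi_diff[OF *(1,2)] by (simp add: sqi_def)
    ultimately show ?thesis by (simp add: l2n_power2)
  qed
  have "(\<lambda>n. sqrt ((l2n M (\<lambda>x. F n x - f x))\<^sup>2)) \<longlonglongrightarrow> sqrt (\<Sum>i\<in>(UNIV::'n set). 0\<^sup>2)"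
    unfolding eq by (intro tendsto_intros *)
  then show ?thesis using s by (simp add: l2conv_def)
qed

lemma l2conv_component:
  fixes F :: "nat \<Rightarrow> 'a \<Rightarrow> real^'n"
  assumes "l2conv M F f"
  shows "l2conv M (\<lambda>n x. F n x $ i) (\<lambda>x. f x $ i)"
proof -
  note * = l2convD[OF assms]
  have "(\<lambda>n. l2n M (\<lambda>x. F n x $ i - f x $ i)) \<longlonglongrightarrow> 0"
  proof (rule Lim_null_comparison[OF _ *(3)])
    have "l2n M (\<lambda>x. F n x $ i - f x $ i) \<le> 1 * l2n M (\<lambda>x. F n x - f x)" for n
    proof (rule l2n_mono)
      show "AE x in M. norm (F n x $ i - f x $ i) \<le> 1 * norm (F n x - f x)"
        using component_le_norm_cart[of "F n _ - f _" i] by simp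
    qed (use sqi_diff[OF sqi_component[OF *(1)] sqi_component[OF *(2)]] in \<open>auto intro: sqi_diff * sqi_measurable\<close>)
    then show "\<forall>\<^sub>F n in sequentially. norm (l2n M (\<lambda>x. F n x $ i - f x $ i)) \<le> l2n M (\<lambda>x. F n x - f x)"
      by simp
  qed
  then show ?thesis using * by (auto simp: l2conv_def sqi_component)
qed

lemma l2conv_mult_bounded:
  fixes F :: "nat \<Rightarrow> 'a \<Rightarrow> 'b::euclidean_space" and b :: "nat \<Rightarrow> 'a \<Rightarrow> real"
  assumes F: "l2conv M F f" and b: "\<And>n. b n \<in> borel_measurable M" "c \<in> borel_measurable M"
    and bd: "\<And>n. AE x in M. \<bar>b n x\<bar> \<le> K" and lim: "AE x in M. (\<lambda>n. b n x) \<longlonglongrightarrow> c x"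
  shows "l2conv M (\<lambda>n x. b n x *\<^sub>R F n x) (\<lambda>x. c x *\<^sub>R f x)"
proof -
  note * = l2convD[OF F]
  have K: "0 \<le> \<bar>K\<bar>" by simp
  have bd': "AE x in M. \<bar>b n x\<bar> \<le> \<bar>K\<bar>" for n using bd[of n] by eventually_elim simp
  have s: "sqi M (\<lambda>x. b n x *\<^sub>R F n x)" for n by (rule sqi_mult_bounded[OF *(1) b(1) bd])
  have 1: "l2conv M (\<lambda>n x. b n x *\<^sub>R f x) (\<lambda>x. c x *\<^sub>R f x)"
  proof (rule l2conv_dominated[of M "\<lambda>x. \<bar>K\<bar> *\<^sub>R f x"])
    show "AE x in M. (\<lambda>n. b n x *\<^sub>R f x) \<longlonglongrightarrow> c x *\<^sub>R f x"
      using lim by eventually_elim (intro tendsto_intros)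
    show "AE x in M. norm (b n x *\<^sub>R f x) \<le> norm (\<bar>K\<bar> *\<^sub>R f x)" for n
      using bd'[of n] by eventually_elim (simp add: mult_right_mono)
  qed (use * b sqi_measurable[OF *(2)] in \<open>auto intro!: borel_measurable_scaleR\<close>)
  have "(\<lambda>n. l2n M (\<lambda>x. b n x *\<^sub>R F n x - c x *\<^sub>R f x)) \<longlonglongrightarrow> 0"
  proof (rule Lim_null_comparison)
    show "\<forall>\<^sub>F n in sequentially. norm (l2n M (\<lambda>x. b n x *\<^sub>R F n x - c x *\<^sub>R f x))
      \<le> \<bar>K\<bar> * l2n M (\<lambda>x. F n x - f x) + l2n M (\<lambda>x. b n x *\<^sub>R f x - c x *\<^sub>R f x)"
    proof (intro always_eventually allI)
      fix n
      have "l2n M (\<lambda>x. b n x *\<^sub>R F n x - c x *\<^sub>R f x)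
        \<le> l2n M (\<lambda>x. b n x *\<^sub>R F n x - b n x *\<^sub>R f x) + l2n M (\<lambda>x. b n x *\<^sub>R f x - c x *\<^sub>R f x)"
        using s l2convD(1,2)[OF 1] by (intro l2n_triangle3)
      also have "l2n M (\<lambda>x. b n x *\<^sub>R F n x - b n x *\<^sub>R f x) \<le> \<bar>K\<bar> * l2n M (\<lambda>x. F n x - f x)"
      proof (rule l2n_mono)
        show "AE x in M. norm (b n x *\<^sub>R F n x - b n x *\<^sub>R f x) \<le> \<bar>K\<bar> * norm (F n x - f x)"
          using bd'[of n] by eventually_elim (simp add: mult_right_mono flip: scaleR_diff_right)
      qed (use * b sqi_measurable[OF *(1)] sqi_measurable[OF *(2)] in
          \<open>auto intro!: sqi_diff borel_measurable_scaleR borel_measurable_diff\<close>)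
      finally show "norm (l2n M (\<lambda>x. b n x *\<^sub>R F n x - c x *\<^sub>R f x))
        \<le> \<bar>K\<bar> * l2n M (\<lambda>x. F n x - f x) + l2n M (\<lambda>x. b n x *\<^sub>R f x - c x *\<^sub>R f x)" by simp
    qed
    show "(\<lambda>n. \<bar>K\<bar> * l2n M (\<lambda>x. F n x - f x) + l2n M (\<lambda>x. b n x *\<^sub>R f x - c x *\<^sub>R f x)) \<longlonglongrightarrow> 0"
      using tendsto_add[OF tendsto_mult_right_zero[OF *(3)] l2convD(3)[OF 1]] by simp
  qed
  then show ?thesis using s l2convD(2)[OF 1] by (simp add: l2conv_def)
qed

section \<open>Weak gradients on a bounded open set\<close>

locale bounded_domain =
  fixes \<Omega> :: "(real^'n) set"
  assumes open_domain: "open \<Omega>" and bounded_domain: "bounded \<Omega>"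
begin

abbreviation M where "M \<equiv> lebesgue_on \<Omega>"

lemma Omega_sets: "\<Omega> \<in> sets borel" "\<Omega> \<in> sets lebesgue" "\<Omega> \<in> lmeasurable"
  using open_domain bounded_domain by (auto simp: bounded_set_imp_lmeasurable)

sublocale finite_measure M
  by (rule finite_measure_lebesgue_on[OF Omega_sets(3)])

lemma space_M [simp]: "space M = \<Omega>" by simp

lemma borel_measurable_M [measurable (raw)]: "f \<in> borel_measurable borel \<Longrightarrow> f \<in> borel_measurable M"
  by (rule measurable_restrict_space1, rule measurable_completion) simp

lemma integral_M_lborel:
  fixes h :: "real^'n \<Rightarrow> 'b::{banach, second_countable_topology}"
  assumes "h \<in> borel_measurable borel" "\<And>x. x \<notin> \<Omega> \<Longrightarrow> h x = 0"
  shows "(\<integral>x. h x \<partial>M) = (\<integral>x. h x \<partial>lborel)" "integrable M h \<longleftrightarrow> integrable lborel h"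
proof -
  have eq: "(\<lambda>x. indicator \<Omega> x *\<^sub>R h x) = h" using assms(2) by (auto simp: fun_eq_iff indicator_def)
  show "(\<integral>x. h x \<partial>M) = (\<integral>x. h x \<partial>lborel)"
    using Omega_sets assms(1) by (simp add: integral_restrict_space eq integral_completion)
  show "integrable M h \<longleftrightarrow> integrable lborel h"
    using Omega_sets assms(1) by (simp add: integrable_restrict_space eq integrable_completion)
qed

lemma sqi_M_lborel:
  fixes h :: "real^'n \<Rightarrow> 'b::euclidean_space"
  assumes [measurable]: "h \<in> borel_measurable borel" and "\<And>x. x \<notin> \<Omega> \<Longrightarrow> h x = 0"
  shows "sqi M h \<longleftrightarrow> sqi lborel h" "l2n M h = l2n lborel h"
  using integral_M_lborel[of "\<lambda>x. (norm (h x))\<^sup>2"] assms by (auto simp: sqi_def l2n_def)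

lemma sqi_M_of_lborel:
  fixes h :: "real^'n \<Rightarrow> 'b::euclidean_space"
  assumes "sqi lborel h" shows "sqi M h" "l2n M h \<le> l2n lborel h"
proof -
  have [measurable]: "h \<in> borel_measurable borel" using sqi_measurable[OF assms] by simp
  define k where "k x = indicator \<Omega> x *\<^sub>R h x" for x
  have km[measurable]: "k \<in> borel_measurable borel" unfolding k_def[abs_def] using Omega_sets(1) by measurable
  have k0: "k x = 0" if "x \<notin> \<Omega>" for x using that by (simp add: k_def)
  have kh: "AE x in M. k x = h x" by (rule AE_I2) (simp add: k_def)
  have b: "AE x in lborel. norm (k x) \<le> 1 * norm (h x)" by (rule AE_I2) (simp add: k_def indicator_def)
  have sk: "sqi lborel k" by (rule sqi_bound[OF assms _ b]) simp
  then have "sqi M k" using sqi_M_lborel(1)[OF km k0] by simp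
  then show "sqi M h" by (rule sqi_cong_AE[OF _ _ kh]) simp
  have "l2n M h = l2n M k" by (rule l2n_cong_AE) (use kh in auto)
  also have "\<dots> = l2n lborel k" by (rule sqi_M_lborel(2)[OF km k0])
  also have "\<dots> \<le> 1 * l2n lborel h" by (rule l2n_mono[OF assms _ b]) simp_all
  finally show "l2n M h \<le> l2n lborel h" by simp
qed

text \<open>Convolutions and Tonelli's theorem are used over \<open>lborel\<close>, whereas
  functions on \<Omega> are only Lebesgue measurable; hence the extension by 0 and the change on a
  null set.\<close>

lemma borel_representative:
  fixes f :: "real^'n \<Rightarrow> real"
  assumes "f \<in> borel_measurable M"
  obtains g where "g \<in> borel_measurable borel" "\<And>x. x \<notin> \<Omega> \<Longrightarrow> g x = 0" "AE x in M. f x = g x"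
proof -
  have "(\<lambda>x. if x \<in> \<Omega> then f x else 0) \<in> borel_measurable lebesgue"
    using assms borel_measurable_if[OF Omega_sets(2)] by blast
  then obtain g where g: "g \<in> borel_measurable lborel" "AE x in lborel. (if x \<in> \<Omega> then f x else 0) = g x"
    using completion_ex_borel_measurable_real by blast
  have [measurable]: "g \<in> borel_measurable borel" using g(1) by simp
  show ?thesis
  proof
    show "(\<lambda>x. indicator \<Omega> x * g x) \<in> borel_measurable borel" using Omega_sets(1) by measurable
    have "AE x in lebesgue. (if x \<in> \<Omega> then f x else 0) = g x" using g(2) by (rule AE_completion)
    then have "AE x in lebesgue. x \<in> \<Omega> \<longrightarrow> f x = indicator \<Omega> x * g x"
      by eventually_elim (simp split: if_splits)
    then show "AE x in M. f x = indicator \<Omega> x * g x"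
      using Omega_sets(2) by (subst AE_restrict_space_iff) auto
  qed simp
qed

lemma borel_representative_vec:
  fixes G :: "real^'n \<Rightarrow> real^'n"
  assumes "G \<in> borel_measurable M"
  obtains H where "\<And>i. (\<lambda>x. H x $ i) \<in> borel_measurable borel" "\<And>x. x \<notin> \<Omega> \<Longrightarrow> H x = 0" "AE x in M. G x = H x"
proof -
  have "\<forall>i. \<exists>g. g \<in> borel_measurable borel \<and> (\<forall>x. x \<notin> \<Omega> \<longrightarrow> g x = 0) \<and> (AE x in M. G x $ i = g x)"
  proof
    fix i
    obtain g where "g \<in> borel_measurable borel" "\<And>x. x \<notin> \<Omega> \<Longrightarrow> g x = 0" "AE x in M. G x $ i = g x"
      by (rule borel_representative[OF borel_measurable_vec_nth[OF assms], of i]) blast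
    then show "\<exists>g. g \<in> borel_measurable borel \<and> (\<forall>x. x \<notin> \<Omega> \<longrightarrow> g x = 0) \<and> (AE x in M. G x $ i = g x)"
      by blast
  qed
  from choice[OF this] obtain g where g: "\<forall>i. g i \<in> borel_measurable borel \<and> (\<forall>x. x \<notin> \<Omega> \<longrightarrow> g i x = 0) \<and> (AE x in M. G x $ i = g i x)"
    by blast
  show ?thesis
  proof
    show "(\<lambda>x. (\<chi> i. g i x) $ i) \<in> borel_measurable borel" for i using g by simp
    show "x \<notin> \<Omega> \<Longrightarrow> (\<chi> i. g i x) = 0" for x using g by (simp add: vec_eq_iff)
    have "AE x in M. \<forall>i. G x $ i = g i x" using g by (simp add: AE_all_countable)
    then show "AE x in M. G x = (\<chi> i. g i x)" by eventually_elim (simp add: vec_eq_iff)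
  qed
qed

lemma test_fn:
  assumes "\<psi> \<in> test_functions \<Omega>"
  shows "sqi M \<psi>" "sqi M (grad \<psi>)" "\<psi> \<in> borel_measurable borel" "grad \<psi> \<in> borel_measurable borel"
    "\<exists>B\<ge>0. (\<forall>x. \<bar>\<psi> x\<bar> \<le> B) \<and> (\<forall>x. norm (grad \<psi> x) \<le> B)"
    "x \<notin> \<Omega> \<Longrightarrow> \<psi> x = 0" "x \<notin> \<Omega> \<Longrightarrow> grad \<psi> x = 0"
    "l2n M \<psi> = l2n lborel \<psi>" "l2n M (grad \<psi>) = l2n lborel (grad \<psi>)"
    "sqi M (partial i \<psi>)"
proof -
  note D = C1cD[OF test_functions_C1c[OF assms]]
  show m: "\<psi> \<in> borel_measurable borel" "grad \<psi> \<in> borel_measurable borel"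
    using D by (auto intro: borel_measurable_continuous_onI)
  show "\<exists>B\<ge>0. (\<forall>x. \<bar>\<psi> x\<bar> \<le> B) \<and> (\<forall>x. norm (grad \<psi> x) \<le> B)" using D(11) by blast
  obtain K where K: "compact K" "K \<subseteq> \<Omega>" "\<And>x. x \<notin> K \<Longrightarrow> \<psi> x = 0" using test_functionsE[OF assms] by metis
  have z: "\<psi> x = 0" "grad \<psi> x = 0" if "x \<notin> \<Omega>" for x
  proof -
    have "x \<notin> K" using K(2) that by auto
    then show "\<psi> x = 0" "grad \<psi> x = 0"
      using K(3) partial_zero_outside(2)[OF K(3) compact_imp_closed[OF K(1)]] by auto
  qed
  then show "x \<notin> \<Omega> \<Longrightarrow> \<psi> x = 0" "x \<notin> \<Omega> \<Longrightarrow> grad \<psi> x = 0" by auto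
  show "sqi M \<psi>" "l2n M \<psi> = l2n lborel \<psi>" using sqi_M_lborel[OF m(1) z(1)] D(9) by auto
  show s: "sqi M (grad \<psi>)" "l2n M (grad \<psi>) = l2n lborel (grad \<psi>)" using sqi_M_lborel[OF m(2) z(2)] D(10) by auto
  show "sqi M (partial i \<psi>)" using sqi_component[OF s(1), of i] by (simp add: grad_def)
qed

text \<open>The weak gradient as a relation between square integrable functions: limits, sums and
  changes on null sets can be taken in f and G together, without the choice made in
  \<open>wgrad\<close>. The link to the latter is \<open>wgr_wgrad\<close> and
  \<open>H1_wgr\<close>.\<close>

definition wgr :: "(real^'n \<Rightarrow> real) \<Rightarrow> (real^'n \<Rightarrow> real^'n) \<Rightarrow> bool" where
  "wgr f G \<longleftrightarrow> sqi M f \<and> sqi M G \<and>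
     (\<forall>\<psi>\<in>test_functions \<Omega>. \<forall>i. (\<integral>x. f x * partial i \<psi> x \<partial>M) = - (\<integral>x. G x $ i * \<psi> x \<partial>M))"

lemma wgrD:
  assumes "wgr f G"
  shows "sqi M f" "sqi M G" "\<psi> \<in> test_functions \<Omega> \<Longrightarrow> (\<integral>x. f x * partial i \<psi> x \<partial>M) = - (\<integral>x. G x $ i * \<psi> x \<partial>M)"
  using assms by (auto simp: wgr_def)

lemma sqi_prod_integrable: "sqi M f \<Longrightarrow> sqi M g \<Longrightarrow> integrable M (\<lambda>x. f x * g x)" for f g :: "real^'n \<Rightarrow> real"
  using sqi_mult_integrable[of M f g] by simp

lemma wgr_add: "wgr f G \<Longrightarrow> wgr g H \<Longrightarrow> wgr (\<lambda>x. f x + g x) (\<lambda>x. G x + H x)"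
  using test_fn(1,10) by (auto simp: wgr_def distrib_right sqi_prod_integrable sqi_component sqi_add)

lemma wgr_scale: "wgr f G \<Longrightarrow> wgr (\<lambda>x. c * f x) (\<lambda>x. c *\<^sub>R G x)"
  using sqi_scaleR[of M f c] by (auto simp: wgr_def mult.assoc sqi_scaleR)

lemma wgr_diff: "wgr f G \<Longrightarrow> wgr g H \<Longrightarrow> wgr (\<lambda>x. f x - g x) (\<lambda>x. G x - H x)"
  using wgr_add[of f G "\<lambda>x. (-1) * g x" "\<lambda>x. (-1) *\<^sub>R H x"] wgr_scale[of g H "-1"] by simp

lemma wgr_cong_AE:
  assumes "wgr f G" "g \<in> borel_measurable M" "H \<in> borel_measurable M" "AE x in M. f x = g x" "AE x in M. G x = H x"
  shows "wgr g H"
proof -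
  note W = wgrD[OF assms(1)]
  have s: "sqi M g" "sqi M H" using sqi_cong_AE[OF W(1) assms(2,4)] sqi_cong_AE[OF W(2) assms(3,5)] by auto
  have "(\<integral>x. g x * partial i \<psi> x \<partial>M) = - (\<integral>x. H x $ i * \<psi> x \<partial>M)" if \<psi>: "\<psi> \<in> test_functions \<Omega>" for \<psi> i
  proof -
    note [measurable] = sqi_measurable[OF test_fn(1)[OF \<psi>]] sqi_measurable[OF test_fn(10)[OF \<psi>, of i]]
      assms(2,3) sqi_measurable[OF W(1)] sqi_measurable[OF W(2)]
      sqi_measurable[OF sqi_component[OF W(2), of i]] sqi_measurable[OF sqi_component[OF s(2), of i]]
    have "(\<integral>x. g x * partial i \<psi> x \<partial>M) = (\<integral>x. f x * partial i \<psi> x \<partial>M)"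
      by (rule integral_cong_AE) (use assms(4) in \<open>auto elim: eventually_mono\<close>)
    moreover have "(\<integral>x. H x $ i * \<psi> x \<partial>M) = (\<integral>x. G x $ i * \<psi> x \<partial>M)"
      by (rule integral_cong_AE) (use assms(5) in \<open>auto elim: eventually_mono\<close>)
    ultimately show ?thesis using W(3)[OF \<psi>, of i] by simp
  qed
  with s show ?thesis by (simp add: wgr_def)
qed

lemma wgr_limit:
  assumes "\<And>n. wgr (f n) (G n)" "l2conv M f g" "l2conv M G H"
  shows "wgr g H"
proof -
  have "(\<integral>x. g x * partial i \<psi> x \<partial>M) = - (\<integral>x. H x $ i * \<psi> x \<partial>M)" if \<psi>: "\<psi> \<in> test_functions \<Omega>" for \<psi> i
  proof -
    have 1: "(\<lambda>n. \<integral>x. f n x * partial i \<psi> x \<partial>M) \<longlonglongrightarrow> (\<integral>x. g x * partial i \<psi> x \<partial>M)"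
      using l2conv_inner[OF assms(2) l2conv_const[OF test_fn(10)[OF \<psi>, of i]]] by simp
    have 2: "(\<lambda>n. - (\<integral>x. G n x $ i * \<psi> x \<partial>M)) \<longlonglongrightarrow> - (\<integral>x. H x $ i * \<psi> x \<partial>M)"
      using tendsto_minus[OF l2conv_inner[OF l2conv_component[OF assms(3)] l2conv_const[OF test_fn(1)[OF \<psi>]]]] by simp
    show ?thesis by (rule LIMSEQ_unique[OF 1]) (use 2 wgrD(3)[OF assms(1) \<psi>] in simp)
  qed
  with l2convD(2)[OF assms(2)] l2convD(2)[OF assms(3)] show ?thesis by (simp add: wgr_def)
qed

end

lemma l2conv_cong_limit:
  assumes "l2conv M F f" "g \<in> borel_measurable M" "AE x in M. f x = g x"
  shows "l2conv M F g"
proof -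
  note * = l2convD[OF assms(1)]
  have sg: "sqi M g" by (rule sqi_cong_AE[OF *(2) assms(2,3)])
  have "l2n M (\<lambda>x. F n x - g x) = l2n M (\<lambda>x. F n x - f x)" for n
  proof (rule l2n_cong_AE)
    show "AE x in M. F n x - g x = F n x - f x" using assms(3) by eventually_elim simp
  qed (use sqi_measurable[OF *(1)] sqi_measurable[OF *(2)] assms(2) in auto)
  then show ?thesis using * sg by (simp add: l2conv_def)
qed

text \<open>A function and all components of its gradient must be smoothed by the same kernels. The
  radius is the smallest of the finitely many that \<open>convol_L2_close\<close> provides.\<close>

lemma mollifier_sequence:
  fixes F :: "'i::finite \<Rightarrow> real^'n \<Rightarrow> real"
  assumes F: "\<And>i. sqi lborel (F i)" "\<And>i. integrable lborel (F i)" and r: "0 < r"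
  obtains \<eta> :: "nat \<Rightarrow> real^'n \<Rightarrow> real" where "\<And>j. \<eta> j \<in> CcInf" "\<And>j x. 0 \<le> \<eta> j x" "\<And>j x. r \<le> norm x \<Longrightarrow> \<eta> j x = 0"
    "\<And>j. (\<integral>x. \<eta> j x \<partial>lborel) = 1" "\<And>i. l2conv lborel (\<lambda>j. convol (\<eta> j) (F i)) (F i)"
proof -
  have "\<forall>j. \<exists>\<eta>. \<eta> \<in> CcInf \<and> (\<forall>x. 0 \<le> \<eta> x) \<and> (\<integral>x. \<eta> x \<partial>lborel) = 1 \<and> (\<forall>x. r \<le> norm x \<longrightarrow> \<eta> x = 0) \<and>
    (\<forall>i. sqi lborel (\<lambda>x. convol \<eta> (F i) x - F i x) \<and> l2n lborel (\<lambda>x. convol \<eta> (F i) x - F i x) \<le> 1 / real (Suc j))"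
    (is "\<forall>j. ?P j")
  proof
    fix j :: nat
    have "\<forall>i. \<exists>d>0. \<forall>\<eta>. continuous_on UNIV \<eta> \<and> (\<forall>x. 0 \<le> \<eta> x) \<and> (\<forall>x. d \<le> norm x \<longrightarrow> \<eta> x = 0)
     \<and> (\<integral>x. \<eta> x \<partial>lborel) = 1 \<longrightarrow> convol \<eta> (F i) \<in> borel_measurable borel \<longrightarrow>
     sqi lborel (\<lambda>x. convol \<eta> (F i) x - F i x) \<and> l2n lborel (\<lambda>x. convol \<eta> (F i) x - F i x) \<le> 1 / real (Suc j)"
      using convol_L2_close[OF F(1), of "1 / real (Suc j)"] by simp
    from choice[OF this] obtain d where d: "\<And>i. 0 < d i" "\<And>i \<eta>. continuous_on UNIV \<eta> \<Longrightarrow> (\<forall>x. 0 \<le> \<eta> x) \<Longrightarrow> (\<forall>x. d i \<le> norm x \<longrightarrow> \<eta> x = 0)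
     \<Longrightarrow> (\<integral>x. \<eta> x \<partial>lborel) = 1 \<Longrightarrow> convol \<eta> (F i) \<in> borel_measurable borel \<Longrightarrow>
     sqi lborel (\<lambda>x. convol \<eta> (F i) x - F i x) \<and> l2n lborel (\<lambda>x. convol \<eta> (F i) x - F i x) \<le> 1 / real (Suc j)" by blast
    define e where "e = min r (Min (range d))"
    have e: "0 < e" "e \<le> r" "\<And>i. e \<le> d i"
      using d(1) r by (auto simp: e_def min.coboundedI2)
    obtain \<eta> :: "real^'n \<Rightarrow> real" where \<eta>: "\<eta> \<in> CcInf" "\<And>x. 0 \<le> \<eta> x" "\<And>x. e \<le> norm x \<Longrightarrow> \<eta> x = 0"
      "(\<integral>x. \<eta> x \<partial>lborel) = 1" using mollifier_exists[OF e(1)] by blast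
    have "sqi lborel (\<lambda>x. convol \<eta> (F i) x - F i x) \<and> l2n lborel (\<lambda>x. convol \<eta> (F i) x - F i x) \<le> 1 / real (Suc j)" for i
    proof (rule d(2))
      show "continuous_on UNIV \<eta>" by (rule smoothD(3)[OF test_functions_smooth[OF \<eta>(1)]])
      show "convol \<eta> (F i) \<in> borel_measurable borel"
        by (rule borel_measurable_continuous_onI[OF smoothD(3)[OF convol_smooth(1)[OF \<eta>(1) F(2)]]])
      show "\<forall>x. d i \<le> norm x \<longrightarrow> \<eta> x = 0" using \<eta>(3) e(3)[of i] by (meson order_trans)
    qed (use \<eta> in auto)
    then show "?P j" using \<eta> e(2) by (intro exI[of _ \<eta>] conjI allI impI) (auto intro: order_trans)
  qed
  from choice[OF this] obtain \<eta> where \<eta>': "\<And>j x. 0 \<le> \<eta> j x" "\<And>j. (\<integral>x. \<eta> j x \<partial>lborel) = 1"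
    and \<eta>: "\<And>j. \<eta> j \<in> CcInf" "\<And>j x. r \<le> norm x \<Longrightarrow> \<eta> j x = 0"
    "\<And>i j. sqi lborel (\<lambda>x. convol (\<eta> j) (F i) x - F i x)"
    "\<And>i j. l2n lborel (\<lambda>x. convol (\<eta> j) (F i) x - F i x) \<le> 1 / real (Suc j)" by blast
  show thesis
  proof
    show "l2conv lborel (\<lambda>j. convol (\<eta> j) (F i)) (F i)" for i
      unfolding l2conv_def
    proof (intro conjI allI F)
      fix n show "sqi lborel (convol (\<eta> n) (F i))"
        using sqi_add[OF \<eta>(3)[where j=n] F(1), of i i] by simp
    next
      show "(\<lambda>n. l2n lborel (\<lambda>x. convol (\<eta> n) (F i) x - F i x)) \<longlonglongrightarrow> 0"
      proof (rule Lim_null_comparison)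
        show "\<forall>\<^sub>F n in sequentially. norm (l2n lborel (\<lambda>x. convol (\<eta> n) (F i) x - F i x)) \<le> 1 / real (Suc n)"
          using \<eta>(4)[where i=i] by simp
        show "(\<lambda>n. 1 / real (Suc n)) \<longlonglongrightarrow> 0" by (rule LIMSEQ_Suc[OF lim_1_over_n])
      qed
    qed
  qed (use \<eta> \<eta>' in auto)
qed

section \<open>Smooth approximation inside the domain and the space H10\<close>

context bounded_domain
begin

lemma l2conv_M_of_lborel:
  fixes F :: "nat \<Rightarrow> real^'n \<Rightarrow> 'b::euclidean_space"
  assumes "l2conv lborel F f" shows "l2conv M F f"
proof -
  note * = l2convD[OF assms]
  have "(\<lambda>n. l2n M (\<lambda>x. F n x - f x)) \<longlonglongrightarrow> 0"
    by (rule Lim_null_comparison[OF _ *(3)])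
      (use sqi_M_of_lborel(2)[OF sqi_diff[OF *(1,2)]] in auto)
  then show ?thesis using * sqi_M_of_lborel(1) by (auto simp: l2conv_def)
qed

text \<open>On a compact set \<open>C n\<close> the natural test function is the sign of g. Its
  mollifications are bounded by 1 and supported in the next compact set, on which the local
  integrability of g provides the dominating function.\<close>

lemma fundamental_lemma:
  fixes g :: "real^'n \<Rightarrow> real"
  assumes g: "g \<in> borel_measurable M" "\<And>K. compact K \<Longrightarrow> K \<subseteq> \<Omega> \<Longrightarrow> integrable (lebesgue_on K) g"
    and z: "\<And>\<psi>. \<psi> \<in> test_functions \<Omega> \<Longrightarrow> (\<integral>x. g x * \<psi> x \<partial>M) = 0"
  shows "AE x in M. g x = 0"
proof -
  obtain C where C: "\<And>n::nat. compact (C n)" "\<And>n. C n \<subseteq> \<Omega>" "\<And>n. C n \<subseteq> interior (C (Suc n))" "\<Union>(range C) = \<Omega>"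
    using open_Union_compact_subsets[OF open_domain] by metis
  obtain g' where g': "g' \<in> borel_measurable borel" "\<And>x. x \<notin> \<Omega> \<Longrightarrow> g' x = 0" "AE x in M. g x = g' x"
    using borel_representative[OF g(1)] by metis
  note [measurable] = g'(1)
  have "AE x in M. x \<in> C n \<longrightarrow> g x = 0" for n
  proof -
    let ?K = "C n" and ?L = "C (Suc n)"
    have clo [measurable]: "?K \<in> sets borel" "?L \<in> sets borel" by (simp_all add: compact_imp_closed[OF C(1)])
    obtain r where r: "0 < r" "(\<Union>x\<in>?K. ball x r) \<subseteq> interior ?L"
      using compact_subset_open_imp_ball_epsilon_subset[OF C(1) open_interior C(3)] by metis
    define \<zeta> where "\<zeta> x = indicator ?K x * sgn (g' x)" for x
    have [measurable]: "\<zeta> \<in> borel_measurable borel" unfolding \<zeta>_def[abs_def] by measurable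
    have \<zeta>: "\<bar>\<zeta> x\<bar> \<le> indicator ?K x" "x \<notin> ?K \<Longrightarrow> \<zeta> x = 0" for x by (auto simp: \<zeta>_def sgn_if indicator_def)
    have iK: "integrable lborel (indicator ?K :: real^'n \<Rightarrow> real)"
      using emeasure_bounded_finite[OF compact_imp_bounded[OF C(1)]] by (intro integrable_real_indicator) auto
    have \<zeta>i: "integrable lborel \<zeta>" by (rule Bochner_Integration.integrable_bound[OF iK]) (use \<zeta>(1) in auto)
    have \<zeta>s: "sqi lborel \<zeta>"
      unfolding sqi_def
    proof
      have "(norm (\<zeta> x))\<^sup>2 \<le> indicator ?K x" for x
        using \<zeta>(1)[of x] power_le_one[of "\<bar>\<zeta> x\<bar>" 2] by (cases "x \<in> ?K") auto
      then show "integrable lborel (\<lambda>x. (norm (\<zeta> x))\<^sup>2)"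
        by (intro Bochner_Integration.integrable_bound[OF iK]) auto
    qed simp
    obtain \<eta> :: "nat \<Rightarrow> real^'n \<Rightarrow> real" where \<eta>: "\<And>j. \<eta> j \<in> CcInf" "\<And>j x. 0 \<le> \<eta> j x" "\<And>j x. r \<le> norm x \<Longrightarrow> \<eta> j x = 0"
      "\<And>j. (\<integral>x. \<eta> j x \<partial>lborel) = 1" "\<And>i::unit. l2conv lborel (\<lambda>j. convol (\<eta> j) \<zeta>) \<zeta>"
      by (rule mollifier_sequence[of "\<lambda>_. \<zeta>" r]) (use \<zeta>i \<zeta>s r(1) in auto)
    obtain q where q: "strict_mono (q :: nat \<Rightarrow> nat)" "AE x in lborel. (\<lambda>j. convol (\<eta> (q j)) \<zeta> x) \<longlonglongrightarrow> \<zeta> x"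
      using l2conv_AE_subseq[OF \<eta>(5)] by blast
    have off: "convol (\<eta> j) \<zeta> x = 0" if "x \<notin> ?L" for j x
    proof -
      have eq: "\<eta> j (x - y) * \<zeta> y = 0" for y
      proof (cases "y \<in> ?K")
        case True
        then have "r \<le> norm (x - y)" using that r(2) interior_subset[of ?L] by (force simp: dist_norm norm_minus_commute)
        then show ?thesis using \<eta>(3) by simp
      qed (simp add: \<zeta>)
      show ?thesis unfolding convol_def eq by simp
    qed
    have test: "convol (\<eta> j) \<zeta> \<in> test_functions \<Omega>" for j
      by (rule test_functionsI[OF convol_smooth(1)[OF \<eta>(1) \<zeta>i] C(1,2) off])
    have bound: "\<bar>convol (\<eta> j) \<zeta> x\<bar> \<le> indicator ?L x" for j x
    proof (cases "x \<in> ?L")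
      case True
      note E = C1cD[OF test_functions_C1c[OF \<eta>(1)[of j]]]
      have m: "\<eta> j \<in> borel_measurable borel" using E(3) by (rule borel_measurable_continuous_onI)
      obtain B where B: "\<And>x. \<bar>\<eta> j x\<bar> \<le> B" using E(11) by blast
      have i: "integrable lborel (\<lambda>y. \<eta> j (x - y))" using integral_lborel_reflect(2)[OF m] E(6) by blast
      have "\<bar>convol (\<eta> j) \<zeta> x\<bar> \<le> (\<integral>y. norm (\<eta> j (x - y) * \<zeta> y) \<partial>lborel)"
        unfolding convol_def using integral_norm_bound[of lborel "\<lambda>y. \<eta> j (x - y) * \<zeta> y"] by simp
      also have "\<dots> \<le> (\<integral>y. \<eta> j (x - y) \<partial>lborel)"
      proof (rule integral_mono[OF integrable_norm[OF convol_integrand[OF E(3) B \<zeta>i]] i])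
        have "\<bar>\<zeta> y\<bar> \<le> 1" for y using order_trans[OF \<zeta>(1)[of y] indicator_le_1] .
        then show "norm (\<eta> j (x - y) * \<zeta> y) \<le> \<eta> j (x - y)" for y
          using \<eta>(2)[of j "x - y"] by (simp add: abs_mult mult_left_le)
      qed
      finally show ?thesis using integral_lborel_reflect(1)[OF m, of x] \<eta>(4) True by simp
    qed (simp add: off)
    have gL: "integrable M (\<lambda>x. \<bar>g x\<bar> * indicator ?L x)"
    proof -
      have "integrable (lebesgue_on ?L) g" by (rule g(2)[OF C(1,2)])
      then have "integrable lebesgue (\<lambda>x. indicator ?L x *\<^sub>R g x)" using clo by (simp add: integrable_restrict_space)
      from integrable_mult_indicator[OF Omega_sets(2) integrable_abs[OF this]]
      have "integrable lebesgue (\<lambda>x. indicator \<Omega> x *\<^sub>R \<bar>indicator ?L x *\<^sub>R g x\<bar>)" .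
      then have "integrable M (\<lambda>x. \<bar>indicator ?L x *\<^sub>R g x\<bar>)" using Omega_sets(2) by (simp add: integrable_restrict_space)
      moreover have "(\<lambda>x. \<bar>indicator ?L x *\<^sub>R g x\<bar>) = (\<lambda>x. \<bar>g x\<bar> * indicator ?L x)" by (simp add: fun_eq_iff abs_mult mult.commute)
      ultimately show ?thesis by simp
    qed
    note [measurable] = g(1) borel_measurable_M[OF test_fn(3)[OF test]] borel_measurable_M[of \<zeta>]
    have aeM: "AE x in M. (\<lambda>j. convol (\<eta> (q j)) \<zeta> x) \<longlonglongrightarrow> \<zeta> x"
      using AE_completion[OF q(2)] Omega_sets(2) by (subst AE_restrict_space_iff) (auto elim: eventually_mono)
    have "(\<lambda>j. \<integral>x. g x * convol (\<eta> (q j)) \<zeta> x \<partial>M) \<longlonglongrightarrow> (\<integral>x. g x * \<zeta> x \<partial>M)"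
    proof (rule integral_dominated_convergence[OF _ _ gL])
      show "AE x in M. (\<lambda>j. g x * convol (\<eta> (q j)) \<zeta> x) \<longlonglongrightarrow> g x * \<zeta> x"
        using aeM by eventually_elim (rule tendsto_mult_left)
      show "AE x in M. norm (g x * convol (\<eta> (q j)) \<zeta> x) \<le> \<bar>g x\<bar> * indicator ?L x" for j
        using bound by (simp add: abs_mult mult_left_mono)
    qed measurable
    then have 0: "(\<integral>x. g x * \<zeta> x \<partial>M) = 0" using z[OF test] by (simp add: LIMSEQ_const_iff)
    have eq: "AE x in M. g x * \<zeta> x = \<bar>g x\<bar> * indicator ?K x"
      using g'(3) by eventually_elim (auto simp: \<zeta>_def sgn_if)
    have KL: "?K \<subseteq> ?L" using C(3)[of n] interior_subset by blast
    have "integrable M (\<lambda>x. g x * \<zeta> x)"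
    proof (rule Bochner_Integration.integrable_bound[OF gL])
      show "AE x in M. norm (g x * \<zeta> x) \<le> norm (\<bar>g x\<bar> * indicator ?L x)"
        using eq by eventually_elim (use KL in \<open>auto simp: indicator_def\<close>)
    qed measurable
    moreover have "AE x in M. 0 \<le> g x * \<zeta> x" using eq by eventually_elim simp
    ultimately have "AE x in M. g x * \<zeta> x = 0" using 0 by (simp add: integral_nonneg_eq_0_iff_AE)
    then show ?thesis using eq by eventually_elim auto
  qed
  then have "AE x in M. \<forall>n. x \<in> C n \<longrightarrow> g x = 0" unfolding AE_all_countable by blast
  then show ?thesis using AE_space
  proof eventually_elim
    case (elim x)
    then show ?case using C(4) by auto
  qed
qed

text \<open>Since the ball of radius r about x lies in \<Omega>, the function y -> \<eta>(x - y) is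
  a test function in \<Omega>, and the definition of the weak gradient moves the derivative from the
  kernel to f.\<close>

lemma convol_partial:
  assumes wg: "wgr f G" and f: "f \<in> borel_measurable borel" "\<And>x. x \<notin> \<Omega> \<Longrightarrow> f x = 0" "integrable lborel f"
    and G: "(\<lambda>x. G x $ i) \<in> borel_measurable borel" "\<And>x. x \<notin> \<Omega> \<Longrightarrow> G x = 0"
    and \<eta>: "\<eta> \<in> CcInf" "\<And>x. r \<le> norm x \<Longrightarrow> \<eta> x = 0" and x: "cball x r \<subseteq> \<Omega>"
  shows "partial i (convol \<eta> f) x = convol \<eta> (\<lambda>x. G x $ i) x"
proof -
  define \<psi> where "\<psi> y = \<eta> (x + (-1) *\<^sub>R y)" for y
  have \<eta>s: "smooth \<eta>" by (rule test_functions_smooth[OF \<eta>(1)])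
  have \<psi>: "\<psi> \<in> test_functions \<Omega>"
    unfolding \<psi>_def[abs_def]
  proof (rule test_functionsI[OF smooth_affine[OF \<eta>s] compact_cball x])
    show "\<eta> (x + (-1) *\<^sub>R y) = 0" if "y \<notin> cball x r" for y
      by (rule \<eta>(2)) (use that in \<open>simp add: dist_norm\<close>)
  qed
  have p\<psi>: "partial i \<psi> y = - partial i \<eta> (x - y)" for y
    unfolding \<psi>_def[abs_def] using partial_affine(1)[of \<eta> i x "-1" y] smoothD(1)[OF \<eta>s] by simp
  note [measurable] = test_fn(3)[OF \<psi>] f(1) G(1)
  have [measurable]: "partial i \<psi> \<in> borel_measurable borel"
    using C1cD(4)[OF test_functions_C1c[OF \<psi>]] by (rule borel_measurable_continuous_onI)
  have "partial i (convol \<eta> f) x = (\<integral>y. partial i \<eta> (x - y) * f y \<partial>lborel)"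
    unfolding convol_smooth(2)[OF \<eta>(1) f(3)] convol_def ..
  also have "\<dots> = - (\<integral>y. f y * partial i \<psi> y \<partial>lborel)" by (simp add: p\<psi> mult.commute)
  also have "(\<integral>y. f y * partial i \<psi> y \<partial>lborel) = (\<integral>y. f y * partial i \<psi> y \<partial>M)"
    by (rule integral_M_lborel(1)[symmetric]) (use f in auto)
  also have "\<dots> = - (\<integral>y. G y $ i * \<psi> y \<partial>M)" by (rule wgrD(3)[OF wg \<psi>])
  also have "(\<integral>y. G y $ i * \<psi> y \<partial>M) = (\<integral>y. G y $ i * \<psi> y \<partial>lborel)"
    by (rule integral_M_lborel(1)) (use G in auto)
  also have "\<dots> = convol \<eta> (\<lambda>x. G x $ i) x" by (simp add: convol_def \<psi>_def mult.commute)
  finally show ?thesis by simp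
qed

lemma wgr_representative:
  assumes "wgr f G"
  obtains f' G' where "wgr f' G'" "f' \<in> borel_measurable borel" "\<And>i. (\<lambda>x. G' x $ i) \<in> borel_measurable borel"
    "\<And>x. x \<notin> \<Omega> \<Longrightarrow> f' x = 0" "\<And>x. x \<notin> \<Omega> \<Longrightarrow> G' x = 0"
    "AE x in M. f x = f' x" "AE x in M. G x = G' x" "sqi lborel f'" "integrable lborel f'"
    "\<And>i. sqi lborel (\<lambda>x. G' x $ i)" "\<And>i. integrable lborel (\<lambda>x. G' x $ i)"
proof -
  note W = wgrD[OF assms]
  obtain f' where f': "f' \<in> borel_measurable borel" "\<And>x. x \<notin> \<Omega> \<Longrightarrow> f' x = 0" "AE x in M. f x = f' x"
    using borel_representative[OF sqi_measurable[OF W(1)]] by blast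
  obtain G' where G': "\<And>i. (\<lambda>x. G' x $ i) \<in> borel_measurable borel" "\<And>x. x \<notin> \<Omega> \<Longrightarrow> G' x = 0" "AE x in M. G x = G' x"
    using borel_representative_vec[OF sqi_measurable[OF W(2)]] by blast
  have fm: "f' \<in> borel_measurable M" using f'(1) by (rule borel_measurable_M)
  have Gm: "G' \<in> borel_measurable M" by (rule borel_measurable_vecI[OF borel_measurable_M[OF G'(1)]])
  have w: "wgr f' G'" by (rule wgr_cong_AE[OF assms fm Gm f'(3) G'(3)])
  have G0: "G' x $ i = 0" if "x \<notin> \<Omega>" for x i using G'(2)[OF that] by simp
  have s: "sqi M f'" "sqi M (\<lambda>x. G' x $ i)" for i using wgrD[OF w] sqi_component by auto
  show thesis
  proof (rule that[OF w f'(1) G'(1) f'(2) G'(2) f'(3) G'(3)])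
    show "sqi lborel f'" using sqi_M_lborel(1)[OF f'(1,2)] s by simp
    show "integrable lborel f'" using integral_M_lborel(2)[OF f'(1,2)] sqi_integrable(1)[OF s(1)] by simp
    show "sqi lborel (\<lambda>x. G' x $ i)" for i using sqi_M_lborel(1)[OF G'(1) G0] s by simp
    show "integrable lborel (\<lambda>x. G' x $ i)" for i
      using integral_M_lborel(2)[OF G'(1) G0] sqi_integrable(1)[OF s(2)] by simp
  qed
qed

text \<open>The extension of f by 0 may jump across the boundary, so the gradients of its
  mollifications converge only at a positive distance from it, here on K, while the functions
  themselves converge on all of \<Omega>.\<close>

lemma smooth_local_approximation:
  assumes wg: "wgr f G" and K: "compact K" "K \<subseteq> \<Omega>"
  obtains v where "\<And>j. smooth (v j)" "l2conv M v f"
    "l2conv M (\<lambda>j x. indicator K x *\<^sub>R grad (v j) x) (\<lambda>x. indicator K x *\<^sub>R G x)"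
proof -
  obtain f' G' where R: "wgr f' G'" "f' \<in> borel_measurable borel" "\<And>i. (\<lambda>x. G' x $ i) \<in> borel_measurable borel"
    "\<And>x. x \<notin> \<Omega> \<Longrightarrow> f' x = 0" "\<And>x. x \<notin> \<Omega> \<Longrightarrow> G' x = 0"
    "AE x in M. f x = f' x" "AE x in M. G x = G' x" "sqi lborel f'" "integrable lborel f'"
    "\<And>i. sqi lborel (\<lambda>x. G' x $ i)" "\<And>i. integrable lborel (\<lambda>x. G' x $ i)"
    by (rule wgr_representative[OF wg]) blast
  obtain r where r: "0 < r" "(\<Union>x\<in>K. ball x r) \<subseteq> \<Omega>"
    using compact_subset_open_imp_ball_epsilon_subset[OF K(1) open_domain K(2)] by metis
  \<comment> \<open>\<open>None\<close> stands for the function and \<open>Some i\<close> for the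
    components of the gradient, so that \<open>mollifier_sequence\<close> treats all of them with
    the same kernels.\<close>
  define F where "F i = (case i of None \<Rightarrow> f' | Some i \<Rightarrow> (\<lambda>x. G' x $ i))" for i
  have F: "sqi lborel (F i)" "integrable lborel (F i)" for i using R by (auto simp: F_def split: option.splits)
  obtain \<eta> :: "nat \<Rightarrow> real^'n \<Rightarrow> real" where \<eta>: "\<And>j. \<eta> j \<in> CcInf" "\<And>j x. r/2 \<le> norm x \<Longrightarrow> \<eta> j x = 0"
    "\<And>i. l2conv lborel (\<lambda>j. convol (\<eta> j) (F i)) (F i)"
    by (rule mollifier_sequence[of F "r/2"]) (use F r(1) in auto)
  define v where "v j = convol (\<eta> j) f'" for j
  have vs: "smooth (v j)" for j unfolding v_def by (rule convol_smooth(1)[OF \<eta>(1) R(9)])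
  have Km: "(indicator K :: real^'n \<Rightarrow> real) \<in> borel_measurable M"
    by (rule borel_measurable_M) (use K(1) in \<open>simp add: compact_imp_closed\<close>)
  show thesis
  proof
    show "smooth (v j)" for j by (rule vs)
    have "l2conv M v f'"
      using l2conv_M_of_lborel[OF \<eta>(3)[of None]] by (simp add: F_def v_def[abs_def])
    then show "l2conv M v f"
      by (rule l2conv_cong_limit) (use sqi_measurable[OF wgrD(1)[OF wg]] R(6) in \<open>auto elim: eventually_mono\<close>)
    show "l2conv M (\<lambda>j x. indicator K x *\<^sub>R grad (v j) x) (\<lambda>x. indicator K x *\<^sub>R G x)"
    proof (rule l2conv_components)
      fix i
      have 1: "l2conv M (\<lambda>j. convol (\<eta> j) (\<lambda>x. G' x $ i)) (\<lambda>x. G' x $ i)"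
        using l2conv_M_of_lborel[OF \<eta>(3)[of "Some i"]] by (simp add: F_def)
      have 2: "l2conv M (\<lambda>j x. indicator K x *\<^sub>R convol (\<eta> j) (\<lambda>x. G' x $ i) x) (\<lambda>x. indicator K x *\<^sub>R G' x $ i)"
        by (rule l2conv_mult_bounded[OF 1 Km Km, of 1]) (simp_all add: indicator_def)
      have eq: "indicator K x *\<^sub>R convol (\<eta> j) (\<lambda>x. G' x $ i) x = (indicator K x *\<^sub>R grad (v j) x) $ i" for j x
      proof (cases "x \<in> K")
        case True
        then have "cball x (r/2) \<subseteq> \<Omega>" using r by (fastforce simp: dist_norm)
        from convol_partial[OF R(1,2,4,9,3,5) \<eta>(1,2) this, of i j]
        show ?thesis using True by (simp add: v_def grad_def)
      qed simp
      show "l2conv M (\<lambda>n x. (indicator K x *\<^sub>R grad (v n) x) $ i) (\<lambda>x. (indicator K x *\<^sub>R G x) $ i)"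
      proof (rule l2conv_cong_limit)
        show "l2conv M (\<lambda>n x. (indicator K x *\<^sub>R grad (v n) x) $ i) (\<lambda>x. indicator K x *\<^sub>R G' x $ i)"
          using 2 by (simp only: eq)
        show "AE x in M. indicator K x *\<^sub>R G' x $ i = (indicator K x *\<^sub>R G x) $ i"
          using R(7) by eventually_elim simp
        show "(\<lambda>x. (indicator K x *\<^sub>R G x) $ i) \<in> borel_measurable M"
          using sqi_measurable[OF wgrD(2)[OF wg]] Km by (intro borel_measurable_vec_nth borel_measurable_scaleR)
      qed
    qed
  qed
qed

text \<open>The closure of the graph of the gradient on test functions. The gradient is carried
  along with the function, and zero boundary values are expressed without a trace.\<close>

definition H10 :: "(real^'n \<Rightarrow> real) \<Rightarrow> (real^'n \<Rightarrow> real^'n) \<Rightarrow> bool" where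
  "H10 f G \<longleftrightarrow> (\<exists>\<psi>. (\<forall>n. \<psi> n \<in> test_functions \<Omega>) \<and> l2conv M \<psi> f \<and> l2conv M (\<lambda>n. grad (\<psi> n)) G)"

lemma H10_I:
  assumes "\<And>n. \<psi> n \<in> test_functions \<Omega>" "l2conv M \<psi> f" "l2conv M (\<lambda>n. grad (\<psi> n)) G"
  shows "H10 f G"
  using assms by (auto simp: H10_def)

lemma H10_E:
  assumes "H10 f G"
  obtains \<psi> where "\<And>n. \<psi> n \<in> test_functions \<Omega>" "l2conv M \<psi> f" "l2conv M (\<lambda>n. grad (\<psi> n)) G"
  using assms by (auto simp: H10_def)

lemma H10_sqi: "H10 f G \<Longrightarrow> sqi M f" "H10 f G \<Longrightarrow> sqi M G"
  by (auto simp: H10_def l2conv_def)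

lemma test_wgr:
  assumes \<psi>: "\<psi> \<in> test_functions \<Omega>" shows "wgr \<psi> (grad \<psi>)"
proof -
  note T = test_fn[OF \<psi>]
  have "(\<integral>x. \<psi> x * partial i \<zeta> x \<partial>M) = - (\<integral>x. grad \<psi> x $ i * \<zeta> x \<partial>M)" if \<zeta>: "\<zeta> \<in> test_functions \<Omega>" for \<zeta> i
  proof -
    note Z = test_fn[OF \<zeta>]
    have p: "(\<lambda>x. \<psi> x * \<zeta> x) \<in> test_functions \<Omega>"
      by (rule test_functions_mult_smooth[OF \<zeta> test_functions_smooth[OF \<psi>]])
    have d: "partial i (\<lambda>x. \<psi> x * \<zeta> x) x = \<psi> x * partial i \<zeta> x + partial i \<psi> x * \<zeta> x" for x
      by (rule partial_mult) (use \<psi> \<zeta> test_functions_smooth smoothD(1) in auto)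
    have "0 = (\<integral>x. partial i (\<lambda>x. \<psi> x * \<zeta> x) x \<partial>lborel)"
      using integral_partial_zero[OF test_functions_C1c[OF p]] by simp
    also have "\<dots> = (\<integral>x. partial i (\<lambda>x. \<psi> x * \<zeta> x) x \<partial>M)"
      by (rule integral_M_lborel(1)[symmetric])
        (use test_fn(3,6)[OF test_functions_partial[OF p]] in auto)
    also have "\<dots> = (\<integral>x. \<psi> x * partial i \<zeta> x \<partial>M) + (\<integral>x. partial i \<psi> x * \<zeta> x \<partial>M)"
      unfolding d using T(1,10) Z(1,10) by (simp add: sqi_prod_integrable)
    finally show ?thesis by (simp add: grad_def)
  qed
  then show ?thesis using T by (simp add: wgr_def)
qed

lemma H10_wgr: "H10 f G \<Longrightarrow> wgr f G"
  by (erule H10_E, rule wgr_limit[OF test_wgr]) auto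

lemma H10_test: "\<psi> \<in> test_functions \<Omega> \<Longrightarrow> H10 \<psi> (grad \<psi>)"
  by (rule H10_I[of "\<lambda>_. \<psi>"]) (auto simp: test_fn l2conv_const)

lemma grad_add_test:
  assumes "\<psi> \<in> test_functions \<Omega>" "\<zeta> \<in> test_functions \<Omega>"
  shows "grad (\<lambda>x. \<psi> x + \<zeta> x) = (\<lambda>x. grad \<psi> x + grad \<zeta> x)"
proof -
  have "partial i (\<lambda>x. \<psi> x + \<zeta> x) x = partial i \<psi> x + partial i \<zeta> x" for i x
    by (rule partial_add) (use assms test_functions_smooth smoothD(1) in auto)
  then show ?thesis by (simp add: fun_eq_iff grad_def vec_eq_iff)
qed

lemma grad_scale_test:
  assumes "\<psi> \<in> test_functions \<Omega>"
  shows "grad (\<lambda>x. c * \<psi> x) = (\<lambda>x. c *\<^sub>R grad \<psi> x)"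
proof
  fix x
  have "((\<lambda>x. c * \<psi> x) has_derivative (\<lambda>h. c * (grad \<psi> x \<bullet> h))) (at x)"
    by (intro has_derivative_mult_right has_derivative_grad smoothD(1) test_functions_smooth[OF assms])
  then have "((\<lambda>x. c * \<psi> x) has_derivative (\<lambda>h. (c *\<^sub>R grad \<psi> x) \<bullet> h)) (at x)" by simp
  then show "grad (\<lambda>x. c * \<psi> x) x = c *\<^sub>R grad \<psi> x" by (rule grad_eqI)
qed

lemma H10_add:
  assumes "H10 f G" "H10 g H" shows "H10 (\<lambda>x. f x + g x) (\<lambda>x. G x + H x)"
proof -
  obtain \<psi> where p: "\<And>n. \<psi> n \<in> test_functions \<Omega>" "l2conv M \<psi> f" "l2conv M (\<lambda>n. grad (\<psi> n)) G"
    using H10_E[OF assms(1)] by blast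
  obtain \<zeta> where z: "\<And>n. \<zeta> n \<in> test_functions \<Omega>" "l2conv M \<zeta> g" "l2conv M (\<lambda>n. grad (\<zeta> n)) H"
    using H10_E[OF assms(2)] by blast
  show ?thesis
    by (rule H10_I[of "\<lambda>n x. \<psi> n x + \<zeta> n x"])
      (use p z in \<open>simp_all add: test_functions_add grad_add_test l2conv_add\<close>)
qed

lemma H10_scale:
  assumes "H10 f G" shows "H10 (\<lambda>x. c * f x) (\<lambda>x. c *\<^sub>R G x)"
proof -
  obtain \<psi> where p: "\<And>n. \<psi> n \<in> test_functions \<Omega>" "l2conv M \<psi> f" "l2conv M (\<lambda>n. grad (\<psi> n)) G"
    using H10_E[OF assms(1)] by blast
  show ?thesis
    by (rule H10_I[of "\<lambda>n x. c * \<psi> n x"])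
      (use p l2conv_scaleR[OF p(2), of c] l2conv_scaleR[OF p(3), of c] in \<open>simp_all add: test_functions_scale grad_scale_test\<close>)
qed

lemma H10_diff:
  assumes "H10 f G" "H10 g H" shows "H10 (\<lambda>x. f x - g x) (\<lambda>x. G x - H x)"
  using H10_add[OF assms(1) H10_scale[OF assms(2), of "-1"]] by simp

lemma H10_cong_AE:
  assumes "H10 f G" "g \<in> borel_measurable M" "H \<in> borel_measurable M" "AE x in M. f x = g x" "AE x in M. G x = H x"
  shows "H10 g H"
proof -
  obtain \<psi> where p: "\<And>n. \<psi> n \<in> test_functions \<Omega>" "l2conv M \<psi> f" "l2conv M (\<lambda>n. grad (\<psi> n)) G"
    using H10_E[OF assms(1)] by blast
  show ?thesis
    by (rule H10_I[OF p(1) l2conv_cong_limit[OF p(2) assms(2,4)] l2conv_cong_limit[OF p(3) assms(3,5)]])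
qed

text \<open>A diagonal sequence: the n-th test function is within 1 / (n + 1) of the n-th
  pair.\<close>

lemma H10_closed:
  assumes "\<And>n. H10 (f n) (G n)" "l2conv M f g" "l2conv M G H"
  shows "H10 g H"
proof -
  have "\<forall>n. \<exists>\<psi>. \<psi> \<in> test_functions \<Omega> \<and> l2n M (\<lambda>x. \<psi> x - f n x) < 1 / real (Suc n) \<and> l2n M (\<lambda>x. grad \<psi> x - G n x) < 1 / real (Suc n)"
    (is "\<forall>n. ?P n")
  proof
    fix n
    obtain \<psi> where p: "\<And>n. \<psi> n \<in> test_functions \<Omega>" "l2conv M \<psi> (f n)" "l2conv M (\<lambda>n. grad (\<psi> n)) (G n)"
      using H10_E[OF assms(1)] by blast
    have "\<forall>\<^sub>F k in sequentially. l2n M (\<lambda>x. \<psi> k x - f n x) < 1 / real (Suc n)"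
      "\<forall>\<^sub>F k in sequentially. l2n M (\<lambda>x. grad (\<psi> k) x - G n x) < 1 / real (Suc n)"
      by (rule order_tendstoD(2)[OF l2convD(3)[OF p(2)]], simp, rule order_tendstoD(2)[OF l2convD(3)[OF p(3)]], simp)
    then have "\<forall>\<^sub>F k in sequentially. l2n M (\<lambda>x. \<psi> k x - f n x) < 1 / real (Suc n) \<and> l2n M (\<lambda>x. grad (\<psi> k) x - G n x) < 1 / real (Suc n)"
      by (rule eventually_conj)
    then obtain k where "l2n M (\<lambda>x. \<psi> k x - f n x) < 1 / real (Suc n)" "l2n M (\<lambda>x. grad (\<psi> k) x - G n x) < 1 / real (Suc n)"
      by (auto simp: eventually_sequentially)
    then show "?P n" using p(1) by blast
  qed
  from choice[OF this] obtain \<psi> where p: "\<And>n. \<psi> n \<in> test_functions \<Omega>"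
    "\<And>n. l2n M (\<lambda>x. \<psi> n x - f n x) < 1 / real (Suc n)" "\<And>n. l2n M (\<lambda>x. grad (\<psi> n) x - G n x) < 1 / real (Suc n)"
    by blast
  have gen: "l2conv M P q" if P: "\<And>n. sqi M (P n)" and F: "l2conv M F q" and le: "\<And>n. l2n M (\<lambda>x. P n x - F n x) < 1 / real (Suc n)"
    for P F :: "nat \<Rightarrow> real^'n \<Rightarrow> 'z::euclidean_space" and q
  proof -
    note * = l2convD[OF F]
    have "(\<lambda>n. l2n M (\<lambda>x. P n x - q x)) \<longlonglongrightarrow> 0"
    proof (rule Lim_null_comparison)
      show "\<forall>\<^sub>F n in sequentially. norm (l2n M (\<lambda>x. P n x - q x)) \<le> 1 / real (Suc n) + l2n M (\<lambda>x. F n x - q x)"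
      proof (intro always_eventually allI)
        fix n
        show "norm (l2n M (\<lambda>x. P n x - q x)) \<le> 1 / real (Suc n) + l2n M (\<lambda>x. F n x - q x)"
          using l2n_triangle3[OF P *(1,2), of n n] le[of n] by simp
      qed
      show "(\<lambda>n. 1 / real (Suc n) + l2n M (\<lambda>x. F n x - q x)) \<longlonglongrightarrow> 0"
        using tendsto_add[OF LIMSEQ_Suc[OF lim_1_over_n] *(3)] by simp
    qed
    then show ?thesis using P *(2) by (simp add: l2conv_def)
  qed
  show ?thesis
    by (rule H10_I[OF p(1) gen[OF _ assms(2) p(2)] gen[OF _ assms(3) p(3)]]) (auto simp: test_fn p(1))
qed

text \<open>The products \<open>v j * \<psi>\<close> see the approximants only on a compact set
  containing the support of \<psi>, where their gradients converge. The resulting product rule later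
  passes between the two forms of the transport term.\<close>

lemma wgr_mult_test:
  assumes wg: "wgr f G" and \<psi>: "\<psi> \<in> test_functions \<Omega>"
  shows "H10 (\<lambda>x. f x * \<psi> x) (\<lambda>x. \<psi> x *\<^sub>R G x + f x *\<^sub>R grad \<psi> x)"
proof -
  note T = test_fn[OF \<psi>]
  obtain B where B: "\<And>x. \<bar>\<psi> x\<bar> \<le> B" "\<And>x. norm (grad \<psi> x) \<le> B" using T(5) by blast
  have pB: "\<bar>partial i \<psi> x\<bar> \<le> B" for i x
    using component_le_norm_cart[of "grad \<psi> x" i] B(2)[of x] by (simp add: grad_def)
  obtain K where K: "compact K" "K \<subseteq> \<Omega>" "\<And>x. x \<notin> K \<Longrightarrow> \<psi> x = 0" using test_functionsE[OF \<psi>] by metis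
  obtain v where v: "\<And>j::nat. smooth (v j)" "l2conv M v f"
    "l2conv M (\<lambda>j x. indicator K x *\<^sub>R grad (v j) x) (\<lambda>x. indicator K x *\<^sub>R G x)"
    using smooth_local_approximation[OF wg K(1,2)] by blast
  note mult = l2conv_mult_bounded[where K=B, OF _ sqi_measurable[OF T(1)] sqi_measurable[OF T(1)]]
  show ?thesis
  proof (rule H10_I)
    show "(\<lambda>x. v j x * \<psi> x) \<in> test_functions \<Omega>" for j by (rule test_functions_mult_smooth[OF \<psi> v(1)])
    show "l2conv M (\<lambda>j x. v j x * \<psi> x) (\<lambda>x. f x * \<psi> x)"
      using mult[OF v(2)] B by (simp add: mult.commute)
    have g: "grad (\<lambda>x. v j x * \<psi> x) x = \<psi> x *\<^sub>R (indicator K x *\<^sub>R grad (v j) x) + v j x *\<^sub>R grad \<psi> x" for j x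
    proof -
      have "grad (\<lambda>x. v j x * \<psi> x) x = \<psi> x *\<^sub>R grad (v j) x + v j x *\<^sub>R grad \<psi> x"
        by (simp add: vec_eq_iff grad_def partial_mult smoothD(1)[OF v(1)] smoothD(1)[OF test_functions_smooth[OF \<psi>]] mult.commute)
      then show ?thesis using K(3)[of x] by (cases "x \<in> K") auto
    qed
    have 1: "l2conv M (\<lambda>j x. \<psi> x *\<^sub>R (indicator K x *\<^sub>R grad (v j) x)) (\<lambda>x. \<psi> x *\<^sub>R (indicator K x *\<^sub>R G x))"
      using mult[OF v(3)] B by simp
    have eq: "\<psi> x *\<^sub>R (indicator K x *\<^sub>R G x) = \<psi> x *\<^sub>R G x" for x using K(3)[of x] by (cases "x \<in> K") auto
    have 2: "l2conv M (\<lambda>j x. v j x *\<^sub>R grad \<psi> x) (\<lambda>x. f x *\<^sub>R grad \<psi> x)"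
    proof (rule l2conv_components)
      fix i
      show "l2conv M (\<lambda>j x. (v j x *\<^sub>R grad \<psi> x) $ i) (\<lambda>x. (f x *\<^sub>R grad \<psi> x) $ i)"
        using l2conv_mult_bounded[where K=B, OF v(2) sqi_measurable[OF T(10)[of i]] sqi_measurable[OF T(10)[of i]]] pB
        by (simp add: grad_def mult.commute)
    qed
    show "l2conv M (\<lambda>j. grad (\<lambda>x. v j x * \<psi> x)) (\<lambda>x. \<psi> x *\<^sub>R G x + f x *\<^sub>R grad \<psi> x)"
      using l2conv_add[OF 1 2] unfolding g[abs_def] eq .
  qed
qed

text \<open>The indicator of the r/2-neighbourhood of K is mollified at scale r/4: the result is 1
  within distance r/4 of K and vanishes beyond 3r/4, which is still inside \<Omega>.\<close>

lemma cutoff_test_function: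
  assumes K: "compact K" "K \<subseteq> \<Omega>"
  obtains c where "c \<in> test_functions \<Omega>" "\<And>x. x \<in> K \<Longrightarrow> c x = 1" "\<And>x. x \<in> K \<Longrightarrow> grad c x = 0"
proof -
  obtain r where r: "0 < r" "(\<Union>x\<in>K. ball x r) \<subseteq> \<Omega>"
    using compact_subset_open_imp_ball_epsilon_subset[OF K(1) open_domain K(2)] by metis
  define L where "L s = {x + y | x y. x \<in> K \<and> y \<in> cball 0 s}" for s :: real
  have cL: "compact (L s)" for s unfolding L_def by (rule compact_sums[OF K(1) compact_cball])
  have Li: "x \<in> L s" if "y \<in> K" "norm (x - y) \<le> s" for x y s
    unfolding L_def using that by (intro CollectI exI[of _ y] exI[of _ "x - y"]) simp
  have Le: "\<exists>y\<in>K. norm (x - y) \<le> s" if "x \<in> L s" for x s using that by (force simp: L_def)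
  obtain \<eta> :: "real^'n \<Rightarrow> real" where \<eta>: "\<eta> \<in> CcInf" "\<And>x. 0 \<le> \<eta> x" "\<And>x. r/4 \<le> norm x \<Longrightarrow> \<eta> x = 0" "(\<integral>x. \<eta> x \<partial>lborel) = 1"
    using mollifier_exists[of "r/4"] r(1) by auto
  have \<eta>m: "\<eta> \<in> borel_measurable borel" using C1cD(3)[OF test_functions_C1c[OF \<eta>(1)]] by (rule borel_measurable_continuous_onI)
  define c where "c = convol \<eta> (indicator (L (r/2)))"
  have iL: "integrable lborel (indicator (L (r/2)) :: real^'n \<Rightarrow> real)"
    using emeasure_bounded_finite[OF compact_imp_bounded[OF cL]] cL by (intro integrable_real_indicator) (auto simp: compact_imp_closed)
  have one: "c x = 1" if y: "y \<in> K" "norm (x - y) < r/4" for x y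
  proof -
    have eq: "\<eta> (x - u) * indicator (L (r/2)) u = \<eta> (x - u)" for u
    proof (cases "norm (x - u) < r/4")
      case True
      have "norm (u - y) \<le> norm (x - y) + norm (x - u)" using norm_triangle_ineq4[of "x - y" "x - u"] by simp
      then have "u \<in> L (r/2)" using Li[OF y(1), of u "r/2"] True y(2) by simp
      then show ?thesis by simp
    qed (simp add: \<eta>(3))
    show ?thesis unfolding c_def convol_def eq using integral_lborel_reflect(1)[OF \<eta>m, of x] \<eta>(4) by simp
  qed
  show thesis
  proof
    show "c \<in> test_functions \<Omega>"
      unfolding c_def
    proof (rule test_functionsI[OF convol_smooth(1)[OF \<eta>(1) iL] cL[of "3/4 * r"]])
      show "L (3/4 * r) \<subseteq> \<Omega>" using Le r by (fastforce simp: dist_norm norm_minus_commute)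
      show "convol \<eta> (indicator (L (r/2))) x = 0" if x: "x \<notin> L (3/4 * r)" for x
      proof -
        have eq: "\<eta> (x - u) * indicator (L (r/2)) u = 0" for u
        proof (cases "u \<in> L (r/2)")
          case True
          then obtain y where y: "y \<in> K" "norm (u - y) \<le> r/2" using Le by blast
          have "norm (x - y) \<le> norm (x - u) + norm (u - y)" using norm_triangle_ineq[of "x - u" "u - y"] by simp
          moreover have "3/4 * r < norm (x - y)" using x Li[OF y(1), of x "3/4 * r"] by force
          ultimately have "r/4 \<le> norm (x - u)" using y(2) by linarith
          then show ?thesis using \<eta>(3) by simp
        qed simp
        show ?thesis unfolding convol_def eq by simp
      qed
    qed
    fix x assume x: "x \<in> K"
    show "c x = 1" by (rule one[OF x]) (use r in simp)
    have "(c has_derivative (\<lambda>h. 0 \<bullet> h)) (at x)"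
      by (rule has_derivative_transform_within_open[of "\<lambda>_. 1" _ _ _ "ball x (r/4)"])
        (use one[OF x] r in \<open>auto simp: dist_norm norm_minus_commute\<close>)
    then show "grad c x = 0" by (rule grad_eqI(1))
  qed
qed

text \<open>Multiplication by a cut-off function that is 1 on K reproduces f, so
  \<open>wgr_mult_test\<close> applies.\<close>

lemma H10_compact_support:
  assumes wg: "wgr f G" and K: "compact K" "K \<subseteq> \<Omega>"
    and z: "\<And>x. x \<in> \<Omega> - K \<Longrightarrow> f x = 0" "\<And>x. x \<in> \<Omega> - K \<Longrightarrow> G x = 0"
  shows "H10 f G"
proof -
  obtain c where c: "c \<in> test_functions \<Omega>" "\<And>x. x \<in> K \<Longrightarrow> c x = 1" "\<And>x. x \<in> K \<Longrightarrow> grad c x = 0"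
    using cutoff_test_function[OF K] by blast
  show ?thesis
  proof (rule H10_cong_AE[OF wgr_mult_test[OF wg c(1)]])
    show "AE x in M. f x * c x = f x" using AE_space by eventually_elim (use z(1) c(2) in force)
    show "AE x in M. c x *\<^sub>R G x + f x *\<^sub>R grad c x = G x"
      using AE_space
    proof eventually_elim
      case (elim x)
      then show ?case using z[of x] c(2,3)[of x] by (cases "x \<in> K") auto
    qed
  qed (use wgrD(1,2)[OF wg] sqi_measurable in auto)
qed

end

text \<open>The outer functions of the chain rule: the bound on the derivative makes P Lipschitz,
  hence compatible with L2 convergence, and continuity lets P' pass to limits almost
  everywhere.\<close>

definition C1b :: "(real \<Rightarrow> real) \<Rightarrow> (real \<Rightarrow> real) \<Rightarrow> bool" where
  "C1b P P' \<longleftrightarrow> (\<forall>t. (P has_real_derivative P' t) (at t)) \<and> continuous_on UNIV P' \<and> (\<exists>L. \<forall>t. \<bar>P' t\<bar> \<le> L)"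

lemma C1bD:
  assumes "C1b P P'"
  shows "(P has_real_derivative P' t) (at t)" "continuous_on UNIV P" "continuous_on UNIV P'"
    "P \<in> borel_measurable borel" "P' \<in> borel_measurable borel"
    "\<exists>L\<ge>0. (\<forall>t. \<bar>P' t\<bar> \<le> L) \<and> (\<forall>s t. \<bar>P s - P t\<bar> \<le> L * \<bar>s - t\<bar>)"
proof -
  have d: "(P has_real_derivative P' t) (at t)" for t using assms by (simp add: C1b_def)
  then show "(P has_real_derivative P' t) (at t)" .
  show c: "continuous_on UNIV P" using DERIV_isCont[OF d] by (simp add: continuous_on_eq_continuous_at)
  show c': "continuous_on UNIV P'" using assms by (simp add: C1b_def)
  show "P \<in> borel_measurable borel" "P' \<in> borel_measurable borel"
    using c c' by (auto intro: borel_measurable_continuous_onI)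
  obtain L where L: "\<And>t. \<bar>P' t\<bar> \<le> L" using assms by (auto simp: C1b_def)
  have "\<bar>P s - P t\<bar> \<le> L * \<bar>s - t\<bar>" for s t
  proof -
    have "norm (P s - P t) \<le> L * norm (s - t)"
      by (rule field_differentiable_bound[of UNIV P P']) (use d L in \<open>auto simp: has_field_derivative_at_within\<close>)
    then show ?thesis by simp
  qed
  moreover have "0 \<le> L" using order_trans[OF abs_ge_zero L[of 0]] .
  ultimately show "\<exists>L\<ge>0. (\<forall>t. \<bar>P' t\<bar> \<le> L) \<and> (\<forall>s t. \<bar>P s - P t\<bar> \<le> L * \<bar>s - t\<bar>)" using L by blast
qed

lemma C_1_compose:
  assumes g: "C_k 1 g" and P: "C1b P P'"
  shows "C_k 1 (\<lambda>x. P (g x))" "partial i (\<lambda>x. P (g x)) x = P' (g x) * partial i g x"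
proof -
  note G = C_1_D[OF g]
  note PD = C1bD[OF P]
  have d: "((\<lambda>x. P (g x)) has_derivative (\<lambda>h. (grad g x \<bullet> h) * P' (g x))) (at x)" for x
    by (rule DERIV_compose_FDERIV[OF PD(1) has_derivative_grad[OF G(1)]])
  have p: "partial i (\<lambda>x. P (g x)) x = P' (g x) * partial i g x" for i x
    by (subst partial_eqI[OF d]) (simp add: grad_def inner_axis)
  then show "partial i (\<lambda>x. P (g x)) x = P' (g x) * partial i g x" .
  have "continuous_on UNIV (\<lambda>x. P' (g x) * partial i g x)" for i
    by (intro continuous_on_mult G(3) continuous_on_compose2[OF PD(3) G(2)]) auto
  then show "C_k 1 (\<lambda>x. P (g x))"
    using d by (auto simp: p[abs_def] differentiable_def)
qed

lemma l2conv_compose_lipschitz: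
  assumes F: "l2conv M F f" and P: "C1b P P'" and fin: "finite_measure M"
  shows "l2conv M (\<lambda>n x. P (F n x)) (\<lambda>x. P (f x))"
proof -
  note * = l2convD[OF F]
  obtain L where L: "0 \<le> L" "\<And>s t. \<bar>P s - P t\<bar> \<le> L * \<bar>s - t\<bar>" using C1bD(6)[OF P] by blast
  note [measurable] = C1bD(4)[OF P]
  interpret finite_measure M by (rule fin)
  have s: "sqi M (\<lambda>x. P (g x))" if g: "sqi M g" for g
  proof -
    note [measurable] = sqi_measurable[OF g]
    have "sqi M (\<lambda>x. P (g x) - P 0)"
      by (rule sqi_bound[OF g, of _ L]) (use L(2)[of _ 0] in auto)
    from sqi_add[OF this sqi_const[of "P 0"]] show ?thesis by simp
  qed
  have "(\<lambda>n. l2n M (\<lambda>x. P (F n x) - P (f x))) \<longlonglongrightarrow> 0"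
  proof (rule Lim_null_comparison[OF _ tendsto_mult_right_zero[OF *(3), of L]])
    have "l2n M (\<lambda>x. P (F n x) - P (f x)) \<le> L * l2n M (\<lambda>x. F n x - f x)" for n
      by (rule l2n_mono) (use L * sqi_measurable[OF sqi_diff[OF s[OF *(1)] s[OF *(2)]]] in \<open>auto intro: sqi_diff\<close>)
    then show "\<forall>\<^sub>F n in sequentially. norm (l2n M (\<lambda>x. P (F n x) - P (f x))) \<le> L * l2n M (\<lambda>x. F n x - f x)" by simp
  qed
  then show ?thesis using s * by (simp add: l2conv_def)
qed

section \<open>Chain rule, and the relation of \<open>wgr\<close> to \<open>H1\<close>\<close>

context bounded_domain
begin

text \<open>The subsequence is chosen to converge almost everywhere: P' of it then converges
  boundedly and may multiply the L2 convergent factor.\<close>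

lemma chain_limit:
  assumes f: "l2conv M F f" "l2conv M G g" and P: "C1b P P'"
  obtains r where "strict_mono (r :: nat \<Rightarrow> nat)" "l2conv M (\<lambda>n x. P (F (r n) x)) (\<lambda>x. P (f x))"
    "l2conv M (\<lambda>n x. P' (F (r n) x) *\<^sub>R G (r n) x) (\<lambda>x. P' (f x) *\<^sub>R g x)"
proof -
  obtain r where r: "strict_mono r" "AE x in M. (\<lambda>n. F (r n) x) \<longlonglongrightarrow> f x"
    using l2conv_AE_subseq[OF f(1)] by blast
  obtain L where L: "\<And>t. \<bar>P' t\<bar> \<le> L" using C1bD(6)[OF P] by blast
  note [measurable] = C1bD(5)[OF P] sqi_measurable[OF l2convD(1)[OF f(1)]] sqi_measurable[OF l2convD(2)[OF f(1)]]
  show thesis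
  proof
    show "strict_mono r" by (rule r)
    show "l2conv M (\<lambda>n x. P (F (r n) x)) (\<lambda>x. P (f x))"
      by (rule l2conv_compose_lipschitz[OF l2conv_subseq[OF f(1) r(1)] P]) unfold_locales
    show "l2conv M (\<lambda>n x. P' (F (r n) x) *\<^sub>R G (r n) x) (\<lambda>x. P' (f x) *\<^sub>R g x)"
    proof (rule l2conv_mult_bounded[OF l2conv_subseq[OF f(2) r(1)], of _ _ L])
      show "AE x in M. (\<lambda>n. P' (F (r n) x)) \<longlonglongrightarrow> P' (f x)"
        using r(2)
      proof eventually_elim
        case (elim x)
        have "isCont P' (f x)" using C1bD(3)[OF P] by (simp add: continuous_on_eq_continuous_at)
        then show ?case using elim by (rule isCont_tendsto_compose)
      qed
    qed (use L in auto)
  qed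
qed

text \<open>On the support of \<psi> the function is a limit of smooth functions v with convergent
  gradients. For these P(v) \<psi> is in \<open>C1c\<close>, its partial derivatives integrate to 0,
  and the identity passes to the limit.\<close>

lemma wgr_chain:
  assumes wg: "wgr f G" and P: "C1b P P'"
  shows "wgr (\<lambda>x. P (f x)) (\<lambda>x. P' (f x) *\<^sub>R G x)"
proof -
  note W = wgrD[OF wg]
  have "(\<integral>x. P (f x) * partial i \<psi> x \<partial>M) = - (\<integral>x. (P' (f x) *\<^sub>R G x) $ i * \<psi> x \<partial>M)"
    if \<psi>: "\<psi> \<in> test_functions \<Omega>" for \<psi> i
  proof -
    obtain K where K: "compact K" "K \<subseteq> \<Omega>" "\<And>x. x \<notin> K \<Longrightarrow> \<psi> x = 0" using test_functionsE[OF \<psi>] by metis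
    obtain v where v: "\<And>j::nat. smooth (v j)" "l2conv M v f"
      "l2conv M (\<lambda>j x. indicator K x *\<^sub>R grad (v j) x) (\<lambda>x. indicator K x *\<^sub>R G x)"
      using smooth_local_approximation[OF wg K(1,2)] by blast
    obtain r where r: "strict_mono (r :: nat \<Rightarrow> nat)" "l2conv M (\<lambda>n x. P (v (r n) x)) (\<lambda>x. P (f x))"
      "l2conv M (\<lambda>n x. P' (v (r n) x) *\<^sub>R (indicator K x *\<^sub>R grad (v (r n)) x)) (\<lambda>x. P' (f x) *\<^sub>R (indicator K x *\<^sub>R G x))"
      using chain_limit[OF v(2,3) P] by blast
    have vC: "C_k 1 (v j)" for j using v(1) by (simp add: smooth_def del: C_k.simps)
    have eq: "(\<integral>x. P (v j x) * partial i \<psi> x \<partial>M) = - (\<integral>x. (P' (v j x) *\<^sub>R (indicator K x *\<^sub>R grad (v j) x)) $ i * \<psi> x \<partial>M)" for j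
    proof -
      have PC: "C_k 1 (\<lambda>x. P (v j x))" by (rule C_1_compose(1)[OF vC P])
      have pC: "C_k 1 \<psi>" using test_functions_smooth[OF \<psi>] by (simp add: smooth_def del: C_k.simps)
      have C: "(\<lambda>x. P (v j x) * \<psi> x) \<in> C1c"
        using C_k_mult[OF PC pC] K(1,3) by (auto simp: C1c_def simp del: C_k.simps intro!: exI[of _ K])
      have d: "partial i (\<lambda>x. P (v j x) * \<psi> x) x = P (v j x) * partial i \<psi> x + P' (v j x) * partial i (v j) x * \<psi> x" for x
        by (subst partial_mult) (use C_1_D(1)[OF PC] C_1_D(1)[OF pC] C_1_compose(2)[OF vC P] in auto)
      have c: "continuous_on UNIV (\<lambda>x. P (v j x))" "continuous_on UNIV (\<lambda>x. P' (v j x) * partial i (v j) x)"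
        using C_1_D(2)[OF PC] C_1_D(3)[OF PC, of i] C_1_compose(2)[OF vC P] by (auto simp: fun_eq_iff[symmetric])
      have [measurable]: "(\<lambda>x. P (v j x)) \<in> borel_measurable borel" "(\<lambda>x. P' (v j x) * partial i (v j) x) \<in> borel_measurable borel"
        using c by (auto intro: borel_measurable_continuous_onI)
      note [measurable] = test_fn(3)[OF \<psi>] test_fn(3)[OF test_functions_partial[OF \<psi>, of i]]
      have i1: "integrable lborel (\<lambda>x. P (v j x) * partial i \<psi> x)"
        by (rule continuous_compact_support(1)[OF _ K(1)])
          (use c(1) C1cD(4)[OF test_functions_C1c[OF \<psi>]] partial_zero_outside(1)[OF K(3) compact_imp_closed[OF K(1)]]
            in \<open>auto intro!: continuous_on_mult\<close>)
      have i2: "integrable lborel (\<lambda>x. P' (v j x) * partial i (v j) x * \<psi> x)"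
        by (rule continuous_compact_support(1)[OF _ K(1)])
          (use c(2) C1cD(3)[OF test_functions_C1c[OF \<psi>]] K(3) in \<open>auto intro!: continuous_on_mult\<close>)
      have a: "0 = (\<integral>x. P (v j x) * partial i \<psi> x \<partial>lborel) + (\<integral>x. P' (v j x) * partial i (v j) x * \<psi> x \<partial>lborel)"
        using integral_partial_zero[OF C, of i] i1 i2 by (simp add: d)
      have b: "(\<integral>x. P (v j x) * partial i \<psi> x \<partial>M) = (\<integral>x. P (v j x) * partial i \<psi> x \<partial>lborel)"
        by (rule integral_M_lborel(1)) (use test_fn(6)[OF test_functions_partial[OF \<psi>]] in auto)
      have c: "(\<integral>x. P' (v j x) * partial i (v j) x * \<psi> x \<partial>M) = (\<integral>x. P' (v j x) * partial i (v j) x * \<psi> x \<partial>lborel)"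
        by (rule integral_M_lborel(1)) (use test_fn(6)[OF \<psi>] in auto)
      have e: "(P' (v j x) *\<^sub>R (indicator K x *\<^sub>R grad (v j) x)) $ i * \<psi> x = P' (v j x) * partial i (v j) x * \<psi> x" for x
        using K(3)[of x] by (cases "x \<in> K") (auto simp: grad_def)
      show ?thesis unfolding e using a b c by linarith
    qed
    have 1: "(\<lambda>n. \<integral>x. P (v (r n) x) * partial i \<psi> x \<partial>M) \<longlonglongrightarrow> (\<integral>x. P (f x) * partial i \<psi> x \<partial>M)"
      using l2conv_inner[OF r(2) l2conv_const[OF test_fn(10)[OF \<psi>, of i]]] by simp
    have 2: "(\<lambda>n. - (\<integral>x. (P' (v (r n) x) *\<^sub>R (indicator K x *\<^sub>R grad (v (r n)) x)) $ i * \<psi> x \<partial>M)) \<longlonglongrightarrow>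
        - (\<integral>x. (P' (f x) *\<^sub>R (indicator K x *\<^sub>R G x)) $ i * \<psi> x \<partial>M)"
      using tendsto_minus[OF l2conv_inner[OF l2conv_component[OF r(3), of i] l2conv_const[OF test_fn(1)[OF \<psi>]]]] by simp
    have 3: "(\<integral>x. (P' (f x) *\<^sub>R (indicator K x *\<^sub>R G x)) $ i * \<psi> x \<partial>M) = (\<integral>x. (P' (f x) *\<^sub>R G x) $ i * \<psi> x \<partial>M)"
    proof (rule Bochner_Integration.integral_cong)
      show "(P' (f x) *\<^sub>R (indicator K x *\<^sub>R G x)) $ i * \<psi> x = (P' (f x) *\<^sub>R G x) $ i * \<psi> x" for x
        using K(3)[of x] by (cases "x \<in> K") auto
    qed simp
    show ?thesis
      by (rule LIMSEQ_unique[OF 1]) (use 2 in \<open>simp only: eq 3\<close>)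
  qed
  moreover have "sqi M (\<lambda>x. P (f x))"
    using l2convD(2)[OF l2conv_compose_lipschitz[OF l2conv_const[OF W(1)] P]] finite_measure_axioms by blast
  moreover have "sqi M (\<lambda>x. P' (f x) *\<^sub>R G x)"
  proof -
    obtain L where L: "\<And>t. \<bar>P' t\<bar> \<le> L" using C1bD(6)[OF P] by blast
    note [measurable] = C1bD(5)[OF P] sqi_measurable[OF W(1)]
    show ?thesis by (rule sqi_mult_bounded[OF W(2), of _ L]) (use L in auto)
  qed
  ultimately show ?thesis by (simp add: wgr_def)
qed

text \<open>
  If \<open>P\<close> vanishes on the range of \<open>f\<close>, then \<open>P(f + \<psi>)\<close> has compact support for every
  test function \<open>\<psi>\<close>; this replaces any discussion of boundary values.
\<close>
lemma H10_compose:
  assumes f: "wgr f G" "\<And>x. x \<in> \<Omega> \<Longrightarrow> f x \<in> I" and z: "H10 z Z" and P: "C1b P P'"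
    and P0: "\<And>t. t \<in> I \<Longrightarrow> P t = 0" "\<And>t. t \<in> I \<Longrightarrow> P' t = 0"
  shows "H10 (\<lambda>x. P (f x + z x)) (\<lambda>x. P' (f x + z x) *\<^sub>R (G x + Z x))"
proof -
  note W = wgrD[OF f(1)]
  obtain \<psi> where p: "\<And>n. \<psi> n \<in> test_functions \<Omega>" "l2conv M \<psi> z" "l2conv M (\<lambda>n. grad (\<psi> n)) Z"
    using H10_E[OF z] by blast
  obtain r where r: "strict_mono (r :: nat \<Rightarrow> nat)" "l2conv M (\<lambda>n x. P (f x + \<psi> (r n) x)) (\<lambda>x. P (f x + z x))"
    "l2conv M (\<lambda>n x. P' (f x + \<psi> (r n) x) *\<^sub>R (G x + grad (\<psi> (r n)) x)) (\<lambda>x. P' (f x + z x) *\<^sub>R (G x + Z x))"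
    using chain_limit[OF l2conv_add[OF l2conv_const[OF W(1)] p(2)] l2conv_add[OF l2conv_const[OF W(2)] p(3)] P] by blast
  have "H10 (\<lambda>x. P (f x + \<psi> n x)) (\<lambda>x. P' (f x + \<psi> n x) *\<^sub>R (G x + grad (\<psi> n) x))" for n
  proof -
    have w: "wgr (\<lambda>x. P (f x + \<psi> n x)) (\<lambda>x. P' (f x + \<psi> n x) *\<^sub>R (G x + grad (\<psi> n) x))"
      by (rule wgr_chain[OF wgr_add[OF f(1) test_wgr[OF p(1)]] P])
    obtain K where K: "compact K" "K \<subseteq> \<Omega>" "\<And>x. x \<notin> K \<Longrightarrow> \<psi> n x = 0" using test_functionsE[OF p(1)] by metis
    \<comment> \<open>Outside K the argument of P is a value of f, at which both P and its
      derivative vanish.\<close>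
    show ?thesis by (rule H10_compact_support[OF w K(1,2)]) (use K(3) f(2) P0 in auto)
  qed
  from H10_closed[OF this r(2,3)] show ?thesis .
qed

lemma sqi_Lp2: "f \<in> Lp M 2 \<longleftrightarrow> sqi M f" for f :: "real^'n \<Rightarrow> real"
  by (simp add: Lp_def sqi_def)

lemma integrable_on_subset:
  fixes f :: "real^'n \<Rightarrow> real"
  assumes "integrable M f" "K \<subseteq> \<Omega>" "K \<in> sets lebesgue"
  shows "integrable (lebesgue_on K) f"
proof -
  have "integrable lebesgue (\<lambda>x. indicator \<Omega> x *\<^sub>R f x)"
    using assms(1) Omega_sets(2) by (simp add: integrable_restrict_space)
  from integrable_mult_indicator[OF assms(3) this]
  have "integrable lebesgue (\<lambda>x. indicator K x *\<^sub>R indicator \<Omega> x *\<^sub>R f x)" .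
  moreover have "(\<lambda>x. indicator K x *\<^sub>R indicator \<Omega> x *\<^sub>R f x) = (\<lambda>x. indicator K x *\<^sub>R f x)"
    using assms(2) by (auto simp: fun_eq_iff indicator_def)
  ultimately show ?thesis using assms(3) by (simp add: integrable_restrict_space)
qed

lemma sqi_locally_integrable:
  assumes "sqi M f" shows "locally_integrable \<Omega> f"
  unfolding locally_integrable_def
  using sqi_measurable[OF assms] integrable_on_subset[OF sqi_integrable(1)[OF assms]]
  by (blast intro: fmeasurableD[OF lmeasurable_compact])

lemma wgr_has_weak_gradient: "wgr f G \<Longrightarrow> has_weak_gradient \<Omega> f G"
  by (auto simp: has_weak_gradient_def wgr_def sqi_locally_integrable sqi_component)

lemma locally_integrable_mult_test:
  assumes f: "locally_integrable \<Omega> f" and \<psi>: "\<psi> \<in> test_functions \<Omega>"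
  shows "integrable M (\<lambda>x. f x * \<psi> x)"
proof -
  obtain K where K: "compact K" "K \<subseteq> \<Omega>" "\<And>x. x \<notin> K \<Longrightarrow> \<psi> x = 0" using test_functionsE[OF \<psi>] by metis
  obtain B where B: "\<And>x. \<bar>\<psi> x\<bar> \<le> B" using test_fn(5)[OF \<psi>] by blast
  have Ks: "K \<in> sets lebesgue" using K(1) by (simp add: compact_imp_closed)
  have "integrable (lebesgue_on K) f" using f K by (simp add: locally_integrable_def)
  then have i: "integrable lebesgue (\<lambda>x. indicator K x *\<^sub>R f x)" using Ks by (simp add: integrable_restrict_space)
  have \<psi>m: "\<psi> \<in> borel_measurable lebesgue"
    by (rule measurable_completion) (use test_fn(3)[OF \<psi>] in simp)
  have "integrable lebesgue (\<lambda>x. (indicator K x *\<^sub>R f x) * \<psi> x)"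
  proof (rule Bochner_Integration.integrable_bound[OF integrable_mult_right[OF i, of B]])
    show "(\<lambda>x. (indicator K x *\<^sub>R f x) * \<psi> x) \<in> borel_measurable lebesgue"
      using borel_measurable_integrable[OF i] \<psi>m by (rule borel_measurable_times)
    show "AE x in lebesgue. norm ((indicator K x *\<^sub>R f x) * \<psi> x) \<le> norm (B * (indicator K x *\<^sub>R f x))"
    proof (rule AE_I2)
      fix x
      have "\<bar>\<psi> x\<bar> \<le> \<bar>B\<bar>" using B[of x] by simp
      then show "norm ((indicator K x *\<^sub>R f x) * \<psi> x) \<le> norm (B * (indicator K x *\<^sub>R f x))"
        by (simp add: abs_mult mult.commute[of "\<bar>B\<bar>"] mult_left_mono)
    qed
  qed
  moreover have "(\<lambda>x. (indicator K x *\<^sub>R f x) * \<psi> x) = (\<lambda>x. indicator \<Omega> x *\<^sub>R (f x * \<psi> x))"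
    using K by (auto simp: fun_eq_iff indicator_def)
  ultimately show ?thesis using Omega_sets(2) by (simp add: integrable_restrict_space)
qed

lemma wgr_unique:
  assumes wg: "wgr f G" and H: "has_weak_gradient \<Omega> f H"
  shows "AE x in M. G x = H x" "H \<in> borel_measurable M"
proof -
  have Hm: "(\<lambda>x. H x $ i) \<in> borel_measurable M" for i using H by (auto simp: has_weak_gradient_def locally_integrable_def)
  then show "H \<in> borel_measurable M" by (rule borel_measurable_vecI)
  note W = wgrD[OF wg]
  have "AE x in M. G x $ i - H x $ i = 0" for i
  proof (rule fundamental_lemma)
    have Gl: "locally_integrable \<Omega> (\<lambda>x. G x $ i)" by (rule sqi_locally_integrable[OF sqi_component[OF W(2)]])
    have Hl: "locally_integrable \<Omega> (\<lambda>x. H x $ i)" using H by (simp add: has_weak_gradient_def)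
    show "(\<lambda>x. G x $ i - H x $ i) \<in> borel_measurable M"
      using Hm sqi_measurable[OF sqi_component[OF W(2)]] by (rule borel_measurable_diff[rotated])
    show "integrable (lebesgue_on K) (\<lambda>x. G x $ i - H x $ i)" if "compact K" "K \<subseteq> \<Omega>" for K
      using Gl Hl that by (simp add: locally_integrable_def)
    fix \<psi> assume \<psi>: "\<psi> \<in> test_functions \<Omega>"
    have "(\<integral>x. G x $ i * \<psi> x \<partial>M) = (\<integral>x. H x $ i * \<psi> x \<partial>M)"
      using W(3)[OF \<psi>, of i] H \<psi> by (simp add: has_weak_gradient_def)
    then show "(\<integral>x. (G x $ i - H x $ i) * \<psi> x \<partial>M) = 0"
      using locally_integrable_mult_test[OF Gl \<psi>] locally_integrable_mult_test[OF Hl \<psi>]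
      by (simp add: left_diff_distrib)
  qed
  then have "AE x in M. \<forall>i. G x $ i - H x $ i = 0" by (simp add: AE_all_countable)
  then show "AE x in M. G x = H x" by eventually_elim (simp add: vec_eq_iff)
qed

text \<open>\<open>wgrad\<close> is a Hilbert choice; uniqueness almost everywhere identifies it
  with whatever weak gradient has been constructed.\<close>

lemma wgr_wgrad:
  assumes "wgr f G"
  shows "AE x in M. wgrad \<Omega> f x = G x" "wgrad \<Omega> f \<in> borel_measurable M" "wgr f (wgrad \<Omega> f)" "f \<in> H1 \<Omega>"
proof -
  have h: "has_weak_gradient \<Omega> f (wgrad \<Omega> f)"
    unfolding wgrad_def by (rule someI[of _ G]) (rule wgr_has_weak_gradient[OF assms])
  note U = wgr_unique[OF assms h]
  show "AE x in M. wgrad \<Omega> f x = G x" using U(1) by eventually_elim simp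
  show "wgrad \<Omega> f \<in> borel_measurable M" by (rule U(2))
  show w: "wgr f (wgrad \<Omega> f)"
    by (rule wgr_cong_AE[OF assms _ U(2) _ U(1)]) (use sqi_measurable[OF wgrD(1)[OF assms]] in auto)
  have "\<forall>i. (\<lambda>x. wgrad \<Omega> f x $ i) \<in> Lp M 2" using sqi_component[OF wgrD(2)[OF w]] by (simp add: sqi_Lp2)
  then show "f \<in> H1 \<Omega>"
    using wgrD(1)[OF w] wgr_has_weak_gradient[OF assms] unfolding H1_def by (auto simp: sqi_Lp2)
qed

lemma H1_wgr:
  assumes "f \<in> H1 \<Omega>" shows "wgr f (wgrad \<Omega> f)"
proof -
  have f: "sqi M f" "\<exists>G. has_weak_gradient \<Omega> f G" "\<And>i. sqi M (\<lambda>x. wgrad \<Omega> f x $ i)"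
    using assms by (auto simp: H1_def sqi_Lp2)
  have h: "has_weak_gradient \<Omega> f (wgrad \<Omega> f)"
    unfolding wgrad_def using f(2) by (rule someI_ex)
  have "sqi M (wgrad \<Omega> f)"
    using l2convD(2)[OF l2conv_components[of M "\<lambda>_. wgrad \<Omega> f" "wgrad \<Omega> f"]] l2conv_const[OF f(3)] by blast
  then show ?thesis using f(1) h by (simp add: wgr_def has_weak_gradient_def)
qed

lemma H1_norm_wgr:
  assumes "wgr f G" shows "H1_norm \<Omega> f = sqrt ((l2n M f)\<^sup>2 + (l2n M G)\<^sup>2)"
proof -
  have "(\<integral>x. (norm (wgrad \<Omega> f x))\<^sup>2 \<partial>M) = (l2n M G)\<^sup>2"
    using l2n_cong_AE[OF wgr_wgrad(2)[OF assms] sqi_measurable[OF wgrD(2)[OF assms]] wgr_wgrad(1)[OF assms]]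
    by (metis l2n_power2)
  then show ?thesis by (simp add: H1_norm_def l2n_power2)
qed

lemma H1_norm_tendsto:
  assumes "\<And>n. wgr (f n) (G n)"
  shows "(\<lambda>n. H1_norm \<Omega> (f n)) \<longlonglongrightarrow> 0 \<longleftrightarrow> (\<lambda>n. l2n M (f n)) \<longlonglongrightarrow> 0 \<and> (\<lambda>n. l2n M (G n)) \<longlonglongrightarrow> 0"
proof
  assume L: "(\<lambda>n. H1_norm \<Omega> (f n)) \<longlonglongrightarrow> 0"
  have "norm (l2n M (f n)) \<le> H1_norm \<Omega> (f n)" "norm (l2n M (G n)) \<le> H1_norm \<Omega> (f n)" for n
    unfolding H1_norm_wgr[OF assms] by (simp_all add: real_le_rsqrt)
  then show "(\<lambda>n. l2n M (f n)) \<longlonglongrightarrow> 0 \<and> (\<lambda>n. l2n M (G n)) \<longlonglongrightarrow> 0"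
    by (auto intro!: Lim_null_comparison[OF _ L])
next
  assume L: "(\<lambda>n. l2n M (f n)) \<longlonglongrightarrow> 0 \<and> (\<lambda>n. l2n M (G n)) \<longlonglongrightarrow> 0"
  then have "(\<lambda>n. sqrt ((l2n M (f n))\<^sup>2 + (l2n M (G n))\<^sup>2)) \<longlonglongrightarrow> sqrt (0\<^sup>2 + 0\<^sup>2)"
    by (intro tendsto_intros) auto
  then show "(\<lambda>n. H1_norm \<Omega> (f n)) \<longlonglongrightarrow> 0" by (simp add: H1_norm_wgr[OF assms])
qed

end

section \<open>Grid averages and the Nash inequality\<close>

definition cell :: "real \<Rightarrow> real^'n \<Rightarrow> int^'n" where
  "cell e x = (\<chi> i. \<lfloor>x $ i / e\<rfloor>)"

lemma cell_eq_iff: "cell e x = cell e y \<longleftrightarrow> (\<forall>i. \<lfloor>x $ i / e\<rfloor> = \<lfloor>y $ i / e\<rfloor>)"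
  by (auto simp: cell_def vec_eq_iff)

lemma cell_measurable_pred [measurable (raw)]:
  assumes "f \<in> borel_measurable M" "g \<in> borel_measurable M"
  shows "Measurable.pred M (\<lambda>x. cell e (f x) = cell e (g x))"
proof -
  note [measurable] = assms
  have "(\<lambda>x. \<lfloor>f x $ i / e\<rfloor>) \<in> measurable M (count_space UNIV)" "(\<lambda>x. \<lfloor>g x $ i / e\<rfloor>) \<in> measurable M (count_space UNIV)" for i
    by measurable
  then show ?thesis unfolding cell_eq_iff by measurable
qed

lemma cell_close:
  fixes x y :: "real^'n"
  assumes e: "0 < e" and q: "cell e x = cell e y"
  shows "norm (x - y) \<le> real CARD('n) * e"
proof -
  have "\<bar>(x - y) $ i\<bar> \<le> e" for i
  proof -
    have "\<lfloor>x $ i / e\<rfloor> = \<lfloor>y $ i / e\<rfloor>" using q by (simp add: cell_eq_iff)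
    then have "\<bar>x $ i / e - y $ i / e\<bar> \<le> 1"
      using floor_correct[of "x $ i / e"] floor_correct[of "y $ i / e"] by linarith
    then show ?thesis using e by (simp flip: diff_divide_distrib add: field_simps)
  qed
  then have "norm (x - y) \<le> (\<Sum>i\<in>(UNIV::'n set). e)"
    by (intro order_trans[OF norm_le_l1_cart] sum_mono)
  then show ?thesis by simp
qed

lemma cell_emeasure:
  fixes c :: "int^'n"
  assumes e: "0 < e"
  shows "emeasure lborel {y::real^'n. cell e y = c} = ennreal (e ^ CARD('n))"
    "{y::real^'n. cell e y = c} \<in> sets borel"
proof -
  define a b :: "real^'n" where "a = (\<chi> i. e * real_of_int (c $ i))" "b = (\<chi> i. e * (real_of_int (c $ i) + 1))"
  define x0 :: "real^'n" where "x0 = (\<chi> i. e * real_of_int (c $ i))"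
  have c: "cell e x0 = c" using e by (simp add: cell_def x0_def vec_eq_iff)
  have "Measurable.pred borel (\<lambda>y. cell e y = cell e x0)" by measurable
  then show m: "{y::real^'n. cell e y = c} \<in> sets borel" unfolding c pred_def by simp
  have iff: "cell e y = c \<longleftrightarrow> (\<forall>i. a $ i \<le> y $ i \<and> y $ i < b $ i)" for y
  proof -
    have "\<lfloor>y $ i / e\<rfloor> = c $ i \<longleftrightarrow> a $ i \<le> y $ i \<and> y $ i < b $ i" for i
      using e by (auto simp: floor_eq_iff a_b_def field_simps)
    then show ?thesis by (simp add: cell_def vec_eq_iff)
  qed
  have s1: "box a b \<subseteq> {y. cell e y = c}" and s2: "{y. cell e y = c} \<subseteq> cbox a b"
    by (auto simp: iff mem_box_cart less_imp_le)
  have le: "a \<bullet> i \<le> b \<bullet> i" if "i \<in> Basis" for i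
    using that e by (auto simp: Basis_vec_def inner_axis a_b_def)
  have pr: "(\<Prod>i\<in>Basis. (b - a) \<bullet> i) = e ^ CARD('n)"
  proof -
    have "(b - a) \<bullet> i = e" if "i \<in> Basis" for i
      using that by (auto simp: Basis_vec_def inner_axis a_b_def algebra_simps)
    then show ?thesis by simp
  qed
  have "emeasure lborel (cbox a b) = ennreal (e ^ CARD('n))" "emeasure lborel (box a b) = ennreal (e ^ CARD('n))"
    using le pr by (simp_all add: emeasure_lborel_cbox_eq emeasure_lborel_box_eq)
  then show "emeasure lborel {y. cell e y = c} = ennreal (e ^ CARD('n))"
    using emeasure_mono[OF s1, of lborel] emeasure_mono[OF s2, of lborel] m by (simp add: antisym)
qed

text \<open>By Cauchy-Schwarz the squared error at x is at most the mean of |z x - z y|^2 over the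
  cell of x. The cell lies in the ball of radius R = N e about x, so the mean is at most e^(-N)
  times the integral over all shifts h in the ball of radius R, and each shift costs at most R^2
  times the energy. With the volume of that ball, R^2 e^(-N) becomes N^(N+2) e^2 times the volume of
  the unit ball.\<close>

lemma cell_average_close:
  fixes z :: "real^'n \<Rightarrow> real"
  assumes z: "z \<in> C1c" and e: "0 < e"
  defines "P \<equiv> (\<lambda>x. (\<integral>y. indicator {y. cell e y = cell e x} y * z y \<partial>lborel) / e ^ CARD('n))"
  assumes Pm: "P \<in> borel_measurable borel"
  shows "sqi lborel (\<lambda>x. z x - P x)"
    "l2n lborel (\<lambda>x. z x - P x)
      \<le> sqrt (unit_ball_vol (real CARD('n)) * real CARD('n) ^ (CARD('n) + 2)) * e * l2n lborel (grad z)"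
proof -
  note D = C1cD[OF z]
  let ?N = "CARD('n)"
  have zm[measurable]: "z \<in> borel_measurable borel" using D(3) by (rule borel_measurable_continuous_onI)
  note [measurable] = Pm
  define k where "k x y = indicator {y. cell e y = cell e x} y / e ^ ?N" for x y :: "real^'n"
  have km[measurable]: "(\<lambda>p. k (fst p) (snd p)) \<in> borel_measurable (lborel \<Otimes>\<^sub>M lborel)"
    unfolding k_def[abs_def] indicator_def by measurable
  have [measurable]: "k x \<in> borel_measurable borel" for x
    using cell_emeasure(2)[OF e, of "cell e x"] unfolding k_def[abs_def] by measurable
  have k0: "0 \<le> k x y" for x y using e by (simp add: k_def)
  have ki: "integrable lborel (k x)" "(\<integral>y. k x y \<partial>lborel) = 1" for x
    using cell_emeasure[OF e, of "cell e x"] e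
    by (auto simp: k_def[abs_def] measure_def intro!: integrable_divide_zero integrable_real_indicator)
  have nk: "(\<integral>\<^sup>+y. ennreal (k x y) \<partial>lborel) = 1" for x
    using ki k0 by (simp add: nn_integral_eq_integral)
  obtain B where B: "\<And>x. \<bar>z x\<bar> \<le> B" using D(11) by blast
  have kz: "integrable lborel (\<lambda>y. k x y * z y)" for x
  proof (rule Bochner_Integration.integrable_bound[OF integrable_mult_right[OF ki(1), of B]])
    show "AE y in lborel. norm (k x y * z y) \<le> norm (B * k x y)"
    proof (rule AE_I2)
      fix y have "\<bar>z y\<bar> \<le> \<bar>B\<bar>" using B[of y] by simp
      then show "norm (k x y * z y) \<le> norm (B * k x y)"
        by (simp add: abs_mult mult.commute[of "\<bar>B\<bar>"] mult_left_mono)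
    qed
  qed measurable
  have Pk: "P x = (\<integral>y. k x y * z y \<partial>lborel)" for x by (simp add: P_def k_def)
  have pw: "ennreal ((z x - P x)\<^sup>2) \<le> (\<integral>\<^sup>+y. ennreal (k x y * (z x - z y)\<^sup>2) \<partial>lborel)" for x
  proof -
    have i2: "integrable lborel (\<lambda>y. k x y * (z x - z y))"
      using kz ki(1) by (simp add: right_diff_distrib)
    have eq: "z x - P x = (\<integral>y. k x y * (z x - z y) \<partial>lborel)"
      using kz ki by (simp add: Pk right_diff_distrib)
    have "ennreal \<bar>z x - P x\<bar> \<le> (\<integral>\<^sup>+y. ennreal (k x y * \<bar>z x - z y\<bar>) \<partial>lborel)"
      using integral_norm_bound_ennreal[OF i2] k0 by (simp add: eq abs_mult)
    also have "\<dots> = (\<integral>\<^sup>+y. ennreal (sqrt (k x y)) * ennreal (sqrt (k x y) * \<bar>z x - z y\<bar>) \<partial>lborel)"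
      using k0 by (intro nn_integral_cong) (simp flip: ennreal_mult' mult.assoc)
    finally have "(ennreal \<bar>z x - P x\<bar>)\<^sup>2 \<le>
      (\<integral>\<^sup>+y. ennreal (sqrt (k x y)) * ennreal (sqrt (k x y) * \<bar>z x - z y\<bar>) \<partial>lborel)\<^sup>2"
      by (rule power_mono) simp
    also have "\<dots> \<le> (\<integral>\<^sup>+y. (ennreal (sqrt (k x y)))\<^sup>2 \<partial>lborel) *
        (\<integral>\<^sup>+y. (ennreal (sqrt (k x y) * \<bar>z x - z y\<bar>))\<^sup>2 \<partial>lborel)"
      by (rule Cauchy_Schwarz_nn_integral) measurable
    also have "(\<integral>\<^sup>+y. (ennreal (sqrt (k x y)))\<^sup>2 \<partial>lborel) = 1"
      using k0 nk by (simp add: ennreal_power)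
    also have "(\<integral>\<^sup>+y. (ennreal (sqrt (k x y) * \<bar>z x - z y\<bar>))\<^sup>2 \<partial>lborel)
        = (\<integral>\<^sup>+y. ennreal (k x y * (z x - z y)\<^sup>2) \<partial>lborel)"
      using k0 by (simp add: ennreal_power power_mult_distrib)
    finally show ?thesis by (simp add: ennreal_power)
  qed
  define R where "R = real ?N * e"
  have R: "0 \<le> R" using e by (simp add: R_def)
  define E where "E = l2n lborel (grad z)"
  have "(\<integral>\<^sup>+x. ennreal ((z x - P x)\<^sup>2) \<partial>lborel)
      \<le> (\<integral>\<^sup>+x. \<integral>\<^sup>+y. ennreal (k x y * (z x - z y)\<^sup>2) \<partial>lborel \<partial>lborel)"
    by (intro nn_integral_mono pw)
  also have "\<dots> \<le> (\<integral>\<^sup>+x. \<integral>\<^sup>+h. ennreal (indicator (cball 0 R) h / e ^ ?N * (z x - z (x + h))\<^sup>2) \<partial>lborel \<partial>lborel)"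
  proof (rule nn_integral_mono)
    fix x
    have "(\<integral>\<^sup>+y. ennreal (k x y * (z x - z y)\<^sup>2) \<partial>lborel)
       = (\<integral>\<^sup>+y. ennreal (k x y * (z x - z y)\<^sup>2) \<partial>distr lborel borel ((+) x))" by (simp add: lborel_distr_plus)
    also have "\<dots> = (\<integral>\<^sup>+h. ennreal (k x (x + h) * (z x - z (x + h))\<^sup>2) \<partial>lborel)"
      by (subst nn_integral_distr) auto
    also have "\<dots> \<le> (\<integral>\<^sup>+h. ennreal (indicator (cball 0 R) h / e ^ ?N * (z x - z (x + h))\<^sup>2) \<partial>lborel)"
    proof (intro nn_integral_mono ennreal_leI mult_right_mono)
      fix h
      show "k x (x + h) \<le> indicator (cball 0 R) h / e ^ ?N"
        using cell_close[OF e, of "x + h" x] e by (auto simp: k_def R_def indicator_def)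
    qed simp
    finally show "(\<integral>\<^sup>+y. ennreal (k x y * (z x - z y)\<^sup>2) \<partial>lborel)
      \<le> (\<integral>\<^sup>+h. ennreal (indicator (cball 0 R) h / e ^ ?N * (z x - z (x + h))\<^sup>2) \<partial>lborel)" .
  qed
  also have "\<dots> = (\<integral>\<^sup>+h. \<integral>\<^sup>+x. ennreal (indicator (cball 0 R) h / e ^ ?N * (z x - z (x + h))\<^sup>2) \<partial>lborel \<partial>lborel)"
  proof (rule lborel_pair.Fubini')
    have [measurable]: "(indicator (cball 0 R) :: real^'n \<Rightarrow> real) \<in> borel_measurable borel"
      by (rule borel_measurable_indicator) simp
    show "(\<lambda>(y, x). ennreal (indicator (cball 0 R) y / e ^ ?N * (z x - z (x + y))\<^sup>2)) \<in> borel_measurable (lborel \<Otimes>\<^sub>M lborel)"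
      by measurable
  qed
  also have "\<dots> \<le> (\<integral>\<^sup>+h. ennreal (R\<^sup>2 * E\<^sup>2 / e ^ ?N) * indicator (cball 0 R) h \<partial>(lborel :: (real^'n) measure))"
  proof (rule nn_integral_mono)
    fix h :: "real^'n"
    show "(\<integral>\<^sup>+x. ennreal (indicator (cball 0 R) h / e ^ ?N * (z x - z (x + h))\<^sup>2) \<partial>lborel)
      \<le> ennreal (R\<^sup>2 * E\<^sup>2 / e ^ ?N) * indicator (cball 0 R) h"
    proof (cases "h \<in> cball 0 R")
      case True
      have s: "sqi lborel (\<lambda>x. z x - z (x + h))" by (rule sqi_diff[OF D(9) l2n_translate(2)[OF zm, THEN iffD2, OF D(9)]])
      have "l2n lborel (\<lambda>x. z x - z (x + h)) \<le> norm h * E"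
        using l2n_translation_diff[OF z, of h] by (simp add: E_def l2n_minus_commute[of _ z])
      also have "\<dots> \<le> R * E" using True by (intro mult_right_mono) (auto simp: E_def)
      finally have "(l2n lborel (\<lambda>x. z x - z (x + h)))\<^sup>2 \<le> (R * E)\<^sup>2" by (rule power_mono) simp
      then have b: "(\<integral>x. (z x - z (x + h))\<^sup>2 \<partial>lborel) \<le> R\<^sup>2 * E\<^sup>2" by (simp add: l2n_power2 power_mult_distrib)
      have "(\<integral>\<^sup>+x. ennreal ((z x - z (x + h))\<^sup>2 / e ^ ?N) \<partial>lborel) = ennreal (\<integral>x. (z x - z (x + h))\<^sup>2 / e ^ ?N \<partial>lborel)"
        using s e by (intro nn_integral_eq_integral) (auto simp: sqi_def)
      also have "\<dots> \<le> ennreal (R\<^sup>2 * E\<^sup>2 / e ^ ?N)"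
        using b e by (intro ennreal_leI) (simp add: divide_right_mono)
      finally show ?thesis using True by simp
    qed simp
  qed
  also have "\<dots> = ennreal (R\<^sup>2 * E\<^sup>2 / e ^ ?N) * emeasure lborel (cball (0::real^'n) R)"
    by (rule nn_integral_cmult_indicator) simp
  also have "emeasure lborel (cball (0::real^'n) R) = ennreal (unit_ball_vol (real ?N) * R ^ ?N)"
    using R emeasure_cball[of R "0::real^'n"] by simp
  also have "ennreal (R\<^sup>2 * E\<^sup>2 / e ^ ?N) * ennreal (unit_ball_vol (real ?N) * R ^ ?N)
      = ennreal ((sqrt (unit_ball_vol (real ?N) * real ?N ^ (?N + 2)) * e * E)\<^sup>2)"
    using e R by (subst ennreal_mult[symmetric])
      (auto simp: E_def power_mult_distrib R_def field_simps power_add power2_eq_square intro!: mult_nonneg_nonneg)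
  finally have fin: "(\<integral>\<^sup>+x. ennreal ((z x - P x)\<^sup>2) \<partial>lborel)
     \<le> ennreal ((sqrt (unit_ball_vol (real ?N) * real ?N ^ (?N + 2)) * e * E)\<^sup>2)" .
  then have i: "integrable lborel (\<lambda>x. (z x - P x)\<^sup>2)"
    by (intro integrableI_bounded) (auto simp: top.extremum_strict intro: le_less_trans)
  then show "sqi lborel (\<lambda>x. z x - P x)" by (simp add: sqi_def)
  have "ennreal ((l2n lborel (\<lambda>x. z x - P x))\<^sup>2) \<le> ennreal ((sqrt (unit_ball_vol (real ?N) * real ?N ^ (?N + 2)) * e * E)\<^sup>2)"
    using fin nn_integral_eq_integral[OF i] by (simp add: l2n_power2)
  then have "(l2n lborel (\<lambda>x. z x - P x))\<^sup>2 \<le> (sqrt (unit_ball_vol (real ?N) * real ?N ^ (?N + 2)) * e * E)\<^sup>2"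
    by (subst (asm) ennreal_le_iff) simp_all
  then show "l2n lborel (\<lambda>x. z x - P x) \<le> sqrt (unit_ball_vol (real ?N) * real ?N ^ (?N + 2)) * e * l2n lborel (grad z)"
    unfolding E_def by (rule power2_le_imp_le) (use e in simp)
qed

text \<open>Along the levels k_j = k0 + d (1 - 2^(-j)) one shows a(k_j) \<le> \<mu> 2^(-j/\<beta>)
  by induction: the superlinear power 1 + \<beta> beats the factor 2^j that comes from the shrinking
  gaps.\<close>

lemma Stampacchia_iteration:
  fixes a :: "real \<Rightarrow> real"
  assumes mono: "\<And>k l. k0 \<le> k \<Longrightarrow> k \<le> l \<Longrightarrow> l \<le> k0 + d \<Longrightarrow> a l \<le> a k"
    and nonneg: "\<And>k. 0 \<le> a k" and bd: "a k0 \<le> \<mu>"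
    and step: "\<And>k l. k0 \<le> k \<Longrightarrow> k < l \<Longrightarrow> l \<le> k0 + d \<Longrightarrow> (l - k) * a l \<le> C * a k powr (1 + \<beta>)"
    and \<beta>: "0 < \<beta>" and C: "0 \<le> C" and d: "0 < d" "C * \<mu> powr \<beta> * 2 powr (1 + 1/\<beta>) \<le> d"
  shows "a (k0 + d) = 0"
proof -
  have \<mu>: "0 \<le> \<mu>" using nonneg bd by (rule order_trans)
  define k where "k j = k0 + d * (1 - (1/2)^j)" for j :: nat
  have kk: "k0 \<le> k j" "k j \<le> k0 + d" "k j < k (Suc j)" "k (Suc j) - k j = d * (1/2)^Suc j" for j
    using d(1) by (auto simp: k_def power_le_one field_simps)
  have bound: "a (k j) \<le> \<mu> * 2 powr (- real j / \<beta>)" for j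
  proof (induction j)
    case 0 then show ?case using bd by (simp add: k_def)
  next
    case (Suc j)
    have "d * (1/2)^Suc j * a (k (Suc j)) \<le> C * a (k j) powr (1 + \<beta>)"
      using step[OF kk(1,3,2), of j] by (simp add: kk(4))
    also have "\<dots> \<le> C * (\<mu> * 2 powr (- real j / \<beta>)) powr (1 + \<beta>)"
      using Suc C nonneg \<beta> by (intro mult_left_mono powr_mono2) auto
    also have "\<dots> = C * \<mu> powr (1 + \<beta>) * 2 powr (- real j / \<beta> * (1 + \<beta>))"
      using \<mu> by (simp add: powr_mult powr_powr)
    also have "\<mu> powr (1 + \<beta>) = \<mu> * \<mu> powr \<beta>" using \<mu> by (simp add: powr_add)
    also have "- real j / \<beta> * (1 + \<beta>) = - real j / \<beta> - real j" using \<beta> by (simp add: field_simps)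
    \<comment> \<open>The factor \<open>2 powr (1 + 1/\<beta>)\<close> is split off so that the
      hypothesis on d applies: one 2 pays for the gap d / 2^(j+1), and
      \<open>2 powr (1/\<beta>)\<close> for the decay gained in one step.\<close>
    also have "C * (\<mu> * \<mu> powr \<beta>) * 2 powr (- real j / \<beta> - real j) =
       (C * \<mu> powr \<beta> * 2 powr (1 + 1/\<beta>)) * \<mu> * 2 powr (- real j / \<beta> - real j - (1 + 1/\<beta>))"
    proof -
      have "2 powr (- real j / \<beta> - real j) = 2 powr (1 + 1/\<beta>) * 2 powr (- real j / \<beta> - real j - (1 + 1/\<beta>))"
        by (subst powr_add[symmetric]) (rule arg_cong, simp)
      then show ?thesis by (simp only: mult_ac)
    qed
    also have "\<dots> \<le> d * \<mu> * 2 powr (- real j / \<beta> - real j - (1 + 1/\<beta>))"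
      using d(2) \<mu> by (intro mult_right_mono) auto
    also have "2 powr (- real j / \<beta> - real j - (1 + 1/\<beta>)) = 2 powr (- real (Suc j) / \<beta>) * (1/2)^Suc j"
    proof -
      have "- real j / \<beta> - real j - (1 + 1/\<beta>) = - real (Suc j) / \<beta> + - real (Suc j)"
        using \<beta> by (simp add: field_simps)
      then have "2 powr (- real j / \<beta> - real j - (1 + 1/\<beta>)) = 2 powr (- real (Suc j) / \<beta>) * 2 powr (- real (Suc j))"
        by (simp only: powr_add)
      also have "2 powr (- real (Suc j)) = (1/2::real)^Suc j"
        by (simp only: powr_minus powr_realpow zero_less_numeral power_one_over[symmetric] inverse_eq_divide)
      finally show ?thesis .
    qed
    finally have "(d * (1/2)^Suc j) * a (k (Suc j)) \<le> (d * (1/2)^Suc j) * (\<mu> * 2 powr (- real (Suc j) / \<beta>))"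
      by (simp only: mult_ac)
    then show ?case using d(1) by (subst (asm) mult_le_cancel_left_pos) auto
  qed
  have "(\<lambda>j. \<mu> * 2 powr (- real j / \<beta>)) \<longlonglongrightarrow> \<mu> * 0"
  proof (intro tendsto_mult tendsto_const)
    have "(\<lambda>j. (2 powr (- 1 / \<beta>)) ^ j) \<longlonglongrightarrow> 0"
      using \<beta> by (intro LIMSEQ_power_zero) (simp add: powr_less_one)
    moreover have "(2 powr (- 1 / \<beta>)) ^ j = 2 powr (- real j / \<beta>)" for j
      by (simp add: powr_powr flip: powr_realpow)
    ultimately show "(\<lambda>j. 2 powr (- real j / \<beta>)) \<longlonglongrightarrow> 0" by simp
  qed
  then have "a (k0 + d) \<le> \<mu> * 0"
  proof (rule LIMSEQ_le_const)
    show "\<exists>N. \<forall>n\<ge>N. a (k0 + d) \<le> \<mu> * 2 powr (- real n / \<beta>)"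
      using mono[OF kk(1,2)] bound by (intro exI[of _ 0]) (auto intro: order_trans)
  qed
  then show ?thesis using nonneg[of "k0 + d"] by simp
qed

section \<open>A C^1 truncation between two levels\<close>

lemma DERIV_zero_quadratic:
  fixes f :: "real \<Rightarrow> real"
  assumes "\<And>h. \<bar>f (a + h) - f a\<bar> \<le> C * h\<^sup>2"
  shows "(f has_real_derivative 0) (at a)"
  unfolding DERIV_def
proof (rule Lim_null_comparison)
  show "\<forall>\<^sub>F h in at 0. norm ((f (a + h) - f a) / h) \<le> C * \<bar>h\<bar>"
    unfolding eventually_at
  proof (intro exI[of _ 1] conjI ballI impI)
    fix h :: real assume "h \<noteq> 0 \<and> dist h 0 < 1"
    then have "0 < \<bar>h\<bar>" by simp
    have "\<bar>f (a + h) - f a\<bar> \<le> (C * \<bar>h\<bar>) * \<bar>h\<bar>" using assms[of h] by (simp add: power2_eq_square)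
    then show "norm ((f (a + h) - f a) / h) \<le> C * \<bar>h\<bar>" using \<open>0 < \<bar>h\<bar>\<close> by (simp add: divide_le_eq)
  qed simp
  show "((\<lambda>h. C * \<bar>h\<bar>) \<longlongrightarrow> 0) (at 0)" by (auto intro!: tendsto_eq_intros)
qed

lemma DERIV_max_square: "((\<lambda>s. (max 0 (s - a))\<^sup>2) has_real_derivative 2 * max 0 (s - a)) (at s)" for a :: real
proof -
  consider "s < a" | "s = a" | "a < s" by linarith
  then show ?thesis
  proof cases
    case 1
    have "((\<lambda>s. (max 0 (s - a))\<^sup>2) has_real_derivative 0) (at s)"
      by (rule has_field_derivative_transform_within_open[OF DERIV_const[of 0], of "{..<a}"]) (use 1 in auto)
    then show ?thesis using 1 by simp
  next
    case 2
    have "((\<lambda>s. (max 0 (s - a))\<^sup>2) has_real_derivative 0) (at a)"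
      by (rule DERIV_zero_quadratic[where C=1]) (auto simp: max_def)
    then show ?thesis using 2 by simp
  next
    case 3
    have "((\<lambda>s. (s - a)\<^sup>2) has_real_derivative 2 * (s - a)) (at s)" by (auto intro!: derivative_eq_intros)
    then have "((\<lambda>s. (max 0 (s - a))\<^sup>2) has_real_derivative 2 * (s - a)) (at s)"
      by (rule has_field_derivative_transform_within_open[of _ _ _ "{a<..}"]) (use 3 in auto)
    then show ?thesis using 3 by simp
  qed
qed

text \<open>
  A \<open>C\<^sup>1\<close> substitute for the truncation \<open>min (max s k) l - k\<close>, whose chain rule
  would need the weak derivative of Lipschitz functions.
\<close>
definition step :: "real \<Rightarrow> real \<Rightarrow> real \<Rightarrow> real" where
  "step k l s = (2 * (max 0 (s - k))\<^sup>2 - 4 * (max 0 (s - (k + l) / 2))\<^sup>2 + 2 * (max 0 (s - l))\<^sup>2) / (l - k)"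

definition step' :: "real \<Rightarrow> real \<Rightarrow> real \<Rightarrow> real" where
  "step' k l s = (4 * max 0 (s - k) - 8 * max 0 (s - (k + l) / 2) + 4 * max 0 (s - l)) / (l - k)"

text \<open>The derivative \<open>step'\<close> is the tent over [k, l] with height 2 at the
  midpoint, so its integral is l - k and \<open>step\<close> increases from 0 to l - k.\<close>

lemma step_props:
  assumes "k < l"
  shows "C1b (step k l) (step' k l)" "\<And>s. 0 \<le> step' k l s" "\<And>s. step' k l s \<le> 2"
    "\<And>s. 0 \<le> step k l s" "\<And>s. step k l s \<le> l - k" "\<And>s. s \<le> k \<Longrightarrow> step k l s = 0" "\<And>s. s \<le> k \<Longrightarrow> step' k l s = 0"
    "\<And>s. l \<le> s \<Longrightarrow> step k l s = l - k" "\<And>s. l \<le> s \<Longrightarrow> step' k l s = 0"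
    "continuous_on UNIV (step' k l)" "\<And>s. (step k l has_real_derivative step' k l s) (at s)"
proof -
  have lk: "0 < l - k" using assms by simp
  show D: "(step k l has_real_derivative step' k l s) (at s)" for s
  proof -
    have "((\<lambda>s. (2 * (max 0 (s - k))\<^sup>2 - 4 * (max 0 (s - (k + l) / 2))\<^sup>2 + 2 * (max 0 (s - l))\<^sup>2) / (l - k)) has_real_derivative
        (2 * (2 * max 0 (s - k)) - 4 * (2 * max 0 (s - (k + l) / 2)) + 2 * (2 * max 0 (s - l))) / (l - k)) (at s)"
      by (intro DERIV_cdivide DERIV_add DERIV_diff DERIV_cmult DERIV_max_square)
    then show ?thesis by (simp add: step_def[abs_def] step'_def)
  qed
  show cont: "continuous_on UNIV (step' k l)"
    unfolding step'_def[abs_def] by (intro continuous_intros) (use lk in auto)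
  show b: "0 \<le> step' k l s" "step' k l s \<le> 2" for s
  proof -
    define m where "m = (k + l) / 2"
    have m: "2 * m = k + l" by (simp add: m_def)
    have "0 \<le> 4 * max 0 (s - k) - 8 * max 0 (s - m) + 4 * max 0 (s - l)"
      "4 * max 0 (s - k) - 8 * max 0 (s - m) + 4 * max 0 (s - l) \<le> 2 * (l - k)"
      using m lk by (auto simp: max_def)
    then show "0 \<le> step' k l s" "step' k l s \<le> 2" unfolding step'_def m_def[symmetric] using lk by (simp_all add: divide_le_eq)
  qed
  show low: "step k l s = 0" "step' k l s = 0" if "s \<le> k" for s
    using that assms by (auto simp: step_def step'_def max_def)
  show high: "step k l s = l - k" "step' k l s = 0" if "l \<le> s" for s
  proof -
    have "2 * (s - k)\<^sup>2 - 4 * (s - (k + l) / 2)\<^sup>2 + 2 * (s - l)\<^sup>2 = (l - k) * (l - k)"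
      "4 * (s - k) - 8 * (s - (k + l) / 2) + 4 * (s - l) = 0"
      by (simp_all add: power2_eq_square field_simps)
    moreover have "max 0 (s - k) = s - k" "max 0 (s - (k + l) / 2) = s - (k + l) / 2" "max 0 (s - l) = s - l"
      using that assms by auto
    ultimately show "step k l s = l - k" "step' k l s = 0"
      using lk by (simp_all only: step_def step'_def nonzero_mult_div_cancel_left div_0 less_irrefl)
  qed
  have mono: "step k l s \<le> step k l t" if "s \<le> t" for s t
    by (rule DERIV_nonneg_imp_nondecreasing[OF that]) (use D b in blast)
  show "0 \<le> step k l s" "step k l s \<le> l - k" for s
    using mono[of "min s k" s] mono[of s "max s l"] low(1)[of "min s k"] high(1)[of "max s l"] by auto
  have "\<bar>step' k l s\<bar> \<le> 2" for s using b[of s] by simp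
  then show "C1b (step k l) (step' k l)" unfolding C1b_def using D cont by blast
qed

section \<open>Averages over grid cells: Nash, Faber-Krahn, Poincare and Rellich\<close>

context bounded_domain
begin

text \<open>Also for cells cut by the boundary the integral is divided by the full volume of the
  cell: this is the average of the extension by 0, to which the estimate on the whole space
  applies.\<close>

definition grid_avg :: "real \<Rightarrow> (real^'n \<Rightarrow> real) \<Rightarrow> real^'n \<Rightarrow> real" where
  "grid_avg e z x = (\<integral>y. indicator {y. cell e y = cell e x} y * z y \<partial>M) / e ^ CARD('n)"

lemma cell_indicator_measurable: "0 < e \<Longrightarrow> (indicator {y. cell e y = c} :: real^'n \<Rightarrow> real) \<in> borel_measurable M"
  by (intro borel_measurable_M borel_measurable_indicator cell_emeasure(2))

lemma cell_coefficient_integrable: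
  fixes z :: "real^'n \<Rightarrow> real"
  assumes "0 < e" "integrable M z"
  shows "integrable M (\<lambda>y. indicator {y. cell e y = c} y * z y)"
    "\<bar>\<integral>y. indicator {y. cell e y = c} y * z y \<partial>M\<bar> \<le> (\<integral>y. \<bar>z y\<bar> \<partial>M)"
proof -
  show i: "integrable M (\<lambda>y. indicator {y. cell e y = c} y * z y)"
    by (rule Bochner_Integration.integrable_bound[OF assms(2)
          borel_measurable_times[OF cell_indicator_measurable[OF assms(1)] borel_measurable_integrable[OF assms(2)]]])
      (auto simp: indicator_def)
  have "\<bar>\<integral>y. indicator {y. cell e y = c} y * z y \<partial>M\<bar> \<le> (\<integral>y. \<bar>indicator {y. cell e y = c} y * z y\<bar> \<partial>M)"
    using integral_norm_bound[of M "\<lambda>y. indicator {y. cell e y = c} y * z y"] by simp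
  also have "\<dots> \<le> (\<integral>y. \<bar>z y\<bar> \<partial>M)"
    by (rule integral_mono) (use i assms(2) in \<open>auto simp: indicator_def\<close>)
  finally show "\<bar>\<integral>y. indicator {y. cell e y = c} y * z y \<partial>M\<bar> \<le> (\<integral>y. \<bar>z y\<bar> \<partial>M)" .
qed

lemma grid_avg_bound:
  assumes "0 < e" "sqi M z"
  shows "\<bar>grid_avg e z x\<bar> \<le> (\<integral>y. \<bar>z y\<bar> \<partial>M) / e ^ CARD('n)"
  using cell_coefficient_integrable(2)[OF assms(1) sqi_integrable(1)[OF assms(2)]] assms(1)
  by (simp add: grid_avg_def divide_right_mono)

lemma grid_avg_measurable:
  fixes z :: "real^'n \<Rightarrow> real"
  assumes "z \<in> borel_measurable M"
  shows "grid_avg e z \<in> borel_measurable borel"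
proof -
  note [measurable] = assms
  have m: "(\<lambda>p. indicator {y. cell e y = cell e (fst p)} (snd p) * z (snd p)) \<in> borel_measurable (borel \<Otimes>\<^sub>M M)"
  proof -
    have [measurable]: "(snd :: _ \<Rightarrow> real^'n) \<in> borel_measurable (borel \<Otimes>\<^sub>M M)"
      by (rule measurable_compose[OF measurable_snd borel_measurable_M]) simp
    have "(\<lambda>p. if cell e (snd p) = cell e (fst p) then z (snd p) else 0) \<in> borel_measurable (borel \<Otimes>\<^sub>M M)"
      by measurable
    then show ?thesis by (rule measurable_cong[THEN iffD1, rotated]) (simp add: indicator_def)
  qed
  show ?thesis unfolding grid_avg_def[abs_def]
    by (intro borel_measurable_divide borel_measurable_const borel_measurable_lebesgue_integral)
      (use m in \<open>simp add: case_prod_beta'\<close>)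
qed

lemma grid_avg_sqi: "0 < e \<Longrightarrow> sqi M z \<Longrightarrow> sqi M (grid_avg e z)"
  by (rule sqi_bounded[OF borel_measurable_M[OF grid_avg_measurable[OF sqi_measurable]]])
    (use grid_avg_bound in auto)

definition grid_const :: real where
  "grid_const = sqrt (unit_ball_vol (real CARD('n)) * real CARD('n) ^ (CARD('n) + 2))"

lemma grid_const_nonneg: "0 \<le> grid_const"
  by (simp add: grid_const_def)

lemma grid_avg_diff:
  assumes "0 < e" "sqi M z" "sqi M w"
  shows "grid_avg e (\<lambda>x. z x - w x) x = grid_avg e z x - grid_avg e w x"
  using cell_coefficient_integrable(1)[OF assms(1) sqi_integrable(1)[OF assms(2)]]
    cell_coefficient_integrable(1)[OF assms(1) sqi_integrable(1)[OF assms(3)]]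
  by (simp add: grid_avg_def right_diff_distrib diff_divide_distrib)

text \<open>For test functions this is \<open>cell_average_close\<close>. In the limit the averages
  converge at every point, so Fatou's lemma treats the left side while the energies on the right
  converge.\<close>

lemma grid_avg_close:
  assumes z: "H10 z Z" and e: "0 < e"
  shows "l2n M (\<lambda>x. z x - grid_avg e z x) \<le> grid_const * e * l2n M Z"
proof -
  obtain \<psi> where p: "\<And>n. \<psi> n \<in> test_functions \<Omega>" "l2conv M \<psi> z" "l2conv M (\<lambda>n. grad (\<psi> n)) Z"
    using H10_E[OF z] by blast
  note * = l2convD[OF p(2)]
  have t: "l2n M (\<lambda>x. \<psi> n x - grid_avg e (\<psi> n) x) \<le> grid_const * e * l2n M (grad (\<psi> n))" for n
  proof -
    note T = test_fn[OF p(1)[of n]]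
    have eq: "grid_avg e (\<psi> n) x = (\<integral>y. indicator {y. cell e y = cell e x} y * \<psi> n y \<partial>lborel) / e ^ CARD('n)" for x
    proof -
      note [measurable] = T(3) cell_emeasure(2)[OF e, of "cell e x"]
      have "(\<integral>y. indicator {y. cell e y = cell e x} y * \<psi> n y \<partial>M) = (\<integral>y. indicator {y. cell e y = cell e x} y * \<psi> n y \<partial>lborel)"
        by (rule integral_M_lborel(1)) (use T(6) in auto)
      then show "grid_avg e (\<psi> n) x = (\<integral>y. indicator {y. cell e y = cell e x} y * \<psi> n y \<partial>lborel) / e ^ CARD('n)"
        by (simp add: grid_avg_def)
    qed
    have m: "grid_avg e (\<psi> n) \<in> borel_measurable borel" by (rule grid_avg_measurable[OF sqi_measurable[OF T(1)]])
    note C = cell_average_close[OF test_functions_C1c[OF p(1)[of n]] e m[unfolded eq[abs_def]], folded eq]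
    have "l2n M (\<lambda>x. \<psi> n x - grid_avg e (\<psi> n) x) \<le> l2n lborel (\<lambda>x. \<psi> n x - grid_avg e (\<psi> n) x)"
      by (rule sqi_M_of_lborel(2)[OF C(1)])
    then show ?thesis using C(2) T(9) by (simp add: grid_const_def)
  qed
  obtain r where r: "strict_mono r" "AE x in M. (\<lambda>n. \<psi> (r n) x) \<longlonglongrightarrow> z x"
    using l2conv_AE_subseq[OF p(2)] by blast
  have av: "(\<lambda>n. grid_avg e (\<psi> n) x) \<longlonglongrightarrow> grid_avg e z x" for x
  proof -
    have "(\<lambda>n. grid_avg e (\<psi> n) x - grid_avg e z x) \<longlonglongrightarrow> 0"
    proof (rule Lim_null_comparison)
      show "\<forall>\<^sub>F n in sequentially. norm (grid_avg e (\<psi> n) x - grid_avg e z x)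
          \<le> sqrt (measure M (space M)) / e ^ CARD('n) * l2n M (\<lambda>x. \<psi> n x - z x)"
      proof (intro always_eventually allI)
        fix n
        have s: "sqi M (\<lambda>x. \<psi> n x - z x)" by (rule sqi_diff[OF *(1,2)])
        have "norm (grid_avg e (\<psi> n) x - grid_avg e z x) = \<bar>grid_avg e (\<lambda>x. \<psi> n x - z x) x\<bar>"
          by (simp add: grid_avg_diff[OF e *(1,2)])
        also have "\<dots> \<le> (\<integral>y. \<bar>\<psi> n y - z y\<bar> \<partial>M) / e ^ CARD('n)" by (rule grid_avg_bound[OF e s])
        also have "\<dots> \<le> (sqrt (measure M (space M)) * l2n M (\<lambda>x. \<psi> n x - z x)) / e ^ CARD('n)"
          using sqi_integrable(2)[OF s] e by (intro divide_right_mono) auto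
        finally show "norm (grid_avg e (\<psi> n) x - grid_avg e z x)
          \<le> sqrt (measure M (space M)) / e ^ CARD('n) * l2n M (\<lambda>x. \<psi> n x - z x)" by simp
      qed
      show "(\<lambda>n. sqrt (measure M (space M)) / e ^ CARD('n) * l2n M (\<lambda>x. \<psi> n x - z x)) \<longlonglongrightarrow> 0"
        by (rule tendsto_mult_right_zero[OF *(3)])
    qed
    then show ?thesis by (simp add: LIM_zero_iff)
  qed
  have lim: "AE x in M. (\<lambda>n. \<psi> (r n) x - grid_avg e (\<psi> (r n)) x) \<longlonglongrightarrow> z x - grid_avg e z x"
    using r(2)
  proof eventually_elim
    case (elim x)
    then show ?case using LIMSEQ_subseq_LIMSEQ[OF av r(1), of x] by (intro tendsto_diff) (auto simp: o_def)
  qed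
  have sd: "sqi M (\<lambda>x. w x - grid_avg e w x)" if "sqi M w" for w
    by (rule sqi_diff[OF that grid_avg_sqi[OF e that]])
  show ?thesis
  proof (rule field_le_epsilon)
    fix d :: real assume "0 < d"
    have "(\<lambda>n. grid_const * e * l2n M (grad (\<psi> (r n)))) \<longlonglongrightarrow> grid_const * e * l2n M Z"
      using l2conv_norm_tendsto[OF l2conv_subseq[OF p(3) r(1)]] by (rule tendsto_mult_left)
    then have "\<forall>\<^sub>F n in sequentially. grid_const * e * l2n M (grad (\<psi> (r n))) < grid_const * e * l2n M Z + d"
      by (rule order_tendstoD(2)) (use \<open>0 < d\<close> in simp)
    then have "\<forall>\<^sub>F n in sequentially. l2n M (\<lambda>x. \<psi> (r n) x - grid_avg e (\<psi> (r n)) x) \<le> grid_const * e * l2n M Z + d"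
      by eventually_elim (use t in \<open>auto intro: order_trans less_imp_le\<close>)
    then show "l2n M (\<lambda>x. z x - grid_avg e z x) \<le> grid_const * e * l2n M Z + d"
      by (rule l2n_le_liminf(2)[OF sd[OF *(1)] sqi_measurable[OF sd[OF *(2)]] lim])
  qed
qed

text \<open>Split z^2 = z (z - P z) + z (P z) with P the grid average: the first product is absorbed
  by Young's inequality, and in the second |P z| is at most the L1 norm of z divided by e^N. The
  mesh stays free until \<open>Faber_Krahn\<close>.\<close>

lemma Nash:
  assumes z: "H10 z Z" and e: "0 < e"
  shows "(l2n M z)\<^sup>2 \<le> (grid_const * e * l2n M Z)\<^sup>2 + 2 * (\<integral>x. \<bar>z x\<bar> \<partial>M)\<^sup>2 / e ^ CARD('n)"
proof -
  let ?P = "grid_avg e z" and ?N = "CARD('n)"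
  define I where "I = (\<integral>x. \<bar>z x\<bar> \<partial>M)"
  have s: "sqi M z" "sqi M ?P" "sqi M (\<lambda>x. z x - ?P x)"
    using H10_sqi[OF z] grid_avg_sqi[OF e] by auto
  have pw: "(z x)\<^sup>2 \<le> 1/2 * (z x)\<^sup>2 + 1/2 * (z x - ?P x)\<^sup>2 + I / e ^ ?N * \<bar>z x\<bar>" for x
  proof -
    have "(z x)\<^sup>2 = z x * (z x - ?P x) + z x * ?P x" by (simp add: power2_eq_square algebra_simps)
    moreover have "z x * (z x - ?P x) \<le> 1/2 * (z x)\<^sup>2 + 1/2 * (z x - ?P x)\<^sup>2"
      using sum_squares_bound[of "z x" "z x - ?P x"] by simp
    moreover have "z x * ?P x \<le> \<bar>z x\<bar> * (I / e ^ ?N)"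
      using mult_left_mono[OF grid_avg_bound[OF e s(1), of x], of "\<bar>z x\<bar>"] abs_ge_self[of "z x * ?P x"]
      by (simp add: abs_mult I_def)
    ultimately show ?thesis by (simp add: mult.commute)
  qed
  have "(l2n M z)\<^sup>2 = (\<integral>x. (z x)\<^sup>2 \<partial>M)" by (simp add: l2n_power2)
  also have "\<dots> \<le> (\<integral>x. 1/2 * (z x)\<^sup>2 + 1/2 * (z x - ?P x)\<^sup>2 + I / e ^ ?N * \<bar>z x\<bar> \<partial>M)"
    by (rule integral_mono[OF _ _ pw]) (use s sqi_integrable(1)[OF s(1)] in \<open>auto simp: sqi_def\<close>)
  also have "\<dots> = 1/2 * (l2n M z)\<^sup>2 + 1/2 * (l2n M (\<lambda>x. z x - ?P x))\<^sup>2 + I / e ^ ?N * I"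
    using s sqi_integrable(1)[OF s(1)] by (simp add: sqi_def l2n_power2 I_def)
  finally have "(l2n M z)\<^sup>2 \<le> (l2n M (\<lambda>x. z x - ?P x))\<^sup>2 + 2 * I\<^sup>2 / e ^ ?N" by (simp add: power2_eq_square)
  moreover have "(l2n M (\<lambda>x. z x - ?P x))\<^sup>2 \<le> (grid_const * e * l2n M Z)\<^sup>2"
    by (rule power_mono[OF grid_avg_close[OF z e]]) simp
  ultimately show ?thesis by (simp add: I_def)
qed

definition FK_const :: real where
  "FK_const = 2 * grid_const\<^sup>2 * 4 powr (2 / real CARD('n))"

lemma FK_const_nonneg: "0 \<le> FK_const"
  by (simp add: FK_const_def)

text \<open>The squared L1 norm of a function vanishing off A is at most |A| times its squared L2
  norm. With the mesh given by e^N = 4 |A| the last term of \<open>Nash\<close> is at most half of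
  the left side and is absorbed; this is the origin of the 4 and the 2 in
  \<open>FK_const\<close>.\<close>

lemma Faber_Krahn:
  assumes z: "H10 z Z" and A: "A \<in> sets M" "AE x in M. x \<notin> A \<longrightarrow> z x = 0"
  shows "(l2n M z)\<^sup>2 \<le> FK_const * measure M A powr (2 / real CARD('n)) * (l2n M Z)\<^sup>2"
proof -
  let ?N = "CARD('n)"
  define m where "m = measure M A"
  have s: "sqi M z" using H10_sqi[OF z] by auto
  have I: "(\<integral>x. \<bar>z x\<bar> \<partial>M) \<le> sqrt m * l2n M z"
  proof -
    have si: "sqi M (indicator A :: _ \<Rightarrow> real)" by (rule sqi_bounded[of _ 1]) (use A(1) in auto)
    have "(\<integral>x. \<bar>z x\<bar> \<partial>M) = (\<integral>x. norm (indicator A x :: real) * norm (z x) \<partial>M)"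
      by (rule integral_cong_AE)
        (use A sqi_measurable[OF s] in \<open>auto elim!: eventually_mono simp: indicator_def\<close>)
    also have "\<dots> \<le> l2n M (indicator A :: _ \<Rightarrow> real) * l2n M z" by (rule l2_Cauchy_Schwarz_norm[OF si s])
    also have "l2n M (indicator A :: _ \<Rightarrow> real) = sqrt m"
    proof -
      have "(norm (indicator A x :: real))\<^sup>2 = indicator A x" for x :: "real^'n" by (simp add: indicator_def)
      then show ?thesis using A(1) sets.sets_into_space[OF A(1)] by (simp add: l2n_def m_def Int_absorb2)
    qed
    finally show ?thesis .
  qed
  show ?thesis
  proof (cases "m = 0")
    case True
    then have "(\<integral>x. \<bar>z x\<bar> \<partial>M) = 0" using I by (simp add: antisym)
    then have "AE x in M. z x = 0" using sqi_integrable(1)[OF s] by (simp add: integral_nonneg_eq_0_iff_AE)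
    then have "l2n M z = l2n M (\<lambda>x. 0 :: real)" by (intro l2n_cong_AE) (use sqi_measurable[OF s] in auto)
    then have "l2n M z = 0" by (simp add: l2n_def)
    then show ?thesis using FK_const_nonneg by simp
  next
    case False
    then have m: "0 < m" using measure_nonneg[of M A] unfolding m_def by linarith
    define e where "e = (4 * m) powr (1 / real ?N)"
    have e: "0 < e" using m by (simp add: e_def)
    have eN: "e ^ ?N = 4 * m" using m by (simp add: e_def powr_powr flip: powr_realpow)
    have e2: "e\<^sup>2 = 4 powr (2 / real ?N) * m powr (2 / real ?N)"
      using m by (simp add: e_def powr_mult powr_powr power_mult_distrib flip: powr_realpow)
    have "(\<integral>x. \<bar>z x\<bar> \<partial>M)\<^sup>2 \<le> (sqrt m * l2n M z)\<^sup>2" by (rule power_mono[OF I]) simp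
    then have "2 * (\<integral>x. \<bar>z x\<bar> \<partial>M)\<^sup>2 / e ^ ?N \<le> 1/2 * (l2n M z)\<^sup>2"
      using m unfolding eN by (simp add: power_mult_distrib field_simps)
    then have "(l2n M z)\<^sup>2 \<le> 2 * (grid_const * e * l2n M Z)\<^sup>2" using Nash[OF z e] by linarith
    also have "\<dots> = FK_const * m powr (2 / real ?N) * (l2n M Z)\<^sup>2"
      by (simp add: power_mult_distrib e2 FK_const_def)
    finally show ?thesis by (simp add: m_def)
  qed
qed

definition vol where "vol = measure M \<Omega>"

definition Poincare_const :: real where
  "Poincare_const = sqrt (FK_const * vol powr (2 / real CARD('n)))"

lemma vol_nonneg: "0 \<le> vol" by (simp add: vol_def)

lemma measure_le_vol: "measure M A \<le> vol"
  unfolding vol_def using bounded_measure[of A] by simp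

lemma Poincare_const_nonneg: "0 \<le> Poincare_const"
  using FK_const_nonneg by (simp add: Poincare_const_def)

lemma Poincare:
  assumes "H10 z Z" shows "l2n M z \<le> Poincare_const * l2n M Z"
proof -
  have "(l2n M z)\<^sup>2 \<le> FK_const * vol powr (2 / real CARD('n)) * (l2n M Z)\<^sup>2"
    unfolding vol_def by (rule Faber_Krahn[OF assms]) auto
  also have "\<dots> = (Poincare_const * l2n M Z)\<^sup>2"
    using FK_const_nonneg by (simp add: Poincare_const_def power_mult_distrib)
  finally show ?thesis
    by (rule power2_le_imp_le) (simp add: Poincare_const_nonneg)
qed

text \<open>Chebyshev's inequality below and \<open>Faber_Krahn\<close> above: the truncation equals
  l - k above the level l and vanishes below k.\<close>

lemma level_set_estimate:
  assumes v: "H10 (\<lambda>x. step k l (\<xi> x)) V" and kl: "k < l" and \<xi>: "\<xi> \<in> borel_measurable M"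
  shows "(l - k)\<^sup>2 * measure M {x\<in>\<Omega>. l \<le> \<xi> x}
    \<le> FK_const * measure M {x\<in>\<Omega>. k < \<xi> x} powr (2 / real CARD('n)) * (l2n M V)\<^sup>2"
proof -
  note S = step_props[OF kl]
  note [measurable] = \<xi>
  have sets: "{x\<in>\<Omega>. l \<le> \<xi> x} \<in> sets M" "{x\<in>\<Omega>. k < \<xi> x} \<in> sets M"
    using measurable_sets[OF \<xi>, of "{l..}"] measurable_sets[OF \<xi>, of "{k<..}"]
    by (auto simp: vimage_def Int_def conj_commute)
  have s: "sqi M (\<lambda>x. step k l (\<xi> x))" using H10_sqi[OF v] by auto
  have "(l - k)\<^sup>2 * measure M {x\<in>\<Omega>. l \<le> \<xi> x} = (\<integral>x. (l - k)\<^sup>2 * indicator {x\<in>\<Omega>. l \<le> \<xi> x} x \<partial>M)"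
  proof -
    have "{x\<in>\<Omega>. l \<le> \<xi> x} \<inter> \<Omega> = {x\<in>\<Omega>. l \<le> \<xi> x}" by auto
    then show ?thesis using sets by simp
  qed
  also have "\<dots> \<le> (\<integral>x. (step k l (\<xi> x))\<^sup>2 \<partial>M)"
  proof (rule integral_mono)
    show "(l - k)\<^sup>2 * indicator {x\<in>\<Omega>. l \<le> \<xi> x} x \<le> (step k l (\<xi> x))\<^sup>2" for x
      by (cases "l \<le> \<xi> x") (auto simp: S(8) indicator_def)
  qed (use s sets in \<open>auto simp: sqi_def emeasure_eq_measure intro!: integrable_real_indicator\<close>)
  also have "\<dots> = (l2n M (\<lambda>x. step k l (\<xi> x)))\<^sup>2" by (simp add: l2n_power2)
  also have "\<dots> \<le> FK_const * measure M {x\<in>\<Omega>. k < \<xi> x} powr (2 / real CARD('n)) * (l2n M V)\<^sup>2"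
    by (rule Faber_Krahn[OF v sets(2)]) (auto intro!: AE_I2 S(6))
  finally show ?thesis .
qed

lemma cell_finite_range: "0 < e \<Longrightarrow> finite (cell e ` \<Omega>)"
proof -
  assume e: "0 < e"
  obtain b where b: "\<And>x. x \<in> \<Omega> \<Longrightarrow> norm x \<le> b" using bounded_domain by (auto simp: bounded_iff)
  have "cell e ` \<Omega> \<subseteq> {c. \<forall>i. c $ i \<in> {\<lfloor>- b / e\<rfloor>..\<lfloor>b / e\<rfloor>}}"
  proof clarify
    fix x i assume "x \<in> \<Omega>"
    then have "\<bar>x $ i\<bar> \<le> b" using b component_le_norm_cart order_trans by blast
    then show "cell e x $ i \<in> {\<lfloor>- b / e\<rfloor>..\<lfloor>b / e\<rfloor>}"
      using e divide_right_mono[of "- b" "x $ i" e] divide_right_mono[of "x $ i" b e]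
      by (auto simp: cell_def intro!: floor_mono)
  qed
  moreover have "finite {c :: int^'n. \<forall>i. c $ i \<in> {\<lfloor>- b / e\<rfloor>..\<lfloor>b / e\<rfloor>}}"
  proof (rule finite_subset)
    show "{c :: int^'n. \<forall>i. c $ i \<in> {\<lfloor>- b / e\<rfloor>..\<lfloor>b / e\<rfloor>}} \<subseteq>
      (\<lambda>f. \<chi> i. f i) ` (UNIV \<rightarrow>\<^sub>E {\<lfloor>- b / e\<rfloor>..\<lfloor>b / e\<rfloor>})"
    proof
      fix c :: "int^'n" assume "c \<in> {c. \<forall>i. c $ i \<in> {\<lfloor>- b / e\<rfloor>..\<lfloor>b / e\<rfloor>}}"
      then show "c \<in> (\<lambda>f. \<chi> i. f i) ` (UNIV \<rightarrow>\<^sub>E {\<lfloor>- b / e\<rfloor>..\<lfloor>b / e\<rfloor>})"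
        by (intro image_eqI[of _ _ "\<lambda>i. c $ i"]) auto
    qed
    show "finite ((\<lambda>f. \<chi> i. f i) ` (UNIV \<rightarrow>\<^sub>E {\<lfloor>- b / e\<rfloor>..\<lfloor>b / e\<rfloor>}) :: (int^'n) set)"
      by (intro finite_imageI finite_PiE) auto
  qed
  ultimately show ?thesis by (rule finite_subset)
qed

text \<open>For a fixed mesh the averages are determined by finitely many integrals, and a diagonal
  argument makes these converge for countably many meshes at once. By \<open>grid_avg_close\<close>
  the functions stay uniformly close to their averages, hence form a Cauchy sequence.\<close>

lemma Rellich:
  assumes z: "\<And>n::nat. H10 (z n) (Z n)" and R: "\<And>n. l2n M (Z n) \<le> R"
  obtains r w where "strict_mono (r :: nat \<Rightarrow> nat)" "l2conv M (\<lambda>n. z (r n)) w"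
proof -
  have R0: "0 \<le> R" using order_trans[OF l2n_nonneg R] .
  have s: "sqi M (z n)" for n using H10_sqi[OF z] by auto
  define B where "B = sqrt (measure M (space M)) * (Poincare_const * R)"
  have zB: "(\<integral>y. \<bar>z n y\<bar> \<partial>M) \<le> B" for n
  proof -
    have "l2n M (z n) \<le> Poincare_const * R"
      using Poincare[OF z] mult_left_mono[OF R Poincare_const_nonneg] by (rule order_trans)
    then have "sqrt (measure M (space M)) * l2n M (z n) \<le> B" unfolding B_def by (rule mult_left_mono) simp
    then show ?thesis using sqi_integrable(2)[OF s[of n]] by simp
  qed
  define e where "e j = 1 / real (Suc j)" for j
  have e: "0 < e j" for j by (simp add: e_def)
  define S where "S = (\<Union>j. {j} \<times> cell (e j) ` \<Omega>)"
  have "countable S"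
    unfolding S_def 
  proof (rule countable_UN)
    show "countable ({j} \<times> cell (e j) ` \<Omega>)" for j
      by (rule countable_finite) (simp add: cell_finite_range[OF e])
  qed simp
  define a where "a n p = (\<integral>y. indicator {y. cell (e (fst p)) y = snd p} y * z n y \<partial>M)" for n p
  have aB: "norm (a n p) \<le> B" if "p \<in> S" for n p
    using order_trans[OF cell_coefficient_integrable(2)[OF e sqi_integrable(1)[OF s]] zB] by (simp add: a_def)
  obtain r where r: "strict_mono (r :: nat \<Rightarrow> nat)" "\<And>p. p \<in> S \<Longrightarrow> \<exists>l. (\<lambda>n. a (r n) p) \<longlonglongrightarrow> l"
    by (rule function_convergent_subsequence[of S a B, OF \<open>countable S\<close> aB]) blast+
  have conv: "\<exists>l. (\<lambda>n. grid_avg (e j) (z (r n)) x) \<longlonglongrightarrow> l" if "x \<in> \<Omega>" for j x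
  proof -
    have "(j, cell (e j) x) \<in> S" using that by (auto simp: S_def)
    then obtain l where l: "(\<lambda>n. a (r n) (j, cell (e j) x)) \<longlonglongrightarrow> l" using r(2) by blast
    have "(\<lambda>n. a (r n) (j, cell (e j) x) / e j ^ CARD('n)) \<longlonglongrightarrow> l / e j ^ CARD('n)"
      by (intro tendsto_divide l tendsto_const) (use e[of j] in simp)
    then show ?thesis by (auto simp: a_def grid_avg_def)
  qed
  have P: "\<exists>g. l2conv M (\<lambda>n. grid_avg (e j) (z (r n))) g" for j
  proof -
    define g where "g x = lim (\<lambda>n. grid_avg (e j) (z (r n)) x)" for x
    note [measurable] = borel_measurable_M[OF grid_avg_measurable[OF sqi_measurable[OF s]]]
    have "l2conv M (\<lambda>n. grid_avg (e j) (z (r n))) g"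
    proof (rule l2conv_dominated[OF sqi_const[of "B / e j ^ CARD('n)"]])
      show "grid_avg (e j) (z (r n)) \<in> borel_measurable M" for n by measurable
      show "g \<in> borel_measurable M" unfolding g_def by measurable
      show "AE x in M. (\<lambda>n. grid_avg (e j) (z (r n)) x) \<longlonglongrightarrow> g x"
      proof (rule AE_I2)
        fix x assume "x \<in> space M"
        then have "x \<in> \<Omega>" by simp
        from conv[OF this, of j] have "convergent (\<lambda>n. grid_avg (e j) (z (r n)) x)" by (simp add: convergent_def)
        then show "(\<lambda>n. grid_avg (e j) (z (r n)) x) \<longlonglongrightarrow> g x" by (simp add: g_def convergent_LIMSEQ_iff)
      qed
      show "AE x in M. norm (grid_avg (e j) (z (r n)) x) \<le> norm (B / e j ^ CARD('n))" for n
      proof (rule AE_I2)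
        fix x
        have "\<bar>grid_avg (e j) (z (r n)) x\<bar> \<le> (\<integral>y. \<bar>z (r n) y\<bar> \<partial>M) / e j ^ CARD('n)" by (rule grid_avg_bound[OF e s])
        also have "\<dots> \<le> B / e j ^ CARD('n)" using zB e[of j] by (intro divide_right_mono) auto
        also have "\<dots> \<le> norm (B / e j ^ CARD('n))" by (simp only: real_norm_def abs_ge_self)
        finally show "norm (grid_avg (e j) (z (r n)) x) \<le> norm (B / e j ^ CARD('n))" by simp
      qed
    qed
    then show ?thesis by blast
  qed
  have "\<exists>w. l2conv M (\<lambda>n. z (r n)) w"
  proof (rule l2_complete[OF s])
    fix d :: real assume "0 < d"
    obtain j where j: "2 * (grid_const * e j * R) < d / 2"
    proof -
      have "(\<lambda>j. 2 * (grid_const * e j * R)) \<longlonglongrightarrow> 2 * (grid_const * 0 * R)"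
        unfolding e_def by (intro tendsto_intros LIMSEQ_Suc lim_1_over_n)
      then have "\<forall>\<^sub>F j in sequentially. 2 * (grid_const * e j * R) < d / 2"
        by (rule order_tendstoD(2)) (use \<open>0 < d\<close> in simp)
      then show thesis using that by (auto simp: eventually_sequentially)
    qed
    obtain g where g: "l2conv M (\<lambda>n. grid_avg (e j) (z (r n))) g" using P by blast
    have "\<forall>\<^sub>F n in sequentially. l2n M (\<lambda>x. grid_avg (e j) (z (r n)) x - g x) < d / 4"
      by (rule order_tendstoD(2)[OF l2convD(3)[OF g]]) (use \<open>0 < d\<close> in simp)
    then obtain K where K: "\<And>n. n \<ge> K \<Longrightarrow> l2n M (\<lambda>x. grid_avg (e j) (z (r n)) x - g x) < d / 4"
      by (auto simp: eventually_sequentially)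
    have c: "l2n M (\<lambda>x. z (r n) x - grid_avg (e j) (z (r n)) x) \<le> grid_const * e j * R" for n
      using grid_avg_close[OF z e] mult_left_mono[OF R, of "grid_const * e j"] grid_const_nonneg e[of j]
      by (meson order_trans less_imp_le mult_nonneg_nonneg)
    have sP: "sqi M (grid_avg (e j) (z n))" for n by (rule grid_avg_sqi[OF e s])
    show "\<exists>K. \<forall>m\<ge>K. \<forall>n\<ge>K. l2n M (\<lambda>x. z (r m) x - z (r n) x) < d"
    proof (intro exI[of _ K] allI impI)
      fix m n assume mn: "m \<ge> K" "n \<ge> K"
      let ?p = "\<lambda>n. grid_avg (e j) (z (r n))"
      have "l2n M (\<lambda>x. z (r m) x - z (r n) x) \<le> l2n M (\<lambda>x. z (r m) x - ?p m x) + l2n M (\<lambda>x. ?p m x - z (r n) x)"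
        by (rule l2n_triangle3[OF s sP s])
      also have "l2n M (\<lambda>x. ?p m x - z (r n) x) \<le> l2n M (\<lambda>x. ?p m x - g x) + l2n M (\<lambda>x. g x - z (r n) x)"
        by (rule l2n_triangle3[OF sP l2convD(2)[OF g] s])
      also have "l2n M (\<lambda>x. g x - z (r n) x) \<le> l2n M (\<lambda>x. g x - ?p n x) + l2n M (\<lambda>x. ?p n x - z (r n) x)"
        by (rule l2n_triangle3[OF l2convD(2)[OF g] sP s])
      finally show "l2n M (\<lambda>x. z (r m) x - z (r n) x) < d"
        using K[OF mn(1)] K[OF mn(2)] c[of m] c[of n] j
          l2n_minus_commute[of M g "?p n"] l2n_minus_commute[of M "?p n" "z (r n)"] by linarith
    qed
  qed
  then show thesis using that r(1) by blast
qed

end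

section \<open>Integration of H10 functions against L^r functions\<close>

context bounded_domain
begin

lemma zero_wgr: "wgr (\<lambda>x. 0) (\<lambda>x. 0)"
  by (simp add: wgr_def)

lemma H10_step:
  assumes v: "H10 v V" and k: "0 \<le> k" "k < l"
  shows "H10 (\<lambda>x. step k l (v x)) (\<lambda>x. step' k l (v x) *\<^sub>R V x)"
    "l2n M (\<lambda>x. step' k l (v x) *\<^sub>R V x) \<le> 2 * l2n M V"
proof -
  note S = step_props[OF k(2)]
  have "H10 (\<lambda>x. step k l (0 + v x)) (\<lambda>x. step' k l (0 + v x) *\<^sub>R (0 + V x))"
    by (rule H10_compose[OF zero_wgr, of "{0}"]) (use v S(1,6,7) k in auto)
  then show h: "H10 (\<lambda>x. step k l (v x)) (\<lambda>x. step' k l (v x) *\<^sub>R V x)" by simp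
  show "l2n M (\<lambda>x. step' k l (v x) *\<^sub>R V x) \<le> 2 * l2n M V"
  proof (rule l2n_mono)
    show "AE x in M. norm (step' k l (v x) *\<^sub>R V x) \<le> 2 * norm (V x)"
    proof (rule AE_I2)
      fix x show "norm (step' k l (v x) *\<^sub>R V x) \<le> 2 * norm (V x)"
        using mult_right_mono[OF S(3) norm_ge_zero, of "v x" "V x"] S(2) by simp
    qed
  qed (use H10_sqi[OF v] sqi_measurable[OF H10_sqi(2)[OF h]] in auto)
qed

lemma dyadic_cover:
  assumes "1 < (t::real)" shows "\<exists>j::nat. 2^j < t \<and> t \<le> 2^Suc j"
proof -
  obtain n where n: "t < 2^n" using real_arch_pow[of 2 t] by auto
  define m where "m = (LEAST n. t \<le> 2^n)"
  have m: "t \<le> 2^m" unfolding m_def by (rule LeastI[of _ n]) (use n in simp)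
  have "m \<noteq> 0" using m assms by (intro notI) simp
  then obtain j where j: "m = Suc j" by (cases m) auto
  have "\<not> t \<le> 2^j" using not_less_Least[of j "\<lambda>n. t \<le> 2^n"] j by (simp add: m_def)
  then show ?thesis using m j by (intro exI[of _ j]) auto
qed

text \<open>A substitute for the Sobolev embedding: \<open>level_set_estimate\<close> at the levels
  2^j forces the superlevel sets to have measure of order 2^(-s j), and Hoelder's inequality on the
  dyadic layers leaves a geometric series. The positive part of v is treated alone because the
  truncations start at nonnegative levels.\<close>

lemma dual_bound_unit:
  assumes N: "2 \<le> CARD('n)" and r: "r > real CARD('n) / 2"
  shows "\<exists>C\<ge>0. \<forall>H\<in>Lp M r. \<forall>v V. H10 v V \<longrightarrow> l2n M V \<le> 1 \<longrightarrow>
    (\<integral>\<^sup>+x. ennreal (\<bar>H x\<bar> * max (v x) 0) \<partial>M) \<le> ennreal (C * Lp_norm M r H)"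
proof -
  let ?N = "real CARD('n)"
  have N2: "2 \<le> ?N" using N by simp
  have r1: "r > 1" using r N2 by linarith
  define p where "p = 1 - 1/r"
  have p: "0 < p" using r1 by (simp add: p_def)
  \<comment> \<open>The midpoint of an interval: \<gamma> has to exceed 0 and 2/r - 1 and to stay
    below 1 and 2/N. There is room because r > N/2 gives 2/r < 4/N, and 4/N - 1 \<le> 2/N from
    dimension 2 on. Since 2/N = 1 for N = 2, the exponent 2/N itself cannot serve.\<close>
  define \<gamma> where "\<gamma> = (max 0 (2/r - 1) + min 1 (2/?N)) / 2"
  have "2/r < 4/?N" using r r1 N2 by (simp add: field_simps)
  moreover have "4/?N - 1 \<le> 2/?N" using N2 by (simp add: field_simps)
  ultimately have "2/r - 1 < 2/?N" by linarith
  moreover have "2/r - 1 < 1" using r1 by (simp add: field_simps)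
  moreover have "0 < 2/?N" using N2 by simp
  ultimately have \<gamma>: "0 < \<gamma>" "2/r - 1 < \<gamma>" "\<gamma> < 1" "\<gamma> < 2/?N" 
  proof -
    have gen: "0 < (max 0 (x - 1) + min 1 y) / 2 \<and> x - 1 < (max 0 (x - 1) + min 1 y) / 2 \<and>
      (max 0 (x - 1) + min 1 y) / 2 < 1 \<and> (max 0 (x - 1) + min 1 y) / 2 < y"
      if "x - 1 < y" "x - 1 < 1" "0 < y" for x y :: real
      using that by (auto simp: max_def min_def)
    assume "2/r - 1 < 2/?N" "2/r - 1 < 1" "0 < 2/?N"
    from gen[OF this] show "0 < \<gamma>" "2/r - 1 < \<gamma>" "\<gamma> < 1" "\<gamma> < 2/?N" by (simp_all only: \<gamma>_def)
  qed
  \<comment> \<open>The decay rate that the recursion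
    \<open>4^j * a (Suc j) \<le> C2 * a j powr \<gamma>\<close> reproduces, that is the solution of
    s = 2 + s \<gamma>. The inequality s p > 1 below is the summability of the layers.\<close>
  define s where "s = 2 / (1 - \<gamma>)"
  have s: "0 < s" "s = 2 + s * \<gamma>" using \<gamma> by (auto simp: s_def field_simps)
  have sp: "s * p > 1"
  proof -
    have "1 - \<gamma> < 2 * p" using \<gamma>(2) by (simp add: p_def)
    then show ?thesis using \<gamma>(3) by (simp add: s_def field_simps)
  qed
  define C1 where "C1 = FK_const * (4)"
  define C2 where "C2 = C1 * vol powr (2/?N - \<gamma>)"
  have C0: "0 \<le> C1" "0 \<le> C2" using FK_const_nonneg by (auto simp: C1_def C2_def)
  \<comment> \<open>Large enough to start the induction, since a 0 is at most vol, and to close it: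
    C2 2^s B^\<gamma> \<le> B.\<close>
  define B where "B = max vol ((C2 * 2 powr s) powr (1 / (1 - \<gamma>)))"
  have B: "vol \<le> B" "0 \<le> B" using vol_nonneg by (auto simp: B_def)
  have BC: "C2 * 2 powr s * B powr \<gamma> \<le> B"
  proof (cases "B = 0")
    case False
    then have Bp: "0 < B" using B by simp
    have "C2 * 2 powr s = ((C2 * 2 powr s) powr (1 / (1 - \<gamma>))) powr (1 - \<gamma>)"
      using \<gamma> C0 by (simp add: powr_powr)
    also have "\<dots> \<le> B powr (1 - \<gamma>)" using \<gamma> by (intro powr_mono2) (auto simp: B_def)
    finally have "C2 * 2 powr s * B powr \<gamma> \<le> B powr (1 - \<gamma>) * B powr \<gamma>" by (rule mult_right_mono) simp
    also have "\<dots> = B" using Bp by (simp flip: powr_add)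
    finally show ?thesis .
  qed simp
  \<comment> \<open>The ratio of the geometric series: on the j-th layer v is of size 2^j, and
    Hoelder's inequality contributes the measure 2^(-s j) to the power p.\<close>
  define \<theta> where "\<theta> = 2 powr (1 - s * p)"
  have \<theta>: "0 \<le> \<theta>" "\<theta> < 1" using sp by (auto simp: \<theta>_def powr_less_one)
  define C where "C = 2 * vol powr p + 4 * B powr p * (1 / (1 - \<theta>))"
  have Cn: "0 \<le> C" using \<theta> by (simp add: C_def)
  show ?thesis
  proof (intro exI[of _ C] conjI ballI allI impI Cn)
    fix H v V assume H: "H \<in> Lp M r" and v: "H10 v V" and V1: "l2n M V \<le> 1"
    define h where "h = Lp_norm M r H"
    have h0: "0 \<le> h" by (simp add: h_def Lp_norm_def)
    have vm: "v \<in> borel_measurable M" using sqi_measurable[OF H10_sqi(1)[OF v]] .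
    have Hm: "H \<in> borel_measurable M" using H by (simp add: Lp_def)
    note [measurable] = vm Hm
    define A where "A j = {x\<in>\<Omega>. 2^j < v x}" for j :: nat
    have As[measurable]: "A j \<in> sets M" for j
      using measurable_sets[OF vm, of "{2^j<..}"] by (auto simp: A_def vimage_def Int_def conj_commute)
    define a where "a j = measure M (A j)" for j
    have a0: "0 \<le> a j" "a j \<le> vol" for j by (auto simp: a_def measure_le_vol)
    have rec: "4^j * a (Suc j) \<le> C2 * a j powr \<gamma>" for j
    proof -
      have kl: "(0::real) \<le> 2^j" "(2::real)^j < 2^Suc j" by auto
      note hs = H10_step[OF v kl]
      have le: "a (Suc j) \<le> measure M {x\<in>\<Omega>. 2^Suc j \<le> v x}"
        unfolding a_def A_def
        by (rule finite_measure_mono) (use measurable_sets[OF vm, of "{2^Suc j..}"] in \<open>auto simp: vimage_def Int_def conj_commute\<close>)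
      have "(2^Suc j - 2^j)\<^sup>2 = (4::real)^j" by (simp add: power2_eq_square flip: power_mult_distrib)
      then have "4^j * measure M {x\<in>\<Omega>. 2^Suc j \<le> v x}
         \<le> FK_const * a j powr (2/?N) * (l2n M (\<lambda>x. step' (2^j) (2^Suc j) (v x) *\<^sub>R V x))\<^sup>2"
        using level_set_estimate[OF hs(1) kl(2) vm] by (simp add: a_def A_def)
      also have "\<dots> \<le> FK_const * a j powr (2/?N) * 2\<^sup>2"
        using hs(2) V1 FK_const_nonneg by (intro mult_left_mono power_mono) auto
      also have "\<dots> = C1 * a j powr (2/?N)" by (simp add: C1_def power2_eq_square)
      also have "a j powr (2/?N) = a j powr (2/?N - \<gamma>) * a j powr \<gamma>" by (simp flip: powr_add)
      also have "C1 * (a j powr (2/?N - \<gamma>) * a j powr \<gamma>) \<le> C1 * (vol powr (2/?N - \<gamma>) * a j powr \<gamma>)"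
        using a0[of j] \<gamma> C0 by (intro mult_left_mono mult_right_mono powr_mono2) auto
      finally have "4^j * measure M {x\<in>\<Omega>. 2^Suc j \<le> v x} \<le> C2 * a j powr \<gamma>" by (simp add: C2_def)
      then show ?thesis by (rule order_trans[rotated]) (rule mult_left_mono[OF le], simp)
    qed
    have decay: "a j \<le> B * 2 powr (- s * real j)" for j
    proof (induction j)
      case 0 then show ?case using a0(2)[of 0] B by simp
    next
      case (Suc j)
      have "4^j * a (Suc j) \<le> C2 * (B * 2 powr (- s * real j)) powr \<gamma>"
        using Suc rec[of j] a0[of j] C0 \<gamma> by (intro order_trans[OF rec] mult_left_mono powr_mono2) auto
      also have "\<dots> = C2 * B powr \<gamma> * 2 powr (- s * real j * \<gamma>)"
        using B by (simp add: powr_mult powr_powr)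
      also have "2 powr (- s * real j * \<gamma>) = 4^j * (2 powr s * 2 powr (- s * real (Suc j)))"
      proof -
        have "(4::real)^j = 2 powr (2 * real j)"
          using powr_realpow[of 4 j] powr_powr[of 2 2 "real j"] by simp
        moreover have "- s * real j * \<gamma> = 2 * real j + (s + - s * real (Suc j))"
          using arg_cong[OF s(2), of "\<lambda>x. real j * x"] by (simp add: algebra_simps)
        ultimately show ?thesis by (simp only: powr_add)
      qed
      also have "C2 * B powr \<gamma> * (4^j * (2 powr s * 2 powr (- s * real (Suc j))))
         = 4^j * ((C2 * 2 powr s * B powr \<gamma>) * 2 powr (- s * real (Suc j)))" by (simp only: mult_ac)
      also have "\<dots> \<le> 4^j * (B * 2 powr (- s * real (Suc j)))"
        using BC by (intro mult_left_mono mult_right_mono) auto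
      finally show ?case by simp
    qed
    have level_term: "(\<integral>\<^sup>+x. ennreal (2 * 2^j * (\<bar>H x\<bar> * indicator (A j) x)) \<partial>M) \<le> ennreal (4 * h * B powr p * \<theta>^j)" for j
    proof -
      note L = Lp_integral_set[OF H r1 As[of j]]
      have i: "integrable M (\<lambda>x. \<bar>H x\<bar> * indicator (A j) x)"
        using integrable_mult_indicator[OF As[of j] integrable_abs[OF L(1)]] by (simp add: mult.commute)
      have "(\<integral>\<^sup>+x. ennreal (2 * 2^j * (\<bar>H x\<bar> * indicator (A j) x)) \<partial>M)
         = ennreal (\<integral>x. 2 * 2^j * (\<bar>H x\<bar> * indicator (A j) x) \<partial>M)"
        using i by (intro nn_integral_eq_integral) auto
      also have "(\<integral>x. 2 * 2^j * (\<bar>H x\<bar> * indicator (A j) x) \<partial>M) = 2 * 2^j * (\<integral>x. \<bar>H x\<bar> * indicator (A j) x \<partial>M)"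
        by (rule integral_mult_right_zero)
      also have "ennreal (2 * 2^j * (\<integral>x. \<bar>H x\<bar> * indicator (A j) x \<partial>M)) \<le> ennreal (4 * h * B powr p * \<theta>^j)"
      proof (rule ennreal_leI)
        have "2 * 2^j * (\<integral>x. \<bar>H x\<bar> * indicator (A j) x \<partial>M) \<le> 2 * 2^j * (2 * h * a j powr p)"
          using L(2) by (intro mult_left_mono) (auto simp: h_def a_def p_def)
        also have "\<dots> \<le> 2 * 2^j * (2 * h * (B * 2 powr (- s * real j)) powr p)"
          using decay[of j] a0 h0 p by (intro mult_left_mono powr_mono2) auto
        also have "(B * 2 powr (- s * real j)) powr p = B powr p * 2 powr (- s * real j * p)"
          using B by (simp add: powr_mult powr_powr)
        also have "2 * 2^j * (2 * h * (B powr p * 2 powr (- s * real j * p))) = 4 * h * B powr p * \<theta>^j"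
        proof -
          have "\<theta>^j = 2 powr (real j + - s * real j * p)"
            unfolding \<theta>_def by (subst powr_realpow[symmetric]) (simp_all add: powr_powr algebra_simps)
          then have "\<theta>^j = 2^j * 2 powr (- s * real j * p)" by (simp only: powr_add powr_realpow zero_less_numeral)
          then show ?thesis by simp
        qed
        finally show "2 * 2^j * (\<integral>x. \<bar>H x\<bar> * indicator (A j) x \<partial>M) \<le> 4 * h * B powr p * \<theta>^j" .
      qed
      finally show ?thesis .
    qed
    have "(\<integral>\<^sup>+x. ennreal (\<bar>H x\<bar> * max (v x) 0) \<partial>M)
      \<le> (\<integral>\<^sup>+x. ennreal \<bar>H x\<bar> + (\<Sum>j. ennreal (2 * 2^j * (\<bar>H x\<bar> * indicator (A j) x))) \<partial>M)"
    proof (rule nn_integral_mono)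
      fix x assume "x \<in> space M"
      then have x: "x \<in> \<Omega>" by simp
      show "ennreal (\<bar>H x\<bar> * max (v x) 0) \<le> ennreal \<bar>H x\<bar> + (\<Sum>j. ennreal (2 * 2^j * (\<bar>H x\<bar> * indicator (A j) x)))"
      proof (cases "v x \<le> 1")
        case True
        have "\<bar>H x\<bar> * max (v x) 0 \<le> \<bar>H x\<bar> * 1" using True by (intro mult_left_mono) auto
        then have "ennreal (\<bar>H x\<bar> * max (v x) 0) \<le> ennreal \<bar>H x\<bar>" by (intro ennreal_leI) simp
        then show ?thesis by (rule order_trans) simp
      next
        case False
        then obtain j where j: "2^j < v x" "v x \<le> 2^Suc j" using dyadic_cover[of "v x"] by auto
        then have "x \<in> A j" using x by (simp add: A_def)
        then have "\<bar>H x\<bar> * max (v x) 0 \<le> 2 * 2^j * (\<bar>H x\<bar> * indicator (A j) x)"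
          using False j mult_left_mono[OF j(2), of "\<bar>H x\<bar>"] by (simp add: mult_ac)
        then have "ennreal (\<bar>H x\<bar> * max (v x) 0) \<le> ennreal (2 * 2^j * (\<bar>H x\<bar> * indicator (A j) x))" by (rule ennreal_leI)
        also have "\<dots> = (\<Sum>i\<in>{j}. ennreal (2 * 2^i * (\<bar>H x\<bar> * indicator (A i) x)))" by simp
        also have "\<dots> \<le> (\<Sum>j. ennreal (2 * 2^j * (\<bar>H x\<bar> * indicator (A j) x)))"
          by (rule sum_le_suminf) auto
        finally show ?thesis by (rule order_trans) simp
      qed
    qed
    also have "\<dots> = (\<integral>\<^sup>+x. ennreal \<bar>H x\<bar> \<partial>M) + (\<Sum>j. \<integral>\<^sup>+x. ennreal (2 * 2^j * (\<bar>H x\<bar> * indicator (A j) x)) \<partial>M)"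
      by (subst nn_integral_add) (auto simp: nn_integral_suminf)
    also have "\<dots> \<le> ennreal (2 * h * vol powr p) + (\<Sum>j. ennreal (4 * h * B powr p * \<theta>^j))"
    proof (rule add_mono)
      have Os: "\<Omega> \<in> sets M" using sets.top[of M] by simp
      note L = Lp_integral_set[OF H r1 Os]
      have "(\<integral>\<^sup>+x. ennreal \<bar>H x\<bar> \<partial>M) = ennreal (\<integral>x. \<bar>H x\<bar> \<partial>M)"
        using L(1) sets.top[of M] by (intro nn_integral_eq_integral) auto
      also have "(\<integral>x. \<bar>H x\<bar> \<partial>M) = (\<integral>x. \<bar>H x\<bar> * indicator \<Omega> x \<partial>M)"
        by (rule Bochner_Integration.integral_cong) auto
      also have "ennreal \<dots> \<le> ennreal (2 * h * vol powr p)"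
        using L(2) sets.top[of M] by (intro ennreal_leI) (simp add: h_def vol_def p_def)
      finally show "(\<integral>\<^sup>+x. ennreal \<bar>H x\<bar> \<partial>M) \<le> ennreal (2 * h * vol powr p)" .
      show "(\<Sum>j. \<integral>\<^sup>+x. ennreal (2 * 2^j * (\<bar>H x\<bar> * indicator (A j) x)) \<partial>M) \<le> (\<Sum>j. ennreal (4 * h * B powr p * \<theta>^j))"
        by (rule suminf_le[OF level_term]) auto
    qed
    also have "(\<Sum>j. ennreal (4 * h * B powr p * \<theta>^j)) = ennreal (4 * h * B powr p * (1 / (1 - \<theta>)))"
    proof (rule suminf_ennreal_eq)
      show "(\<lambda>j. 4 * h * B powr p * \<theta>^j) sums (4 * h * B powr p * (1 / (1 - \<theta>)))"
        by (intro sums_mult geometric_sums) (use \<theta> in simp)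
    qed (use h0 \<theta> in simp)
    also have "ennreal (2 * h * vol powr p) + ennreal (4 * h * B powr p * (1 / (1 - \<theta>))) = ennreal (C * h)"
      using h0 \<theta> by (subst ennreal_plus[symmetric]) (auto simp: C_def algebra_simps)
    finally show "(\<integral>\<^sup>+x. ennreal (\<bar>H x\<bar> * max (v x) 0) \<partial>M) \<le> ennreal (C * Lp_norm M r H)" by (simp add: h_def)
  qed
qed

text \<open>The unit bound is applied to v and to -v, whose positive parts add up to |v|, and
  extended by homogeneity. When the gradient vanishes and scaling is impossible, Poincare's
  inequality gives v = 0.\<close>

lemma dual_bound:
  assumes N: "2 \<le> CARD('n)" and r: "r > real CARD('n) / 2"
  obtains C where "0 \<le> C" "\<And>H v V. H \<in> Lp M r \<Longrightarrow> H10 v V \<Longrightarrow> integrable M (\<lambda>x. H x * v x)"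
    "\<And>H v V. H \<in> Lp M r \<Longrightarrow> H10 v V \<Longrightarrow> (\<integral>x. \<bar>H x * v x\<bar> \<partial>M) \<le> C * Lp_norm M r H * l2n M V"
proof -
  obtain C where C: "0 \<le> C" "\<And>H v V. H \<in> Lp M r \<Longrightarrow> H10 v V \<Longrightarrow> l2n M V \<le> 1 \<Longrightarrow>
    (\<integral>\<^sup>+x. ennreal (\<bar>H x\<bar> * max (v x) 0) \<partial>M) \<le> ennreal (C * Lp_norm M r H)"
    using dual_bound_unit[OF assms] by blast
  have main: "integrable M (\<lambda>x. H x * v x) \<and> (\<integral>x. \<bar>H x * v x\<bar> \<partial>M) \<le> 2 * C * Lp_norm M r H * l2n M V"
    if H: "H \<in> Lp M r" and v: "H10 v V" for H v V
  proof -
    define h where "h = Lp_norm M r H"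
    have h0: "0 \<le> h" by (simp add: h_def Lp_norm_def)
    have vm: "v \<in> borel_measurable M" using sqi_measurable[OF H10_sqi(1)[OF v]] .
    have Hm: "H \<in> borel_measurable M" using H by (simp add: Lp_def)
    note [measurable] = vm Hm
    have unit: "(\<integral>\<^sup>+x. ennreal \<bar>H x * w x\<bar> \<partial>M) \<le> ennreal (2 * C * h)" if w: "H10 w W" "l2n M W \<le> 1" for w W
    proof -
      have wm[measurable]: "w \<in> borel_measurable M" using sqi_measurable[OF H10_sqi(1)[OF w(1)]] .
      have w': "H10 (\<lambda>x. - w x) (\<lambda>x. - W x)" using H10_scale[OF w(1), of "-1"] by simp
      have "(\<integral>\<^sup>+x. ennreal \<bar>H x * w x\<bar> \<partial>M)
         = (\<integral>\<^sup>+x. ennreal (\<bar>H x\<bar> * max (w x) 0) + ennreal (\<bar>H x\<bar> * max (- w x) 0) \<partial>M)"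
      proof (rule nn_integral_cong)
        fix x
        have "\<bar>w x\<bar> = max (w x) 0 + max (- w x) 0" by simp
        then have "\<bar>H x * w x\<bar> = \<bar>H x\<bar> * max (w x) 0 + \<bar>H x\<bar> * max (- w x) 0"
          by (simp only: abs_mult distrib_left)
        then show "ennreal \<bar>H x * w x\<bar> = ennreal (\<bar>H x\<bar> * max (w x) 0) + ennreal (\<bar>H x\<bar> * max (- w x) 0)"
          by (simp flip: ennreal_plus)
      qed
      also have "\<dots> = (\<integral>\<^sup>+x. ennreal (\<bar>H x\<bar> * max (w x) 0) \<partial>M) + (\<integral>\<^sup>+x. ennreal (\<bar>H x\<bar> * max (- w x) 0) \<partial>M)"
        by (rule nn_integral_add) measurable
      also have "\<dots> \<le> ennreal (C * h) + ennreal (C * h)"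
        using C(2)[OF H w] C(2)[OF H w'] w(2) unfolding h_def by (intro add_mono) (auto simp: l2n_minus)
      also have "\<dots> = ennreal (2 * C * h)" using C(1) h0 by (simp flip: ennreal_plus)
      finally show ?thesis .
    qed
    have all: "(\<integral>\<^sup>+x. ennreal \<bar>H x * v x\<bar> \<partial>M) \<le> ennreal (2 * C * h * l2n M V)"
    proof (cases "l2n M V = 0")
      case True
      then have "l2n M v = 0" using Poincare[OF v] by (simp add: antisym)
      then have "AE x in M. v x = 0" by (rule l2n_eq_0_AE[OF H10_sqi(1)[OF v]])
      then have "(\<integral>\<^sup>+x. ennreal \<bar>H x * v x\<bar> \<partial>M) = (\<integral>\<^sup>+x. 0 \<partial>M)"
        by (intro nn_integral_cong_AE) (auto elim: eventually_mono)
      then show ?thesis by simp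
    next
      case False
      then have L: "0 < l2n M V" using l2n_nonneg[of M V] by linarith
      have w: "H10 (\<lambda>x. 1 / l2n M V * v x) (\<lambda>x. (1 / l2n M V) *\<^sub>R V x)" by (rule H10_scale[OF v])
      have "l2n M (\<lambda>x. (1 / l2n M V) *\<^sub>R V x) = 1" using L by simp
      then have "(\<integral>\<^sup>+x. ennreal \<bar>H x * (1 / l2n M V * v x)\<bar> \<partial>M) \<le> ennreal (2 * C * h)" using unit[OF w] by simp
      then have "ennreal (l2n M V) * (\<integral>\<^sup>+x. ennreal \<bar>H x * (1 / l2n M V * v x)\<bar> \<partial>M) \<le> ennreal (l2n M V) * ennreal (2 * C * h)"
        by (rule mult_left_mono) simp
      also have "ennreal (l2n M V) * (\<integral>\<^sup>+x. ennreal \<bar>H x * (1 / l2n M V * v x)\<bar> \<partial>M) = (\<integral>\<^sup>+x. ennreal \<bar>H x * v x\<bar> \<partial>M)"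
        using L by (subst nn_integral_cmult[symmetric]) (auto simp: abs_mult simp flip: ennreal_mult')
      also have "ennreal (l2n M V) * ennreal (2 * C * h) = ennreal (2 * C * h * l2n M V)"
        using C(1) h0 by (simp add: mult.commute flip: ennreal_mult)
      finally show ?thesis .
    qed
    have i: "integrable M (\<lambda>x. H x * v x)"
      by (rule integrableI_bounded) (use all in \<open>auto intro: le_less_trans\<close>)
    have "ennreal (\<integral>x. \<bar>H x * v x\<bar> \<partial>M) = (\<integral>\<^sup>+x. ennreal \<bar>H x * v x\<bar> \<partial>M)"
      using i by (intro nn_integral_eq_integral[symmetric]) auto
    then have "ennreal (\<integral>x. \<bar>H x * v x\<bar> \<partial>M) \<le> ennreal (2 * C * h * l2n M V)" using all by simp
    then have "(\<integral>x. \<bar>H x * v x\<bar> \<partial>M) \<le> 2 * C * h * l2n M V"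
      by (subst (asm) ennreal_le_iff) (use C(1) h0 in auto)
    with i show ?thesis by (simp add: h_def)
  qed
  show thesis by (rule that[of "2 * C"]) (use C(1) main in auto)
qed

end

section \<open>The linear problem\<close>

lemma Lp_dominated:
  assumes "H \<in> Lp M r" "h \<in> borel_measurable M" "AE x in M. \<bar>h x\<bar> \<le> \<bar>H x\<bar>" "0 < r"
  shows "h \<in> Lp M r" "Lp_norm M r h \<le> Lp_norm M r H"
proof -
  have Hi: "integrable M (\<lambda>x. \<bar>H x\<bar> powr r)" using assms(1) by (simp add: Lp_def)
  have le: "AE x in M. \<bar>h x\<bar> powr r \<le> \<bar>H x\<bar> powr r"
    using assms(3) by eventually_elim (use assms(4) in \<open>auto intro: powr_mono2\<close>)
  have hi: "integrable M (\<lambda>x. \<bar>h x\<bar> powr r)"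
    by (rule Bochner_Integration.integrable_bound[OF Hi]) (use le assms(2) in auto)
  then show "h \<in> Lp M r" using assms(2) by (simp add: Lp_def)
  have "(\<integral>x. \<bar>h x\<bar> powr r \<partial>M) \<le> (\<integral>x. \<bar>H x\<bar> powr r \<partial>M)" by (rule integral_mono_AE[OF hi Hi le])
  then show "Lp_norm M r h \<le> Lp_norm M r H"
    unfolding Lp_norm_def using assms(4) by (intro powr_mono2) auto
qed

lemma Lp_scale:
  assumes "H \<in> Lp M r" shows "(\<lambda>x. c * H x) \<in> Lp M r"
  using assms by (auto simp: Lp_def abs_mult powr_mult)

lemma Lp_norm_scale:
  assumes "0 < r" shows "Lp_norm M r (\<lambda>x. c * H x) = \<bar>c\<bar> * Lp_norm M r H"
  using assms by (simp add: Lp_norm_def abs_mult powr_mult powr_powr)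

lemma Lp_abs: "H \<in> Lp M r \<Longrightarrow> (\<lambda>x. \<bar>H x\<bar>) \<in> Lp M r"
  by (auto simp: Lp_def)

lemma Lp_norm_nonneg: "0 \<le> Lp_norm M r H"
  by (simp add: Lp_norm_def)

text \<open>It follows from |a + b| \<le> 2 max |a| |b|. The constant 4, where Minkowski's
  inequality has 1, only enlarges the constants chosen later.\<close>

lemma Lp_add:
  assumes "f \<in> Lp M r" "g \<in> Lp M r" "1 \<le> r"
  shows "(\<lambda>x. f x + g x) \<in> Lp M r" "Lp_norm M r (\<lambda>x. f x + g x) \<le> 4 * (Lp_norm M r f + Lp_norm M r g)"
proof -
  have r0: "0 < r" using assms(3) by simp
  have fi: "integrable M (\<lambda>x. \<bar>f x\<bar> powr r)" and gi: "integrable M (\<lambda>x. \<bar>g x\<bar> powr r)"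
    using assms(1,2) by (auto simp: Lp_def)
  have pw: "\<bar>a + b\<bar> powr r \<le> 2 powr r * (\<bar>a\<bar> powr r + \<bar>b\<bar> powr r)" for a b :: real
  proof -
    have "\<bar>a + b\<bar> powr r \<le> (2 * max \<bar>a\<bar> \<bar>b\<bar>) powr r" using r0 by (intro powr_mono2) auto
    also have "\<dots> = 2 powr r * (max \<bar>a\<bar> \<bar>b\<bar>) powr r" by (simp add: powr_mult)
    also have "\<dots> \<le> 2 powr r * (\<bar>a\<bar> powr r + \<bar>b\<bar> powr r)" by (intro mult_left_mono) (auto simp: max_def)
    finally show ?thesis .
  qed
  have si: "integrable M (\<lambda>x. 2 powr r * (\<bar>f x\<bar> powr r + \<bar>g x\<bar> powr r))" using fi gi by simp
  have m: "(\<lambda>x. f x + g x) \<in> borel_measurable M" using assms(1,2) by (auto simp: Lp_def)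
  have i: "integrable M (\<lambda>x. \<bar>f x + g x\<bar> powr r)"
    by (rule Bochner_Integration.integrable_bound[OF si]) (use m pw in auto)
  then show "(\<lambda>x. f x + g x) \<in> Lp M r" using m by (simp add: Lp_def)
  define F G where "F = (\<integral>x. \<bar>f x\<bar> powr r \<partial>M)" "G = (\<integral>x. \<bar>g x\<bar> powr r \<partial>M)"
  have FG: "0 \<le> F" "0 \<le> G" by (auto simp: F_G_def)
  have "(\<integral>x. \<bar>f x + g x\<bar> powr r \<partial>M) \<le> 2 powr r * (F + G)"
    using integral_mono[OF i si pw] fi gi by (simp add: F_G_def)
  also have "\<dots> \<le> 2 powr r * (2 powr r * max F G)"
  proof (rule mult_left_mono)
    have "2 * max F G \<le> 2 powr r * max F G" using powr_mono[of 1 r 2] assms(3) FG by (intro mult_right_mono) auto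
    then show "F + G \<le> 2 powr r * max F G" by linarith
  qed simp
  finally have "Lp_norm M r (\<lambda>x. f x + g x) \<le> (2 powr r * (2 powr r * max F G)) powr (1/r)"
    unfolding Lp_norm_def using r0 by (intro powr_mono2) auto
  also have "\<dots> = 4 * max (F powr (1/r)) (G powr (1/r))"
    using FG r0 powr_mono2[of "1/r" F G] powr_mono2[of "1/r" G F] by (auto simp: powr_mult powr_powr max_def)
  also have "\<dots> \<le> 4 * (F powr (1/r) + G powr (1/r))" by (simp add: max_def)
  finally show "Lp_norm M r (\<lambda>x. f x + g x) \<le> 4 * (Lp_norm M r f + Lp_norm M r g)"
    by (simp add: Lp_norm_def F_G_def)
qed

lemma Lp_norm_dominated_tendsto:
  assumes H: "H \<in> Lp M r" and r: "0 < r" and h: "\<And>n. h n \<in> borel_measurable M" "k \<in> borel_measurable M"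
    and b: "\<And>n. AE x in M. \<bar>h n x\<bar> \<le> \<bar>H x\<bar>" and lim: "AE x in M. (\<lambda>n. h n x) \<longlonglongrightarrow> k x"
  shows "(\<lambda>n. Lp_norm M r (\<lambda>x. h n x - k x)) \<longlonglongrightarrow> 0" "\<And>n. (\<lambda>x. h n x - k x) \<in> Lp M r"
proof -
  have all: "AE x in M. \<forall>n. \<bar>h n x\<bar> \<le> \<bar>H x\<bar>" using b by (simp add: AE_all_countable)
  have kb: "AE x in M. \<bar>k x\<bar> \<le> \<bar>H x\<bar>"
    using all lim
  proof eventually_elim
    case (elim x)
    show ?case by (rule LIMSEQ_le_const2[OF tendsto_rabs[OF elim(2)]]) (use elim(1) in auto)
  qed
  have db: "AE x in M. \<bar>h n x - k x\<bar> \<le> \<bar>2 * H x\<bar>" for n using b[of n] kb by eventually_elim auto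
  show L: "(\<lambda>x. h n x - k x) \<in> Lp M r" for n
    by (rule Lp_dominated(1)[OF Lp_scale[OF H] _ db r]) (use h in auto)
  have "(\<lambda>n. \<integral>x. \<bar>h n x - k x\<bar> powr r \<partial>M) \<longlonglongrightarrow> (\<integral>x. 0 \<partial>M)"
  proof (rule integral_dominated_convergence[where w="\<lambda>x. \<bar>2 * H x\<bar> powr r"])
    show "integrable M (\<lambda>x. \<bar>2 * H x\<bar> powr r)" using Lp_scale[OF H, of 2] by (simp add: Lp_def)
    show "AE x in M. (\<lambda>n. \<bar>h n x - k x\<bar> powr r) \<longlonglongrightarrow> 0"
      using lim
    proof eventually_elim
      case (elim x)
      from tendsto_rabs[OF LIM_zero[OF elim]] have "(\<lambda>n. \<bar>h n x - k x\<bar>) \<longlonglongrightarrow> 0" by simp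
      then have "(\<lambda>n. \<bar>h n x - k x\<bar> powr r) \<longlonglongrightarrow> 0 powr r"
        by (rule tendsto_powr2) (use r in auto)
      then show ?case by simp
    qed
    show "AE x in M. norm (\<bar>h n x - k x\<bar> powr r) \<le> \<bar>2 * H x\<bar> powr r" for n
      using db[of n] by eventually_elim (use r in \<open>auto intro: powr_mono2\<close>)
  qed (use h in auto)
  then have "(\<lambda>n. \<integral>x. \<bar>h n x - k x\<bar> powr r \<partial>M) \<longlonglongrightarrow> 0" by simp
  then have "(\<lambda>n. (\<integral>x. \<bar>h n x - k x\<bar> powr r \<partial>M) powr (1/r)) \<longlonglongrightarrow> 0 powr (1/r)"
    by (rule tendsto_powr2) (use r in auto)
  then show "(\<lambda>n. Lp_norm M r (\<lambda>x. h n x - k x)) \<longlonglongrightarrow> 0" by (simp add: Lp_norm_def)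
qed

section \<open>Minimising a quadratic energy over test functions\<close>

context bounded_domain
begin

text \<open>The form is symmetric, so the Euler equation of J is the weak equation. Coercivity and
  the parallelogram identity make the gradients of a minimising sequence Cauchy, and Poincare's
  inequality carries this over to the functions. The functional \<open>l\<close> is prescribed on
  test functions only, so J is never evaluated at the limit.\<close>

lemma minimising_sequence:
  fixes l :: "(real^'n \<Rightarrow> real) \<Rightarrow> real"
  assumes \<kappa>: "\<kappa> \<in> borel_measurable M" "AE x in M. \<kappa>0 \<le> \<kappa> x \<and> \<kappa> x \<le> K" "0 < \<kappa>0"
    and l: "\<And>\<psi> \<zeta>. \<psi> \<in> test_functions \<Omega> \<Longrightarrow> \<zeta> \<in> test_functions \<Omega> \<Longrightarrow> l (\<lambda>x. \<psi> x + \<zeta> x) = l \<psi> + l \<zeta>"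
      "\<And>\<psi> c. \<psi> \<in> test_functions \<Omega> \<Longrightarrow> l (\<lambda>x. c * \<psi> x) = c * l \<psi>"
      "\<And>\<psi>. \<psi> \<in> test_functions \<Omega> \<Longrightarrow> \<bar>l \<psi>\<bar> \<le> C * l2n M (grad \<psi>)"
  obtains z Z where "H10 z Z" "\<And>\<psi>. \<psi> \<in> test_functions \<Omega> \<Longrightarrow> (\<integral>x. (\<kappa> x *\<^sub>R Z x) \<bullet> grad \<psi> x \<partial>M) = l \<psi>"
proof -
  let ?T = "test_functions \<Omega>"
  have \<kappa>a: "AE x in M. \<bar>\<kappa> x\<bar> \<le> K" using \<kappa>(2) by eventually_elim (use \<kappa>(3) in auto)
  have \<kappa>s: "sqi M (\<lambda>x. \<kappa> x *\<^sub>R F x)" if "sqi M F" for F :: "real^'n \<Rightarrow> real^'n" by (rule sqi_mult_bounded[OF that \<kappa>(1) \<kappa>a])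
  define b where "b F G = (\<integral>x. (\<kappa> x *\<^sub>R F x) \<bullet> G x \<partial>M)" for F G :: "real^'n \<Rightarrow> real^'n"
  have bi: "integrable M (\<lambda>x. (\<kappa> x *\<^sub>R F x) \<bullet> G x)" if "sqi M F" "sqi M G" for F G :: "real^'n \<Rightarrow> real^'n"
    by (rule sqi_inner_integrable[OF \<kappa>s[OF that(1)] that(2)])
  have badd: "b (\<lambda>x. F x + G x) H = b F H + b G H" "b H (\<lambda>x. F x + G x) = b H F + b H G"
    "b (\<lambda>x. c *\<^sub>R F x) H = c * b F H" "b H (\<lambda>x. c *\<^sub>R F x) = c * b H F" "b F G = b G F"
    if "sqi M F" "sqi M G" "sqi M H" for F G H c
  proof -
    have "(\<kappa> x *\<^sub>R (F x + G x)) \<bullet> H x = (\<kappa> x *\<^sub>R F x) \<bullet> H x + (\<kappa> x *\<^sub>R G x) \<bullet> H x"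
      "(\<kappa> x *\<^sub>R H x) \<bullet> (F x + G x) = (\<kappa> x *\<^sub>R H x) \<bullet> F x + (\<kappa> x *\<^sub>R H x) \<bullet> G x"
      "(\<kappa> x *\<^sub>R (c *\<^sub>R F x)) \<bullet> H x = c * ((\<kappa> x *\<^sub>R F x) \<bullet> H x)"
      "(\<kappa> x *\<^sub>R H x) \<bullet> (c *\<^sub>R F x) = c * ((\<kappa> x *\<^sub>R H x) \<bullet> F x)"
      "(\<kappa> x *\<^sub>R F x) \<bullet> G x = (\<kappa> x *\<^sub>R G x) \<bullet> F x" for x
      by (simp_all add: inner_add_left inner_add_right inner_commute mult.left_commute distrib_left)
    note eqs = this
    show "b (\<lambda>x. F x + G x) H = b F H + b G H" unfolding b_def eqs(1) by (rule Bochner_Integration.integral_add[OF bi bi]) (use that in auto)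
    show "b H (\<lambda>x. F x + G x) = b H F + b H G" unfolding b_def eqs(2) by (rule Bochner_Integration.integral_add[OF bi bi]) (use that in auto)
    show "b (\<lambda>x. c *\<^sub>R F x) H = c * b F H" unfolding b_def eqs(3) by (rule integral_mult_right_zero)
    show "b H (\<lambda>x. c *\<^sub>R F x) = c * b H F" unfolding b_def eqs(4) by (rule integral_mult_right_zero)
    show "b F G = b G F" unfolding b_def by (simp only: eqs(5))
  qed
  have coer: "\<kappa>0 * (l2n M F)\<^sup>2 \<le> b F F" if F: "sqi M F" for F
  proof -
    have "\<kappa>0 * (l2n M F)\<^sup>2 = (\<integral>x. \<kappa>0 * (norm (F x))\<^sup>2 \<partial>M)" by (simp add: l2n_power2)
    also have "\<dots> \<le> b F F"
      unfolding b_def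
    proof (rule integral_mono_AE)
      show "AE x in M. \<kappa>0 * (norm (F x))\<^sup>2 \<le> (\<kappa> x *\<^sub>R F x) \<bullet> F x"
        using \<kappa>(2) by eventually_elim (auto simp: power2_norm_eq_inner intro!: mult_right_mono)
    qed (use F bi in \<open>auto simp: sqi_def\<close>)
    finally show ?thesis .
  qed
  note gs = test_fn(2)
  define J where "J \<psi> = 1/2 * b (grad \<psi>) (grad \<psi>) - l \<psi>" for \<psi>
  \<comment> \<open>The minimum of (\<kappa>0 / 2) e^2 - C e over e, by completing the
    square.\<close>
  have Jlow: "- C\<^sup>2 / (2 * \<kappa>0) \<le> J \<psi>" if \<psi>: "\<psi> \<in> ?T" for \<psi>
  proof -
    let ?e = "l2n M (grad \<psi>)"
    have "J \<psi> \<ge> 1/2 * (\<kappa>0 * ?e\<^sup>2) - C * ?e" using coer[OF gs[OF \<psi>]] l(3)[OF \<psi>] by (simp add: J_def)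
    moreover have "1/2 * (\<kappa>0 * ?e\<^sup>2) - C * ?e + C\<^sup>2 / (2 * \<kappa>0) = \<kappa>0 / 2 * (?e - C / \<kappa>0)\<^sup>2"
      using \<kappa>(3) by (simp add: power2_eq_square field_simps)
    moreover have "0 \<le> \<kappa>0 / 2 * (?e - C / \<kappa>0)\<^sup>2" using \<kappa>(3) by simp
    ultimately show ?thesis by simp
  qed
  define m where "m = Inf (J ` ?T)"
  have ne: "J ` ?T \<noteq> {}" using test_functions_zero by blast
  have bdd: "bdd_below (J ` ?T)" using Jlow by (intro bdd_belowI2)
  have mle: "m \<le> J \<psi>" if "\<psi> \<in> ?T" for \<psi> unfolding m_def by (rule cInf_lower[OF imageI[OF that] bdd])
  have "\<forall>n. \<exists>\<psi>. \<psi> \<in> ?T \<and> J \<psi> < m + 1 / real (Suc n)"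
  proof
    fix n
    have "\<exists>y\<in>J ` ?T. y < m + 1 / real (Suc n)"
      using cInf_less_iff[OF ne bdd, of "m + 1 / real (Suc n)"] by (simp add: m_def)
    then show "\<exists>\<psi>. \<psi> \<in> ?T \<and> J \<psi> < m + 1 / real (Suc n)" by blast
  qed
  from choice[OF this] obtain \<psi> where \<psi>: "\<And>n. \<psi> n \<in> ?T" "\<And>n. J (\<psi> n) < m + 1 / real (Suc n)" by blast
  \<comment> \<open>The midpoint of two nearly minimal functions is a competitor too, so the
    parallelogram identity bounds the energy of their difference.\<close>
  have par: "\<kappa>0 / 4 * (l2n M (\<lambda>x. grad (\<psi> n) x - grad (\<psi> k) x))\<^sup>2 \<le> 1 / real (Suc n) + 1 / real (Suc k)" for n k
  proof -
    let ?a = "grad (\<psi> n)" and ?b = "grad (\<psi> k)"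
    note s = gs[OF \<psi>(1)[of n]] gs[OF \<psi>(1)[of k]]
    have mid: "(\<lambda>x. 1/2 * (\<psi> n x + \<psi> k x)) \<in> ?T" by (intro test_functions_scale test_functions_add \<psi>)
    have gm: "grad (\<lambda>x. 1/2 * (\<psi> n x + \<psi> k x)) = (\<lambda>x. (1/2) *\<^sub>R (?a x + ?b x))"
      by (simp only: grad_scale_test[OF test_functions_add[OF \<psi>(1) \<psi>(1)]] grad_add_test[OF \<psi>(1) \<psi>(1)])
    have lm: "l (\<lambda>x. 1/2 * (\<psi> n x + \<psi> k x)) = 1/2 * (l (\<psi> n) + l (\<psi> k))"
      by (simp only: l(2)[OF test_functions_add[OF \<psi>(1) \<psi>(1)]] l(1)[OF \<psi>(1) \<psi>(1)])
    have bm: "b (\<lambda>x. (1/2) *\<^sub>R (?a x + ?b x)) (\<lambda>x. (1/2) *\<^sub>R (?a x + ?b x)) = 1/4 * (b ?a ?a + 2 * b ?a ?b + b ?b ?b)"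
      using badd(1,2)[of ?a ?b] badd(3)[of "\<lambda>x. ?a x + ?b x" ?a] badd(4)[of "\<lambda>x. ?a x + ?b x" ?a] badd(5)[of ?a ?b ?a] s
      by (simp add: sqi_add sqi_scaleR add_divide_distrib)
    have bd: "b (\<lambda>x. ?a x - ?b x) (\<lambda>x. ?a x - ?b x) = b ?a ?a - 2 * b ?a ?b + b ?b ?b"
      using badd(1,2)[of ?a "\<lambda>x. (-1) *\<^sub>R ?b x"] badd(3,4)[of ?b ?a _ "-1"] badd(5)[of ?a ?b ?a] s sqi_minus[OF s(2)] sqi_diff[OF s]
      by simp
    have "2 * m \<le> 2 * J (\<lambda>x. 1/2 * (\<psi> n x + \<psi> k x))" using mle[OF mid] by simp
    also have "\<dots> = J (\<psi> n) + J (\<psi> k) - 1/4 * b (\<lambda>x. ?a x - ?b x) (\<lambda>x. ?a x - ?b x)"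
      unfolding J_def gm lm bm bd by (simp add: field_simps)
    finally have "1/4 * b (\<lambda>x. ?a x - ?b x) (\<lambda>x. ?a x - ?b x) \<le> 1 / real (Suc n) + 1 / real (Suc k)"
      using \<psi>(2)[of n] \<psi>(2)[of k] by linarith
    then show ?thesis using coer[OF sqi_diff[OF s]] by simp
  qed
  have cau: "\<exists>K. \<forall>n\<ge>K. \<forall>k\<ge>K. l2n M (\<lambda>x. grad (\<psi> n) x - grad (\<psi> k) x) < e" if e: "0 < e" for e
  proof -
    have "0 < \<kappa>0 / 4 * e\<^sup>2 / 2" using \<kappa>(3) e by simp
    then obtain K where K: "1 / real (Suc K) < \<kappa>0 / 4 * e\<^sup>2 / 2"
      using nat_approx_posE by metis
    show ?thesis
    proof (intro exI[of _ K] allI impI)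
      fix n k assume "n \<ge> K" "k \<ge> K"
      then have "1 / real (Suc n) \<le> 1 / real (Suc K)" "1 / real (Suc k) \<le> 1 / real (Suc K)"
        by (auto intro!: divide_left_mono)
      then have "\<kappa>0 / 4 * (l2n M (\<lambda>x. grad (\<psi> n) x - grad (\<psi> k) x))\<^sup>2 < \<kappa>0 / 4 * e\<^sup>2"
        using par[of n k] K by linarith
      then have "(l2n M (\<lambda>x. grad (\<psi> n) x - grad (\<psi> k) x))\<^sup>2 < e\<^sup>2"
        using \<kappa>(3) by (subst (asm) mult_less_cancel_left_pos) auto
      then show "l2n M (\<lambda>x. grad (\<psi> n) x - grad (\<psi> k) x) < e"
        by (rule power2_less_imp_less) (use e in simp)
    qed
  qed
  obtain Z where Z: "l2conv M (\<lambda>n. grad (\<psi> n)) Z" using l2_complete[OF gs[OF \<psi>(1)] cau] by blast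
  have pd: "l2n M (\<lambda>x. \<psi> n x - \<psi> k x) \<le> Poincare_const * l2n M (\<lambda>x. grad (\<psi> n) x - grad (\<psi> k) x)" for n k
    by (rule Poincare[OF H10_diff[OF H10_test[OF \<psi>(1)] H10_test[OF \<psi>(1)]]])
  have cau': "\<exists>K. \<forall>n\<ge>K. \<forall>k\<ge>K. l2n M (\<lambda>x. \<psi> n x - \<psi> k x) < e" if e: "0 < e" for e
  proof -
    have P: "0 < Poincare_const + 1" using Poincare_const_nonneg by simp
    obtain K where K: "\<forall>n\<ge>K. \<forall>k\<ge>K. l2n M (\<lambda>x. grad (\<psi> n) x - grad (\<psi> k) x) < e / (Poincare_const + 1)"
      using cau[of "e / (Poincare_const + 1)"] e P by auto
    show ?thesis
    proof (intro exI[of _ K] allI impI)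
      fix n k assume nk: "n \<ge> K" "k \<ge> K"
      let ?d = "l2n M (\<lambda>x. grad (\<psi> n) x - grad (\<psi> k) x)"
      have "Poincare_const * ?d \<le> (Poincare_const + 1) * ?d" by (intro mult_right_mono) auto
      also have "\<dots> < (Poincare_const + 1) * (e / (Poincare_const + 1))" using K nk P by (intro mult_strict_left_mono) auto
      also have "\<dots> = e" using P by simp
      finally show "l2n M (\<lambda>x. \<psi> n x - \<psi> k x) < e" using pd[of n k] by simp
    qed
  qed
  obtain z where z: "l2conv M \<psi> z" using l2_complete[OF test_fn(1)[OF \<psi>(1)] cau'] by blast
  have H: "H10 z Z" by (rule H10_I[OF \<psi>(1) z Z])
  have "b Z (grad \<zeta>) = l \<zeta>" if \<zeta>: "\<zeta> \<in> ?T" for \<zeta>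
  proof -
    let ?q = "b (grad \<zeta>) (grad \<zeta>)"
    have conv: "(\<lambda>n. b (grad (\<psi> n)) (grad \<zeta>)) \<longlonglongrightarrow> b Z (grad \<zeta>)"
      unfolding b_def
      by (rule l2conv_inner[OF l2conv_mult_bounded[OF Z \<kappa>(1) \<kappa>(1), of K] l2conv_const[OF gs[OF \<zeta>]]])
        (use \<kappa>a in auto)
    \<comment> \<open>The first variation at the limit is obtained from the competitors \<psi> n + t
      \<zeta>: J is at least m at them, while J (\<psi> n) exceeds m by less than 1 / (n +
      1).\<close>
    have ge: "0 \<le> 1/2 * t\<^sup>2 * ?q + t * (b Z (grad \<zeta>) - l \<zeta>)" for t
    proof (rule LIMSEQ_le)
      show "(\<lambda>n. - (1 / real (Suc n))) \<longlonglongrightarrow> 0" using tendsto_minus[OF LIMSEQ_Suc[OF lim_1_over_n]] by simp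
      show "(\<lambda>n. 1/2 * t\<^sup>2 * ?q + t * (b (grad (\<psi> n)) (grad \<zeta>) - l \<zeta>)) \<longlonglongrightarrow> 1/2 * t\<^sup>2 * ?q + t * (b Z (grad \<zeta>) - l \<zeta>)"
        by (intro tendsto_intros conv)
      show "\<exists>N. \<forall>n\<ge>N. - (1 / real (Suc n)) \<le> 1/2 * t\<^sup>2 * ?q + t * (b (grad (\<psi> n)) (grad \<zeta>) - l \<zeta>)"
      proof (intro exI[of _ 0] allI impI)
        fix n
        have t\<zeta>: "(\<lambda>x. t * \<zeta> x) \<in> ?T" by (rule test_functions_scale[OF \<zeta>])
        have tt: "(\<lambda>x. \<psi> n x + t * \<zeta> x) \<in> ?T" by (rule test_functions_add[OF \<psi>(1) t\<zeta>])
        have g: "grad (\<lambda>x. \<psi> n x + t * \<zeta> x) = (\<lambda>x. grad (\<psi> n) x + t *\<^sub>R grad \<zeta> x)"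
          by (simp only: grad_add_test[OF \<psi>(1) t\<zeta>] grad_scale_test[OF \<zeta>])
        have ll: "l (\<lambda>x. \<psi> n x + t * \<zeta> x) = l (\<psi> n) + t * l \<zeta>" by (simp only: l(1)[OF \<psi>(1) t\<zeta>] l(2)[OF \<zeta>])
        let ?a = "grad (\<psi> n)" and ?c = "grad \<zeta>"
        note s = gs[OF \<psi>(1)[of n]] gs[OF \<zeta>]
        have "b (\<lambda>x. ?a x + t *\<^sub>R ?c x) (\<lambda>x. ?a x + t *\<^sub>R ?c x) = b ?a ?a + 2 * t * b ?a ?c + t\<^sup>2 * ?q"
          using badd(1,2)[of ?a "\<lambda>x. t *\<^sub>R ?c x"] badd(3,4)[of ?c ?c _ t] badd(5)[of ?a ?c ?a] s
          by (simp add: sqi_add sqi_scaleR power2_eq_square algebra_simps)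
        then have "J (\<lambda>x. \<psi> n x + t * \<zeta> x) = J (\<psi> n) + (1/2 * t\<^sup>2 * ?q + t * (b ?a ?c - l \<zeta>))"
          unfolding J_def g ll by (simp add: algebra_simps)
        then show "- (1 / real (Suc n)) \<le> 1/2 * t\<^sup>2 * ?q + t * (b (grad (\<psi> n)) (grad \<zeta>) - l \<zeta>)"
          using mle[OF tt] \<psi>(2)[of n] by linarith
      qed
    qed
    define d where "d = b Z (grad \<zeta>) - l \<zeta>"
    have q0: "0 \<le> ?q" using coer[OF gs[OF \<zeta>]] \<kappa>(3) by (meson less_imp_le mult_nonneg_nonneg order_trans zero_le_power2)
    have "d = 0"
    proof (rule ccontr)
      assume d: "d \<noteq> 0"
      \<comment> \<open>Up to the 1 this minimises the parabola in t; the 1 keeps the denominator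
        positive when \<open>?q\<close> vanishes.\<close>
      define t where "t = - d / (?q + 1)"
      have "0 \<le> 1/2 * t\<^sup>2 * ?q + t * d" using ge[of t] by (simp add: d_def)
      also have "\<dots> \<le> 1/2 * t\<^sup>2 * (?q + 1) + t * d" by (intro add_right_mono mult_left_mono) auto
      also have "\<dots> = - (d\<^sup>2 / (2 * (?q + 1)))" 
      proof -
        have "1/2 * (- d / p)\<^sup>2 * p + (- d / p) * d = - (d\<^sup>2 / (2 * p))" if "0 < p" for p :: real
          using that by (simp add: power2_eq_square field_simps)
        from this[of "?q + 1"] show ?thesis using q0 by (simp add: t_def)
      qed
      finally have "d\<^sup>2 / (2 * (?q + 1)) \<le> 0" by simp
      moreover have "0 < d\<^sup>2 / (2 * (?q + 1))" using d q0 by simp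
      ultimately show False by simp
    qed
    then show ?thesis by (simp add: d_def)
  qed
  then show thesis using that[OF H] by (simp add: b_def)
qed

end

section \<open>Solvability, energy bound and stability of the linear problem\<close>

locale elliptic_domain = bounded_domain \<Omega> for \<Omega> :: "(real^'n) set" +
  fixes r :: real
  assumes dimension: "2 \<le> CARD('n)" and exponent: "r > real CARD('n) / 2"
begin

lemma r1: "1 < r"
  using dimension exponent by linarith

definition dualC :: real where
  "dualC = (SOME C. 0 \<le> C \<and> (\<forall>H v V. H \<in> Lp M r \<longrightarrow> H10 v V \<longrightarrow> integrable M (\<lambda>x. H x * v x) \<and>
     (\<integral>x. \<bar>H x * v x\<bar> \<partial>M) \<le> C * Lp_norm M r H * l2n M V))"

lemma dualC:
  "0 \<le> dualC"
  "H \<in> Lp M r \<Longrightarrow> H10 v V \<Longrightarrow> integrable M (\<lambda>x. H x * v x)"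
  "H \<in> Lp M r \<Longrightarrow> H10 v V \<Longrightarrow> \<bar>\<integral>x. H x * v x \<partial>M\<bar> \<le> dualC * Lp_norm M r H * l2n M V"
proof -
  have "\<exists>C. 0 \<le> C \<and> (\<forall>H v V. H \<in> Lp M r \<longrightarrow> H10 v V \<longrightarrow> integrable M (\<lambda>x. H x * v x) \<and>
     (\<integral>x. \<bar>H x * v x\<bar> \<partial>M) \<le> C * Lp_norm M r H * l2n M V)"
    by (rule dual_bound[OF dimension exponent]) blast
  from someI_ex[OF this] have D: "0 \<le> dualC \<and> (\<forall>H v V. H \<in> Lp M r \<longrightarrow> H10 v V \<longrightarrow> integrable M (\<lambda>x. H x * v x) \<and>
     (\<integral>x. \<bar>H x * v x\<bar> \<partial>M) \<le> dualC * Lp_norm M r H * l2n M V)"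
    unfolding dualC_def .
  then show "0 \<le> dualC" "H \<in> Lp M r \<Longrightarrow> H10 v V \<Longrightarrow> integrable M (\<lambda>x. H x * v x)" by blast+
  assume H: "H \<in> Lp M r" "H10 v V"
  have "\<bar>\<integral>x. H x * v x \<partial>M\<bar> \<le> (\<integral>x. \<bar>H x * v x\<bar> \<partial>M)"
    using integral_norm_bound[of M "\<lambda>x. H x * v x"] by simp
  then show "\<bar>\<integral>x. H x * v x \<partial>M\<bar> \<le> dualC * Lp_norm M r H * l2n M V" using D H by (meson order_trans)
qed

text \<open>\<open>- div (\<kappa> G) = h - div g\<close>, tested with \<open>H\<^sup>1\<^sub>0\<close>.\<close>
definition weak_eq :: "(real^'n \<Rightarrow> real) \<Rightarrow> (real^'n \<Rightarrow> real^'n) \<Rightarrow> (real^'n \<Rightarrow> real^'n) \<Rightarrow> (real^'n \<Rightarrow> real) \<Rightarrow> bool" where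
  "weak_eq \<kappa> G g h \<longleftrightarrow> (\<forall>v V. H10 v V \<longrightarrow>
     (\<integral>x. (\<kappa> x *\<^sub>R G x) \<bullet> V x \<partial>M) = (\<integral>x. h x * v x \<partial>M) + (\<integral>x. g x \<bullet> V x \<partial>M))"

definition coefficient :: "real \<Rightarrow> real \<Rightarrow> (real^'n \<Rightarrow> real) \<Rightarrow> bool" where
  "coefficient \<kappa>0 K \<kappa> \<longleftrightarrow> \<kappa> \<in> borel_measurable M \<and> (AE x in M. \<kappa>0 \<le> \<kappa> x \<and> \<kappa> x \<le> K)"

lemma coefficientD:
  assumes "coefficient \<kappa>0 K \<kappa>" "0 < \<kappa>0"
  shows "\<kappa> \<in> borel_measurable M" "AE x in M. \<kappa>0 \<le> \<kappa> x \<and> \<kappa> x \<le> K" "AE x in M. \<bar>\<kappa> x\<bar> \<le> K"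
    "\<And>F :: real^'n \<Rightarrow> real^'n. sqi M F \<Longrightarrow> sqi M (\<lambda>x. \<kappa> x *\<^sub>R F x)"
proof -
  show 1: "\<kappa> \<in> borel_measurable M" "AE x in M. \<kappa>0 \<le> \<kappa> x \<and> \<kappa> x \<le> K" using assms(1) by (auto simp: coefficient_def)
  show 2: "AE x in M. \<bar>\<kappa> x\<bar> \<le> K" using 1(2) by eventually_elim (use assms(2) in auto)
  show "sqi M F \<Longrightarrow> sqi M (\<lambda>x. \<kappa> x *\<^sub>R F x)" for F :: "real^'n \<Rightarrow> real^'n" by (rule sqi_mult_bounded[OF _ 1(1) 2])
qed

lemma coefficient_coercive:
  fixes V :: "real^'n \<Rightarrow> real^'n"
  assumes "coefficient \<kappa>0 K \<kappa>" "0 < \<kappa>0" "sqi M V"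
  shows "\<kappa>0 * (l2n M V)\<^sup>2 \<le> (\<integral>x. (\<kappa> x *\<^sub>R V x) \<bullet> V x \<partial>M)"
proof -
  note C = coefficientD[OF assms(1,2)]
  have "\<kappa>0 * (l2n M V)\<^sup>2 = (\<integral>x. \<kappa>0 * (norm (V x))\<^sup>2 \<partial>M)" by (simp add: l2n_power2)
  also have "\<dots> \<le> (\<integral>x. (\<kappa> x *\<^sub>R V x) \<bullet> V x \<partial>M)"
  proof (rule integral_mono_AE)
    show "AE x in M. \<kappa>0 * (norm (V x))\<^sup>2 \<le> (\<kappa> x *\<^sub>R V x) \<bullet> V x"
      using C(2) by eventually_elim (auto simp: power2_norm_eq_inner intro!: mult_right_mono)
  qed (use assms(3) sqi_inner_integrable[OF C(4)[OF assms(3)] assms(3)] in \<open>auto simp: sqi_def\<close>)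
  finally show ?thesis .
qed

text \<open>G is the gradient of the extended boundary data; its contribution is moved into the
  functional so that the unknown z lies in H10. The equation extends from test functions to H10
  because every term is continuous in the gradient.\<close>

lemma linear_problem:
  assumes \<kappa>: "coefficient \<kappa>0 K \<kappa>" "0 < \<kappa>0" and G: "sqi M G" and g: "sqi M g" and h: "h \<in> Lp M r"
  obtains z Z where "H10 z Z" "weak_eq \<kappa> (\<lambda>x. G x + Z x) g h"
proof -
  note C = coefficientD[OF \<kappa>]
  define l where "l \<psi> = (\<integral>x. h x * \<psi> x \<partial>M) + (\<integral>x. g x \<bullet> grad \<psi> x \<partial>M) - (\<integral>x. (\<kappa> x *\<^sub>R G x) \<bullet> grad \<psi> x \<partial>M)" for \<psi>
  note i = dualC(2)[OF h H10_test] sqi_inner_integrable[OF g test_fn(2)] sqi_inner_integrable[OF C(4)[OF G] test_fn(2)]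
  obtain z Z where z: "H10 z Z" "\<And>\<psi>. \<psi> \<in> test_functions \<Omega> \<Longrightarrow> (\<integral>x. (\<kappa> x *\<^sub>R Z x) \<bullet> grad \<psi> x \<partial>M) = l \<psi>"
  proof (rule minimising_sequence[OF C(1,2) \<kappa>(2), of l "dualC * Lp_norm M r h + l2n M g + l2n M (\<lambda>x. \<kappa> x *\<^sub>R G x)"])
    show "l (\<lambda>x. \<psi> x + \<zeta> x) = l \<psi> + l \<zeta>" if "\<psi> \<in> test_functions \<Omega>" "\<zeta> \<in> test_functions \<Omega>" for \<psi> \<zeta>
      unfolding l_def grad_add_test[OF that] using i[OF that(1)] i[OF that(2)]
      by (simp add: distrib_left inner_add_right)
    show "l (\<lambda>x. c * \<psi> x) = c * l \<psi>" if "\<psi> \<in> test_functions \<Omega>" for \<psi> c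
      unfolding l_def grad_scale_test[OF that] by (simp add: mult.left_commute algebra_simps)
    show "\<bar>l \<psi>\<bar> \<le> (dualC * Lp_norm M r h + l2n M g + l2n M (\<lambda>x. \<kappa> x *\<^sub>R G x)) * l2n M (grad \<psi>)"
      if "\<psi> \<in> test_functions \<Omega>" for \<psi>
      unfolding l_def distrib_right
      using dualC(3)[OF h H10_test[OF that]] l2_Cauchy_Schwarz[OF g test_fn(2)[OF that]]
        l2_Cauchy_Schwarz[OF C(4)[OF G] test_fn(2)[OF that]] by linarith
  qed blast
  have "weak_eq \<kappa> (\<lambda>x. G x + Z x) g h"
    unfolding weak_eq_def
  proof (intro allI impI)
    fix v V assume v: "H10 v V"
    obtain \<psi> where p: "\<And>n. \<psi> n \<in> test_functions \<Omega>" "l2conv M \<psi> v" "l2conv M (\<lambda>n. grad (\<psi> n)) V"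
      using H10_E[OF v] by blast
    have sZ: "sqi M (\<lambda>x. G x + Z x)" using G H10_sqi(2)[OF z(1)] by (rule sqi_add)
    have t: "(\<integral>x. (\<kappa> x *\<^sub>R (G x + Z x)) \<bullet> grad (\<psi> n) x \<partial>M) = (\<integral>x. h x * \<psi> n x \<partial>M) + (\<integral>x. g x \<bullet> grad (\<psi> n) x \<partial>M)" for n
      using z(2)[OF p(1)[of n]] i(3)[OF p(1)[of n]] sqi_inner_integrable[OF C(4)[OF H10_sqi(2)[OF z(1)]] test_fn(2)[OF p(1)[of n]]]
      by (simp add: l_def scaleR_add_right inner_add_left)
    have 1: "(\<lambda>n. \<integral>x. (\<kappa> x *\<^sub>R (G x + Z x)) \<bullet> grad (\<psi> n) x \<partial>M) \<longlonglongrightarrow> (\<integral>x. (\<kappa> x *\<^sub>R (G x + Z x)) \<bullet> V x \<partial>M)"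
      by (rule l2conv_inner[OF l2conv_const[OF C(4)[OF sZ]] p(3)])
    have 2: "(\<lambda>n. \<integral>x. g x \<bullet> grad (\<psi> n) x \<partial>M) \<longlonglongrightarrow> (\<integral>x. g x \<bullet> V x \<partial>M)"
      by (rule l2conv_inner[OF l2conv_const[OF g] p(3)])
    have 3: "(\<lambda>n. \<integral>x. h x * \<psi> n x \<partial>M) \<longlonglongrightarrow> (\<integral>x. h x * v x \<partial>M)"
    proof -
      have "(\<lambda>n. (\<integral>x. h x * \<psi> n x \<partial>M) - (\<integral>x. h x * v x \<partial>M)) \<longlonglongrightarrow> 0"
      proof (rule Lim_null_comparison)
        show "\<forall>\<^sub>F n in sequentially. norm ((\<integral>x. h x * \<psi> n x \<partial>M) - (\<integral>x. h x * v x \<partial>M))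
          \<le> dualC * Lp_norm M r h * l2n M (\<lambda>x. grad (\<psi> n) x - V x)"
        proof (intro always_eventually allI)
          fix n
          have "(\<integral>x. h x * \<psi> n x \<partial>M) - (\<integral>x. h x * v x \<partial>M) = (\<integral>x. h x * (\<psi> n x - v x) \<partial>M)"
            using i(1)[OF p(1)] dualC(2)[OF h v] by (simp add: right_diff_distrib)
          then show "norm ((\<integral>x. h x * \<psi> n x \<partial>M) - (\<integral>x. h x * v x \<partial>M))
             \<le> dualC * Lp_norm M r h * l2n M (\<lambda>x. grad (\<psi> n) x - V x)"
            using dualC(3)[OF h H10_diff[OF H10_test[OF p(1)] v]] by simp
        qed
        show "(\<lambda>n. dualC * Lp_norm M r h * l2n M (\<lambda>x. grad (\<psi> n) x - V x)) \<longlonglongrightarrow> 0"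
          by (rule tendsto_mult_right_zero[OF l2convD(3)[OF p(3)]])
      qed
      then show ?thesis by (simp add: LIM_zero_iff)
    qed
    show "(\<integral>x. (\<kappa> x *\<^sub>R (G x + Z x)) \<bullet> V x \<partial>M) = (\<integral>x. h x * v x \<partial>M) + (\<integral>x. g x \<bullet> V x \<partial>M)"
      by (rule LIMSEQ_unique[OF 1]) (use tendsto_add[OF 3 2] in \<open>simp only: t\<close>)
  qed
  with z(1) show thesis by (rule that)
qed

lemma energy_bound:
  assumes \<kappa>: "coefficient \<kappa>0 K \<kappa>" "0 < \<kappa>0" and G: "sqi M G" and g: "sqi M g" and h: "h \<in> Lp M r"
    and z: "H10 z Z" "weak_eq \<kappa> (\<lambda>x. G x + Z x) g h"
  shows "\<kappa>0 * l2n M Z \<le> dualC * Lp_norm M r h + l2n M g + \<bar>K\<bar> * l2n M G"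
proof -
  note C = coefficientD[OF \<kappa>]
  have Z: "sqi M Z" by (rule H10_sqi(2)[OF z(1)])
  have KG: "l2n M (\<lambda>x. \<kappa> x *\<^sub>R G x) \<le> \<bar>K\<bar> * l2n M G"
  proof (rule l2n_mono[OF G])
    show "AE x in M. norm (\<kappa> x *\<^sub>R G x) \<le> \<bar>K\<bar> * norm (G x)"
      using C(3) by eventually_elim (auto intro!: mult_right_mono)
  qed (use sqi_measurable[OF C(4)[OF G]] in auto)
  have "(\<integral>x. (\<kappa> x *\<^sub>R (G x + Z x)) \<bullet> Z x \<partial>M) = (\<integral>x. h x * z x \<partial>M) + (\<integral>x. g x \<bullet> Z x \<partial>M)"
    using z by (simp add: weak_eq_def)
  then have "(\<integral>x. (\<kappa> x *\<^sub>R Z x) \<bullet> Z x \<partial>M) = (\<integral>x. h x * z x \<partial>M) + (\<integral>x. g x \<bullet> Z x \<partial>M) - (\<integral>x. (\<kappa> x *\<^sub>R G x) \<bullet> Z x \<partial>M)"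
    using sqi_inner_integrable[OF C(4)[OF G] Z] sqi_inner_integrable[OF C(4)[OF Z] Z]
    by (simp add: scaleR_add_right inner_add_left)
  then have "\<kappa>0 * (l2n M Z)\<^sup>2 \<le> dualC * Lp_norm M r h * l2n M Z + l2n M g * l2n M Z + l2n M (\<lambda>x. \<kappa> x *\<^sub>R G x) * l2n M Z"
    using coefficient_coercive[OF \<kappa> Z] dualC(3)[OF h z(1)] l2_Cauchy_Schwarz[OF g Z] l2_Cauchy_Schwarz[OF C(4)[OF G] Z]
    by linarith
  then have "(\<kappa>0 * l2n M Z) * l2n M Z \<le> (dualC * Lp_norm M r h + l2n M g + l2n M (\<lambda>x. \<kappa> x *\<^sub>R G x)) * l2n M Z"
    by (simp add: power2_eq_square distrib_right)
  moreover have "0 \<le> dualC * Lp_norm M r h + l2n M g + l2n M (\<lambda>x. \<kappa> x *\<^sub>R G x)"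
    using dualC(1) Lp_norm_nonneg[of M r h] by simp
  ultimately have "\<kappa>0 * l2n M Z \<le> dualC * Lp_norm M r h + l2n M g + l2n M (\<lambda>x. \<kappa> x *\<^sub>R G x)"
    using l2n_nonneg[of M Z] by (cases "l2n M Z = 0") (auto simp: mult_le_cancel_right)
  then show ?thesis using KG by linarith
qed

text \<open>The difference of the two equations is tested with z n - z'. The coefficients converge
  only almost everywhere, so \<kappa> n is kept on the difference of the gradients, where it is
  coercive, and the error \<kappa> n - \<mu> falls on the fixed field G + Z', where dominated
  convergence applies.\<close>

lemma stability:
  assumes \<kappa>: "\<And>n. coefficient \<kappa>0 K (\<kappa> n)" "coefficient \<kappa>0 K \<mu>" "0 < \<kappa>0" "AE x in M. (\<lambda>n. \<kappa> n x) \<longlonglongrightarrow> \<mu> x"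
    and G: "sqi M G" and g: "l2conv M g g'"
    and h: "H \<in> Lp M r" "\<And>n. h n \<in> borel_measurable M" "h' \<in> borel_measurable M"
      "\<And>n. AE x in M. \<bar>h n x\<bar> \<le> \<bar>H x\<bar>" "AE x in M. (\<lambda>n. h n x) \<longlonglongrightarrow> h' x" "AE x in M. \<bar>h' x\<bar> \<le> \<bar>H x\<bar>"
    and z: "\<And>n. H10 (z n) (Z n)" "\<And>n. weak_eq (\<kappa> n) (\<lambda>x. G x + Z n x) (g n) (h n)"
    and z': "H10 z' Z'" "weak_eq \<mu> (\<lambda>x. G x + Z' x) g' h'"
  shows "l2conv M Z Z'" "l2conv M z z'"
proof -
  have r0: "0 < r" using r1 by simp
  note C = coefficientD[OF \<kappa>(1) \<kappa>(3)]
  note C' = coefficientD[OF \<kappa>(2,3)]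
  have sZ: "sqi M (Z n)" "sqi M Z'" for n using H10_sqi(2)[OF z(1)] H10_sqi(2)[OF z'(1)] by auto
  have sY: "sqi M (\<lambda>x. G x + Z' x)" by (rule sqi_add[OF G sZ(2)])
  note hd = Lp_norm_dominated_tendsto[OF h(1) r0 h(2,3,4,5)]
  have hn: "h n \<in> Lp M r" "h' \<in> Lp M r" for n
    using Lp_dominated(1)[OF h(1,2,4) r0] Lp_dominated(1)[OF h(1,3,6) r0] by auto
  have kc: "l2conv M (\<lambda>n x. \<kappa> n x *\<^sub>R (G x + Z' x)) (\<lambda>x. \<mu> x *\<^sub>R (G x + Z' x))"
    by (rule l2conv_mult_bounded[OF l2conv_const[OF sY] C(1) C'(1) C(3) \<kappa>(4)])
  define e where "e n = dualC * Lp_norm M r (\<lambda>x. h n x - h' x) + l2n M (\<lambda>x. g n x - g' x)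
     + l2n M (\<lambda>x. \<kappa> n x *\<^sub>R (G x + Z' x) - \<mu> x *\<^sub>R (G x + Z' x))" for n
  have e0: "e \<longlonglongrightarrow> 0"
    unfolding e_def using tendsto_add[OF tendsto_add[OF tendsto_mult_right_zero[OF hd(1), of dualC] l2convD(3)[OF g]] l2convD(3)[OF kc]]
    by simp
  have est: "\<kappa>0 * l2n M (\<lambda>x. Z n x - Z' x) \<le> e n" for n
  proof -
    define V where "V x = Z n x - Z' x" for x
    define v where "v x = z n x - z' x" for x
    have v: "H10 v V" unfolding v_def[abs_def] V_def[abs_def] by (rule H10_diff[OF z(1) z'(1)])
    have V: "sqi M V" by (rule H10_sqi(2)[OF v])
    have 1: "(\<integral>x. (\<kappa> n x *\<^sub>R (G x + Z n x)) \<bullet> V x \<partial>M) = (\<integral>x. h n x * v x \<partial>M) + (\<integral>x. g n x \<bullet> V x \<partial>M)"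
      using z(2) v by (simp add: weak_eq_def)
    have 2: "(\<integral>x. (\<mu> x *\<^sub>R (G x + Z' x)) \<bullet> V x \<partial>M) = (\<integral>x. h' x * v x \<partial>M) + (\<integral>x. g' x \<bullet> V x \<partial>M)"
      using z'(2) v by (simp add: weak_eq_def)
    have 3: "(\<integral>x. (\<kappa> n x *\<^sub>R (G x + Z n x)) \<bullet> V x \<partial>M) = (\<integral>x. (\<kappa> n x *\<^sub>R (G x + Z' x)) \<bullet> V x \<partial>M) + (\<integral>x. (\<kappa> n x *\<^sub>R V x) \<bullet> V x \<partial>M)"
    proof -
      have "(\<kappa> n x *\<^sub>R (G x + Z n x)) \<bullet> V x = (\<kappa> n x *\<^sub>R (G x + Z' x)) \<bullet> V x + (\<kappa> n x *\<^sub>R V x) \<bullet> V x" for x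
        by (simp add: V_def scaleR_add_right scaleR_diff_right inner_add_left inner_diff_left)
      then show ?thesis using sqi_inner_integrable[OF C(4)[OF sY] V] sqi_inner_integrable[OF C(4)[OF V] V] by simp
    qed
    have "(\<integral>x. (\<kappa> n x *\<^sub>R V x) \<bullet> V x \<partial>M) = (\<integral>x. (h n x - h' x) * v x \<partial>M) + (\<integral>x. (g n x - g' x) \<bullet> V x \<partial>M)
       - (\<integral>x. (\<kappa> n x *\<^sub>R (G x + Z' x) - \<mu> x *\<^sub>R (G x + Z' x)) \<bullet> V x \<partial>M)"
      using 1 2 3 dualC(2)[OF hn(1) v] dualC(2)[OF hn(2) v] sqi_inner_integrable[OF l2convD(1)[OF g] V]
        sqi_inner_integrable[OF l2convD(2)[OF g] V] sqi_inner_integrable[OF C(4)[OF sY] V] sqi_inner_integrable[OF C'(4)[OF sY] V]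
      by (simp add: left_diff_distrib inner_diff_left)
    moreover have "\<bar>\<integral>x. (h n x - h' x) * v x \<partial>M\<bar> \<le> dualC * Lp_norm M r (\<lambda>x. h n x - h' x) * l2n M V"
      by (rule dualC(3)[OF hd(2) v])
    moreover have "\<bar>\<integral>x. (g n x - g' x) \<bullet> V x \<partial>M\<bar> \<le> l2n M (\<lambda>x. g n x - g' x) * l2n M V"
      by (rule l2_Cauchy_Schwarz[OF sqi_diff[OF l2convD(1,2)[OF g]] V])
    moreover have "\<bar>\<integral>x. (\<kappa> n x *\<^sub>R (G x + Z' x) - \<mu> x *\<^sub>R (G x + Z' x)) \<bullet> V x \<partial>M\<bar>
       \<le> l2n M (\<lambda>x. \<kappa> n x *\<^sub>R (G x + Z' x) - \<mu> x *\<^sub>R (G x + Z' x)) * l2n M V"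
      by (rule l2_Cauchy_Schwarz[OF sqi_diff[OF l2convD(1,2)[OF kc]] V])
    ultimately have "\<kappa>0 * (l2n M V)\<^sup>2 \<le> e n * l2n M V"
      using coefficient_coercive[OF \<kappa>(1,3) V, of n] unfolding e_def distrib_right by linarith
    then have "(\<kappa>0 * l2n M V) * l2n M V \<le> e n * l2n M V" by (simp add: power2_eq_square)
    moreover have "0 \<le> e n" using dualC(1) Lp_norm_nonneg[of M r] by (simp add: e_def)
    ultimately have "\<kappa>0 * l2n M V \<le> e n"
      using l2n_nonneg[of M V] by (cases "l2n M V = 0") (auto simp: mult_le_cancel_right)
    then show ?thesis by (simp add: V_def[abs_def])
  qed
  have lim: "(\<lambda>n. l2n M (\<lambda>x. Z n x - Z' x)) \<longlonglongrightarrow> 0"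
  proof (rule Lim_null_comparison)
    show "\<forall>\<^sub>F n in sequentially. norm (l2n M (\<lambda>x. Z n x - Z' x)) \<le> 1 / \<kappa>0 * e n"
      using est \<kappa>(3) by (intro always_eventually allI) (simp add: field_simps)
    show "(\<lambda>n. 1 / \<kappa>0 * e n) \<longlonglongrightarrow> 0" by (rule tendsto_mult_right_zero[OF e0])
  qed
  then show "l2conv M Z Z'" using sZ by (simp add: l2conv_def)
  have "(\<lambda>n. l2n M (\<lambda>x. z n x - z' x)) \<longlonglongrightarrow> 0"
  proof (rule Lim_null_comparison[OF _ tendsto_mult_right_zero[OF lim, of Poincare_const]])
    show "\<forall>\<^sub>F n in sequentially. norm (l2n M (\<lambda>x. z n x - z' x)) \<le> Poincare_const * l2n M (\<lambda>x. Z n x - Z' x)"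
      using Poincare[OF H10_diff[OF z(1) z'(1)]] by (intro always_eventually allI) simp
  qed
  then show "l2conv M z z'" using H10_sqi(1)[OF z(1)] H10_sqi(1)[OF z'(1)] by (simp add: l2conv_def)
qed

end

section \<open>Fixed points\<close>

text \<open>On a grid of mesh 2 R / p Kuhn's combinatorial lemma gives, for each coordinate j, two
  points near a common one such that f does not lower the coordinate j of the first and does not
  raise that of the second; a limit of the common points is fixed. The index set is a set because it
  will consist of the cells that meet \<Omega>, which depend on the mesh.\<close>

lemma Brouwer_finite_index:
  fixes f :: "('j \<Rightarrow> real) \<Rightarrow> 'j \<Rightarrow> real"
  assumes J: "finite J" and R: "0 < R"
    and bound: "\<And>x j. (\<forall>j\<in>J. \<bar>x j\<bar> \<le> R) \<Longrightarrow> j \<in> J \<Longrightarrow> \<bar>f x j\<bar> \<le> R"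
    and cont: "\<And>X x j. (\<And>j. j \<in> J \<Longrightarrow> (\<lambda>n::nat. X n j) \<longlonglongrightarrow> x j) \<Longrightarrow> j \<in> J \<Longrightarrow> (\<lambda>n. f (X n) j) \<longlonglongrightarrow> f x j"
  obtains x where "\<And>j. j \<in> J \<Longrightarrow> f x j = x j"
proof -
  obtain h where h: "bij_betw h {..<card J} J"
    using ex_bij_betw_nat_finite[OF J] by (auto simp: atLeast0LessThan)
  define g where "g = inv_into {..<card J} h"
  have g: "g (h i) = i" if "i < card J" for i using bij_betw_inv_into_left[OF h] that by (simp add: g_def)
  have hg: "h (g j) = j" "g j < card J" if "j \<in> J" for j
    using bij_betw_inv_into_right[OF h that] bij_betw_inv_into[OF h] that by (auto simp: g_def bij_betw_def)
  have hJ: "h i \<in> J" if "i < card J" for i using h that by (auto simp: bij_betw_def)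
  define pt where "pt p q j = - R + 2 * R * (real (q (g j)) / real p)" for p :: nat and q :: "nat \<Rightarrow> nat" and j
  \<comment> \<open>Label 0 means that f does not lower the coordinate. On the upper face q i = p
    the label is forced to be 1, as Kuhn's lemma demands; there the coordinate is R and f cannot
    exceed it, so the label 1 keeps its meaning.\<close>
  define label where "label p q i = (if q i < p \<and> pt p q (h i) \<le> f (pt p q) (h i) then 0 else 1::nat)" for p q i
  have box: "\<bar>pt p q j\<bar> \<le> R" if "\<forall>i<card J. q i \<le> p" "0 < p" "j \<in> J" for p q j
  proof -
    have "0 \<le> real (q (g j)) / real p" "real (q (g j)) / real p \<le> 1" using that hg by (auto simp: divide_le_eq)
    then have "0 \<le> 2 * R * (real (q (g j)) / real p)" "2 * R * (real (q (g j)) / real p) \<le> 2 * R * 1"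
      using R mult_left_mono[of "real (q (g j)) / real p" 1 "2 * R"] by auto
    then show ?thesis by (simp add: pt_def abs_le_iff)
  qed
  have lab: "pt p q j \<le> f (pt p q) j" if "label p q (g j) = 0" "j \<in> J" for p q j
    using that hg[OF that(2)] by (auto simp: label_def split: if_splits)
  have lab1: "f (pt p q) j \<le> pt p q j" if "label p q (g j) = 1" "j \<in> J" "\<forall>i<card J. q i \<le> p" "0 < p" for p q j
  proof (cases "q (g j) < p")
    case True
    then show ?thesis using that hg[OF that(2)] by (auto simp: label_def split: if_splits)
  next
    case False
    then have "q (g j) = p" using that hg by (meson le_less_linear le_neq_implies_less)
    then have "pt p q j = R" using that by (simp add: pt_def)
    then show ?thesis using bound[of "pt p q" j] box[OF that(3,4)] that(2) by fastforce
  qed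
  define good where "good p q a b j \<longleftrightarrow> (\<forall>l\<in>J. \<bar>pt p a l - pt p q l\<bar> \<le> 2 * R / real p \<and> \<bar>pt p b l - pt p q l\<bar> \<le> 2 * R / real p) \<and>
      pt p a j \<le> f (pt p a) j \<and> f (pt p b) j \<le> pt p b j" for p and q a b :: "nat \<Rightarrow> nat" and j
  have "\<exists>Q. (\<forall>j\<in>J. \<bar>pt (Suc k) (fst Q) j\<bar> \<le> R) \<and> (\<forall>j\<in>J. good (Suc k) (fst Q) (fst (snd Q j)) (snd (snd Q j)) j)" for k
  proof -
    let ?p = "Suc k"
    have p0: "0 < ?p" by simp
    have l0: "\<forall>x. (\<forall>i<card J. x i \<le> ?p) \<longrightarrow> (\<forall>i<card J. x i = 0 \<longrightarrow> label ?p x i = 0)"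
    proof (intro allI impI)
      fix x i assume a: "\<forall>i<card J. x i \<le> ?p" "i < card J" "x i = 0"
      have "- R \<le> f (pt ?p x) (h i)" using bound[of "pt ?p x" "h i"] box[OF a(1) p0] hJ[OF a(2)] by fastforce
      then show "label ?p x i = 0" using a g by (simp add: label_def pt_def)
    qed
    obtain q where q: "\<forall>i<card J. q i < ?p" "\<forall>i<card J. \<exists>r s. (\<forall>j<card J. q j \<le> r j \<and> r j \<le> q j + 1) \<and>
        (\<forall>j<card J. q j \<le> s j \<and> s j \<le> q j + 1) \<and> label ?p r i \<noteq> label ?p s i"
      by (rule kuhn_lemma[where n="card J", OF p0 _ l0]) (auto simp: label_def)
    have near: "\<bar>pt ?p r j - pt ?p q j\<bar> \<le> 2 * R / ?p" if "\<forall>j<card J. q j \<le> r j \<and> r j \<le> q j + 1" "j \<in> J" for r j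
    proof -
      have "pt ?p r j - pt ?p q j = (2 * R / ?p) * (real (r (g j)) - real (q (g j)))"
        by (simp add: pt_def right_diff_distrib del: of_nat_Suc)
      moreover have "\<bar>real (r (g j)) - real (q (g j))\<bar> \<le> 1" using that hg[OF that(2)] by fastforce
      ultimately have "\<bar>pt ?p r j - pt ?p q j\<bar> = (2 * R / ?p) * \<bar>real (r (g j)) - real (q (g j))\<bar>"
        using R by (simp add: abs_mult)
      also have "\<dots> \<le> (2 * R / ?p) * 1" using R \<open>\<bar>real (r (g j)) - real (q (g j))\<bar> \<le> 1\<close> by (intro mult_left_mono) auto
      finally show ?thesis by simp
    qed
    have "\<forall>j. \<exists>ab. j \<in> J \<longrightarrow> good ?p q (fst ab) (snd ab) j"
    proof
      fix j
      have "\<exists>a b. j \<in> J \<longrightarrow> good ?p q a b j"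
      proof (cases "j \<in> J")
        case True
        from q(2) hg(2)[OF True] obtain r s where rs: "\<forall>j<card J. q j \<le> r j \<and> r j \<le> q j + 1"
          "\<forall>j<card J. q j \<le> s j \<and> s j \<le> q j + 1" "label ?p r (g j) \<noteq> label ?p s (g j)" by blast
        have le: "\<forall>i<card J. r i \<le> ?p" "\<forall>i<card J. s i \<le> ?p" using rs q(1) by fastforce+
        from rs(3) have "label ?p r (g j) = 0 \<and> label ?p s (g j) = 1 \<or> label ?p r (g j) = 1 \<and> label ?p s (g j) = 0"
          by (auto simp: label_def split: if_splits)
        then show ?thesis
        proof
          assume "label ?p r (g j) = 0 \<and> label ?p s (g j) = 1"
          then show ?thesis unfolding good_def using near[OF rs(1)] near[OF rs(2)] lab[of ?p r j] lab1[OF _ True le(2) p0] True by blast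
        next
          assume "label ?p r (g j) = 1 \<and> label ?p s (g j) = 0"
          then show ?thesis unfolding good_def using near[OF rs(1)] near[OF rs(2)] lab[of ?p s j] lab1[OF _ True le(1) p0] True by blast
        qed
      qed blast
      then show "\<exists>ab. j \<in> J \<longrightarrow> good ?p q (fst ab) (snd ab) j" by auto
    qed
    from choice[OF this] obtain ab where "\<forall>j. j \<in> J \<longrightarrow> good ?p q (fst (ab j)) (snd (ab j)) j" by blast
    moreover have "\<forall>j\<in>J. \<bar>pt ?p q j\<bar> \<le> R" using box[of q ?p] q(1) by (auto intro: less_imp_le)
    ultimately show ?thesis by (intro exI[of _ "(q, ab)"]) simp
  qed
  then have "\<forall>k. \<exists>Q. (\<forall>j\<in>J. \<bar>pt (Suc k) (fst Q) j\<bar> \<le> R) \<and> (\<forall>j\<in>J. good (Suc k) (fst Q) (fst (snd Q j)) (snd (snd Q j)) j)" ..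
  from choice[OF this] obtain Q where Q: "\<And>k. (\<forall>j\<in>J. \<bar>pt (Suc k) (fst (Q k)) j\<bar> \<le> R) \<and>
      (\<forall>j\<in>J. good (Suc k) (fst (Q k)) (fst (snd (Q k) j)) (snd (snd (Q k) j)) j)"
    by blast
  define X where "X k = pt (Suc k) (fst (Q k))" for k
  define A where "A j k = pt (Suc k) (fst (snd (Q k) j))" for j k
  define B where "B j k = pt (Suc k) (snd (snd (Q k) j))" for j k
  have XAB: "\<bar>X k j\<bar> \<le> R" "\<bar>A j k l - X k l\<bar> \<le> 2 * R / Suc k" "\<bar>B j k l - X k l\<bar> \<le> 2 * R / Suc k"
    "A j k j \<le> f (A j k) j" "f (B j k) j \<le> B j k j" if "j \<in> J" "l \<in> J" for j k l
    using Q[of k] that unfolding X_def A_def B_def good_def by auto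
  obtain s where s: "strict_mono (s :: nat \<Rightarrow> nat)" "\<And>j. j \<in> J \<Longrightarrow> \<exists>l. (\<lambda>n. X (s n) j) \<longlonglongrightarrow> l"
    by (rule function_convergent_subsequence[of J X R]) (use XAB(1) J in \<open>auto intro: countable_finite\<close>)
  have "\<forall>j. \<exists>l. j \<in> J \<longrightarrow> (\<lambda>n. X (s n) j) \<longlonglongrightarrow> l" using s(2) by blast
  from choice[OF this] obtain x where x: "\<And>j. j \<in> J \<Longrightarrow> (\<lambda>n. X (s n) j) \<longlonglongrightarrow> x j" by blast
  have z: "(\<lambda>n. 2 * R / Suc (s n)) \<longlonglongrightarrow> 0"
    using LIMSEQ_subseq_LIMSEQ[OF LIMSEQ_Suc[OF lim_const_over_n[of "2 * R"]] s(1)] by (simp add: o_def)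
  have Y: "(\<lambda>n. Y (s n) l) \<longlonglongrightarrow> x l" if "\<And>k l. l \<in> J \<Longrightarrow> \<bar>Y k l - X k l\<bar> \<le> 2 * R / Suc k" "l \<in> J" for Y l
  proof -
    have "(\<lambda>n. Y (s n) l - X (s n) l) \<longlonglongrightarrow> 0"
      by (rule Lim_null_comparison[OF _ z]) (use that in auto)
    from tendsto_add[OF this x[OF that(2)]] show ?thesis by simp
  qed
  show thesis
  proof (rule that[of x], rule antisym)
    fix j assume j: "j \<in> J"
    have A: "(\<lambda>n. A j (s n) l) \<longlonglongrightarrow> x l" and B: "(\<lambda>n. B j (s n) l) \<longlonglongrightarrow> x l" if "l \<in> J" for l
      using Y[of "A j" l] Y[of "B j" l] XAB(2,3) j that by auto
    show "x j \<le> f x j" by (rule LIMSEQ_le[OF A[OF j] cont[OF A j]]) (use XAB(4) j in auto)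
    show "f x j \<le> x j" by (rule LIMSEQ_le[OF cont[OF B j] B[OF j]]) (use XAB(5) j in auto)
  qed
qed

text \<open>Induction on the finite index set: a further subsequence keeps what has been achieved so
  far.\<close>

lemma common_subsequence:
  assumes "finite I"
    and sub: "\<And>i (r :: nat \<Rightarrow> nat) s. i \<in> I \<Longrightarrow> P i r \<Longrightarrow> strict_mono r \<Longrightarrow> strict_mono (s :: nat \<Rightarrow> nat) \<Longrightarrow> P i (\<lambda>n. r (s n))"
    and ex: "\<And>i r. i \<in> I \<Longrightarrow> strict_mono (r :: nat \<Rightarrow> nat) \<Longrightarrow> \<exists>s :: nat \<Rightarrow> nat. strict_mono s \<and> P i (\<lambda>n. r (s n))"
  shows "\<exists>r. strict_mono r \<and> (\<forall>i\<in>I. P i r)"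
  using assms
proof (induction I rule: finite_induct)
  case empty
  then show ?case using strict_mono_id by auto
next
  case (insert i I)
  have "\<exists>r. strict_mono r \<and> (\<forall>i\<in>I. P i r)"
    by (rule insert.IH) (use insert.prems in \<open>blast+\<close>)
  then obtain r where r: "strict_mono r" "\<forall>i\<in>I. P i r" by blast
  from insert.prems(2)[OF insertI1 r(1)] obtain s where s: "strict_mono s" "P i (\<lambda>n. r (s n))" by blast
  moreover have "strict_mono (\<lambda>n. r (s n))" using r(1) s(1) by (simp add: strict_mono_def)
  moreover have "P j (\<lambda>n. r (s n))" if "j \<in> I" for j using insert.prems(1)[of j r s] r s(1) that by auto
  ultimately show ?case by blast
qed

section \<open>Schauder's argument by grid averages\<close>

context bounded_domain
begin

text \<open>Functions constant on the cells are described by finitely many coefficients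
  \<open>c\<close>. The cell averages of S define a continuous map of the coefficients, bounded by
  Poincare's inequality, to which Brouwer's theorem applies.\<close>

lemma grid_fixed_point:
  fixes S :: "('i::finite \<Rightarrow> real^'n \<Rightarrow> real) \<Rightarrow> 'i \<Rightarrow> real^'n \<Rightarrow> real"
  assumes S: "\<And>z i. (\<And>i. z i \<in> borel_measurable M) \<Longrightarrow> H10 (S z i) (T z i) \<and> l2n M (T z i) \<le> R"
    and cont: "\<And>z w i. (\<And>n i. z n i \<in> borel_measurable M) \<Longrightarrow> (\<And>i. w i \<in> borel_measurable M) \<Longrightarrow>
      (\<And>i. AE x in M. (\<lambda>n::nat. z n i x) \<longlonglongrightarrow> w i x) \<Longrightarrow> l2conv M (\<lambda>n. S (z n) i) (S w i)"
    and e: "0 < e"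
  shows "\<exists>w. (\<forall>i. w i \<in> borel_measurable M) \<and> (\<forall>i. \<forall>x\<in>\<Omega>. w i x = grid_avg e (S w i) x)"
proof -
  let ?C = "cell e ` \<Omega>"
  let ?J = "?C \<times> (UNIV :: 'i set)"
  have fin: "finite ?C" by (rule cell_finite_range[OF e])
  define u where "u c i x = (\<Sum>k\<in>?C. c (k, i) * indicator {y. cell e y = k} x)" for c :: "_ \<Rightarrow> real" and i :: 'i and x
  have um: "u c i \<in> borel_measurable M" for c i
    unfolding u_def[abs_def]
    by (intro borel_measurable_sum borel_measurable_times borel_measurable_const cell_indicator_measurable[OF e])
  have ux: "u c i x = c (cell e x, i)" if "x \<in> \<Omega>" for c i x
  proof -
    have "u c i x = (\<Sum>k\<in>?C. if cell e x = k then c (k, i) else 0)" unfolding u_def by (rule sum.cong) auto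
    then show ?thesis using fin that by simp
  qed
  define f where "f c ki = (\<integral>y. indicator {y. cell e y = fst ki} y * S (u c) (snd ki) y \<partial>M) / e ^ CARD('n)" for c ki
  define B where "B = sqrt (measure M (space M)) * (Poincare_const * R) / e ^ CARD('n)"
  have fB: "\<bar>f c ki\<bar> \<le> B" for c ki
  proof -
    let ?S = "S (u c) (snd ki)"
    have S': "H10 ?S (T (u c) (snd ki)) \<and> l2n M (T (u c) (snd ki)) \<le> R" using S[of "u c" "snd ki"] um by blast
    then have s': "sqi M ?S" using H10_sqi(1) by blast
    have "\<bar>\<integral>y. indicator {y. cell e y = fst ki} y * ?S y \<partial>M\<bar> \<le> (\<integral>y. \<bar>?S y\<bar> \<partial>M)"
      by (rule cell_coefficient_integrable(2)[OF e sqi_integrable(1)[OF s']])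
    also have "\<dots> \<le> sqrt (measure M (space M)) * l2n M ?S" using sqi_integrable(2)[OF s'] by simp
    also have "l2n M ?S \<le> Poincare_const * l2n M (T (u c) (snd ki))" using Poincare S' by blast
    also have "\<dots> \<le> Poincare_const * R" using S' Poincare_const_nonneg by (auto intro: mult_left_mono)
    finally show ?thesis using e by (simp add: f_def B_def divide_right_mono mult_left_mono)
  qed
  have B0: "0 \<le> B" using order_trans[OF abs_ge_zero fB] .
  obtain c where c: "\<And>j. j \<in> ?J \<Longrightarrow> f c j = c j"
  proof (rule Brouwer_finite_index[of ?J "B + 1" f])
    show "finite ?J" using fin by simp
    show "0 < B + 1" using B0 by simp
    show "\<bar>f x j\<bar> \<le> B + 1" for x j using fB[of x j] by simp
    show "(\<lambda>n. f (X n) j) \<longlonglongrightarrow> f x j" if X: "\<And>j. j \<in> ?J \<Longrightarrow> (\<lambda>n. X n j) \<longlonglongrightarrow> x j" for X x j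
    proof -
      have "(\<lambda>n. u (X n) i y) \<longlonglongrightarrow> u x i y" for i y
        unfolding u_def by (intro tendsto_sum tendsto_mult tendsto_const X) auto
      then have "l2conv M (\<lambda>n. S (u (X n)) (snd j)) (S (u x) (snd j))"
        by (intro cont um) auto
      from l2conv_inner[OF l2conv_const[OF sqi_bounded[OF cell_indicator_measurable[OF e], of "fst j" 1]] this]
      show ?thesis unfolding f_def using e by (intro tendsto_divide tendsto_const) (auto simp: indicator_def)
    qed
  qed blast
  show ?thesis
  proof (intro exI[of _ "u c"] conjI allI ballI)
    fix i x assume x: "x \<in> \<Omega>"
    then show "u c i x = grid_avg e (S (u c) i) x"
      using c[of "(cell e x, i)"] by (simp add: ux f_def grid_avg_def)
  qed (rule um)
qed

text \<open>The fixed points \<open>w n\<close> for finer and finer grids differ from S (w n) by at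
  most a multiple of the mesh. Rellich's theorem, applied to S (w n), thus yields a subsequence of
  \<open>w n\<close> converging almost everywhere, and this is the convergence under which S is
  continuous.\<close>

lemma Schauder:
  fixes S :: "('i::finite \<Rightarrow> real^'n \<Rightarrow> real) \<Rightarrow> 'i \<Rightarrow> real^'n \<Rightarrow> real"
  assumes S: "\<And>z i. (\<And>i. z i \<in> borel_measurable M) \<Longrightarrow> H10 (S z i) (T z i) \<and> l2n M (T z i) \<le> R"
    and cont: "\<And>z w i. (\<And>n i. z n i \<in> borel_measurable M) \<Longrightarrow> (\<And>i. w i \<in> borel_measurable M) \<Longrightarrow>
      (\<And>i. AE x in M. (\<lambda>n::nat. z n i x) \<longlonglongrightarrow> w i x) \<Longrightarrow> l2conv M (\<lambda>n. S (z n) i) (S w i)"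
  obtains w where "\<And>i. w i \<in> borel_measurable M" "\<And>i. AE x in M. S w i x = w i x"
proof -
  have "\<forall>n. \<exists>w. (\<forall>i. w i \<in> borel_measurable M) \<and> (\<forall>i. \<forall>x\<in>\<Omega>. w i x = grid_avg (1 / real (Suc n)) (S w i) x)"
    by (intro allI grid_fixed_point[OF S cont]) auto
  from choice[OF this] obtain w where w: "\<And>n i. w n i \<in> borel_measurable M"
    "\<And>n i x. x \<in> \<Omega> \<Longrightarrow> w n i x = grid_avg (1 / real (Suc n)) (S (w n) i) x" by blast
  have S': "H10 (S (w n) i) (T (w n) i) \<and> l2n M (T (w n) i) \<le> R" for n i using S[of "w n" i] w(1) by blast
  have s: "sqi M (S (w n) i)" for n i using S' H10_sqi(1) by blast
  have sw: "sqi M (w n i)" for n i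
    by (rule sqi_cong_AE[OF grid_avg_sqi[OF _ s] w(1), of "1 / real (Suc n)"]) (use w(2) in auto)
  have close: "(\<lambda>n. l2n M (\<lambda>x. w n i x - S (w n) i x)) \<longlonglongrightarrow> 0" for i
  proof (rule Lim_null_comparison)
    show "\<forall>\<^sub>F n in sequentially. norm (l2n M (\<lambda>x. w n i x - S (w n) i x)) \<le> (grid_const * R) * (1 / real (Suc n))"
    proof (intro always_eventually allI)
      fix n
      have "l2n M (\<lambda>x. w n i x - S (w n) i x) = l2n M (\<lambda>x. S (w n) i x - grid_avg (1 / real (Suc n)) (S (w n) i) x)"
        unfolding l2n_minus_commute[of M "w n i"]
        by (rule l2n_cong_AE) (use sqi_measurable[OF sqi_diff[OF s sw]]
            sqi_measurable[OF sqi_diff[OF s grid_avg_sqi[OF _ s]]] w(2) in auto)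
      also have "\<dots> \<le> grid_const * (1 / real (Suc n)) * l2n M (T (w n) i)"
        by (rule grid_avg_close) (use S' in auto)
      also have "\<dots> \<le> grid_const * (1 / real (Suc n)) * R"
        using S' grid_const_nonneg by (intro mult_left_mono) auto
      finally show "norm (l2n M (\<lambda>x. w n i x - S (w n) i x)) \<le> (grid_const * R) * (1 / real (Suc n))" by simp
    qed
    show "(\<lambda>n. grid_const * R * (1 / real (Suc n))) \<longlonglongrightarrow> 0"
      by (rule tendsto_mult_right_zero[OF LIMSEQ_Suc[OF lim_const_over_n]])
  qed
  have dc: "l2conv M (\<lambda>n x. w (q n) i x - S (w (q n)) i x) (\<lambda>x. 0)" if "strict_mono q" for q :: "nat \<Rightarrow> nat" and i
    unfolding l2conv_def using LIMSEQ_subseq_LIMSEQ[OF close that, of i] sqi_diff[OF sw s] by (simp add: o_def)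
  define P where "P i q \<longleftrightarrow> (\<exists>v. l2conv M (\<lambda>n. w (q n) i) v \<and> (AE x in M. (\<lambda>n. w (q n) i x) \<longlonglongrightarrow> v x))" for i and q :: "nat \<Rightarrow> nat"
  have "\<exists>q. strict_mono q \<and> (\<forall>i\<in>UNIV. P i q)"
  proof (rule common_subsequence)
    show "P i (\<lambda>n. q (s n))" if "P i q" "strict_mono s" for i and q s :: "nat \<Rightarrow> nat"
    proof -
      from that(1) obtain v where v: "l2conv M (\<lambda>n. w (q n) i) v" "AE x in M. (\<lambda>n. w (q n) i x) \<longlonglongrightarrow> v x"
        by (auto simp: P_def)
      have "AE x in M. (\<lambda>n. w (q (s n)) i x) \<longlonglongrightarrow> v x"
        using v(2) by eventually_elim (use LIMSEQ_subseq_LIMSEQ[OF _ that(2)] in \<open>fastforce simp: o_def\<close>)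
      then show ?thesis unfolding P_def using l2conv_subseq[OF v(1) that(2)] by blast
    qed
    show "\<exists>s. strict_mono s \<and> P i (\<lambda>n. q (s n))" if q: "strict_mono q" for i and q :: "nat \<Rightarrow> nat"
    proof -
      obtain s v where sv: "strict_mono s" "l2conv M (\<lambda>n. S (w (q (s n))) i) v"
        by (rule Rellich[of "\<lambda>n. S (w (q n)) i" "\<lambda>n. T (w (q n)) i" R]) (use S' in auto)
      have "strict_mono (\<lambda>n. q (s n))" using q sv(1) by (simp add: strict_mono_def)
      from l2conv_add[OF dc[OF this, of i] sv(2)] have c: "l2conv M (\<lambda>n. w (q (s n)) i) v" by simp
      from l2conv_AE_subseq[OF c] obtain t where t: "strict_mono t" "AE x in M. (\<lambda>n. w (q (s (t n))) i x) \<longlonglongrightarrow> v x" by blast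
      show ?thesis
      proof (intro exI[of _ "\<lambda>n. s (t n)"] conjI)
        show "strict_mono (\<lambda>n. s (t n))" using sv(1) t(1) by (simp add: strict_mono_def)
        show "P i (\<lambda>n. q (s (t n)))" unfolding P_def using l2conv_subseq[OF c t(1)] t(2) by blast
      qed
    qed
  qed simp
  then obtain q where q: "strict_mono q" "\<And>i. P i q" by blast
  have "\<forall>i. \<exists>v. l2conv M (\<lambda>n. w (q n) i) v \<and> (AE x in M. (\<lambda>n. w (q n) i x) \<longlonglongrightarrow> v x)" using q(2) by (simp add: P_def)
  from choice[OF this] obtain v where v: "\<And>i. l2conv M (\<lambda>n. w (q n) i) (v i)" "\<And>i. AE x in M. (\<lambda>n. w (q n) i x) \<longlonglongrightarrow> v i x" by blast
  have vm: "v i \<in> borel_measurable M" for i by (rule sqi_measurable[OF l2convD(2)[OF v(1)]])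
  \<comment> \<open>The limit of S (w (q n)) is computed twice, by continuity of S and by its
    closeness to w (q n); uniqueness of the limit is the fixed point equation.\<close>
  have 1: "l2conv M (\<lambda>n. S (w (q n)) i) (S v i)" for i by (rule cont[OF w(1) vm v(2)])
  have 2: "l2conv M (\<lambda>n. S (w (q n)) i) (v i)" for i using l2conv_diff[OF v(1)[of i] dc[OF q(1), of i]] by simp
  show thesis by (rule that[of v, OF vm l2conv_unique[OF 1 2]])
qed

end

section \<open>Pointwise bounds\<close>

text \<open>The cut-off at t makes the logarithm meaningful for all real s. It lies below the band
  of values on which \<open>step\<close> varies, so the composition is constant around the kink of
  the maximum and stays C^1. For \<sigma> = -1 small values are high levels, hence the condition on
  l in place of k.\<close>

lemma log_step:
  fixes \<sigma> t :: real
  assumes \<sigma>: "\<sigma> = 1 \<and> ln t < k \<or> \<sigma> = - 1 \<and> l < - ln t" and t: "0 < t" and kl: "k < l"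
  shows "C1b (\<lambda>s. step k l (\<sigma> * ln (max s t))) (\<lambda>s. \<sigma> * step' k l (\<sigma> * ln (max s t)) / max s t)"
    "\<And>s. step' k l (\<sigma> * ln (max s t)) \<noteq> 0 \<Longrightarrow> t < s \<and> k < \<sigma> * ln s \<and> \<sigma> * ln s < l"
proof -
  note S = step_props[OF kl]
  \<comment> \<open>The lower end of the band in terms of s itself: there ln s = k or - ln s =
    l.\<close>
  define t' where "t' = (if \<sigma> = 1 then exp k else exp (- l))"
  have "ln t < ln t'" using \<sigma> by (auto simp: t'_def)
  then have t': "t < t'" using t ln_less_cancel_iff[of t t'] by (simp add: t'_def split: if_splits)
  have dead: "step k l (\<sigma> * ln (max s t)) = (if \<sigma> = 1 then 0 else l - k)" "step' k l (\<sigma> * ln (max s t)) = 0" if "s < t'" for s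
  proof -
    have "ln (max s t) < ln t'" using that t' t by (subst ln_less_cancel_iff) auto
    then show "step k l (\<sigma> * ln (max s t)) = (if \<sigma> = 1 then 0 else l - k)" "step' k l (\<sigma> * ln (max s t)) = 0"
      using \<sigma> S by (auto simp: t'_def)
  qed
  have der: "((\<lambda>s. step k l (\<sigma> * ln (max s t))) has_real_derivative \<sigma> * step' k l (\<sigma> * ln (max s t)) / max s t) (at s)" for s
  proof (cases "s < t'")
    case True
    have "((\<lambda>s. step k l (\<sigma> * ln (max s t))) has_real_derivative 0) (at s)"
      by (rule has_field_derivative_transform_within_open[of "\<lambda>_. if \<sigma> = 1 then 0 else l - k" _ _ "{..<t'}"])
        (use True dead in auto)
    then show ?thesis using dead(2)[OF True] by simp
  next
    case False
    then have s: "t < s" "0 < s" using t' t by auto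
    have "((\<lambda>s. step k l (\<sigma> * ln s)) has_real_derivative step' k l (\<sigma> * ln s) * (\<sigma> * (1 / s))) (at s)"
      by (rule DERIV_chain2[OF S(11)]) (use s in \<open>auto intro!: derivative_eq_intros\<close>)
    then have "((\<lambda>s. step k l (\<sigma> * ln (max s t))) has_real_derivative step' k l (\<sigma> * ln s) * (\<sigma> * (1 / s))) (at s)"
      by (rule has_field_derivative_transform_within_open[of _ _ _ "{t<..}"]) (use s in auto)
    then show ?thesis using s by (simp add: max_def mult.commute)
  qed
  have mt: "max s t \<noteq> 0" for s using t by (simp add: max_def)
  have "continuous_on UNIV (\<lambda>s. step' k l (\<sigma> * ln (max s t)))"
    by (rule continuous_on_compose2[OF S(10)]) (use mt in \<open>auto intro!: continuous_intros\<close>)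
  then have "continuous_on UNIV (\<lambda>s. \<sigma> * step' k l (\<sigma> * ln (max s t)) / max s t)"
    using mt by (auto intro!: continuous_intros)
  moreover have "\<bar>\<sigma> * step' k l (\<sigma> * ln (max s t)) / max s t\<bar> \<le> 2 / t" for s
  proof -
    have "\<bar>\<sigma> * step' k l (\<sigma> * ln (max s t)) / max s t\<bar> = step' k l (\<sigma> * ln (max s t)) / max s t"
      using \<sigma> t S(2)[of "\<sigma> * ln (max s t)"] by (auto simp: abs_mult)
    also have "\<dots> \<le> 2 / t" by (rule frac_le) (use S t in auto)
    finally show ?thesis .
  qed
  ultimately show "C1b (\<lambda>s. step k l (\<sigma> * ln (max s t))) (\<lambda>s. \<sigma> * step' k l (\<sigma> * ln (max s t)) / max s t)"
    using der unfolding C1b_def by blast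
  show "t < s \<and> k < \<sigma> * ln s \<and> \<sigma> * ln s < l" if "step' k l (\<sigma> * ln (max s t)) \<noteq> 0" for s
  proof -
    have "t < s" using dead(2)[of s] that t' by force
    then have "max s t = s" by simp
    then show ?thesis using that S(7)[of "\<sigma> * ln s"] S(9)[of "\<sigma> * ln s"] \<open>t < s\<close> by (metis not_le)
  qed
qed

text \<open>It serves for the primitive of s P'(s) in \<open>level_bound\<close> and for that of the
  trapezoid in \<open>cutoff_exists\<close>. Since g vanishes on the convex set I, normalising the
  primitive at one point of I makes it vanish on all of I.\<close>

lemma C1b_antiderivative:
  assumes g: "continuous_on UNIV g" "\<And>t. \<bar>g t\<bar> \<le> L" and I: "convex I" "\<And>t. t \<in> I \<Longrightarrow> g t = 0"
  obtains P where "C1b P g" "\<And>t. t \<in> I \<Longrightarrow> P t = 0"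
proof -
  have "\<exists>F. \<forall>x. - \<infinity> < ereal x \<longrightarrow> ereal x < \<infinity> \<longrightarrow> (F has_vector_derivative g x) (at x)"
    by (rule einterval_antiderivative) (use g(1) in \<open>auto simp: continuous_on_eq_continuous_at\<close>)
  then obtain F where F: "(F has_real_derivative g x) (at x)" for x
    by (auto simp: has_real_derivative_iff_has_vector_derivative)
  \<comment> \<open>The point of normalisation; for empty I, as in \<open>cutoff_exists\<close>, it
    is an unspecified number.\<close>
  define p where "p = (SOME p. p \<in> I)"
  have "F t - F p = 0" if t: "t \<in> I" for t
  proof -
    have p: "p \<in> I" unfolding p_def using t by (rule someI)
    obtain c where "\<forall>x\<in>I. F x = c"
      using has_field_derivative_zero_constant[OF I(1), of F] has_field_derivative_at_within[OF F] I(2) by metis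
    then have "F t = F p" using t p by simp
    then show ?thesis by simp
  qed
  moreover have "C1b (\<lambda>t. F t - F p) g"
    unfolding C1b_def using F g by (auto intro!: derivative_eq_intros)
  ultimately show thesis by (rule that[rotated])
qed

section \<open>Level set estimates for the logarithm\<close>

context elliptic_domain
begin

text \<open>The gain 2/N of \<open>Faber_Krahn\<close> less the loss 1/r of Hoelder's inequality for
  the source. It is the exponent \<beta> of the iteration and is positive because r > N/2.\<close>

definition rate where "rate = 2 / real CARD('n) - 1 / r"

lemma rate_pos: "0 < rate"
proof -
  have "1 / r < 2 / real CARD('n)" using exponent r1 by (simp add: field_simps)
  then show ?thesis by (simp add: rate_def)
qed

text \<open>The lower bound that \<open>Stampacchia_iteration\<close> puts on d, with \<mu> = vol,
  stripped of the factor \<open>Lp_norm M r H / c\<close> that depends on the equation.\<close>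

definition level_const where "level_const = 4 * FK_const * vol powr rate * 2 powr (1 + 1 / rate)"

lemma level_const_nonneg: "0 \<le> level_const"
  using FK_const_nonneg by (simp add: level_const_def)

text \<open>
  The test function \<open>step k l (\<sigma> ln \<theta>)\<close> turns the degenerate diffusion \<open>\<kappa> \<ge> c / \<theta>\<close> into
  a uniformly elliptic one for \<open>ln \<theta>\<close>, and the transport term vanishes because \<open>w\<close> is solenoidal.
\<close>
lemma level_bound:
  fixes \<sigma> k0 d c :: real and f z h H \<kappa> :: "real^'n \<Rightarrow> real"
  assumes \<sigma>: "\<sigma> = 1 \<or> \<sigma> = - 1"
    and f: "wgr f G" "\<And>x. x \<in> \<Omega> \<Longrightarrow> 0 < f x" "\<And>x. x \<in> \<Omega> \<Longrightarrow> \<sigma> * ln (f x) \<le> k0"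
    and z: "H10 z Z" and eq: "weak_eq \<kappa> (\<lambda>x. G x + Z x) (\<lambda>x. T (f x + z x) *\<^sub>R w x) h"
    and \<kappa>: "coefficient \<kappa>0 K \<kappa>" "0 < \<kappa>0"
    and w: "\<And>v V. H10 v V \<Longrightarrow> (\<integral>x. w x \<bullet> V x \<partial>M) = 0"
    and T: "\<And>s. 0 < s \<Longrightarrow> k0 \<le> \<sigma> * ln s \<Longrightarrow> \<sigma> * ln s \<le> k0 + d \<Longrightarrow> T s = s"
    and c: "0 < c" "AE x in M. 0 < f x + z x \<longrightarrow> k0 \<le> \<sigma> * ln (f x + z x) \<longrightarrow> \<sigma> * ln (f x + z x) \<le> k0 + d \<longrightarrow> c \<le> \<kappa> x * (f x + z x)"
    and h: "h \<in> Lp M r" "H \<in> Lp M r" "AE x in M. \<sigma> * h x \<le> H x" "AE x in M. 0 \<le> H x"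
    and d: "0 < d" "level_const * Lp_norm M r H / c \<le> d"
  shows "AE x in M. if \<sigma> = 1 then f x + z x \<le> exp (k0 + d) else exp (- (k0 + d)) \<le> f x + z x"
proof -
  note W = wgrD[OF f(1)]
  define Y where "Y x = G x + Z x" for x
  have sY: "sqi M Y" unfolding Y_def[abs_def] by (rule sqi_add[OF W(2) H10_sqi(2)[OF z]])
  define \<theta> where "\<theta> x = f x + z x" for x
  note [measurable] = sqi_measurable[OF W(1)] sqi_measurable[OF H10_sqi(1)[OF z]]
  have \<theta>m [measurable]: "\<theta> \<in> borel_measurable M" unfolding \<theta>_def[abs_def] by measurable
  \<comment> \<open>A positive number strictly below every value whose level lies between k0 and k0
    + d, as \<open>log_step\<close> requires.\<close>
  define t where "t = (if \<sigma> = 1 then exp (k0 - 1) else exp (- (k0 + d) - 1))"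
  have t: "0 < t" by (simp add: t_def)
  define \<xi> where "\<xi> x = \<sigma> * ln (max (\<theta> x) t)" for x
  have \<xi>m [measurable]: "\<xi> \<in> borel_measurable M" unfolding \<xi>_def[abs_def] by measurable
  have Lf: "\<sigma> * ln (max s t) \<le> k0" if "0 < s" "\<sigma> * ln s \<le> k0" for s
  proof (cases "\<sigma> = 1")
    case True
    then show ?thesis using that by (auto simp: t_def max_def)
  next
    case False
    then have s: "\<sigma> = - 1" using \<sigma> by blast
    have "ln s \<le> ln (max s t)" "- ln s \<le> k0" using that t s by simp_all
    then have "- ln (max s t) \<le> k0" by linarith
    then show ?thesis using s by simp
  qed
  define a where "a k = measure M {x\<in>\<Omega>. k < \<xi> x}" for k
  have Asets: "{x\<in>\<Omega>. k < \<xi> x} \<in> sets M" "{x\<in>\<Omega>. k \<le> \<xi> x} \<in> sets M" for k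
    using measurable_sets[OF \<xi>m, of "{k<..}"] measurable_sets[OF \<xi>m, of "{k..}"] by (simp_all add: vimage_def Int_def conj_commute)
  \<comment> \<open>The 4 is a 2 from Hoelder's inequality on a set times a 2 from the ellipticity
    estimate, where the height 2 of \<open>step'\<close> enters.\<close>
  define C where "C = 4 * FK_const * Lp_norm M r H / c"
  have C0: "0 \<le> C" using FK_const_nonneg Lp_norm_nonneg[of M r H] c(1) by (simp add: C_def)
  have step: "(l - k) * a l \<le> C * a k powr (1 + rate)" if k: "k0 \<le> k" and kl: "k < l" and l: "l \<le> k0 + d" for k l
  proof -
    note S = step_props[OF kl]
    have st: "\<sigma> = 1 \<and> ln t < k \<or> \<sigma> = - 1 \<and> l < - ln t" using \<sigma> k l by (auto simp: t_def)
    note LS = log_step[OF st t kl]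
    define P P' where "P s = step k l (\<sigma> * ln (max s t))" and "P' s = \<sigma> * step' k l (\<sigma> * ln (max s t)) / max s t" for s
    have CP: "C1b P P'" unfolding P_def[abs_def] P'_def[abs_def] by (rule LS(1))
    note CD = C1bD[OF CP]
    have act: "t < s \<and> k < \<sigma> * ln s \<and> \<sigma> * ln s < l" if "P' s \<noteq> 0" for s using LS(2)[of s] that by (auto simp: P'_def)
    let ?I = "{s. 0 < s \<and> \<sigma> * ln s \<le> k0}"
    have fI: "f x \<in> ?I" if "x \<in> \<Omega>" for x using f that by auto
    have PI: "P s = 0" "P' s = 0" if "s \<in> ?I" for s
      using Lf[of s] that k S(6,7) by (auto simp: P_def P'_def)
    define v V where "v x = P (f x + z x)" and "V x = P' (f x + z x) *\<^sub>R (G x + Z x)" for x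
    have vV: "H10 v V" unfolding v_def[abs_def] V_def[abs_def]
      by (rule H10_compose[OF f(1) fI z CP PI])
    have Veq: "V x = P' (\<theta> x) *\<^sub>R Y x" and veq: "v x = step k l (\<xi> x)" for x
      by (simp_all add: V_def v_def Y_def \<theta>_def \<xi>_def P_def)
    note sV = H10_sqi(2)[OF vV]
    have transport: "(\<integral>x. (T (f x + z x) *\<^sub>R w x) \<bullet> V x \<partial>M) = 0"
    proof -
      obtain B where B: "\<And>s. \<bar>P' s\<bar> \<le> B" using CD(6) by blast
      \<comment> \<open>T is the identity on the band of levels, and off the band P'
        vanishes.\<close>
      have T': "T s * P' s = s * P' s" for s
        using T[of s] act[of s] t k l by (cases "P' s = 0") auto
      have bnd: "\<bar>s * P' s\<bar> \<le> 2" for s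
      proof (cases "P' s = 0")
        case False
        from act[OF this] have "t < s" by blast
        then have "\<bar>s * P' s\<bar> = step' k l (\<sigma> * ln s)" using t \<sigma> S(2)[of "\<sigma> * ln s"] by (auto simp: P'_def max_def abs_mult)
        then show ?thesis using S(3) by simp
      qed simp
      have conv: "convex ?I"
      proof -
        have "?I = (if \<sigma> = 1 then {0<..exp k0} else {exp (- k0)..})"
        proof (cases "\<sigma> = 1")
          case True
          then show ?thesis by (auto simp: ln_le_cancel_iff[symmetric] ln_ge_iff simp del: ln_le_cancel_iff)
        next
          case False
          then have s: "\<sigma> = - 1" using \<sigma> by blast
          have "0 < s \<and> - ln s \<le> k0 \<longleftrightarrow> exp (- k0) \<le> s" for s
            using ln_ge_iff[of s "- k0"] exp_gt_zero[of "- k0"] by linarith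
          then show ?thesis using s by auto
        qed
        then show ?thesis by (simp add: convex_real_interval)
      qed
      \<comment> \<open>With Q' = s P'(s) the transport integrand is w times the gradient of Q (f +
        z), and Q (f + z) lies in H10 like the test function itself.\<close>
      obtain Q where Q: "C1b Q (\<lambda>s. s * P' s)" "\<And>s. s \<in> ?I \<Longrightarrow> Q s = 0"
        by (rule C1b_antiderivative[of "\<lambda>s. s * P' s" 2, OF _ bnd conv]) (use CD(3) PI in \<open>auto intro!: continuous_intros\<close>)
      have "H10 (\<lambda>x. Q (f x + z x)) (\<lambda>x. ((f x + z x) * P' (f x + z x)) *\<^sub>R (G x + Z x))"
        by (rule H10_compose[OF f(1) fI z Q]) (use PI in auto)
      moreover have "(T (f x + z x) *\<^sub>R w x) \<bullet> V x = w x \<bullet> (((f x + z x) * P' (f x + z x)) *\<^sub>R (G x + Z x))" for x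
        unfolding V_def T'[symmetric] by simp
      ultimately show ?thesis using w by presburger
    qed
    have main: "\<sigma> * (\<integral>x. (\<kappa> x *\<^sub>R Y x) \<bullet> V x \<partial>M) = \<sigma> * (\<integral>x. h x * v x \<partial>M)"
      using eq vV transport by (simp add: weak_eq_def Y_def)
    have low: "c * (1/2) * (l2n M V)\<^sup>2 \<le> \<sigma> * (\<integral>x. (\<kappa> x *\<^sub>R Y x) \<bullet> V x \<partial>M)"
    proof -
      have "c * (1/2) * (l2n M V)\<^sup>2 = (\<integral>x. c * (1/2) * (norm (V x))\<^sup>2 \<partial>M)" by (simp add: l2n_power2)
      also have "\<dots> \<le> (\<integral>x. \<sigma> * ((\<kappa> x *\<^sub>R Y x) \<bullet> V x) \<partial>M)"
      proof (rule integral_mono_AE)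
        show "AE x in M. c * (1/2) * (norm (V x))\<^sup>2 \<le> \<sigma> * ((\<kappa> x *\<^sub>R Y x) \<bullet> V x)"
          using c(2)
        proof eventually_elim
          case (elim x)
          show ?case
          proof (cases "P' (\<theta> x) = 0")
            case False
            note A = act[OF False]
            define q where "q = step' k l (\<sigma> * ln (\<theta> x))"
            have \<theta>0: "0 < \<theta> x" using A t by simp
            have q: "0 \<le> q" "q \<le> 2" using S by (auto simp: q_def)
            have P': "P' (\<theta> x) = \<sigma> * q / \<theta> x" using A by (simp add: P'_def q_def max_def)
            have ck: "c \<le> \<kappa> x * \<theta> x" using elim A \<theta>0 k l by (simp add: \<theta>_def)
            \<comment> \<open>From 0 \<le> q \<le> 2 one gets q^2 \<le> 2 q, the price for a
              derivative that is a tent and not an indicator.\<close>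
            have "c * (1/2) * q\<^sup>2 = (1/2 * c * q) * q" by (simp add: power2_eq_square)
            also have "\<dots> \<le> (1/2 * c * q) * 2" using q c(1) by (intro mult_left_mono) auto
            also have "\<dots> = c * q" by simp
            also have "\<dots> \<le> \<kappa> x * \<theta> x * q" using ck q by (intro mult_right_mono) auto
            finally have "c * (1/2) * q\<^sup>2 * ((norm (Y x))\<^sup>2 / (\<theta> x)\<^sup>2) \<le> \<kappa> x * \<theta> x * q * ((norm (Y x))\<^sup>2 / (\<theta> x)\<^sup>2)"
              by (rule mult_right_mono) simp
            moreover have "(norm (V x))\<^sup>2 = q\<^sup>2 * ((norm (Y x))\<^sup>2 / (\<theta> x)\<^sup>2)"
              using \<sigma> by (auto simp: Veq P' power_mult_distrib power_divide)
            moreover have "\<sigma> * ((\<kappa> x *\<^sub>R Y x) \<bullet> V x) = \<kappa> x * \<theta> x * q * ((norm (Y x))\<^sup>2 / (\<theta> x)\<^sup>2)"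
              using \<sigma> \<theta>0 by (auto simp: Veq P' dot_square_norm power2_eq_square)
            ultimately show ?thesis by simp
          qed (simp add: Veq)
        qed
      qed (use sV sqi_inner_integrable[OF coefficientD(4)[OF \<kappa> sY] sV] in \<open>auto simp: sqi_def\<close>)
      finally show ?thesis by simp
    qed
    have up: "\<sigma> * (\<integral>x. h x * v x \<partial>M) \<le> (l - k) * (2 * Lp_norm M r H * a k powr (1 - 1/r))"
    proof -
      note I = Lp_integral_set[OF h(2) r1 Asets(1)[of k]]
      have iA: "integrable M (\<lambda>x. \<bar>H x\<bar> * indicator {x\<in>\<Omega>. k < \<xi> x} x)"
        by (rule integrable_real_mult_indicator[OF Asets(1) integrable_abs[OF I(1)], of k])
      have "\<sigma> * (\<integral>x. h x * v x \<partial>M) = (\<integral>x. \<sigma> * (h x * v x) \<partial>M)" by simp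
      also have "\<dots> \<le> (\<integral>x. (l - k) * (\<bar>H x\<bar> * indicator {x\<in>\<Omega>. k < \<xi> x} x) \<partial>M)"
      proof (rule integral_mono_AE)
        show "integrable M (\<lambda>x. \<sigma> * (h x * v x))" using dualC(2)[OF h(1) vV] by simp
        show "integrable M (\<lambda>x. (l - k) * (\<bar>H x\<bar> * indicator {x\<in>\<Omega>. k < \<xi> x} x))" using iA by simp
        show "AE x in M. \<sigma> * (h x * v x) \<le> (l - k) * (\<bar>H x\<bar> * indicator {x\<in>\<Omega>. k < \<xi> x} x)"
          using h(3,4) AE_space[of M]
        proof eventually_elim
          case (elim x)
          have "\<sigma> * (h x * v x) = (\<sigma> * h x) * v x" by simp
          also have "\<dots> \<le> H x * v x" using elim S(4) by (intro mult_right_mono) (auto simp: veq)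
          also have "\<dots> \<le> (l - k) * (\<bar>H x\<bar> * indicator {x\<in>\<Omega>. k < \<xi> x} x)"
          proof (cases "k < \<xi> x")
            case True
            then show ?thesis using elim S(5)[of "\<xi> x"] by (simp add: veq mult.commute[of "l - k"] mult_left_mono)
          next
            case False
            then show ?thesis using S(6)[of "\<xi> x"] by (simp add: veq)
          qed
          finally show ?case .
        qed
      qed
      also have "\<dots> = (l - k) * (\<integral>x. \<bar>H x\<bar> * indicator {x\<in>\<Omega>. k < \<xi> x} x \<partial>M)" by simp
      also have "\<dots> \<le> (l - k) * (2 * Lp_norm M r H * a k powr (1 - 1/r))"
        unfolding a_def using I(2) kl by (intro mult_left_mono) auto
      finally show ?thesis .
    qed
    have E: "(l2n M V)\<^sup>2 \<le> (l - k) * (4 / c * Lp_norm M r H * a k powr (1 - 1/r))"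
    proof -
      have "c * (1/2) * (l2n M V)\<^sup>2 \<le> (l - k) * (2 * Lp_norm M r H * a k powr (1 - 1/r))"
        using low main up by linarith
      then show ?thesis using c(1) by (simp add: field_simps)
    qed
    \<comment> \<open>The energy estimate \<open>E\<close> carries one factor l - k, which cancels
      against one of the two produced by Chebyshev's inequality.\<close>
    have "(l - k)\<^sup>2 * a l \<le> (l - k)\<^sup>2 * measure M {x\<in>\<Omega>. l \<le> \<xi> x}"
      unfolding a_def by (intro mult_left_mono finite_measure_mono Asets) auto
    also have "\<dots> \<le> FK_const * a k powr (2 / real CARD('n)) * (l2n M V)\<^sup>2"
      unfolding a_def by (rule level_set_estimate[OF _ kl \<xi>m]) (use vV in \<open>simp add: veq[abs_def]\<close>)
    also have "\<dots> \<le> FK_const * a k powr (2 / real CARD('n)) * ((l - k) * (4 / c * Lp_norm M r H * a k powr (1 - 1/r)))"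
      using E FK_const_nonneg by (intro mult_left_mono) auto
    also have "\<dots> = (l - k) * (C * (a k powr (2 / real CARD('n)) * a k powr (1 - 1/r)))" by (simp add: C_def)
    also have "a k powr (2 / real CARD('n)) * a k powr (1 - 1/r) = a k powr (1 + rate)"
      by (simp add: powr_add[symmetric] rate_def algebra_simps)
    finally have "(l - k) * ((l - k) * a l) \<le> (l - k) * (C * a k powr (1 + rate))" by (simp add: power2_eq_square mult.assoc)
    then show ?thesis using kl by (simp add: mult_le_cancel_left)
  qed
  have "a (k0 + d) = 0"
  proof (rule Stampacchia_iteration[OF _ _ _ step rate_pos C0 d(1)])
    show "a l \<le> a k" if "k \<le> l" for k l
      unfolding a_def by (intro finite_measure_mono Asets) (use that in auto)
    show "0 \<le> a k" for k by (simp add: a_def)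
    show "a k0 \<le> vol" unfolding a_def by (rule measure_le_vol)
    show "C * vol powr rate * 2 powr (1 + 1 / rate) \<le> d"
      using d(2) by (simp add: C_def level_const_def mult_ac)
  qed
  then have "{x\<in>\<Omega>. k0 + d < \<xi> x} \<in> null_sets M"
    using Asets(1)[of "k0 + d"] by (intro null_setsI) (simp_all add: a_def emeasure_eq_measure)
  then have "AE x in M. \<not> (x \<in> \<Omega> \<and> k0 + d < \<xi> x)" by (auto dest: AE_not_in)
  with AE_space[of M] show ?thesis
  proof eventually_elim
    case (elim x)
    then have \<xi>: "\<xi> x \<le> k0 + d" by simp
    show ?case
    proof (cases "\<sigma> = 1")
      case True
      then have "ln (max (\<theta> x) t) \<le> k0 + d" using \<xi> by (simp add: \<xi>_def)
      then have "exp (ln (max (\<theta> x) t)) \<le> exp (k0 + d)" by (rule exp_le_cancel_iff[THEN iffD2])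
      moreover have "exp (ln (max (\<theta> x) t)) = max (\<theta> x) t" using t by (intro exp_ln) auto
      ultimately have "max (\<theta> x) t \<le> exp (k0 + d)" by metis
      then show ?thesis using True by (simp add: \<theta>_def)
    next
      case False
      then have "\<sigma> = - 1" using \<sigma> by blast
      then have "- (k0 + d) \<le> ln (max (\<theta> x) t)" using \<xi> by (simp add: \<xi>_def)
      then have "exp (- (k0 + d)) \<le> max (\<theta> x) t" using t by (subst (asm) ln_ge_iff) auto
      moreover have "t < exp (- (k0 + d))" using False by (simp add: t_def)
      ultimately show ?thesis using False by (simp add: \<theta>_def max_def split: if_splits)
    qed
  qed
qed

end

section \<open>The truncated system\<close>

definition clamp_to :: "real \<Rightarrow> real \<Rightarrow> real \<Rightarrow> real" where
  "clamp_to m m' s = max m (min s m')"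

lemma clamp_to:
  assumes "m \<le> m'"
  shows "m \<le> clamp_to m m' s" "clamp_to m m' s \<le> m'" "m \<le> s \<Longrightarrow> s \<le> m' \<Longrightarrow> clamp_to m m' s = s"
  using assms by (auto simp: clamp_to_def)

lemma clamp_to_continuous: "continuous_on A (clamp_to m m')"
  by (auto simp: clamp_to_def[abs_def] intro!: continuous_intros)

lemma clamp_to_measurable [measurable]: "clamp_to m m' \<in> borel_measurable borel"
  unfolding clamp_to_def[abs_def] by measurable

lemma diffusion_functionD:
  assumes "diffusion_function \<Omega> C"
  shows "v \<in> borel_measurable (lebesgue_on \<Omega>) \<Longrightarrow> w \<in> borel_measurable (lebesgue_on \<Omega>) \<Longrightarrow>
      (\<And>x. 0 \<le> v x \<and> v x \<le> m \<and> 0 \<le> w x \<and> w x \<le> m) \<Longrightarrow> (\<lambda>x. C x (v x) (w x)) \<in> Linf (lebesgue_on \<Omega>)"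
    "AE x in lebesgue_on \<Omega>. continuous_on ({0..} \<times> {0..}) (\<lambda>(v, w). C x v w)"
    "\<And>v w. 0 \<le> v \<Longrightarrow> 0 \<le> w \<Longrightarrow> (\<lambda>x. C x v w) \<in> borel_measurable (lebesgue_on \<Omega>)"
    "\<exists>\<alpha>>0. AE x in lebesgue_on \<Omega>. \<forall>v\<ge>0. \<forall>w\<ge>0. \<alpha> \<le> C x v w"
proof -
  have all: "\<And>v w. v \<in> borel_measurable (lebesgue_on \<Omega>) \<and> w \<in> borel_measurable (lebesgue_on \<Omega>) \<and>
        (\<exists>M. \<forall>x\<in>\<Omega>. 0 \<le> v x \<and> v x \<le> M \<and> 0 \<le> w x \<and> w x \<le> M) \<Longrightarrow>
        (\<lambda>x. C x (v x) (w x)) \<in> Linf (lebesgue_on \<Omega>)" and c: "caratheodory \<Omega> C"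
    and \<alpha>: "\<exists>\<alpha>>0. AE x in lebesgue_on \<Omega>. \<forall>v\<ge>0. \<forall>w\<ge>0. \<alpha> \<le> C x v w"
    using assms by (simp_all add: diffusion_function_def)
  show "(\<lambda>x. C x (v x) (w x)) \<in> Linf (lebesgue_on \<Omega>)"
    if "v \<in> borel_measurable (lebesgue_on \<Omega>)" "w \<in> borel_measurable (lebesgue_on \<Omega>)"
      "\<And>x. 0 \<le> v x \<and> v x \<le> m \<and> 0 \<le> w x \<and> w x \<le> m"
    by (rule all) (use that in \<open>intro conjI exI[of _ m]; simp\<close>)
qed (use assms in \<open>simp_all add: diffusion_function_def caratheodory_def\<close>)

text \<open>
  Only the composition with each pair of bounded functions is known to be essentially bounded.
  Composing with a measurable choice of a nearly maximal point among countably many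
  candidates makes the bound uniform.
\<close>
lemma diffusion_function_bounded:
  assumes C: "diffusion_function \<Omega> C" and m: "0 \<le> m"
  shows "\<exists>K. AE x in lebesgue_on \<Omega>. \<forall>v\<in>{0..m}. \<forall>w\<in>{0..m}. C x v w \<le> K"
proof -
  note D = diffusion_functionD[OF C]
  let ?M = "lebesgue_on \<Omega>" and ?S = "{0..m} \<times> {0..m}"
  obtain T where T: "countable T" "T \<subseteq> ?S" "?S \<subseteq> closure T" using separable[of ?S] by blast
  have "closure T \<subseteq> ?S" using T(2) by (intro closure_minimal closed_Times) auto
  then have cT: "closure T = ?S" using T(3) by blast
  have ne: "T \<noteq> {}" using cT m by force
  define q where "q = from_nat_into T"
  have qT: "q n \<in> T" "range q = T" for n
    using from_nat_into[OF ne] range_from_nat_into[OF ne T(1)] by (auto simp: q_def)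
  have q: "0 \<le> fst (q n) \<and> fst (q n) \<le> m \<and> 0 \<le> snd (q n) \<and> snd (q n) \<le> m" for n using qT(1)[of n] T(2) by fastforce
  define c where "c n x = C x (fst (q n)) (snd (q n))" for n x
  have cm [measurable]: "c n \<in> borel_measurable ?M" for n unfolding c_def[abs_def] using D(3) q by blast
  \<comment> \<open>The supremum over the candidates rounded up to a natural number, so that it is a
    measurable choice from a countable set.\<close>
  define N where "N x = (LEAST N::nat. \<forall>n. c n x \<le> real N)" for x
  have Nm [measurable]: "N \<in> measurable ?M (count_space UNIV)" unfolding N_def[abs_def] by measurable
  have [measurable]: "(\<lambda>x. real (N x)) \<in> borel_measurable ?M" by (rule measurable_compose[OF Nm]) simp
  \<comment> \<open>The first candidate whose value is within 1 of that number. For N x = 0 there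
    need not be one, and the bound is then trivial.\<close>
  define j where "j x = (LEAST n. c n x > real (N x) - 1)" for x
  have jm [measurable]: "j \<in> measurable ?M (count_space UNIV)" unfolding j_def[abs_def] by measurable
  have "(\<lambda>x. C x (fst (q (j x))) (snd (q (j x)))) \<in> Linf ?M"
    by (rule D(1)[of _ _ m]) (use q in \<open>auto intro: measurable_compose[OF jm]\<close>)
  then obtain k where k: "AE x in ?M. \<bar>c (j x) x\<bar> \<le> k" by (auto simp: Linf_def c_def)
  have "AE x in ?M. \<forall>v\<in>{0..m}. \<forall>w\<in>{0..m}. C x v w \<le> max 0 (k + 1)"
    using k D(2)
  proof eventually_elim
    case (elim x)
    have cont: "continuous_on ?S (\<lambda>(v, w). C x v w)" by (rule continuous_on_subset[OF elim(2)]) auto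
    have "compact ((\<lambda>(v, w). C x v w) ` ?S)" by (rule compact_continuous_image[OF cont]) (auto intro: compact_Times)
    then obtain B where B: "\<And>p. p \<in> ?S \<Longrightarrow> \<bar>(\<lambda>(v, w). C x v w) p\<bar> \<le> B" 
      by (force dest!: compact_imp_bounded simp: bounded_real)
    have "\<exists>N::nat. \<forall>n. c n x \<le> real N"
    proof -
      obtain N :: nat where "B \<le> real N" using real_arch_simple by blast
      moreover have "c n x \<le> B" for n using B[of "q n"] q[of n] by (auto simp: c_def case_prod_beta mem_Times_iff)
      ultimately show ?thesis by (meson order_trans)
    qed
    from LeastI_ex[OF this] have NN: "c n x \<le> real (N x)" for n unfolding N_def by blast
    have "real (N x) \<le> max 0 (k + 1)"
    proof (cases "N x")
      case (Suc i)
      then have "i < (LEAST N::nat. \<forall>n. c n x \<le> real N)" unfolding N_def by simp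
      then have "\<not> (\<forall>n. c n x \<le> real i)" by (rule not_less_Least)
      then have "\<exists>n. c n x > real (N x) - 1" using Suc by (auto simp: not_le)
      from LeastI_ex[OF this] have "c (j x) x > real (N x) - 1" unfolding j_def .
      then show ?thesis using elim(1) by linarith
    qed simp
    then have le: "c n x \<le> max 0 (k + 1)" for n using NN[of n] by linarith
    have "(\<lambda>(v, w). C x v w) p \<le> max 0 (k + 1)" if "p \<in> ?S" for p
    proof (rule continuous_le_on_closure[of T])
      show "continuous_on (closure T) (\<lambda>(v, w). C x v w)" using cont cT by simp
      show "p \<in> closure T" using that cT by simp
      show "(\<lambda>(v, w). C x v w) y \<le> max 0 (k + 1)" if "y \<in> T" for y
      proof -
        from that obtain n where "y = q n" using qT(2) by blast
        then show ?thesis using le[of n] by (simp add: c_def case_prod_beta)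
      qed
    qed
    then show ?case by force
  qed
  then show ?thesis by blast
qed

text \<open>The two unknowns are indexed by \<open>bool\<close>: \<open>True\<close> stands for
  \<theta> and \<open>False\<close> for \<phi>.\<close>

definition truncated :: "real \<Rightarrow> (real \<Rightarrow> real) \<Rightarrow> (real \<Rightarrow> real) \<Rightarrow> ('a \<Rightarrow> real \<Rightarrow> real \<Rightarrow> real) \<Rightarrow> 'a \<Rightarrow> (bool \<Rightarrow> real) \<Rightarrow> real" where
  "truncated \<nu> P Q C x s = \<nu> + C x (P (s True)) (Q (s False)) / (P (s True) * Q (s False))"

text \<open>The lower bound keeps the truncated values in the denominator: multiplied by one unknown
  it leaves \<alpha> over the other, which is the ellipticity constant of the logarithm. The
  remaining parts prepare the hypotheses of \<open>coupled_system\<close>.\<close>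

lemma truncated:
  fixes C :: "real^'n \<Rightarrow> real \<Rightarrow> real \<Rightarrow> real"
  assumes C: "diffusion_function \<Omega> C" "AE x in lebesgue_on \<Omega>. \<forall>v\<ge>0. \<forall>w\<ge>0. \<alpha> \<le> C x v w" "0 < \<alpha>" and \<nu>: "0 \<le> \<nu>"
    and m: "0 < m1" "m1 \<le> M1" "0 < m2" "m2 \<le> M2"
  defines "P \<equiv> clamp_to m1 M1" and "Q \<equiv> clamp_to m2 M2"
  shows "\<And>y. (\<And>j. y j \<in> borel_measurable (lebesgue_on \<Omega>)) \<Longrightarrow> (\<lambda>x. truncated \<nu> P Q C x (\<lambda>j. y j x)) \<in> borel_measurable (lebesgue_on \<Omega>)"
    and "AE x in lebesgue_on \<Omega>. \<forall>s. \<alpha> / (P (s True) * Q (s False)) \<le> truncated \<nu> P Q C x s"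
    and "\<exists>K. AE x in lebesgue_on \<Omega>. \<forall>s. truncated \<nu> P Q C x s \<le> K"
    and "AE x in lebesgue_on \<Omega>. \<forall>S s. (\<forall>j. (\<lambda>n::nat. S n j) \<longlonglongrightarrow> s j) \<longrightarrow> (\<lambda>n. truncated \<nu> P Q C x (S n)) \<longlonglongrightarrow> truncated \<nu> P Q C x s"
proof -
  note D = diffusion_functionD[OF C(1)]
  let ?m = "max M1 M2"
  have P: "m1 \<le> P s" "P s \<le> M1" "0 < P s" and Q: "m2 \<le> Q s" "Q s \<le> M2" "0 < Q s" for s
    using clamp_to[OF m(2), of s] clamp_to[OF m(4), of s] m by (auto simp: P_def Q_def intro: less_le_trans)
  show "(\<lambda>x. truncated \<nu> P Q C x (\<lambda>j. y j x)) \<in> borel_measurable (lebesgue_on \<Omega>)"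
    if y: "\<And>j. y j \<in> borel_measurable (lebesgue_on \<Omega>)" for y
  proof -
    note [measurable] = y[of True] y[of False]
    have [measurable]: "(\<lambda>x. P (y True x)) \<in> borel_measurable (lebesgue_on \<Omega>)" "(\<lambda>x. Q (y False x)) \<in> borel_measurable (lebesgue_on \<Omega>)"
      unfolding P_def Q_def by measurable
    have "(\<lambda>x. C x (P (y True x)) (Q (y False x))) \<in> Linf (lebesgue_on \<Omega>)"
    proof (rule D(1)[of _ _ ?m])
      show "0 \<le> P (y True x) \<and> P (y True x) \<le> ?m \<and> 0 \<le> Q (y False x) \<and> Q (y False x) \<le> ?m" for x
        using P[of "y True x"] Q[of "y False x"] by auto
    qed measurable
    then have [measurable]: "(\<lambda>x. C x (P (y True x)) (Q (y False x))) \<in> borel_measurable (lebesgue_on \<Omega>)" by (simp add: Linf_def)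
    show ?thesis unfolding truncated_def by measurable
  qed
  show "AE x in lebesgue_on \<Omega>. \<forall>s. \<alpha> / (P (s True) * Q (s False)) \<le> truncated \<nu> P Q C x s"
    using C(2)
  proof eventually_elim
    case (elim x)
    have "\<alpha> / (P a * Q b) \<le> C x (P a) (Q b) / (P a * Q b)" for a b
      using elim P(3)[of a] Q(3)[of b] by (intro divide_right_mono) auto
    then show ?case using \<nu> by (simp add: truncated_def add_increasing)
  qed
  have "0 \<le> ?m" using m by (simp add: le_max_iff_disj)
  obtain K where K: "AE x in lebesgue_on \<Omega>. \<forall>v\<in>{0..?m}. \<forall>w\<in>{0..?m}. C x v w \<le> K"
    using diffusion_function_bounded[OF C(1) \<open>0 \<le> ?m\<close>] by blast
  have "AE x in lebesgue_on \<Omega>. \<forall>s. truncated \<nu> P Q C x s \<le> \<nu> + max 0 K / (m1 * m2)"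
    using K
  proof eventually_elim
    case (elim x)
    have "C x (P a) (Q b) / (P a * Q b) \<le> max 0 K / (m1 * m2)" for a b
    proof (rule frac_le)
      have "P a \<in> {0..?m}" "Q b \<in> {0..?m}" using P[of a] Q[of b] by auto
      then show "C x (P a) (Q b) \<le> max 0 K" using elim by fastforce
    qed (use P[of a] Q[of b] m in \<open>auto intro: mult_mono\<close>)
    then show ?case by (simp add: truncated_def)
  qed
  then show "\<exists>K. AE x in lebesgue_on \<Omega>. \<forall>s. truncated \<nu> P Q C x s \<le> K" by blast
  show "AE x in lebesgue_on \<Omega>. \<forall>S s. (\<forall>j. (\<lambda>n::nat. S n j) \<longlonglongrightarrow> s j) \<longrightarrow> (\<lambda>n. truncated \<nu> P Q C x (S n)) \<longlonglongrightarrow> truncated \<nu> P Q C x s"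
    using D(2)
  proof eventually_elim
    case (elim x)
    show ?case
    proof (intro allI impI)
      fix S and s :: "bool \<Rightarrow> real" assume S: "\<forall>j. (\<lambda>n::nat. S n j) \<longlonglongrightarrow> s j"
      have p: "(\<lambda>n. P (S n True)) \<longlonglongrightarrow> P (s True)" and qq: "(\<lambda>n. Q (S n False)) \<longlonglongrightarrow> Q (s False)"
        unfolding P_def Q_def clamp_to_def by (intro tendsto_max tendsto_min tendsto_const S[rule_format])+
      have "(\<lambda>n. (\<lambda>(v, w). C x v w) (P (S n True), Q (S n False))) \<longlonglongrightarrow> (\<lambda>(v, w). C x v w) (P (s True), Q (s False))"
        by (rule continuous_on_tendsto_compose[OF elim tendsto_Pair[OF p qq]])
          (use P(3) Q(3) in \<open>auto intro!: always_eventually less_imp_le\<close>)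
      then show "(\<lambda>n. truncated \<nu> P Q C x (S n)) \<longlonglongrightarrow> truncated \<nu> P Q C x s"
        unfolding truncated_def using P(3)[of "s True"] Q(3)[of "s False"] by (auto intro!: tendsto_intros p qq)
    qed
  qed
qed

section \<open>Solving the truncated system\<close>

context elliptic_domain
begin

text \<open>The solution operator freezes the coefficients and also the transported function T (f +
  z) at the old iterate. The transport term thus becomes a given flux, and the linear problem stays
  symmetric. As T and \<kappa> are bounded and h is dominated by H irrespective of z, the energies
  are bounded uniformly.\<close>

lemma coupled_system:
  fixes \<kappa> h :: "'i::finite \<Rightarrow> real^'n \<Rightarrow> ('i \<Rightarrow> real) \<Rightarrow> real" and f :: "'i \<Rightarrow> real^'n \<Rightarrow> real" and G :: "'i \<Rightarrow> real^'n \<Rightarrow> real^'n"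
  assumes \<kappa>: "\<And>i y. (\<And>j. y j \<in> borel_measurable M) \<Longrightarrow> (\<lambda>x. \<kappa> i x (\<lambda>j. y j x)) \<in> borel_measurable M"
      "\<And>i. AE x in M. \<forall>s. \<kappa>0 \<le> \<kappa> i x s \<and> \<kappa> i x s \<le> K" "0 < \<kappa>0"
      "\<And>i. AE x in M. \<forall>S s. (\<forall>j. (\<lambda>n::nat. S n j) \<longlonglongrightarrow> s j) \<longrightarrow> (\<lambda>n. \<kappa> i x (S n)) \<longlonglongrightarrow> \<kappa> i x s"
    and h: "\<And>i y. (\<And>j. y j \<in> borel_measurable M) \<Longrightarrow> (\<lambda>x. h i x (\<lambda>j. y j x)) \<in> borel_measurable M"
      "\<And>i. AE x in M. \<forall>s. \<bar>h i x s\<bar> \<le> H x" "H \<in> Lp M r"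
      "\<And>i. AE x in M. \<forall>S s. (\<forall>j. (\<lambda>n::nat. S n j) \<longlonglongrightarrow> s j) \<longrightarrow> (\<lambda>n. h i x (S n)) \<longlonglongrightarrow> h i x s"
    and T: "\<And>i. continuous_on UNIV (T i)" "\<And>i s. \<bar>T i s\<bar> \<le> B" and w: "sqi M w"
    and f: "\<And>i. f i \<in> borel_measurable M" and G: "\<And>i. sqi M (G i)"
  obtains z Z where "\<And>i. H10 (z i) (Z i)"
    "\<And>i. weak_eq (\<lambda>x. \<kappa> i x (\<lambda>j. f j x + z j x)) (\<lambda>x. G i x + Z i x) (\<lambda>x. T i (f i x + z i x) *\<^sub>R w x) (\<lambda>x. h i x (\<lambda>j. f j x + z j x))"
proof -
  have r0: "0 < r" using r1 by simp
  define E where "E z i v V \<longleftrightarrow> H10 v V \<and> weak_eq (\<lambda>x. \<kappa> i x (\<lambda>j. f j x + z j x)) (\<lambda>x. G i x + V x)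
    (\<lambda>x. T i (f i x + z i x) *\<^sub>R w x) (\<lambda>x. h i x (\<lambda>j. f j x + z j x))" for z i v V
  have ym: "(\<lambda>x. f j x + z j x) \<in> borel_measurable M" if "\<And>j. z j \<in> borel_measurable M" for z j
    using f that by simp
  have co: "coefficient \<kappa>0 K (\<lambda>x. \<kappa> i x (\<lambda>j. f j x + z j x))" if "\<And>j. z j \<in> borel_measurable M" for z i
    unfolding coefficient_def using \<kappa>(1)[OF ym[OF that]] \<kappa>(2)[of i] by auto
  have hm: "(\<lambda>x. h i x (\<lambda>j. f j x + z j x)) \<in> borel_measurable M" if "\<And>j. z j \<in> borel_measurable M" for z i
    using h(1)[OF ym[OF that]] .
  have hH: "AE x in M. \<bar>h i x (\<lambda>j. f j x + z j x)\<bar> \<le> \<bar>H x\<bar>" for z i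
    using h(2)[of i] by eventually_elim (meson abs_ge_self order_trans)
  have hL: "(\<lambda>x. h i x (\<lambda>j. f j x + z j x)) \<in> Lp M r" "Lp_norm M r (\<lambda>x. h i x (\<lambda>j. f j x + z j x)) \<le> Lp_norm M r H"
    if "\<And>j. z j \<in> borel_measurable M" for z i
    using Lp_dominated[OF h(3) hm[OF that] hH r0] by auto
  have Tm: "(\<lambda>x. T i (f i x + z i x)) \<in> borel_measurable M" if "\<And>j. z j \<in> borel_measurable M" for z i
    by (rule measurable_compose[OF ym[OF that] borel_measurable_continuous_onI[OF T(1)]])
  have gs: "sqi M (\<lambda>x. T i (f i x + z i x) *\<^sub>R w x)" if "\<And>j. z j \<in> borel_measurable M" for z i
    by (rule sqi_mult_bounded[where K=B, OF w Tm[OF that]]) (use T(2) in auto)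
  have B0: "0 \<le> B" using order_trans[OF abs_ge_zero T(2)] .
  \<comment> \<open>Some solution is picked for each z; \<open>stability\<close> yields continuity
    for any such choice.\<close>
  define sol where "sol z i = (SOME p. E z i (fst p) (snd p))" for z i
  have sol: "E z i (fst (sol z i)) (snd (sol z i))" if z: "\<And>j. z j \<in> borel_measurable M" for z i
  proof -
    obtain v V where "E z i v V"
      unfolding E_def by (rule linear_problem[OF co[where z=z and i=i, OF z] \<kappa>(3) G[of i] gs[where z=z and i=i, OF z] hL(1)[where z=z and i=i, OF z]]) blast
    then have "\<exists>p. E z i (fst p) (snd p)" by (intro exI[of _ "(v, V)"]) simp
    then show ?thesis unfolding sol_def by (rule someI_ex)
  qed
  define R where "R = (dualC * Lp_norm M r H + B * l2n M w + \<bar>K\<bar> * (\<Sum>i\<in>UNIV. l2n M (G i))) / \<kappa>0"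
  have bd: "l2n M (snd (sol z i)) \<le> R" if z: "\<And>j. z j \<in> borel_measurable M" for z i
  proof -
    note e = sol[where z=z and i=i, OF z, unfolded E_def]
    have "\<kappa>0 * l2n M (snd (sol z i)) \<le> dualC * Lp_norm M r (\<lambda>x. h i x (\<lambda>j. f j x + z j x))
        + l2n M (\<lambda>x. T i (f i x + z i x) *\<^sub>R w x) + \<bar>K\<bar> * l2n M (G i)"
      by (rule energy_bound[OF co[where z=z and i=i, OF z] \<kappa>(3) G[of i] gs[where z=z and i=i, OF z] hL(1)[where z=z and i=i, OF z]]) (use e in auto)
    also have "dualC * Lp_norm M r (\<lambda>x. h i x (\<lambda>j. f j x + z j x)) \<le> dualC * Lp_norm M r H"
      using hL(2)[OF z] dualC(1) by (intro mult_left_mono) auto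
    also have "l2n M (\<lambda>x. T i (f i x + z i x) *\<^sub>R w x) \<le> B * l2n M w"
      by (rule l2n_mono[OF w sqi_measurable[OF gs[OF z]] _ B0])
        (use T(2) in \<open>auto intro!: mult_right_mono AE_I2\<close>)
    also have "\<bar>K\<bar> * l2n M (G i) \<le> \<bar>K\<bar> * (\<Sum>i\<in>UNIV. l2n M (G i))"
      by (intro mult_left_mono member_le_sum) auto
    finally show ?thesis using \<kappa>(3) by (simp add: R_def field_simps)
  qed
  obtain v where v: "\<And>i. v i \<in> borel_measurable M" "\<And>i. AE x in M. fst (sol v i) x = v i x"
  proof (rule Schauder[of "\<lambda>z i. fst (sol z i)" "\<lambda>z i. snd (sol z i)" R])
    show "H10 (fst (sol z i)) (snd (sol z i)) \<and> l2n M (snd (sol z i)) \<le> R" if "\<And>i. z i \<in> borel_measurable M" for z i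
      using sol[where z=z and i=i, OF that] bd[where z=z and i=i, OF that] by (simp add: E_def)
    show "l2conv M (\<lambda>n. fst (sol (z n) i)) (fst (sol y i))"
      if z: "\<And>n i. z n i \<in> borel_measurable M" and y: "\<And>i. y i \<in> borel_measurable M"
        and lim: "\<And>i. AE x in M. (\<lambda>n::nat. z n i x) \<longlonglongrightarrow> y i x" for z y i
    proof -
      have lim': "AE x in M. \<forall>j. (\<lambda>n. f j x + z n j x) \<longlonglongrightarrow> f j x + y j x"
      proof -
        have "AE x in M. \<forall>j\<in>UNIV. (\<lambda>n. f j x + z n j x) \<longlonglongrightarrow> f j x + y j x"
        proof (rule AE_finite_allI[OF finite])
          show "AE x in M. (\<lambda>n. f j x + z n j x) \<longlonglongrightarrow> f j x + y j x" for j
            using lim[of j] by eventually_elim (intro tendsto_intros)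
        qed
        then show ?thesis by simp
      qed
      have Tl: "AE x in M. (\<lambda>n. T i (f i x + z n i x)) \<longlonglongrightarrow> T i (f i x + y i x)"
        using lim' by eventually_elim (use T(1) in \<open>auto intro!: continuous_on_tendsto_compose[OF T(1)]\<close>)
      have g: "l2conv M (\<lambda>n x. T i (f i x + z n i x) *\<^sub>R w x) (\<lambda>x. T i (f i x + y i x) *\<^sub>R w x)"
        by (rule l2conv_mult_bounded[where K=B, OF l2conv_const[OF w] Tm[where z="z n" and i=i for n, OF z] Tm[where z=y and i=i, OF y] _ Tl]) (use T(2) in auto)
      have k: "AE x in M. (\<lambda>n. \<kappa> i x (\<lambda>j. f j x + z n j x)) \<longlonglongrightarrow> \<kappa> i x (\<lambda>j. f j x + y j x)"
        using lim' \<kappa>(4)[of i]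
      proof eventually_elim
        case (elim x)
        show ?case by (rule elim(2)[rule_format, OF elim(1)[rule_format]])
      qed
      have hl: "AE x in M. (\<lambda>n. h i x (\<lambda>j. f j x + z n j x)) \<longlonglongrightarrow> h i x (\<lambda>j. f j x + y j x)"
        using lim' h(4)[of i]
      proof eventually_elim
        case (elim x)
        show ?case by (rule elim(2)[rule_format, OF elim(1)[rule_format]])
      qed
      show ?thesis
        by (rule stability(2)[OF co[where z="z n" and i=i for n, OF z] co[where z=y and i=i, OF y] \<kappa>(3) k G[of i] g h(3)
              hm[where z="z n" and i=i for n, OF z] hm[where z=y and i=i, OF y] hH hl hH,
              where Z="\<lambda>n. snd (sol (z n) i)" and Z'="snd (sol y i)"])
          (use sol[where z="z n" and i=i for n, OF z] sol[where z=y and i=i, OF y] in \<open>auto simp: E_def\<close>)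
    qed
  qed blast
  show thesis
  proof (rule that[of v "\<lambda>i. snd (sol v i)"])
    fix i
    note e = sol[where z=v and i=i, OF v(1), unfolded E_def]
    show "H10 (v i) (snd (sol v i))"
      by (rule H10_cong_AE[of "fst (sol v i)" "snd (sol v i)", OF _ v(1) _ v(2)]) (use e H10_sqi(2) sqi_measurable in blast)+
    show "weak_eq (\<lambda>x. \<kappa> i x (\<lambda>j. f j x + v j x)) (\<lambda>x. G i x + snd (sol v i) x) (\<lambda>x. T i (f i x + v i x) *\<^sub>R w x) (\<lambda>x. h i x (\<lambda>j. f j x + v j x))"
      using e by blast
  qed
qed

end

section \<open>Bounds for the truncated solution and the choice of \<tau>\<close>

context elliptic_domain
begin

text \<open>\<open>level_bound\<close> for \<sigma> = 1 and k0 = ln A, read in terms of values: a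
  rise of the logarithm by d is a factor exp d.\<close>

lemma upper_bound:
  assumes f: "wgr f G" "\<And>x. x \<in> \<Omega> \<Longrightarrow> 0 < f x \<and> f x \<le> A" and A: "0 < A"
    and z: "H10 z Z" and eq: "weak_eq \<kappa> (\<lambda>x. G x + Z x) (\<lambda>x. T (f x + z x) *\<^sub>R w x) h"
    and \<kappa>: "coefficient \<kappa>0 K \<kappa>" "0 < \<kappa>0" and w: "\<And>v V. H10 v V \<Longrightarrow> (\<integral>x. w x \<bullet> V x \<partial>M) = 0"
    and T: "\<And>s. A \<le> s \<Longrightarrow> s \<le> A * exp d \<Longrightarrow> T s = s"
    and c: "0 < c" "AE x in M. A \<le> f x + z x \<longrightarrow> f x + z x \<le> A * exp d \<longrightarrow> c \<le> \<kappa> x * (f x + z x)"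
    and h: "h \<in> Lp M r" "H \<in> Lp M r" "AE x in M. h x \<le> H x" "AE x in M. 0 \<le> H x"
    and d: "0 < d" "level_const * Lp_norm M r H / c \<le> d"
  shows "AE x in M. f x + z x \<le> A * exp d"
proof -
  have ran: "A \<le> s \<and> s \<le> A * exp d" if "0 < s" "ln A \<le> 1 * ln s" "1 * ln s \<le> ln A + d" for s
  proof -
    have "exp (ln s) \<le> exp (ln A + d)" using that(3) by simp
    then show ?thesis using that A by (simp add: exp_add)
  qed
  have "AE x in M. if (1::real) = 1 then f x + z x \<le> exp (ln A + d) else exp (- (ln A + d)) \<le> f x + z x"
  proof (rule level_bound[OF _ f(1) _ _ z eq \<kappa> w _ c(1) _ h(1,2) _ h(4) d])
    show "1 * ln (f x) \<le> ln A" if "x \<in> \<Omega>" for x using f(2)[OF that] by simp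
    show "T s = s" if "0 < s" "ln A \<le> 1 * ln s" "1 * ln s \<le> ln A + d" for s using T ran[OF that] by blast
    show "AE x in M. 0 < f x + z x \<longrightarrow> ln A \<le> 1 * ln (f x + z x) \<longrightarrow> 1 * ln (f x + z x) \<le> ln A + d \<longrightarrow> c \<le> \<kappa> x * (f x + z x)"
      using c(2) by eventually_elim (use ran in blast)
  qed (use f(2) h(3) in auto)
  then show ?thesis using A by (simp add: exp_add)
qed

text \<open>\<open>level_bound\<close> for \<sigma> = -1 and k0 = - ln A: low values are high levels
  of the negated logarithm, so the source enters with the opposite sign.\<close>

lemma lower_bound:
  assumes f: "wgr f G" "\<And>x. x \<in> \<Omega> \<Longrightarrow> A \<le> f x" and A: "0 < A"
    and z: "H10 z Z" and eq: "weak_eq \<kappa> (\<lambda>x. G x + Z x) (\<lambda>x. T (f x + z x) *\<^sub>R w x) h"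
    and \<kappa>: "coefficient \<kappa>0 K \<kappa>" "0 < \<kappa>0" and w: "\<And>v V. H10 v V \<Longrightarrow> (\<integral>x. w x \<bullet> V x \<partial>M) = 0"
    and T: "\<And>s. A * exp (- d) \<le> s \<Longrightarrow> s \<le> A \<Longrightarrow> T s = s"
    and c: "0 < c" "AE x in M. A * exp (- d) \<le> f x + z x \<longrightarrow> f x + z x \<le> A \<longrightarrow> c \<le> \<kappa> x * (f x + z x)"
    and h: "h \<in> Lp M r" "H \<in> Lp M r" "AE x in M. - h x \<le> H x" "AE x in M. 0 \<le> H x"
    and d: "0 < d" "level_const * Lp_norm M r H / c \<le> d"
  shows "AE x in M. A * exp (- d) \<le> f x + z x"
proof -
  have ran: "A * exp (- d) \<le> s \<and> s \<le> A" if "0 < s" "- ln A \<le> - 1 * ln s" "- 1 * ln s \<le> - ln A + d" for s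
  proof -
    have "exp (ln A + - d) \<le> exp (ln s)" using that(3) by simp
    then have "A * exp (- d) \<le> s" using that A unfolding exp_add by simp
    then show ?thesis using that A by simp
  qed
  have "AE x in M. if (- 1::real) = 1 then f x + z x \<le> exp (- ln A + d) else exp (- (- ln A + d)) \<le> f x + z x"
  proof (rule level_bound[OF _ f(1) _ _ z eq \<kappa> w _ c(1) _ h(1,2) _ h(4) d])
    show "0 < f x" "- 1 * ln (f x) \<le> - ln A" if "x \<in> \<Omega>" for x using f(2)[OF that] A by auto
    show "T s = s" if "0 < s" "- ln A \<le> - 1 * ln s" "- 1 * ln s \<le> - ln A + d" for s using T ran[OF that] by blast
    show "AE x in M. 0 < f x + z x \<longrightarrow> - ln A \<le> - 1 * ln (f x + z x) \<longrightarrow> - 1 * ln (f x + z x) \<le> - ln A + d \<longrightarrow> c \<le> \<kappa> x * (f x + z x)"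
      using c(2) by eventually_elim (use ran in blast)
  qed (use h(3) in auto)
  moreover have "exp (- (- ln A + d)) = A * exp (- d)" using A by (simp add: exp_diff exp_minus field_simps)
  ultimately show ?thesis by simp
qed

text \<open>The bounds on \<theta> hold at every point, as \<open>class_S\<close> asks for
  nonnegativity everywhere, while the decomposition \<theta> = f + z holds only almost
  everywhere.\<close>

definition bounded_weak_solution ::
  "(real^'n \<Rightarrow> real) \<Rightarrow> (real^'n \<Rightarrow> real^'n) \<Rightarrow> (real^'n \<Rightarrow> real^'n) \<Rightarrow> (real^'n \<Rightarrow> real) \<Rightarrow> (real^'n \<Rightarrow> real) \<Rightarrow> (real^'n \<Rightarrow> real) \<Rightarrow> bool" where
  "bounded_weak_solution f G w \<kappa> h \<theta> \<longleftrightarrow> (\<exists>m B k K z Z. 0 < m \<and> 0 < k \<and> \<theta> \<in> borel_measurable M \<and> (\<forall>x. m \<le> \<theta> x \<and> \<theta> x \<le> B) \<and>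
     H10 z Z \<and> (AE x in M. \<theta> x = f x + z x) \<and> weak_eq \<kappa> (\<lambda>x. G x + Z x) (\<lambda>x. \<theta> x *\<^sub>R w x) h \<and> coefficient k K \<kappa> \<and> h \<in> Lp M r)"

lemma bounded_weak_solutionI:
  assumes "0 < m" "0 < k" "\<theta> \<in> borel_measurable M" "\<forall>x. m \<le> \<theta> x \<and> \<theta> x \<le> B" "H10 z Z" "AE x in M. \<theta> x = f x + z x"
    "weak_eq \<kappa> (\<lambda>x. G x + Z x) (\<lambda>x. \<theta> x *\<^sub>R w x) h" "coefficient k K \<kappa>" "h \<in> Lp M r"
  shows "bounded_weak_solution f G w \<kappa> h \<theta>"
  unfolding bounded_weak_solution_def using assms by blast

text \<open>
  The upper bounds do not involve \<open>u\<close>: the one for \<open>\<phi>\<close> is fixed first and the one for \<open>\<theta>\<close>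
  then determines \<open>\<tau>\<close>. The lower bounds may depend on \<open>u\<close>.
\<close>
theorem bounded_solution:
  fixes f1 f2 C3 C4 C5 C6 C7 C8 :: "real^'n \<Rightarrow> real" and C\<theta> C\<phi> :: "real^'n \<Rightarrow> real \<Rightarrow> real \<Rightarrow> real"
  assumes C\<theta>: "diffusion_function \<Omega> C\<theta>" and C\<phi>: "diffusion_function \<Omega> C\<phi>" and \<nu>: "0 \<le> \<nu>"
    and f1: "wgr f1 G1" "\<And>x. x \<in> \<Omega> \<Longrightarrow> m0 \<le> f1 x \<and> f1 x \<le> A"
    and f2: "wgr f2 G2" "\<And>x. x \<in> \<Omega> \<Longrightarrow> m0 \<le> f2 x \<and> f2 x \<le> A" and m0: "0 < m0" "m0 \<le> A"
    and Cn: "\<forall>C\<in>{C3, C4, C5, C6, C7, C8}. \<forall>x\<in>\<Omega>. 0 \<le> C x"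
    and Cr: "C5 \<in> Lp M r" "C8 \<in> Lp M r" and Cb: "\<forall>C\<in>{C3, C4, C6, C7}. C \<in> Linf M"
  shows "\<exists>\<tau>>0. \<forall>F D w. (AE x in M. 0 \<le> F x) \<and> F \<in> Lp M r \<and> D \<in> Lp M r \<and> sqi M w \<and>
      (\<forall>v V. H10 v V \<longrightarrow> (\<integral>x. w x \<bullet> V x \<partial>M) = 0) \<and> Lp_norm M r (\<lambda>x. max (D x) 0) \<le> \<tau> \<longrightarrow>
    (\<exists>\<theta> \<phi>. bounded_weak_solution f1 G1 w (\<lambda>x. \<nu> + C\<theta> x (\<theta> x) (\<phi> x) / (\<theta> x * \<phi> x))
        (\<lambda>x. - C3 x * F x * (\<theta> x)\<^sup>2 + C4 x * \<theta> x * D x + C5 x) \<theta> \<and>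
      bounded_weak_solution f2 G2 w (\<lambda>x. \<nu> + C\<phi> x (\<theta> x) (\<phi> x) / (\<theta> x * \<phi> x))
        (\<lambda>x. - \<phi> x * (C6 x * \<theta> x * F x - C7 x * D x + C8 x * inverse (\<theta> x))) \<phi>)"
proof -
  have r0: "0 < r" "1 \<le> r" using r1 by auto
  have "\<exists>L. AE x in M. \<forall>C\<in>{C3, C4, C6, C7}. C x \<le> L"
  proof -
    have "\<forall>C\<in>{C3, C4, C6, C7}. \<exists>c. AE x in M. C x \<le> c"
    proof
      fix C assume "C \<in> {C3, C4, C6, C7}"
      then obtain c where "AE x in M. \<bar>C x\<bar> \<le> c" using Cb by (auto simp: Linf_def)
      then have "AE x in M. C x \<le> c" by eventually_elim simp
      then show "\<exists>c. AE x in M. C x \<le> c" by blast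
    qed
    from bchoice[OF this] obtain c where c: "\<forall>C\<in>{C3, C4, C6, C7}. AE x in M. C x \<le> c C" by blast
    have "AE x in M. \<forall>C\<in>{C3, C4, C6, C7}. C x \<le> c C" by (rule AE_finite_allI) (use c in auto)
    then have "AE x in M. \<forall>C\<in>{C3, C4, C6, C7}. C x \<le> Max (c ` {C3, C4, C6, C7})"
      by eventually_elim (meson Max_ge finite.intros finite_imageI imageI order_trans)
    then show ?thesis by blast
  qed
  then obtain L' where L': "AE x in M. \<forall>C\<in>{C3, C4, C6, C7}. C x \<le> L'" by blast
  define L where "L = max 1 L'"
  have L1: "1 \<le> L" by (simp add: L_def)
  have CL: "AE x in M. (0 \<le> C3 x \<and> C3 x \<le> L) \<and> (0 \<le> C4 x \<and> C4 x \<le> L) \<and> (0 \<le> C6 x \<and> C6 x \<le> L) \<and> (0 \<le> C7 x \<and> C7 x \<le> L) \<and> 0 \<le> C5 x \<and> 0 \<le> C8 x"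
    using L' AE_space by eventually_elim (use Cn in \<open>auto simp: L_def\<close>)
  obtain \<alpha>\<theta> where \<alpha>\<theta>: "0 < \<alpha>\<theta>" "AE x in M. \<forall>v\<ge>0. \<forall>w\<ge>0. \<alpha>\<theta> \<le> C\<theta> x v w" using diffusion_functionD(4)[OF C\<theta>] by blast
  obtain \<alpha>\<phi> where \<alpha>\<phi>: "0 < \<alpha>\<phi>" "AE x in M. \<forall>v\<ge>0. \<forall>w\<ge>0. \<alpha>\<phi> \<le> C\<phi> x v w" using diffusion_functionD(4)[OF C\<phi>] by blast
  note lc = level_const_nonneg
  \<comment> \<open>The budget: ln \<phi> may rise by ln 2 above its boundary bound, so M\<phi> = 2
    A. Any fixed positive number could stand for ln 2.\<close>
  define M\<phi> where "M\<phi> = A * exp (ln 2)"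
  \<comment> \<open>\<open>4 * (1 + Lp_norm M r C5)\<close> bounds the majorant \<open>HA\<close> of
    the source of \<theta> once the contribution of D to it has norm at most 1, and
    \<open>\<alpha>\<theta> / M\<phi>\<close> is the ellipticity constant. The leading 1 makes d1
    positive.\<close>
  define d1 where "d1 = 1 + level_const * (4 * (1 + Lp_norm M r C5)) / (\<alpha>\<theta> / M\<phi>)"
  define M\<theta> where "M\<theta> = A * exp d1"
  have pos: "0 < M\<phi>" "0 < M\<theta>" using m0 by (auto simp: M\<phi>_def M\<theta>_def)
  \<comment> \<open>The first entry normalises the contribution of D to the source of \<theta>, the
    second keeps the growth of ln \<phi> within its budget ln 2. Neither M\<theta> nor M\<phi>
    depends on \<tau>.\<close>
  define \<tau> where "\<tau> = min (1 / (L * M\<theta>)) (\<alpha>\<phi> / M\<theta> * ln 2 / (1 + level_const * (M\<phi> * L)))"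
  have d1: "1 \<le> d1" using lc \<alpha>\<theta> pos Lp_norm_nonneg[of M r C5] by (simp add: d1_def)
  have e: "0 < 1 + level_const * (M\<phi> * L)" using lc pos L1 by (simp add: add_pos_nonneg)
  have \<tau>0: "0 < \<tau>" using pos L1 \<alpha>\<phi>(1) e by (simp add: \<tau>_def)
  have main: "\<exists>\<theta> \<phi>. bounded_weak_solution f1 G1 w (\<lambda>x. \<nu> + C\<theta> x (\<theta> x) (\<phi> x) / (\<theta> x * \<phi> x))
        (\<lambda>x. - C3 x * F x * (\<theta> x)\<^sup>2 + C4 x * \<theta> x * D x + C5 x) \<theta> \<and>
      bounded_weak_solution f2 G2 w (\<lambda>x. \<nu> + C\<phi> x (\<theta> x) (\<phi> x) / (\<theta> x * \<phi> x))
        (\<lambda>x. - \<phi> x * (C6 x * \<theta> x * F x - C7 x * D x + C8 x * inverse (\<theta> x))) \<phi>"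
    if F: "AE x in M. 0 \<le> F x" "F \<in> Lp M r" and D: "D \<in> Lp M r" and w: "sqi M w" "\<forall>v V. H10 v V \<longrightarrow> (\<integral>x. w x \<bullet> V x \<partial>M) = 0"
      and Dp: "Lp_norm M r (\<lambda>x. max (D x) 0) \<le> \<tau>" for F D w
  proof -
    let ?n = "Lp_norm M r"
    have Dm: "D \<in> borel_measurable M" "F \<in> borel_measurable M" using D F by (auto simp: Lp_def)
    have DpL: "(\<lambda>x. max (D x) 0) \<in> Lp M r" by (rule Lp_dominated(1)[OF D _ _ r0(1)]) (use Dm in auto)
    \<comment> \<open>One-sided majorants for the upper bounds: up to null sets the terms with F and
      with C8 only lower the sources, and of D only the positive part counts.\<close>
    define HA where "HA x = L * M\<theta> * max (D x) 0 + C5 x" for x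
    define HB where "HB x = M\<phi> * L * max (D x) 0" for x
    have HA: "HA \<in> Lp M r" "?n HA \<le> 4 * (1 + ?n C5)"
    proof -
      show "HA \<in> Lp M r" unfolding HA_def[abs_def] by (intro Lp_add(1) Lp_scale DpL Cr r0)
      have "?n HA \<le> 4 * (?n (\<lambda>x. L * M\<theta> * max (D x) 0) + ?n C5)"
        unfolding HA_def[abs_def] by (intro Lp_add(2) Lp_scale DpL Cr r0)
      also have "?n (\<lambda>x. L * M\<theta> * max (D x) 0) = L * M\<theta> * ?n (\<lambda>x. max (D x) 0)"
        using Lp_norm_scale[OF r0(1), of M "L * M\<theta>"] pos L1 by simp
      also have "\<dots> \<le> L * M\<theta> * (1 / (L * M\<theta>))" using Dp pos L1 by (intro mult_left_mono) (auto simp: \<tau>_def)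
      also have "\<dots> = 1" using pos L1 by simp
      finally show "?n HA \<le> 4 * (1 + ?n C5)" by simp
    qed
    have HB: "HB \<in> Lp M r" "level_const * ?n HB / (\<alpha>\<phi> / M\<theta>) \<le> ln 2"
    proof -
      show "HB \<in> Lp M r" unfolding HB_def[abs_def] by (intro Lp_scale DpL)
      have "?n HB = M\<phi> * L * ?n (\<lambda>x. max (D x) 0)"
        unfolding HB_def[abs_def] using Lp_norm_scale[OF r0(1), of M "M\<phi> * L"] pos L1 by simp
      then have "level_const * ?n HB = level_const * (M\<phi> * L) * ?n (\<lambda>x. max (D x) 0)" by simp
      also have "\<dots> \<le> (1 + level_const * (M\<phi> * L)) * \<tau>"
        using Dp lc pos L1 Lp_norm_nonneg[of M r] by (intro mult_mono) auto
      also have "\<dots> \<le> (1 + level_const * (M\<phi> * L)) * (\<alpha>\<phi> / M\<theta> * ln 2 / (1 + level_const * (M\<phi> * L)))"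
        using e by (intro mult_left_mono) (auto simp: \<tau>_def)
      also have "\<dots> = \<alpha>\<phi> / M\<theta> * ln 2" using e by simp
      finally show "level_const * ?n HB / (\<alpha>\<phi> / M\<theta>) \<le> ln 2" using \<alpha>\<phi>(1) pos by (simp add: field_simps)
    qed
    \<comment> \<open>Majorants of the negated sources, for the lower bounds: here F and all of D
      enter. \<open>HD\<close> contains C8 divided by m\<theta>, so m\<theta> is fixed before
      m\<phi>.\<close>
    define HC where "HC x = L * M\<theta>\<^sup>2 * F x + L * M\<theta> * \<bar>D x\<bar>" for x
    define d2 where "d2 = 1 + level_const * ?n HC / (\<alpha>\<theta> / M\<phi>)"
    define m\<theta> where "m\<theta> = m0 * exp (- d2)"
    define HD where "HD x = M\<phi> * L * M\<theta> * F x + (M\<phi> * L * \<bar>D x\<bar> + M\<phi> / m\<theta> * C8 x)" for x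
    define d3 where "d3 = 1 + level_const * ?n HD / (\<alpha>\<phi> / M\<theta>)"
    define m\<phi> where "m\<phi> = m0 * exp (- d3)"
    have HCD: "HC \<in> Lp M r" "HD \<in> Lp M r"
      unfolding HC_def[abs_def] HD_def[abs_def] by (intro Lp_add(1) Lp_scale Lp_abs F D Cr r0)+
    have d23: "1 \<le> d2" "1 \<le> d3" using lc \<alpha>\<theta> \<alpha>\<phi> pos Lp_norm_nonneg[of M r] by (auto simp: d2_def d3_def)
    have mp: "0 < m\<theta>" "m\<theta> \<le> m0" "0 < m\<phi>" "m\<phi> \<le> m0" "A \<le> M\<theta>" "A \<le> M\<phi>"
      using m0 d1 d23 by (auto simp: m\<theta>_def m\<phi>_def M\<theta>_def M\<phi>_def)
    then have mM: "m\<theta> \<le> M\<theta>" "m\<phi> \<le> M\<phi>" using m0 by auto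
    define P Q where "P = clamp_to m\<theta> M\<theta>" and "Q = clamp_to m\<phi> M\<phi>"
    have P: "m\<theta> \<le> P s" "P s \<le> M\<theta>" "0 < P s" "m\<theta> \<le> s \<Longrightarrow> s \<le> M\<theta> \<Longrightarrow> P s = s"
      and Q: "m\<phi> \<le> Q s" "Q s \<le> M\<phi>" "0 < Q s" "m\<phi> \<le> s \<Longrightarrow> s \<le> M\<phi> \<Longrightarrow> Q s = s" for s
      using clamp_to[OF mM(1), of s] clamp_to[OF mM(2), of s] mp by (auto simp: P_def Q_def intro: less_le_trans)
    have Pm [measurable]: "P \<in> borel_measurable borel" "Q \<in> borel_measurable borel" unfolding P_def Q_def by measurable
    note t\<theta> = truncated[OF C\<theta> \<alpha>\<theta>(2,1) \<nu> mp(1) mM(1) mp(3) mM(2), folded P_def Q_def]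
    note t\<phi> = truncated[OF C\<phi> \<alpha>\<phi>(2,1) \<nu> mp(1) mM(1) mp(3) mM(2), folded P_def Q_def]
    obtain K\<theta> K\<phi> where K: "AE x in M. \<forall>s. truncated \<nu> P Q C\<theta> x s \<le> K\<theta>" "AE x in M. \<forall>s. truncated \<nu> P Q C\<phi> x s \<le> K\<phi>"
      using t\<theta>(3) t\<phi>(3) by blast
    define \<kappa> where "\<kappa> i = truncated \<nu> P Q (if i then C\<theta> else C\<phi>)" for i :: bool
    define h where "h i x s = (if i then - C3 x * F x * (P (s True))\<^sup>2 + C4 x * P (s True) * D x + C5 x
      else - Q (s False) * (C6 x * P (s True) * F x - C7 x * D x + C8 x * inverse (P (s True))))" for i :: bool and x s
    define f G T where "f i = (if i then f1 else f2)" and "G i = (if i then G1 else G2)" and "T i = (if i then P else Q)" for i :: bool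
    define \<kappa>0 K where "\<kappa>0 = min \<alpha>\<theta> \<alpha>\<phi> / (M\<theta> * M\<phi>)" and "K = max K\<theta> K\<phi>"
    have \<kappa>0: "0 < \<kappa>0" using \<alpha>\<theta> \<alpha>\<phi> pos by (simp add: \<kappa>0_def)
    have PQ: "\<kappa>0 \<le> \<alpha> / (P s * Q t)" if "min \<alpha>\<theta> \<alpha>\<phi> \<le> \<alpha>" for \<alpha> s t
      unfolding \<kappa>0_def using that \<alpha>\<theta>(1) \<alpha>\<phi>(1) P[of s] Q[of t] by (intro frac_le mult_mono) auto
    have \<kappa>m: "(\<lambda>x. \<kappa> i x (\<lambda>j. y j x)) \<in> borel_measurable M" if "\<And>j. y j \<in> borel_measurable M" for i y
      using t\<theta>(1)[of y] t\<phi>(1)[of y] that by (cases i) (auto simp: \<kappa>_def)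
    have \<kappa>b: "AE x in M. \<forall>s. \<kappa>0 \<le> \<kappa> i x s \<and> \<kappa> i x s \<le> K" for i
    proof (cases i)
      case True
      show ?thesis using t\<theta>(2) K(1)
      proof eventually_elim
        case (elim x)
        have "\<kappa>0 \<le> \<kappa> i x s \<and> \<kappa> i x s \<le> K" for s
          using order_trans[OF PQ[of \<alpha>\<theta> "s True" "s False"] elim(1)[rule_format, of s]] elim(2)[rule_format, of s] True
          by (auto simp: \<kappa>_def K_def)
        then show ?case by blast
      qed
    next
      case False
      show ?thesis using t\<phi>(2) K(2)
      proof eventually_elim
        case (elim x)
        have "\<kappa>0 \<le> \<kappa> i x s \<and> \<kappa> i x s \<le> K" for s
          using order_trans[OF PQ[of \<alpha>\<phi> "s True" "s False"] elim(1)[rule_format, of s]] elim(2)[rule_format, of s] False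
          by (auto simp: \<kappa>_def K_def)
        then show ?case by blast
      qed
    qed
    have Cm [measurable]: "C3 \<in> borel_measurable M" "C4 \<in> borel_measurable M" "C5 \<in> borel_measurable M" "C6 \<in> borel_measurable M"
      "C7 \<in> borel_measurable M" "C8 \<in> borel_measurable M" "D \<in> borel_measurable M" "F \<in> borel_measurable M"
      using Cr Cb Dm by (auto simp: Linf_def Lp_def)
    have hm: "(\<lambda>x. h i x (\<lambda>j. y j x)) \<in> borel_measurable M" if y: "\<And>j. y j \<in> borel_measurable M" for i y
    proof -
      note [measurable] = y
      show ?thesis by (cases i) (simp_all add: h_def)
    qed
    have hT: "\<bar>h True x s\<bar> \<le> HC x + C5 x" "- h True x s \<le> HC x" "h True x s \<le> HA x"
      and hF: "\<bar>h False x s\<bar> \<le> HD x" "h False x s \<le> HB x"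
      if c: "(0 \<le> C3 x \<and> C3 x \<le> L) \<and> (0 \<le> C4 x \<and> C4 x \<le> L) \<and> (0 \<le> C6 x \<and> C6 x \<le> L) \<and> (0 \<le> C7 x \<and> C7 x \<le> L) \<and> 0 \<le> C5 x \<and> 0 \<le> C8 x"
        and F0: "0 \<le> F x" for x s
    proof -
      define p q where "p = P (s True)" and "q = Q (s False)"
      have p: "m\<theta> \<le> p" "p \<le> M\<theta>" "0 < p" and q: "0 < q" "q \<le> M\<phi>" using P Q by (auto simp: p_def q_def)
      have e1: "C3 x * F x * p\<^sup>2 \<le> L * F x * M\<theta>\<^sup>2" "0 \<le> C3 x * F x * p\<^sup>2"
        using c F0 p L1 by (auto intro!: mult_mono power_mono)
      have e2: "\<bar>C4 x * p * D x\<bar> \<le> L * M\<theta> * \<bar>D x\<bar>"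
        unfolding abs_mult using c p L1 pos by (intro mult_mono) auto
      have e3: "C4 x * p * D x \<le> L * M\<theta> * max (D x) 0"
      proof -
        have "C4 x * p * D x \<le> C4 x * p * max (D x) 0" using c p by (intro mult_left_mono) auto
        also have "\<dots> \<le> L * M\<theta> * max (D x) 0" using c p L1 pos by (intro mult_right_mono mult_mono) auto
        finally show ?thesis .
      qed
      have h1: "h True x s = - (C3 x * F x * p\<^sup>2) + C4 x * p * D x + C5 x" by (simp add: h_def p_def)
      show "\<bar>h True x s\<bar> \<le> HC x + C5 x" "- h True x s \<le> HC x" "h True x s \<le> HA x"
        using e1 e2 e3 c unfolding h1 HC_def HA_def by (auto simp: abs_le_iff mult_ac)
      have h2: "h False x s = - (q * (C6 x * p) * F x) + q * C7 x * D x + - (q * inverse p * C8 x)"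
        by (simp add: h_def p_def q_def algebra_simps)
      have g1: "q * (C6 x * p) * F x \<le> M\<phi> * (L * M\<theta>) * F x" "0 \<le> q * (C6 x * p) * F x"
        using c F0 p q L1 pos by (auto intro!: mult_mono)
      have g2: "\<bar>q * C7 x * D x\<bar> \<le> M\<phi> * L * \<bar>D x\<bar>"
        unfolding abs_mult using c q L1 pos by (intro mult_mono) auto
      have g3: "q * inverse p * C8 x \<le> M\<phi> / m\<theta> * C8 x" "0 \<le> q * inverse p * C8 x"
      proof -
        have "q / p \<le> M\<phi> / m\<theta>" using p q mp by (intro frac_le) auto
        then show "q * inverse p * C8 x \<le> M\<phi> / m\<theta> * C8 x" using c by (intro mult_right_mono) (auto simp: divide_inverse)
        show "0 \<le> q * inverse p * C8 x" using c p q by simp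
      qed
      show "\<bar>h False x s\<bar> \<le> HD x" using g1 g2 g3 unfolding h2 HD_def by (auto simp: abs_le_iff mult_ac)
      have "q * C7 x * D x \<le> M\<phi> * L * max (D x) 0"
      proof -
        have "q * C7 x * D x \<le> q * C7 x * max (D x) 0" using c q by (intro mult_left_mono) auto
        also have "\<dots> \<le> M\<phi> * L * max (D x) 0" using c q L1 pos by (intro mult_right_mono mult_mono) auto
        finally show ?thesis .
      qed
      then show "h False x s \<le> HB x" using g1 g3 unfolding h2 HB_def by linarith
    qed
    define H where "H x = HC x + (C5 x + HD x)" for x
    have HL: "H \<in> Lp M r" unfolding H_def[abs_def] by (intro Lp_add(1) HCD Cr r0)
    have hH: "AE x in M. \<forall>s. \<bar>h i x s\<bar> \<le> H x" for i
      using CL F(1)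
    proof eventually_elim
      case (elim x)
      have "0 \<le> HD x" "0 \<le> HC x + C5 x" using hT(1)[OF elim] hF(1)[OF elim] by (meson abs_ge_zero order_trans)+
      then have "\<bar>h i x s\<bar> \<le> H x" for s
        using hT(1)[OF elim, of s] hF(1)[OF elim, of s] unfolding H_def by (cases i) auto
      then show ?case by blast
    qed
    have Pt: "(\<lambda>n. P (S n)) \<longlonglongrightarrow> P s" "(\<lambda>n. Q (S n)) \<longlonglongrightarrow> Q s" if "S \<longlonglongrightarrow> s" for S s
      unfolding P_def Q_def clamp_to_def by (intro tendsto_max tendsto_min tendsto_const that)+
    have hc: "(\<lambda>n. h i x (S n)) \<longlonglongrightarrow> h i x s" if "\<forall>j. (\<lambda>n::nat. S n j) \<longlonglongrightarrow> s j" for i x S s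
      using Pt[OF that[rule_format]] P(3)[of "s True"] by (cases i) (auto simp: h_def intro!: tendsto_intros)
    obtain z Z where z: "\<And>i. H10 (z i) (Z i)"
      "\<And>i. weak_eq (\<lambda>x. \<kappa> i x (\<lambda>j. f j x + z j x)) (\<lambda>x. G i x + Z i x) (\<lambda>x. T i (f i x + z i x) *\<^sub>R w x) (\<lambda>x. h i x (\<lambda>j. f j x + z j x))"
    proof (rule coupled_system[of \<kappa> \<kappa>0 K h H T "max M\<theta> M\<phi>" w f G])
      show "AE x in M. \<forall>S s. (\<forall>j. (\<lambda>n::nat. S n j) \<longlonglongrightarrow> s j) \<longrightarrow> (\<lambda>n. \<kappa> i x (S n)) \<longlonglongrightarrow> \<kappa> i x s" for i
        using t\<theta>(4) t\<phi>(4) by (cases i) (simp_all add: \<kappa>_def)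
      show "continuous_on UNIV (T i)" for i by (simp add: T_def P_def Q_def clamp_to_continuous)
      show "\<bar>T i s\<bar> \<le> max M\<theta> M\<phi>" for i s using P[of s] Q[of s] by (auto simp: T_def)
      show "f i \<in> borel_measurable M" "sqi M (G i)" for i
        using wgrD(1,2)[OF f1(1)] wgrD(1,2)[OF f2(1)] by (auto simp: f_def G_def sqi_measurable)
    qed (use \<kappa>m \<kappa>b \<kappa>0 hm hH HL hc w(1) in auto)
    have ym: "f j \<in> borel_measurable M" "z j \<in> borel_measurable M" for j
      using wgrD(1)[OF f1(1)] wgrD(1)[OF f2(1)] H10_sqi(1)[OF z(1)] by (auto simp: f_def sqi_measurable)
    have ysm: "(\<lambda>x. f j x + z j x) \<in> borel_measurable M" for j using ym by simp
    define y where "y x j = f j x + z j x" for x j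
    have co: "coefficient \<kappa>0 K (\<lambda>x. \<kappa> i x (y x))" for i
      unfolding coefficient_def y_def using \<kappa>m[OF ysm] \<kappa>b[of i] by (auto elim: eventually_mono)
    have hL: "(\<lambda>x. h i x (y x)) \<in> Lp M r" for i
      unfolding y_def
    proof (rule Lp_dominated(1)[OF HL hm[OF ysm] _ r0(1)])
      show "AE x in M. \<bar>h i x (\<lambda>j. f j x + z j x)\<bar> \<le> \<bar>H x\<bar>"
        using hH[of i] by eventually_elim (meson abs_ge_self order_trans)
    qed
    have w': "(\<integral>x. w x \<bullet> V x \<partial>M) = 0" if "H10 v V" for v V using w(2) that by blast
    have eq\<theta>: "weak_eq (\<lambda>x. \<kappa> True x (y x)) (\<lambda>x. G1 x + Z True x) (\<lambda>x. P (f1 x + z True x) *\<^sub>R w x) (\<lambda>x. h True x (y x))"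
      and eq\<phi>: "weak_eq (\<lambda>x. \<kappa> False x (y x)) (\<lambda>x. G2 x + Z False x) (\<lambda>x. Q (f2 x + z False x) *\<^sub>R w x) (\<lambda>x. h False x (y x))"
      using z(2)[of True] z(2)[of False] unfolding y_def by (simp_all add: f_def G_def T_def)
    have yy: "y x True = f1 x + z True x" "y x False = f2 x + z False x" for x by (simp_all add: y_def f_def)
    \<comment> \<open>For \<theta> this reads \<kappa> \<theta> \<ge> \<alpha> / \<phi> \<ge>
      \<alpha> / M\<phi>, one factor \<theta> cancelling; with the roles exchanged it serves for
      \<phi>.\<close>
    have quotient: "\<alpha> / N \<le> k * p" if "\<alpha> / (p * q) \<le> k" "0 < \<alpha>" "0 < p" "0 < q" "q \<le> N" for \<alpha> N k p q :: real
    proof -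
      have "\<alpha> / N \<le> \<alpha> / q" using that by (intro divide_left_mono) auto
      also have "\<dots> = \<alpha> / (p * q) * p" using that by simp
      also have "\<dots> \<le> k * p" using that by (intro mult_right_mono) auto
      finally show ?thesis .
    qed
    have c\<theta>: "AE x in M. P (f1 x + z True x) = f1 x + z True x \<longrightarrow> \<alpha>\<theta> / M\<phi> \<le> \<kappa> True x (y x) * (f1 x + z True x)"
      using t\<theta>(2)
    proof eventually_elim
      case (elim x)
      show ?case using quotient[OF elim[rule_format, of "y x"] \<alpha>\<theta>(1) P(3) Q(3) Q(2)] by (auto simp: \<kappa>_def yy)
    qed
    have c\<phi>: "AE x in M. Q (f2 x + z False x) = f2 x + z False x \<longrightarrow> \<alpha>\<phi> / M\<theta> \<le> \<kappa> False x (y x) * (f2 x + z False x)"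
      using t\<phi>(2)
    proof eventually_elim
      case (elim x)
      show ?case
        using quotient[OF elim[rule_format, of "y x", unfolded mult.commute[of "P (y x True)"]] \<alpha>\<phi>(1) Q(3) P(3) P(2)]
        by (auto simp: \<kappa>_def yy)
    qed
    have bT: "AE x in M. - h True x (y x) \<le> HC x" "AE x in M. h True x (y x) \<le> HA x" "AE x in M. - h False x (y x) \<le> HD x" "AE x in M. h False x (y x) \<le> HB x"
      "AE x in M. 0 \<le> HA x" "AE x in M. 0 \<le> HB x" "AE x in M. 0 \<le> HC x" "AE x in M. 0 \<le> HD x"
    proof -
      have "AE x in M. - h True x (y x) \<le> HC x \<and> h True x (y x) \<le> HA x \<and> - h False x (y x) \<le> HD x \<and> h False x (y x) \<le> HB x \<and>
        0 \<le> HA x \<and> 0 \<le> HB x \<and> 0 \<le> HC x \<and> 0 \<le> HD x"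
        using CL F(1)
      proof eventually_elim
        case (elim x)
        have "- h False x (y x) \<le> HD x" "0 \<le> HD x" using hF(1)[OF elim, of "y x"] by linarith+
        moreover have "0 \<le> HA x" "0 \<le> HB x" "0 \<le> HC x" using elim pos L1 by (auto simp: HA_def HB_def HC_def)
        ultimately show ?case using hT[OF elim] hF[OF elim] by blast
      qed
      then show "AE x in M. - h True x (y x) \<le> HC x" "AE x in M. h True x (y x) \<le> HA x" "AE x in M. - h False x (y x) \<le> HD x" "AE x in M. h False x (y x) \<le> HB x"
        "AE x in M. 0 \<le> HA x" "AE x in M. 0 \<le> HB x" "AE x in M. 0 \<le> HC x" "AE x in M. 0 \<le> HD x" by auto
    qed
    have fpos: "0 < f1 x \<and> f1 x \<le> A" "0 < f2 x \<and> f2 x \<le> A" if "x \<in> \<Omega>" for x using f1(2)[OF that] f2(2)[OF that] m0 by auto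
    have cpos: "0 < \<alpha>\<theta> / M\<phi>" "0 < \<alpha>\<phi> / M\<theta>" using \<alpha>\<theta> \<alpha>\<phi> pos by auto
    have A0: "0 < A" using m0 by simp
    have up\<theta>: "AE x in M. f1 x + z True x \<le> M\<theta>"
      unfolding M\<theta>_def
    proof (rule upper_bound[OF f1(1) fpos(1) A0 z(1) eq\<theta> co \<kappa>0 w' _ cpos(1) _ hL HA(1) bT(2,5)])
      show "level_const * ?n HA / (\<alpha>\<theta> / M\<phi>) \<le> d1"
      proof -
        have "level_const * ?n HA / (\<alpha>\<theta> / M\<phi>) \<le> level_const * (4 * (1 + ?n C5)) / (\<alpha>\<theta> / M\<phi>)"
          using HA(2) lc cpos by (intro divide_right_mono mult_left_mono) auto
        then show ?thesis by (simp add: d1_def)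
      qed
      show "AE x in M. A \<le> f1 x + z True x \<longrightarrow> f1 x + z True x \<le> A * exp d1 \<longrightarrow> \<alpha>\<theta> / M\<phi> \<le> \<kappa> True x (y x) * (f1 x + z True x)"
        using c\<theta> by eventually_elim (use P(4) mp m0 in \<open>auto simp: M\<theta>_def\<close>)
    qed (use P(4) mp m0 d1 in \<open>auto simp: M\<theta>_def\<close>)
    have up\<phi>: "AE x in M. f2 x + z False x \<le> M\<phi>"
      unfolding M\<phi>_def
    proof (rule upper_bound[OF f2(1) fpos(2) A0 z(1) eq\<phi> co \<kappa>0 w' _ cpos(2) _ hL HB(1) bT(4,6) _ HB(2)])
      show "AE x in M. A \<le> f2 x + z False x \<longrightarrow> f2 x + z False x \<le> A * exp (ln 2) \<longrightarrow> \<alpha>\<phi> / M\<theta> \<le> \<kappa> False x (y x) * (f2 x + z False x)"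
        using c\<phi> by eventually_elim (use Q(4) mp m0 in \<open>auto simp: M\<phi>_def\<close>)
    qed (use Q(4) mp m0 in \<open>auto simp: M\<phi>_def\<close>)
    have lo\<theta>: "AE x in M. m\<theta> \<le> f1 x + z True x"
      unfolding m\<theta>_def
    proof (rule lower_bound[OF f1(1) _ m0(1) z(1) eq\<theta> co \<kappa>0 w' _ cpos(1) _ hL HCD(1) bT(1,7)])
      show "AE x in M. m0 * exp (- d2) \<le> f1 x + z True x \<longrightarrow> f1 x + z True x \<le> m0 \<longrightarrow> \<alpha>\<theta> / M\<phi> \<le> \<kappa> True x (y x) * (f1 x + z True x)"
        using c\<theta> by eventually_elim (use P(4) mp m0 in \<open>auto simp: m\<theta>_def\<close>)
    qed (use P(4) mp m0 f1(2) d23 in \<open>auto simp: m\<theta>_def d2_def\<close>)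
    have lo\<phi>: "AE x in M. m\<phi> \<le> f2 x + z False x"
      unfolding m\<phi>_def
    proof (rule lower_bound[OF f2(1) _ m0(1) z(1) eq\<phi> co \<kappa>0 w' _ cpos(2) _ hL HCD(2) bT(3,8)])
      show "AE x in M. m0 * exp (- d3) \<le> f2 x + z False x \<longrightarrow> f2 x + z False x \<le> m0 \<longrightarrow> \<alpha>\<phi> / M\<theta> \<le> \<kappa> False x (y x) * (f2 x + z False x)"
        using c\<phi> by eventually_elim (use Q(4) mp m0 in \<open>auto simp: m\<phi>_def\<close>)
    qed (use Q(4) mp m0 f2(2) d23 in \<open>auto simp: m\<phi>_def d3_def\<close>)
    \<comment> \<open>The truncated functions are taken as the solution: they obey the bounds
      everywhere, and by the estimates the truncation has changed values only on a null set.\<close>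
    define \<theta> \<phi> where "\<theta> x = P (f1 x + z True x)" and "\<phi> x = Q (f2 x + z False x)" for x
    note [measurable] = ysm[of True, unfolded f_def if_True] ysm[of False, unfolded f_def if_False]
    have e1: "\<kappa> True x (y x) = \<nu> + C\<theta> x (\<theta> x) (\<phi> x) / (\<theta> x * \<phi> x)" "\<kappa> False x (y x) = \<nu> + C\<phi> x (\<theta> x) (\<phi> x) / (\<theta> x * \<phi> x)"
      "h True x (y x) = - C3 x * F x * (\<theta> x)\<^sup>2 + C4 x * \<theta> x * D x + C5 x"
      "h False x (y x) = - \<phi> x * (C6 x * \<theta> x * F x - C7 x * D x + C8 x * inverse (\<theta> x))" for x
      by (simp_all add: \<kappa>_def truncated_def h_def yy \<theta>_def \<phi>_def)
    have 1: "\<theta> \<in> borel_measurable M" "\<phi> \<in> borel_measurable M" unfolding \<theta>_def[abs_def] \<phi>_def[abs_def] by measurable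
    have 2: "\<forall>x. m\<theta> \<le> \<theta> x \<and> \<theta> x \<le> M\<theta>" "\<forall>x. m\<phi> \<le> \<phi> x \<and> \<phi> x \<le> M\<phi>"
      using P Q by (auto simp: \<theta>_def \<phi>_def)
    have 3: "AE x in M. \<theta> x = f1 x + z True x" using up\<theta> lo\<theta> by eventually_elim (use P(4) in \<open>simp add: \<theta>_def\<close>)
    have 4: "AE x in M. \<phi> x = f2 x + z False x" using up\<phi> lo\<phi> by eventually_elim (use Q(4) in \<open>simp add: \<phi>_def\<close>)
    have "bounded_weak_solution f1 G1 w (\<lambda>x. \<nu> + C\<theta> x (\<theta> x) (\<phi> x) / (\<theta> x * \<phi> x))
        (\<lambda>x. - C3 x * F x * (\<theta> x)\<^sup>2 + C4 x * \<theta> x * D x + C5 x) \<theta>"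
      by (rule bounded_weak_solutionI[OF mp(1) \<kappa>0 1(1) 2(1) z(1) 3 eq\<theta>[unfolded e1, folded \<theta>_def]
            co[of True, unfolded e1] hL[of True, unfolded e1]])
    moreover have "bounded_weak_solution f2 G2 w (\<lambda>x. \<nu> + C\<phi> x (\<theta> x) (\<phi> x) / (\<theta> x * \<phi> x))
        (\<lambda>x. - \<phi> x * (C6 x * \<theta> x * F x - C7 x * D x + C8 x * inverse (\<theta> x))) \<phi>"
      by (rule bounded_weak_solutionI[OF mp(3) \<kappa>0 1(2) 2(2) z(1) 4 eq\<phi>[unfolded e1, folded \<phi>_def]
            co[of False, unfolded e1] hL[of False, unfolded e1]])
    ultimately show ?thesis by blast
  qed
  show ?thesis
    by (intro exI[of _ \<tau>] conjI[OF \<tau>0] allI impI) (elim conjE, rule main)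
qed

end

section \<open>Boundary values\<close>

text \<open>S is a primitive of the trapezoid g, which is 1 on [\<delta>, A] and vanishes outside
  [\<delta>/2, A + 1]. Since 0 \<le> g \<le> 1, such a primitive does not expand distances, falls by
  at most \<delta>/2 below \<delta> and rises by at most 1 above A.\<close>

lemma cutoff_exists:
  fixes \<delta> A :: real
  assumes "0 < \<delta>" "\<delta> \<le> A"
  obtains S S' where "C1b S S'" "\<And>s t. \<bar>S s - S t\<bar> \<le> \<bar>s - t\<bar>" "\<And>s. \<delta> \<le> s \<Longrightarrow> s \<le> A \<Longrightarrow> S s = s"
    "\<And>s. \<delta> / 2 \<le> S s \<and> S s \<le> A + 1"
proof -
  define g where "g s = max 0 (min 1 (min (2 * s / \<delta> - 1) (A + 1 - s)))" for s
  have g: "0 \<le> g s" "g s \<le> 1" "s \<le> \<delta> / 2 \<Longrightarrow> g s = 0" "A + 1 \<le> s \<Longrightarrow> g s = 0" "\<delta> \<le> s \<Longrightarrow> s \<le> A \<Longrightarrow> g s = 1" for s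
  proof -
    show "0 \<le> g s" "g s \<le> 1" by (auto simp: g_def)
    show "g s = 0" if "s \<le> \<delta> / 2"
    proof -
      have "2 * s / \<delta> - 1 \<le> 0" using that assms by (simp add: field_simps)
      then show ?thesis by (simp add: g_def)
    qed
    show "g s = 0" if "A + 1 \<le> s" using that by (simp add: g_def)
    show "g s = 1" if "\<delta> \<le> s" "s \<le> A"
    proof -
      have "1 \<le> 2 * s / \<delta> - 1" using that assms by (simp add: field_simps)
      then show ?thesis using that by (simp add: g_def)
    qed
  qed
  obtain P where P: "C1b P g"
  proof (rule C1b_antiderivative[of g 1 "{}"])
    show "continuous_on UNIV g" unfolding g_def[abs_def] by (intro continuous_intros) (use assms in auto)
    show "\<bar>g t\<bar> \<le> 1" for t using g(1,2)[of t] by simp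
  qed auto
  note D = C1bD(1)[OF P]
  have mvt: "0 \<le> P b - P a \<and> P b - P a \<le> b - a" if "a \<le> b" for a b
  proof (cases "a = b")
    case False
    then obtain c where "P b - P a = (b - a) * g c" using MVT2[of a b P g] D \<open>a \<le> b\<close> by auto
    then show ?thesis using g(1,2)[of c] that by (simp add: mult_left_le)
  qed simp
  have const: "P s = P t" if "convex I" "\<And>s. s \<in> I \<Longrightarrow> g s = 0" "s \<in> I" "t \<in> I" for I s t
    using has_field_derivative_zero_constant[OF that(1), of P] has_field_derivative_at_within[OF D] that(2-4) by metis
  have lowc: "P s = P (max s (\<delta> / 2))" for s
    using const[of "{..\<delta> / 2}" s "\<delta> / 2"] g(3) by (cases "s \<le> \<delta> / 2") (auto simp: max_def)
  have highc: "P s = P (min s (A + 1))" for s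
    using const[of "{A + 1..}" s "A + 1"] g(4) by (cases "A + 1 \<le> s") (auto simp: min_def)
  have mid: "P s - s = P \<delta> - \<delta>" if "\<delta> \<le> s" "s \<le> A" for s
  proof -
    have "((\<lambda>s. P s - s) has_real_derivative 0) (at x within {\<delta>..A})" if "x \<in> {\<delta>..A}" for x
      using DERIV_diff[OF D DERIV_ident, of x] g(5)[of x] that by (auto intro: has_field_derivative_at_within)
    from has_field_derivative_zero_constant[OF _ this] obtain c where "\<forall>x\<in>{\<delta>..A}. P x - x = c" by auto
    then show ?thesis using that assms by auto
  qed
  show thesis
  proof (rule that[of "\<lambda>s. P s - P \<delta> + \<delta>" g])
    show "C1b (\<lambda>s. P s - P \<delta> + \<delta>) g" using P unfolding C1b_def by (auto intro!: derivative_eq_intros)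
    show "\<bar>P s - P \<delta> + \<delta> - (P t - P \<delta> + \<delta>)\<bar> \<le> \<bar>s - t\<bar>" for s t
      using mvt[of s t] mvt[of t s] by linarith
    show "P s - P \<delta> + \<delta> = s" if "\<delta> \<le> s" "s \<le> A" for s using mid[OF that] by simp
    show "\<delta> / 2 \<le> P s - P \<delta> + \<delta> \<and> P s - P \<delta> + \<delta> \<le> A + 1" for s
    proof (cases "s \<le> \<delta>")
      case True
      then have "\<delta> / 2 \<le> max s (\<delta> / 2)" "max s (\<delta> / 2) \<le> \<delta>" using assms by auto
      then show ?thesis using mvt[of "max s (\<delta> / 2)" \<delta>] lowc[of s] assms by linarith
    next
      case False
      then have "\<delta> \<le> min s (A + 1)" "min s (A + 1) \<le> A + 1" using assms by auto
      then show ?thesis using mvt[of \<delta> "min s (A + 1)"] highc[of s] assms by linarith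
    qed
  qed
qed

lemma space_surface_measure: "space (surface_measure \<Omega>) = frontier \<Omega>"
  by (simp add: surface_measure_def hausdorff_measure_def space_restrict_space)

section \<open>Changing a function without changing its trace\<close>

context bounded_domain
begin

text \<open>The functions S (h n) + \<psi> n, along a subsequence of h, are again continuous up to
  the boundary. There \<psi> n vanishes and S fixes a, and since S does not expand distances the
  boundary error is at most that of h n.\<close>

lemma has_trace_modify:
  assumes f: "has_trace \<Omega> f a" and S: "C1b S S'" "\<And>s t. \<bar>S s - S t\<bar> \<le> \<bar>s - t\<bar>" "AE x in surface_measure \<Omega>. S (a x) = a x"
    and z: "H10 z Z" and \<theta>: "\<theta> \<in> borel_measurable M" "AE x in M. \<theta> x = S (f x) + z x"
  shows "has_trace \<Omega> \<theta> a"
proof -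
  from f obtain h where f1: "f \<in> H1 \<Omega>" and a: "a \<in> Lp (surface_measure \<Omega>) 2" and h: "\<And>n. h n \<in> H1 \<Omega>" "\<And>n. continuous_on (closure \<Omega>) (h n)"
    "(\<lambda>n. H1_norm \<Omega> (\<lambda>x. h n x - f x)) \<longlonglongrightarrow> 0"
    "(\<lambda>n. \<integral>\<^sup>+x. ennreal ((h n x - a x)\<^sup>2) \<partial>surface_measure \<Omega>) \<longlonglongrightarrow> 0"
    by (auto simp: has_trace_def)
  note wh = H1_wgr[OF h(1)] and wf = H1_wgr[OF f1]
  have dw: "wgr (\<lambda>x. h n x - f x) (\<lambda>x. wgrad \<Omega> (h n) x - wgrad \<Omega> f x)" for n by (rule wgr_diff[OF wh wf])
  have hc: "l2conv M h f" "l2conv M (\<lambda>n. wgrad \<Omega> (h n)) (wgrad \<Omega> f)"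
    using H1_norm_tendsto[OF dw] h(3) wgrD(1,2)[OF wh] wgrD(1,2)[OF wf] by (auto simp: l2conv_def)
  obtain r where r: "strict_mono (r :: nat \<Rightarrow> nat)" "l2conv M (\<lambda>n x. S (h (r n) x)) (\<lambda>x. S (f x))"
    "l2conv M (\<lambda>n x. S' (h (r n) x) *\<^sub>R wgrad \<Omega> (h (r n)) x) (\<lambda>x. S' (f x) *\<^sub>R wgrad \<Omega> f x)"
    by (rule chain_limit[OF hc S(1)])
  obtain \<psi> where p: "\<And>n. \<psi> n \<in> test_functions \<Omega>" "l2conv M \<psi> z" "l2conv M (\<lambda>n. grad (\<psi> n)) Z"
    using H10_E[OF z] by blast
  define k where "k n x = S (h (r n) x) + \<psi> n x" for n x
  define K where "K n x = S' (h (r n) x) *\<^sub>R wgrad \<Omega> (h (r n)) x + grad (\<psi> n) x" for n x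
  define Y where "Y x = S' (f x) *\<^sub>R wgrad \<Omega> f x + Z x" for x
  have wk: "wgr (k n) (K n)" for n
    unfolding k_def[abs_def] K_def[abs_def] by (rule wgr_add[OF wgr_chain[OF wh S(1)] test_wgr[OF p(1)]])
  have wY: "wgr \<theta> Y"
  proof (rule wgr_cong_AE)
    show "wgr (\<lambda>x. S (f x) + z x) Y" unfolding Y_def[abs_def] by (rule wgr_add[OF wgr_chain[OF wf S(1)] H10_wgr[OF z]])
    then show "Y \<in> borel_measurable M" using wgrD(2) sqi_measurable by blast
  qed (use \<theta> in auto)
  have "l2conv M k (\<lambda>x. S (f x) + z x)" unfolding k_def[abs_def] by (rule l2conv_add[OF r(2) p(2)])
  then have c1: "l2conv M k \<theta>" by (rule l2conv_cong_limit[OF _ \<theta>(1)]) (use \<theta>(2) in \<open>auto elim: eventually_mono\<close>)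
  have c2: "l2conv M K Y" unfolding K_def[abs_def] Y_def[abs_def] by (rule l2conv_add[OF r(3) p(3)])
  have N: "(\<lambda>n. H1_norm \<Omega> (\<lambda>x. k n x - \<theta> x)) \<longlonglongrightarrow> 0"
    unfolding H1_norm_tendsto[OF wgr_diff[OF wk wY]] using l2convD(3)[OF c1] l2convD(3)[OF c2] by simp
  have cc: "continuous_on (closure \<Omega>) (k n)" for n
    unfolding k_def[abs_def]
    by (intro continuous_on_add continuous_on_compose2[OF C1bD(2)[OF S(1)] h(2)]
        continuous_on_subset[OF smoothD(3)[OF test_functions_smooth[OF p(1)]]]) auto
  have fr: "frontier \<Omega> \<inter> \<Omega> = {}" using open_domain by (simp add: frontier_disjoint_eq)
  have le: "(\<integral>\<^sup>+x. ennreal ((k n x - a x)\<^sup>2) \<partial>surface_measure \<Omega>) \<le> (\<integral>\<^sup>+x. ennreal ((h (r n) x - a x)\<^sup>2) \<partial>surface_measure \<Omega>)" for n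
  proof (rule nn_integral_mono_AE)
    show "AE x in surface_measure \<Omega>. ennreal ((k n x - a x)\<^sup>2) \<le> ennreal ((h (r n) x - a x)\<^sup>2)"
      using S(3) AE_space
    proof eventually_elim
      case (elim x)
      then have "x \<notin> \<Omega>" using fr by (auto simp: space_surface_measure)
      then have "\<bar>k n x - a x\<bar> = \<bar>S (h (r n) x) - S (a x)\<bar>" using test_fn(6)[OF p(1)] elim by (simp add: k_def)
      also have "\<dots> \<le> \<bar>h (r n) x - a x\<bar>" by (rule S(2))
      finally show ?case by (intro ennreal_leI) (simp add: abs_le_square_iff)
    qed
  qed
  have "(\<lambda>n. \<integral>\<^sup>+x. ennreal ((k n x - a x)\<^sup>2) \<partial>surface_measure \<Omega>) \<longlonglongrightarrow> 0"
    by (rule tendsto_sandwich[OF _ _ tendsto_const LIMSEQ_subseq_LIMSEQ[OF h(4) r(1)]]) (use le in auto)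
  then show ?thesis
    unfolding has_trace_def using wgr_wgrad(4)[OF wY] a wgr_wgrad(4)[OF wk] cc N by blast
qed

lemma solenoidal_H10:
  assumes "solenoidal \<Omega> w" "sqi M w" "H10 v V"
  shows "(\<integral>x. w x \<bullet> V x \<partial>M) = 0"
proof -
  obtain \<psi> where p: "\<And>n. \<psi> n \<in> test_functions \<Omega>" "l2conv M (\<lambda>n. grad (\<psi> n)) V" using H10_E[OF assms(3)] by blast
  have "(\<lambda>n. \<integral>x. w x \<bullet> grad (\<psi> n) x \<partial>M) \<longlonglongrightarrow> (\<integral>x. w x \<bullet> V x \<partial>M)"
    by (rule l2conv_inner[OF l2conv_const[OF assms(2)] p(2)])
  then show ?thesis using assms(1) p(1) by (simp add: solenoidal_def LIMSEQ_const_iff)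
qed

lemma Lp3_sqi:
  assumes "\<And>i. (\<lambda>x. u x $ i) \<in> Lp M 3" shows "sqi M u"
proof -
  have "sqi M (\<lambda>x. u x $ i)" for i
  proof -
    have m: "(\<lambda>x. u x $ i) \<in> borel_measurable M" and i: "integrable M (\<lambda>x. \<bar>u x $ i\<bar> powr 3)"
      using assms[of i] by (auto simp: Lp_def)
    have "integrable M (\<lambda>x. (norm (u x $ i))\<^sup>2)"
    proof (rule Bochner_Integration.integrable_bound)
      show "integrable M (\<lambda>x. 1 + \<bar>u x $ i\<bar> powr 3)" using i by simp
      have le: "t\<^sup>2 \<le> 1 + t powr 3" if "0 \<le> t" for t :: real
      proof (cases "t \<le> 1")
        case True
        then show ?thesis using that power_le_one[of t 2] by (simp add: add_increasing2)
      next
        case False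
        then have "t\<^sup>2 \<le> t ^ 3" by (intro power_increasing) auto
        then have "t\<^sup>2 \<le> 1 + t ^ 3" by linarith
        then show ?thesis using that by simp
      qed
      show "AE x in M. norm ((norm (u x $ i))\<^sup>2) \<le> norm (1 + \<bar>u x $ i\<bar> powr 3)"
        using le[OF abs_ge_zero] by (intro AE_I2) (auto simp: add_nonneg_nonneg)
    qed (use m in measurable)
    then show ?thesis using m by (simp add: sqi_def)
  qed
  then have "l2conv M (\<lambda>n. u) u" by (intro l2conv_components l2conv_const)
  then show ?thesis by (rule l2convD(2))
qed

end

section \<open>From bounded weak solutions to problem (Q)\<close>

context elliptic_domain
begin

text \<open>\<open>weak_eq\<close> carries the transport as the flux \<theta> w. Since \<theta>
  \<psi> lies in H10 and w is orthogonal to the gradients of H10, the product rule turns the flux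
  into the convective form.\<close>

lemma transport_diffusionI:
  assumes \<theta>: "wgr \<theta> Y" "\<And>x. \<bar>\<theta> x\<bar> \<le> B" and w: "sqi M w" "\<And>v V. H10 v V \<Longrightarrow> (\<integral>x. w x \<bullet> V x \<partial>M) = 0"
    and \<kappa>: "coefficient k K \<kappa>" "0 < k" and h: "h \<in> Lp M r"
    and eq: "weak_eq \<kappa> Y (\<lambda>x. \<theta> x *\<^sub>R w x) h"
  shows "transport_diffusion \<Omega> w \<kappa> h \<theta>"
  unfolding transport_diffusion_def
proof
  fix \<psi> assume \<psi>: "\<psi> \<in> test_functions \<Omega>"
  note T = test_fn[OF \<psi>]
  let ?Y = "wgrad \<Omega> \<theta>"
  note W = wgr_wgrad[OF \<theta>(1)]
  have sY: "sqi M ?Y" by (rule wgrD(2)[OF W(3)])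
  have sk: "sqi M (\<lambda>x. \<kappa> x *\<^sub>R ?Y x)" by (rule coefficientD(4)[OF \<kappa> sY])
  obtain b where b: "\<And>x. \<bar>\<psi> x\<bar> \<le> b" using T(5) by blast
  have sp: "sqi M (\<lambda>x. \<psi> x *\<^sub>R w x)" by (rule sqi_mult_bounded[where K=b, OF w(1) sqi_measurable[OF T(1)]]) (use b in auto)
  have st: "sqi M (\<lambda>x. \<theta> x *\<^sub>R w x)" by (rule sqi_mult_bounded[where K=B, OF w(1) sqi_measurable[OF wgrD(1)[OF \<theta>(1)]]]) (use \<theta>(2) in auto)
  have i1: "integrable M (\<lambda>x. (w x \<bullet> ?Y x) * \<psi> x)" using sqi_inner_integrable[OF sp sY] by (simp add: mult.commute)
  have i2: "integrable M (\<lambda>x. \<kappa> x * (?Y x \<bullet> grad \<psi> x))" using sqi_inner_integrable[OF sk T(2)] by simp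
  have i3: "integrable M (\<lambda>x. h x * \<psi> x)" by (rule dualC(2)[OF h H10_test[OF \<psi>]])
  have "(\<integral>x. (\<kappa> x *\<^sub>R ?Y x) \<bullet> grad \<psi> x \<partial>M) = (\<integral>x. (\<kappa> x *\<^sub>R Y x) \<bullet> grad \<psi> x \<partial>M)"
  proof (rule integral_cong_AE)
    show "(\<lambda>x. (\<kappa> x *\<^sub>R Y x) \<bullet> grad \<psi> x) \<in> borel_measurable M"
      using sqi_inner_integrable[OF coefficientD(4)[OF \<kappa> wgrD(2)[OF \<theta>(1)]] T(2)] by (rule borel_measurable_integrable)
    show "(\<lambda>x. (\<kappa> x *\<^sub>R ?Y x) \<bullet> grad \<psi> x) \<in> borel_measurable M"
      using sqi_inner_integrable[OF sk T(2)] by (rule borel_measurable_integrable)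
  qed (use W(1) in \<open>auto elim: eventually_mono\<close>)
  also have "\<dots> = (\<integral>x. h x * \<psi> x \<partial>M) + (\<integral>x. (\<theta> x *\<^sub>R w x) \<bullet> grad \<psi> x \<partial>M)"
    using eq H10_test[OF \<psi>] by (simp add: weak_eq_def)
  finally have 1: "(\<integral>x. \<kappa> x * (?Y x \<bullet> grad \<psi> x) \<partial>M) = (\<integral>x. h x * \<psi> x \<partial>M) + (\<integral>x. (\<theta> x *\<^sub>R w x) \<bullet> grad \<psi> x \<partial>M)" by simp
  have "(\<integral>x. w x \<bullet> (\<psi> x *\<^sub>R ?Y x + \<theta> x *\<^sub>R grad \<psi> x) \<partial>M) = 0" by (rule w(2)[OF wgr_mult_test[OF W(3) \<psi>]])
  moreover have "w x \<bullet> (\<psi> x *\<^sub>R ?Y x + \<theta> x *\<^sub>R grad \<psi> x) = (w x \<bullet> ?Y x) * \<psi> x + (\<theta> x *\<^sub>R w x) \<bullet> grad \<psi> x" for x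
    by (simp add: inner_add_right mult.commute)
  ultimately have "(\<integral>x. (w x \<bullet> ?Y x) * \<psi> x \<partial>M) + (\<integral>x. (\<theta> x *\<^sub>R w x) \<bullet> grad \<psi> x \<partial>M) = 0"
    using i1 sqi_inner_integrable[OF st T(2)] by simp
  with 1 i1 i2 i3 show "integrable M (\<lambda>x. (w x \<bullet> ?Y x) * \<psi> x) \<and> integrable M (\<lambda>x. \<kappa> x * (?Y x \<bullet> grad \<psi> x)) \<and>
      integrable M (\<lambda>x. h x * \<psi> x) \<and> (\<integral>x. (w x \<bullet> ?Y x) * \<psi> x \<partial>M) + (\<integral>x. \<kappa> x * (?Y x \<bullet> grad \<psi> x) \<partial>M) = (\<integral>x. h x * \<psi> x \<partial>M)"
    by simp
qed

lemma class_S_I: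
  assumes "wgr \<theta> Y" "0 < m" "\<And>x. m \<le> \<theta> x \<and> \<theta> x \<le> B"
  shows "\<theta> \<in> class_S \<Omega>"
proof -
  have m: "\<theta> \<in> borel_measurable M" by (rule sqi_measurable[OF wgrD(1)[OF assms(1)]])
  have p: "0 < \<theta> x" for x using assms(2) assms(3)[of x] by linarith
  have "\<bar>inverse (\<theta> x)\<bar> \<le> inverse m" for x using assms(2) assms(3)[of x] p[of x] by (simp add: le_imp_inverse_le)
  then have "inverse_Linf M \<theta>" unfolding inverse_Linf_def Linf_def using m p by (auto simp: less_imp_neq[symmetric])
  moreover have "\<bar>\<theta> x\<bar> \<le> B" for x using assms(3)[of x] p[of x] by simp
  then have "\<theta> \<in> Linf M" using m by (auto simp: Linf_def)
  ultimately show ?thesis using wgr_wgrad(4)[OF assms(1)] p by (simp add: class_S_def less_imp_le)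
qed

lemma bounded_weak_solution_regular:
  assumes f: "has_trace \<Omega> f a" and S: "C1b S S'" "\<And>s t. \<bar>S s - S t\<bar> \<le> \<bar>s - t\<bar>" "AE x in surface_measure \<Omega>. S (a x) = a x"
    and w: "solenoidal \<Omega> w" "sqi M w"
    and \<theta>: "bounded_weak_solution (\<lambda>x. S (f x)) (\<lambda>x. S' (f x) *\<^sub>R wgrad \<Omega> f x) w \<kappa> h \<theta>"
  shows "\<theta> \<in> class_S \<Omega>" "transport_diffusion \<Omega> w \<kappa> h \<theta>" "has_trace \<Omega> \<theta> a"
proof -
  let ?G = "\<lambda>x. S' (f x) *\<^sub>R wgrad \<Omega> f x"
  obtain m B k K z Z where mk: "0 < m" "0 < k" and meas: "\<theta> \<in> borel_measurable M" and bd: "\<forall>x. m \<le> \<theta> x \<and> \<theta> x \<le> B"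
    and z: "H10 z Z" and ae: "AE x in M. \<theta> x = S (f x) + z x" and eq: "weak_eq \<kappa> (\<lambda>x. ?G x + Z x) (\<lambda>x. \<theta> x *\<^sub>R w x) h"
    and co: "coefficient k K \<kappa>" and h: "h \<in> Lp M r"
    using \<theta> unfolding bounded_weak_solution_def by blast
  have "f \<in> H1 \<Omega>" using f by (simp add: has_trace_def)
  note wf = wgr_add[OF wgr_chain[OF H1_wgr[OF this] S(1)] H10_wgr[OF z]]
  have w\<theta>: "wgr \<theta> (\<lambda>x. ?G x + Z x)"
    by (rule wgr_cong_AE[OF wf meas sqi_measurable[OF wgrD(2)[OF wf]]]) (use ae in \<open>auto elim: eventually_mono\<close>)
  have ab: "\<bar>\<theta> x\<bar> \<le> B" for x using bd[rule_format, of x] mk(1) by auto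
  show "\<theta> \<in> class_S \<Omega>" using class_S_I[OF w\<theta> mk(1)] bd by blast
  show "transport_diffusion \<Omega> w \<kappa> h \<theta>"
    by (rule transport_diffusionI[OF w\<theta> ab w(2) solenoidal_H10[OF w] co mk(2) h eq])
  show "has_trace \<Omega> \<theta> a" by (rule has_trace_modify[OF f S z meas ae])
qed

end

lemma boundary_data:
  assumes "g \<in> H_half \<Omega> \<inter> Linf (surface_measure \<Omega>)"
  obtains f c where "has_trace \<Omega> f g" "AE x in surface_measure \<Omega>. g x \<le> c"
proof -
  from assms obtain f c where f: "has_trace \<Omega> f g" and c: "AE x in surface_measure \<Omega>. \<bar>g x\<bar> \<le> c" by (auto simp: H_half_def Linf_def)
  have "AE x in surface_measure \<Omega>. g x \<le> c" using c by eventually_elim simp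
  with f show thesis by (rule that)
qed

theorem theorem1:
  fixes \<Omega> :: "(real^'n) set"
    and r \<nu> \<delta> :: real
    and \<rho> a b C3 C4 C5 C6 C7 C8 :: "real^'n \<Rightarrow> real"
    and C\<theta> C\<phi> :: "real^'n \<Rightarrow> real \<Rightarrow> real \<Rightarrow> real"
  assumes "CARD('n) \<in> {2, 3}"
    and "r > real CARD('n) / 2"
    and "open \<Omega>" and "bounded \<Omega>" and "lipschitz_boundary \<Omega>"
    and "\<nu> \<ge> 0"
    and "\<forall>x\<in>\<Omega>. 0 \<le> \<rho> x" and "\<rho> \<in> Linf (lebesgue_on \<Omega>)" and "inverse_Linf (lebesgue_on \<Omega>) \<rho>"
    and "a \<in> H_half \<Omega> \<inter> Linf (surface_measure \<Omega>)"
    and "b \<in> H_half \<Omega> \<inter> Linf (surface_measure \<Omega>)"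
    and "\<delta> > 0"
    and "AE x in surface_measure \<Omega>. \<delta> \<le> a x" and "AE x in surface_measure \<Omega>. \<delta> \<le> b x"
    and "\<forall>C\<in>{C3, C4, C5, C6, C7, C8}. \<forall>x\<in>\<Omega>. 0 \<le> C x"
    and "\<forall>C\<in>{C5, C8}. C \<in> Lp (lebesgue_on \<Omega>) r"
    and "\<forall>C\<in>{C3, C4, C6, C7}. C \<in> Linf (lebesgue_on \<Omega>)"
    and "diffusion_function \<Omega> C\<theta>" and "diffusion_function \<Omega> C\<phi>"
  shows "\<exists>\<tau>>0. \<forall>u :: real^'n \<Rightarrow> real^'n.
    (\<forall>i. (\<lambda>x. u x $ i) \<in> Lp (lebesgue_on \<Omega>) 3) \<and>
    weakly_differentiable \<Omega> u \<and>
    divergence \<Omega> u \<in> Lp (lebesgue_on \<Omega>) r \<and>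
    (AE x in lebesgue_on \<Omega>. 0 \<le> strain \<Omega> u x) \<and> strain \<Omega> u \<in> Lp (lebesgue_on \<Omega>) r \<and>
    solenoidal \<Omega> (\<lambda>x. \<rho> x *\<^sub>R u x) \<and>
    normal_trace_zero \<Omega> u \<and>
    Lp_norm (lebesgue_on \<Omega>) r (\<lambda>x. max (divergence \<Omega> u x) 0) \<le> \<tau>
    \<longrightarrow> (\<exists>\<theta> \<phi>. weak_solution_Q \<Omega> \<nu> \<rho> u C\<theta> C\<phi> C3 C4 C5 C6 C7 C8 a b \<theta> \<phi>)"
proof -
  interpret elliptic_domain \<Omega> r by unfold_locales (use assms(1-4) in auto)
  obtain fa ca where fa: "has_trace \<Omega> fa a" "AE x in surface_measure \<Omega>. a x \<le> ca" by (rule boundary_data[OF assms(10)])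
  obtain fb cb where fb: "has_trace \<Omega> fb b" "AE x in surface_measure \<Omega>. b x \<le> cb" by (rule boundary_data[OF assms(11)])
  \<comment> \<open>An upper bound for both boundary functions, and at least \<delta> so that the
    cut-off exists; S then fixes a and b almost everywhere on the boundary.\<close>
  define A where "A = max \<delta> (max ca cb)"
  obtain S S' where S: "C1b S S'" "\<And>s t. \<bar>S s - S t\<bar> \<le> \<bar>s - t\<bar>" "\<And>s. \<delta> \<le> s \<Longrightarrow> s \<le> A \<Longrightarrow> S s = s"
    "\<And>s. \<delta> / 2 \<le> S s \<and> S s \<le> A + 1"
    by (rule cutoff_exists[OF assms(12), of A]) (auto simp: A_def)
  have Sa: "AE x in surface_measure \<Omega>. S (a x) = a x"
    using fa(2) assms(13) by eventually_elim (rule S(3), auto simp: A_def)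
  have Sb: "AE x in surface_measure \<Omega>. S (b x) = b x"
    using fb(2) assms(14) by eventually_elim (rule S(3), auto simp: A_def)
  have H1: "fa \<in> H1 \<Omega>" "fb \<in> H1 \<Omega>" using fa fb by (auto simp: has_trace_def)
  note wa = wgr_chain[OF H1_wgr[OF H1(1)] S(1)] and wb = wgr_chain[OF H1_wgr[OF H1(2)] S(1)]
  have m: "0 < \<delta> / 2" "\<delta> / 2 \<le> A + 1" using assms(12) by (auto simp: A_def max_def)
  have SA: "x \<in> \<Omega> \<Longrightarrow> \<delta> / 2 \<le> S (fa x) \<and> S (fa x) \<le> A + 1" "x \<in> \<Omega> \<Longrightarrow> \<delta> / 2 \<le> S (fb x) \<and> S (fb x) \<le> A + 1" for x
    using S(4) by blast+
  have Cr: "C5 \<in> Lp M r" "C8 \<in> Lp M r" using assms(16) by auto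
  obtain c\<rho> where c\<rho>: "\<rho> \<in> borel_measurable M" "AE x in M. \<bar>\<rho> x\<bar> \<le> c\<rho>" using assms(8) by (auto simp: Linf_def)
  \<comment> \<open>The threshold is obtained before u appears, so it depends only on the domain,
    the coefficients, the boundary data and r.\<close>
  obtain \<tau> where \<tau>: "0 < \<tau>" and main: "\<And>F D w. (AE x in M. 0 \<le> F x) \<and> F \<in> Lp M r \<and> D \<in> Lp M r \<and> sqi M w \<and>
      (\<forall>v V. H10 v V \<longrightarrow> (\<integral>x. w x \<bullet> V x \<partial>M) = 0) \<and> Lp_norm M r (\<lambda>x. max (D x) 0) \<le> \<tau> \<Longrightarrow>
    (\<exists>\<theta> \<phi>. bounded_weak_solution (\<lambda>x. S (fa x)) (\<lambda>x. S' (fa x) *\<^sub>R wgrad \<Omega> fa x) w (\<lambda>x. \<nu> + C\<theta> x (\<theta> x) (\<phi> x) / (\<theta> x * \<phi> x))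
        (\<lambda>x. - C3 x * F x * (\<theta> x)\<^sup>2 + C4 x * \<theta> x * D x + C5 x) \<theta> \<and>
      bounded_weak_solution (\<lambda>x. S (fb x)) (\<lambda>x. S' (fb x) *\<^sub>R wgrad \<Omega> fb x) w (\<lambda>x. \<nu> + C\<phi> x (\<theta> x) (\<phi> x) / (\<theta> x * \<phi> x))
        (\<lambda>x. - \<phi> x * (C6 x * \<theta> x * F x - C7 x * D x + C8 x * inverse (\<theta> x))) \<phi>)"
    using bounded_solution[where ?f1.0="\<lambda>x. S (fa x)" and ?f2.0="\<lambda>x. S (fb x)",
        OF assms(18,19,6) wa SA(1) wb SA(2) m assms(15) Cr assms(17)] by blast
  show ?thesis
  proof (intro exI[of _ \<tau>] conjI[OF \<tau>] allI impI, elim conjE)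
    fix u :: "real^'n \<Rightarrow> real^'n"
    let ?w = "\<lambda>x. \<rho> x *\<^sub>R u x" and ?D = "divergence \<Omega> u" and ?F = "strain \<Omega> u"
    assume u: "\<forall>i. (\<lambda>x. u x $ i) \<in> Lp M 3" "?D \<in> Lp M r" "AE x in M. 0 \<le> ?F x" "?F \<in> Lp M r" "solenoidal \<Omega> ?w"
      "Lp_norm M r (\<lambda>x. max (?D x) 0) \<le> \<tau>"
    have w: "sqi M ?w" using u(1) by (intro sqi_mult_bounded[OF Lp3_sqi c\<rho>]) simp
    have pre: "(AE x in M. 0 \<le> ?F x) \<and> ?F \<in> Lp M r \<and> ?D \<in> Lp M r \<and> sqi M ?w \<and>
      (\<forall>v V. H10 v V \<longrightarrow> (\<integral>x. ?w x \<bullet> V x \<partial>M) = 0) \<and> Lp_norm M r (\<lambda>x. max (?D x) 0) \<le> \<tau>"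
      using u w solenoidal_H10[OF u(5) w] by blast
    obtain \<theta> \<phi> where \<theta>: "bounded_weak_solution (\<lambda>x. S (fa x)) (\<lambda>x. S' (fa x) *\<^sub>R wgrad \<Omega> fa x) ?w (\<lambda>x. \<nu> + C\<theta> x (\<theta> x) (\<phi> x) / (\<theta> x * \<phi> x))
        (\<lambda>x. - C3 x * ?F x * (\<theta> x)\<^sup>2 + C4 x * \<theta> x * ?D x + C5 x) \<theta>"
      and \<phi>: "bounded_weak_solution (\<lambda>x. S (fb x)) (\<lambda>x. S' (fb x) *\<^sub>R wgrad \<Omega> fb x) ?w (\<lambda>x. \<nu> + C\<phi> x (\<theta> x) (\<phi> x) / (\<theta> x * \<phi> x))
        (\<lambda>x. - \<phi> x * (C6 x * \<theta> x * ?F x - C7 x * ?D x + C8 x * inverse (\<theta> x))) \<phi>"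
      using main[OF pre] by blast
    have "weak_solution_Q \<Omega> \<nu> \<rho> u C\<theta> C\<phi> C3 C4 C5 C6 C7 C8 a b \<theta> \<phi>"
      unfolding weak_solution_Q_def
      using bounded_weak_solution_regular[OF fa(1) S(1,2) Sa u(5) w \<theta>] bounded_weak_solution_regular[OF fb(1) S(1,2) Sb u(5) w \<phi>] by blast
    then show "\<exists>\<theta> \<phi>. weak_solution_Q \<Omega> \<nu> \<rho> u C\<theta> C\<phi> C3 C4 C5 C6 C7 C8 a b \<theta> \<phi>" by blast
  qed
qed

end
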